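(* Let $d\ge1$, with $\nu>0$ in parts (a)–(c) and $\nu>1$ in parts (d),(e). Let $X=BL^*(\mathbb{R}^d)$. (a) The function $F=F_\nu$ is analytic from $X\times\mathcal{P}_d$ into $\mathcal{S}_d$. (b) For any law $Q\in\mathcal{U}_{d,\nu+d}$ and the corresponding $\phi_Q\in X$, at $A=A_\nu(Q)$ the partial derivative linear map $\nabla_C F(\phi_Q,A)$ from $\mathcal{S}_d$ into $\mathcal{S}_d$ (the derivative of $F(\phi_Q,A)$ with respect to $C=A^{-1}$) is invertible. (c) The functional $Q\mapsto A_\nu(Q)$ is analytic on $\mathcal{U}_{d,\nu+d}$ for the $BL^*$ norm. (d) The $t_\nu$ location-scatter functional $P\mapsto(\mu_\nu,\Sigma_\nu)(P)$ is also analytic, at each $P\in\mathcal{V}_{d,\nu+d}$, for the norm on $X$. (e) For $d=1$, the $t_\nu$ location and scatter functionals $\mu_\nu,\sigma_\nu^2$ (with $\sigma_\nu^2=\Sigma_\nu$) are analytic on $\mathcal{V}_{1,\nu+1}$ with respect to the sup norm $\|\cdot\|_{\mathcal{K}}$.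
   Context: A law is a Borel probability measure. $\mathcal{S}_d$ is the space of symmetric real $d\times d$ matrices and $\mathcal{P}_d\subset\mathcal{S}_d$ the open subset of strictly positive definite ones. Vectors are columns, $'$ is transpose. $BL(\mathbb{R}^d)$ is the Banach space of bounded Lipschitz $f:\mathbb{R}^d\to\mathbb{R}$ with norm $\|f\|_{BL}=\sup_x|f(x)|+\sup_{x\ne y}|f(x)-f(y)|/|x-y|$, and $BL^*(\mathbb{R}^d)$ is its dual Banach space. For a law $Q$, $\phi_Q\in BL^*(\mathbb{R}^d)$ is $\phi_Q(f)=\int f\,dQ$. For $d=1$ and a finite signed Borel measure $\tau$ on $\mathbb{R}$, $\|\tau\|_{\mathcal{K}}=\sup_x|\tau((-\infty,x])|$. For $A\in\mathcal{P}_d$, $C=A^{-1}$, $y\in\mathbb{R}^d$, let $$G_{(\nu)}(y,A)=-\frac A2+\frac{(\nu+d)yy'}{2(\nu+y'Cy)}\in\mathcal{S}_d .$$ Each entry is in $BL(\mathbb{R}^d)$ as a function of $y$. Define $F=F_\nu:X\times\mathcal{P}_d\to\mathcal{S}_d$ by applying $\phi$ entrywise: $F(\phi,A)_{ij}=\phi\big(G_{(\nu)}(\cdot,A)_{ij}\big)$. $\mathcal{U}_{d,a}$: laws $Q$ on $\mathbb{R}^d$ with $Q(H)<1-(d-q)/a$ for every linear subspace $H$ of dimension $q$, $0\le q\le d-1$. $\mathcal{V}_{d,a}$: laws $P$ on $\mathbb{R}^d$ with $P(J)<1-(d-q)/a$ for every affine subspace $J$ of dimension $q$, $0\le q\le d-1$.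 With $\rho_{\nu,d}(s)=\frac{\nu+d}{2}\log\frac{\nu+s}{\nu}$: for $Q\in\mathcal{U}_{d,\nu+d}$, $A_\nu(Q)$ is the unique minimizer (and unique critical point) over $A\in\mathcal{P}_d$ of $\frac12\log\det A+\int(\rho_{\nu,d}(y'A^{-1}y)-\rho_{\nu,d}(y'y))\,dQ(y)$. For $\nu>1$, $P\in\mathcal{V}_{d,\nu+d}$, $(\mu_\nu,\Sigma_\nu)(P)$ is the unique minimizer over $(\mu,\Sigma)\in\mathbb{R}^d\times\mathcal{P}_d$ of $\frac12\log\det\Sigma+\int\big(\rho_{\nu,d}((y-\mu)'\Sigma^{-1}(y-\mu))-\rho_{\nu,d}(y'y)\big)\,dP(y)$. Analyticity: a function $f$ from an open set $U$ of a normed space $X$ into a normed space $Y$ is analytic iff it is $C^\infty$ (Fréchet) and for each $x\in U$ there are $r>0$ and $k$-homogeneous polynomials $V_k:X\to Y$ ($k\ge1$) such that $\|v-x\|<r$ implies $v\in U$ and $f(v)=f(x)+\sum_{k\ge1}V_k(v-x)$. A functional $T$ defined on a set $\mathcal{D}$ of laws is analytic with respect to a norm if every $Q_0\in\mathcal{D}$ (identified with $\phi_{Q_0}$, or with $Q_0$ as an element of the space of finite signed measures in part (e)) has an open neighborhood, in the normed space concerned, on which there is an analytic function agreeing with $T$ at all laws of $\mathcal{D}$ in the neighborhood. *)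

theory Defs
  imports "HOL-Probability.Probability"
begin

section \<open>Analytic maps between normed spaces\<close>

text \<open>
  A \<open>k\<close>-linear map is represented as a function on lists, of which only the values on lists of
  length \<open>k\<close> matter.
\<close>

definition bounded_multilinear ::
    "nat \<Rightarrow> ('a::real_normed_vector list \<Rightarrow> 'b::real_normed_vector) \<Rightarrow> bool" where
  "bounded_multilinear k m \<longleftrightarrow>
     (\<forall>vs i. length vs = k \<longrightarrow> i < k \<longrightarrow> linear (\<lambda>x. m (vs[i := x]))) \<and>
     (\<exists>K. \<forall>vs. length vs = k \<longrightarrow> norm (m vs) \<le> K * prod_list (map norm vs))"

definition homogeneous_polynomial ::
    "nat \<Rightarrow> ('a::real_normed_vector \<Rightarrow> 'b::real_normed_vector) \<Rightarrow> bool" where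
  "homogeneous_polynomial k V \<longleftrightarrow>
     (\<exists>m. bounded_multilinear k m \<and> (\<forall>x. V x = m (replicate k x)))"

text \<open>
  \<open>D k\<close> is the \<open>k\<close>-th Frechet derivative, as a map into the bounded \<open>k\<close>-linear maps. The last
  clause says that \<open>D (Suc k) x\<close> is the Frechet derivative of \<open>D k\<close> at \<open>x\<close> for the operator norm
  on \<open>k\<close>-linear maps, under the identification of \<open>L(X, L\<^sup>k(X,Y))\<close> with \<open>L\<^sup>k\<^sup>+\<^sup>1(X,Y)\<close>: the
  bound on the remainder is uniform in \<open>vs\<close>.
\<close>

definition frechet_smooth_on ::
    "'a::real_normed_vector set \<Rightarrow> ('a \<Rightarrow> 'b::real_normed_vector) \<Rightarrow> bool" where
  "frechet_smooth_on U f \<longleftrightarrow>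
     (\<exists>D :: nat \<Rightarrow> 'a \<Rightarrow> 'a list \<Rightarrow> 'b.
        (\<forall>x\<in>U. D 0 x [] = f x) \<and>
        (\<forall>k. \<forall>x\<in>U. bounded_multilinear k (D k x)) \<and>
        (\<forall>k. \<forall>x\<in>U. \<forall>e>0. \<forall>\<^sub>F y in at x. \<forall>vs. length vs = k \<longrightarrow>
           norm (D k y vs - D k x vs - D (Suc k) x ((y - x) # vs))
             \<le> e * norm (y - x) * prod_list (map norm vs)))"

definition frechet_analytic_on ::
    "'a::real_normed_vector set \<Rightarrow> ('a \<Rightarrow> 'b::real_normed_vector) \<Rightarrow> bool" where
  "frechet_analytic_on U f \<longleftrightarrow>
     open U \<and> frechet_smooth_on U f \<and>
     (\<forall>x\<in>U. \<exists>r>0. \<exists>V :: nat \<Rightarrow> 'a \<Rightarrow> 'b.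
        (\<forall>k\<ge>1. homogeneous_polynomial k (V k)) \<and>
        (\<forall>v. norm (v - x) < r \<longrightarrow>
           v \<in> U \<and> (\<lambda>k. V (Suc k) (v - x)) sums (f v - f x)))"

text \<open>
  Here \<open>emb\<close> is the identification of the laws in \<open>\<D>\<close> with elements of a normed space.
\<close>

definition analytic_functional ::
    "('m \<Rightarrow> 'a::real_normed_vector) \<Rightarrow> 'm set \<Rightarrow> ('m \<Rightarrow> 'b::real_normed_vector) \<Rightarrow> bool" where
  "analytic_functional emb \<D> T \<longleftrightarrow>
     (\<forall>Q0\<in>\<D>. \<exists>U g. emb Q0 \<in> U \<and> frechet_analytic_on U g \<and>
        (\<forall>Q\<in>\<D>. emb Q \<in> U \<longrightarrow> g (emb Q) = T Q))"


section \<open>Laws\<close>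

definition law :: "'a::topological_space measure \<Rightarrow> bool" where
  "law Q \<longleftrightarrow> prob_space Q \<and> sets Q = sets borel"

lemma law_space: "law Q \<Longrightarrow> space Q = UNIV"
  unfolding law_def by (metis sets_eq_imp_space_eq space_borel)

definition law_U :: "real \<Rightarrow> 'a::euclidean_space measure set" where
  "law_U a = {Q. law Q \<and> (\<forall>H. subspace H \<and> dim H < DIM('a) \<longrightarrow>
     measure Q H < 1 - (real DIM('a) - real (dim H)) / a)}"

text \<open>
  As \<open>aff_dim {} = -1\<close>, the condition \<open>0 \<le> aff_dim J\<close> excludes the empty set.
\<close>

definition law_V :: "real \<Rightarrow> 'a::euclidean_space measure set" where
  "law_V a = {P. law P \<and> (\<forall>J. affine J \<and> 0 \<le> aff_dim J \<and> aff_dim J < int DIM('a) \<longrightarrow>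
     measure P J < 1 - (real DIM('a) - real_of_int (aff_dim J)) / a)}"


section \<open>Bounded Lipschitz functions and their dual\<close>

definition sup_abs :: "('a \<Rightarrow> real) \<Rightarrow> real" where
  "sup_abs f = (SUP x. \<bar>f x\<bar>)"

definition lip_const :: "('a::euclidean_space \<Rightarrow> real) \<Rightarrow> real" where
  "lip_const f = (SUP (x, y)\<in>{(x, y). x \<noteq> y}. \<bar>f x - f y\<bar> / norm (x - y))"

definition bl_functions :: "('a::euclidean_space \<Rightarrow> real) set" where
  "bl_functions = {f. bounded (range f) \<and> (\<exists>L. L-lipschitz_on UNIV f)}"

lemma bl_functionsI:
  fixes f :: "'a::euclidean_space \<Rightarrow> real"
  assumes "\<And>x. \<bar>f x\<bar> \<le> B" "\<And>x y. \<bar>f x - f y\<bar> \<le> L * norm (x - y)"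
  shows "f \<in> bl_functions"
proof -
  have "\<bar>L\<bar>-lipschitz_on UNIV f"
  proof (rule lipschitz_onI)
    fix x y :: 'a
    have "L * norm (x - y) \<le> \<bar>L\<bar> * norm (x - y)" by (intro mult_right_mono) auto
    then show "dist (f x) (f y) \<le> \<bar>L\<bar> * dist x y"
      using assms(2)[of x y] by (simp add: dist_norm)
  qed simp
  moreover have "bounded (range f)"
    using assms(1) by (intro boundedI[of _ B]) auto
  ultimately show ?thesis by (auto simp: bl_functions_def)
qed

lemma bl_functionsE:
  assumes "f \<in> bl_functions"
  obtains B L where "0 \<le> B" "0 \<le> L" "\<And>x. \<bar>f x\<bar> \<le> B" "\<And>x y. \<bar>f x - f y\<bar> \<le> L * norm (x - y)"
proof -
  obtain L where L: "L-lipschitz_on UNIV f" using assms by (auto simp: bl_functions_def)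
  obtain B where B: "\<And>x. \<bar>f x\<bar> \<le> B"
    using assms by (fastforce simp: bl_functions_def bounded_iff)
  have "0 \<le> B" using B[of 0] by linarith
  moreover have "0 \<le> L" using L by (rule lipschitz_on_nonneg)
  moreover have "\<bar>f x - f y\<bar> \<le> L * norm (x - y)" for x y
    using lipschitz_onD[OF L, of x y] by (simp add: dist_norm)
  ultimately show ?thesis using that B by blast
qed

lemma sup_abs_upper: "f \<in> bl_functions \<Longrightarrow> \<bar>f x\<bar> \<le> sup_abs f"
  unfolding sup_abs_def
  by (elim bl_functionsE, rule cSUP_upper) (auto intro!: bdd_aboveI)

lemma sup_abs_least: "(\<And>x. \<bar>f x\<bar> \<le> B) \<Longrightarrow> sup_abs f \<le> B"
  unfolding sup_abs_def by (rule cSUP_least) auto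

lemma lip_const_upper:
  assumes "f \<in> bl_functions"
  shows "\<bar>f x - f y\<bar> \<le> lip_const f * norm (x - y)"
proof (cases "x = y")
  case False
  obtain L where L: "\<And>x y. \<bar>f x - f y\<bar> \<le> L * norm (x - y)"
    using assms by (elim bl_functionsE) blast
  have "\<bar>f x - f y\<bar> / norm (x - y) \<le> lip_const f"
    unfolding lip_const_def
    by (rule cSUP_upper2[where x = "(x, y)"])
      (use L False in \<open>auto intro!: bdd_aboveI[where M = L] simp: divide_simps\<close>)
  then show ?thesis using False by (simp add: divide_simps)
qed simp

lemma lip_const_least:
  fixes f :: "'a::euclidean_space \<Rightarrow> real"
  assumes "\<And>x y. \<bar>f x - f y\<bar> \<le> L * norm (x - y)"
  shows "lip_const f \<le> L"
proof -
  obtain b :: 'a where "b \<in> Basis" using nonempty_Basis by blast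
  then have "(b, 0) \<in> {(x, y::'a). x \<noteq> y}" by auto
  then have "{(x, y::'a). x \<noteq> y} \<noteq> {}" by blast
  then show ?thesis unfolding lip_const_def
    by (rule cSUP_least) (use assms in \<open>auto simp: divide_simps\<close>)
qed

lemma lip_const_nonneg:
  fixes f :: "'a::euclidean_space \<Rightarrow> real"
  assumes "f \<in> bl_functions"
  shows "0 \<le> lip_const f"
proof -
  obtain b :: 'a where "b \<in> Basis" using nonempty_Basis by blast
  then show ?thesis using lip_const_upper[OF assms, of b 0]
    by simp
qed

lemma bl_functions_zero: "(\<lambda>x. 0) \<in> bl_functions"
  by (rule bl_functionsI[of _ 0 0]) auto

lemma bl_functions_add:
  assumes "f \<in> bl_functions" "g \<in> bl_functions"
  shows "(\<lambda>x. f x + g x) \<in> bl_functions"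
proof (rule bl_functionsI)
  show "\<bar>f x + g x\<bar> \<le> sup_abs f + sup_abs g" for x
    using sup_abs_upper[OF assms(1), of x] sup_abs_upper[OF assms(2), of x] by linarith
  show "\<bar>f x + g x - (f y + g y)\<bar> \<le> (lip_const f + lip_const g) * norm (x - y)" for x y
    using lip_const_upper[OF assms(1), of x y] lip_const_upper[OF assms(2), of x y]
    unfolding distrib_right by linarith
qed

lemma bl_functions_scale:
  assumes "f \<in> bl_functions"
  shows "(\<lambda>x. c * f x) \<in> bl_functions"
proof (rule bl_functionsI)
  show "\<bar>c * f x\<bar> \<le> \<bar>c\<bar> * sup_abs f" for x
    using sup_abs_upper[OF assms, of x] by (simp add: abs_mult mult_left_mono)
  show "\<bar>c * f x - c * f y\<bar> \<le> (\<bar>c\<bar> * lip_const f) * norm (x - y)" for x y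
    using mult_left_mono[OF lip_const_upper[OF assms, of x y], of "\<bar>c\<bar>"]
    by (simp only: abs_mult right_diff_distrib[symmetric] mult.assoc abs_ge_zero)
qed

lemma bl_functions_uminus: "f \<in> bl_functions \<Longrightarrow> (\<lambda>x. - f x) \<in> bl_functions"
  using bl_functions_scale[of f "-1"] by simp

lemma bl_functions_diff:
  "f \<in> bl_functions \<Longrightarrow> g \<in> bl_functions \<Longrightarrow> (\<lambda>x. f x - g x) \<in> bl_functions"
  using bl_functions_add[OF _ bl_functions_uminus, of f g] by simp

typedef (overloaded) 'a bl = "bl_functions :: ('a::euclidean_space \<Rightarrow> real) set"
  morphisms bl_apply Bl
  using bl_functions_zero by blast

setup_lifting type_definition_bl

instantiation bl :: (euclidean_space) real_vector
begin

lift_definition zero_bl :: "'a bl" is "\<lambda>x. 0" by (rule bl_functions_zero)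
lift_definition plus_bl :: "'a bl \<Rightarrow> 'a bl \<Rightarrow> 'a bl" is "\<lambda>f g x. f x + g x"
  by (rule bl_functions_add)
lift_definition minus_bl :: "'a bl \<Rightarrow> 'a bl \<Rightarrow> 'a bl" is "\<lambda>f g x. f x - g x"
  by (rule bl_functions_diff)
lift_definition uminus_bl :: "'a bl \<Rightarrow> 'a bl" is "\<lambda>f x. - f x"
  by (rule bl_functions_uminus)
lift_definition scaleR_bl :: "real \<Rightarrow> 'a bl \<Rightarrow> 'a bl" is "\<lambda>c f x. c * f x"
  by (rule bl_functions_scale)

instance
  by standard (transfer; simp add: algebra_simps)+

end

instantiation bl :: (euclidean_space) real_normed_vector
begin

lift_definition norm_bl :: "'a bl \<Rightarrow> real" is "\<lambda>f. sup_abs f + lip_const f" .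
definition dist_bl :: "'a bl \<Rightarrow> 'a bl \<Rightarrow> real" where "dist_bl f g = norm (f - g)"
definition sgn_bl :: "'a bl \<Rightarrow> 'a bl" where "sgn_bl f = f /\<^sub>R norm f"
definition uniformity_bl :: "('a bl \<times> 'a bl) filter" where
  "uniformity_bl = (INF e\<in>{0<..}. principal {(x, y). dist x y < e})"
definition open_bl :: "'a bl set \<Rightarrow> bool" where
  "open_bl U \<longleftrightarrow> (\<forall>x\<in>U. eventually (\<lambda>(x', y). x' = x \<longrightarrow> y \<in> U) uniformity)"

lemma norm_bl_scale_le: "norm (a *\<^sub>R f) \<le> \<bar>a\<bar> * norm (f :: 'a bl)"
proof transfer
  fix a and f :: "'a \<Rightarrow> real"
  assume f: "f \<in> bl_functions"
  have "sup_abs (\<lambda>x. a * f x) \<le> \<bar>a\<bar> * sup_abs f"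
    by (rule sup_abs_least) (simp add: abs_mult mult_left_mono sup_abs_upper[OF f])
  moreover have "lip_const (\<lambda>x. a * f x) \<le> \<bar>a\<bar> * lip_const f"
    using mult_left_mono[OF lip_const_upper[OF f], of "\<bar>a\<bar>"]
    by (intro lip_const_least)
      (simp only: abs_mult right_diff_distrib[symmetric] mult.assoc abs_ge_zero)
  ultimately show "sup_abs (\<lambda>x. a * f x) + lip_const (\<lambda>x. a * f x)
      \<le> \<bar>a\<bar> * (sup_abs f + lip_const f)"
    by (simp add: distrib_left)
qed

instance
proof
  fix f g :: "'a bl" and a :: real
  show "norm f = 0 \<longleftrightarrow> f = 0"
  proof transfer
    fix f :: "'a \<Rightarrow> real"
    assume f: "f \<in> bl_functions"
    have "f = (\<lambda>x. 0)" if "sup_abs f + lip_const f = 0"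
    proof
      fix x show "f x = 0"
        using that sup_abs_upper[OF f, of x] lip_const_nonneg[OF f] by linarith
    qed
    moreover have "sup_abs (\<lambda>x::'a. 0) + lip_const (\<lambda>x::'a. 0) = 0"
      using sup_abs_least[of "\<lambda>x::'a. 0" 0] lip_const_least[of "\<lambda>x::'a. 0" 0]
        sup_abs_upper[OF bl_functions_zero[where 'a = 'a]]
        lip_const_nonneg[OF bl_functions_zero[where 'a = 'a]] by simp
    ultimately show "sup_abs f + lip_const f = 0 \<longleftrightarrow> f = (\<lambda>x. 0)" by auto
  qed
  show "norm (f + g) \<le> norm f + norm g"
  proof transfer
    fix f g :: "'a \<Rightarrow> real"
    assume fg: "f \<in> bl_functions" "g \<in> bl_functions"
    have "sup_abs (\<lambda>x. f x + g x) \<le> sup_abs f + sup_abs g"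
    proof (rule sup_abs_least)
      fix x show "\<bar>f x + g x\<bar> \<le> sup_abs f + sup_abs g"
        using sup_abs_upper[OF fg(1), of x] sup_abs_upper[OF fg(2), of x] by linarith
    qed
    moreover have "lip_const (\<lambda>x. f x + g x) \<le> lip_const f + lip_const g"
    proof (rule lip_const_least)
      fix x y show "\<bar>f x + g x - (f y + g y)\<bar> \<le> (lip_const f + lip_const g) * norm (x - y)"
        using lip_const_upper[OF fg(1), of x y] lip_const_upper[OF fg(2), of x y]
        unfolding distrib_right by linarith
    qed
    ultimately show "sup_abs (\<lambda>x. f x + g x) + lip_const (\<lambda>x. f x + g x)
        \<le> sup_abs f + lip_const f + (sup_abs g + lip_const g)" by linarith
  qed
  show "norm (a *\<^sub>R f) = \<bar>a\<bar> * norm f"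
  proof (cases "a = 0")
    case True
    then show ?thesis using \<open>norm f = 0 \<longleftrightarrow> f = 0\<close> norm_bl_scale_le[of 0 f]
      norm_bl_scale_le[of 0 "0 :: 'a bl"] norm_bl_scale_le[of "-1" "0 :: 'a bl"]
      norm_bl_scale_le[of 2 "0 :: 'a bl"] by simp
  next
    case False
    have "\<bar>a\<bar> * norm f = \<bar>a\<bar> * norm (inverse a *\<^sub>R (a *\<^sub>R f))" using False by simp
    also have "\<dots> \<le> \<bar>a\<bar> * (\<bar>inverse a\<bar> * norm (a *\<^sub>R f))"
      by (intro mult_left_mono norm_bl_scale_le) simp
    also have "\<dots> = norm (a *\<^sub>R f)" using False by (simp add: abs_inverse)
    finally show ?thesis using norm_bl_scale_le[of a f] by simp
  qed
qed (simp_all add: dist_bl_def sgn_bl_def uniformity_bl_def open_bl_def)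

end

type_synonym 'a bl_dual = "'a bl \<Rightarrow>\<^sub>L real"

definition law_phi :: "'a::euclidean_space measure \<Rightarrow> 'a bl_dual" where
  "law_phi Q = Blinfun (\<lambda>f. \<integral>x. bl_apply f x \<partial>Q)"

lemma law_phi_apply:
  fixes Q :: "'a::euclidean_space measure"
  assumes "law Q"
  shows "blinfun_apply (law_phi Q) f = (\<integral>x. bl_apply f x \<partial>Q)"
proof -
  interpret prob_space Q using assms by (simp add: law_def)
  have int: "integrable Q (bl_apply h)" for h :: "'a bl"
  proof (rule integrable_const_bound)
    have "bl_apply h \<in> bl_functions" using bl_apply by blast
    then obtain L where "L-lipschitz_on UNIV (bl_apply h)" by (auto simp: bl_functions_def)
    then have "continuous_on UNIV (bl_apply h)" by (rule lipschitz_on_continuous_on)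
    then have "bl_apply h \<in> borel_measurable borel" by (rule borel_measurable_continuous_onI)
    then show "bl_apply h \<in> borel_measurable Q"
      using assms measurable_cong_sets[of Q borel borel borel] by (auto simp: law_def)
    show "AE x in Q. norm (bl_apply h x) \<le> sup_abs (bl_apply h)"
      using sup_abs_upper[OF bl_apply] by (auto intro!: AE_I2)
  qed
  have "bounded_linear (\<lambda>f. \<integral>x. bl_apply f x \<partial>Q)"
  proof (rule bounded_linear_intro[where K = 1])
    fix g h :: "'a bl" and c :: real
    show "(\<integral>x. bl_apply (g + h) x \<partial>Q) = (\<integral>x. bl_apply g x \<partial>Q) + (\<integral>x. bl_apply h x \<partial>Q)"
      using int by (simp add: plus_bl.rep_eq)
    show "(\<integral>x. bl_apply (c *\<^sub>R g) x \<partial>Q) = c *\<^sub>R (\<integral>x. bl_apply g x \<partial>Q)"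
      by (simp add: scaleR_bl.rep_eq)
    have "\<bar>\<integral>x. bl_apply g x \<partial>Q\<bar> \<le> (\<integral>x. \<bar>bl_apply g x\<bar> \<partial>Q)"
      using int by simp
    also have "\<dots> \<le> (\<integral>x. sup_abs (bl_apply g) \<partial>Q)"
      using int by (intro integral_mono) (auto intro: sup_abs_upper[OF bl_apply])
    also have "\<dots> \<le> norm g"
      using lip_const_nonneg[OF bl_apply, of g] by (simp add: norm_bl.rep_eq prob_space)
    finally show "norm (\<integral>x. bl_apply g x \<partial>Q) \<le> norm g * 1" by simp
  qed
  then show ?thesis unfolding law_phi_def by (simp add: bounded_linear_Blinfun_apply)
qed


section \<open>Finite signed Borel measures on the line, with the Kolmogorov norm\<close>

definition signed_measures :: "(real set \<Rightarrow> real) set" where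
  "signed_measures = {\<tau>. (\<forall>A. A \<notin> sets borel \<longrightarrow> \<tau> A = 0) \<and>
     (\<forall>A :: nat \<Rightarrow> real set. range A \<subseteq> sets borel \<longrightarrow> disjoint_family A \<longrightarrow>
        (\<lambda>n. \<tau> (A n)) sums \<tau> (\<Union>n. A n))}"

lemma signed_measures_sums:
  "\<tau> \<in> signed_measures \<Longrightarrow> range A \<subseteq> sets borel \<Longrightarrow> disjoint_family A \<Longrightarrow>
     (\<lambda>n. \<tau> (A n)) sums \<tau> (\<Union>n. A n)"
  by (auto simp: signed_measures_def)

lemma signed_measures_empty:
  assumes "\<tau> \<in> signed_measures" shows "\<tau> {} = 0"
proof -
  have "(\<lambda>n::nat. \<tau> {}) sums \<tau> (\<Union>n::nat. {})"
    by (rule signed_measures_sums[OF assms]) (auto simp: disjoint_family_on_def)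
  then show ?thesis by (simp add: summable_const_iff sums_iff)
qed

lemma signed_measures_Un:
  assumes "\<tau> \<in> signed_measures" "A \<in> sets borel" "B \<in> sets borel" "A \<inter> B = {}"
  shows "\<tau> (A \<union> B) = \<tau> A + \<tau> B"
proof -
  have "(\<lambda>n. \<tau> (binaryset A B n)) sums \<tau> (\<Union>n. binaryset A B n)"
    using assms by (intro signed_measures_sums)
      (auto simp: range_binaryset_eq disjoint_family_on_def binaryset_def)
  moreover have "(\<lambda>n. \<tau> (binaryset A B n)) sums (\<tau> A + \<tau> B)"
    using assms by (intro binaryset_sums signed_measures_empty)
  ultimately show ?thesis using sums_unique2 by (fastforce simp: UN_binaryset_eq)
qed

lemma signed_measures_incseq:
  assumes t: "\<tau> \<in> signed_measures" and A: "range A \<subseteq> sets borel" "incseq A"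
  shows "convergent (\<lambda>n. \<tau> (A n))"
proof -
  have d: "range (disjointed A) \<subseteq> sets borel"
    using sets.range_disjointed_sets[OF A(1)] by simp
  have "(\<lambda>n. \<tau> (disjointed A n)) sums \<tau> (\<Union>n. disjointed A n)"
    by (rule signed_measures_sums[OF t d disjoint_family_disjointed])
  then have "(\<lambda>n. \<Sum>i<Suc n. \<tau> (disjointed A i)) \<longlonglongrightarrow> \<tau> (\<Union>n. disjointed A n)"
    unfolding sums_def by (rule LIMSEQ_Suc)
  moreover have "(\<Sum>i<Suc n. \<tau> (disjointed A i)) = \<tau> (A n)" for n
  proof (induction n)
    case 0 then show ?case by (simp add: disjointed_def)
  next
    case (Suc n)
    have "A (Suc n) = A n \<union> disjointed A (Suc n)"
      using A(2) by (simp add: disjointed_mono incseq_SucD Un_absorb1)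
    moreover have "A n \<inter> disjointed A (Suc n) = {}"
      using A(2) by (simp add: disjointed_mono)
    ultimately have "\<tau> (A (Suc n)) = \<tau> (A n) + \<tau> (disjointed A (Suc n))"
      using signed_measures_Un[OF t] A(1) d by (metis range_subsetD)
    then show ?case using Suc by simp
  qed
  ultimately have "(\<lambda>n. \<tau> (A n)) \<longlonglongrightarrow> \<tau> (\<Union>n. disjointed A n)"
    by (simp only:)
  then show ?thesis by (rule convergentI)
qed

lemma signed_measures_bounded:
  assumes t: "\<tau> \<in> signed_measures"
  shows "\<exists>B. \<forall>x. \<bar>\<tau> {..x}\<bar> \<le> B"
proof (rule ccontr)
  assume "\<not> ?thesis"
  then have "\<forall>n. \<exists>x. \<bar>\<tau> {..x}\<bar> > real n" by (meson not_le)
  then obtain x where x: "\<And>n. \<bar>\<tau> {..x n}\<bar> > real n" by metis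
  obtain r where r: "strict_mono r" "monoseq (x \<circ> r)" using seq_monosub[of x] by (auto simp: comp_def)
  have "convergent (\<lambda>n. \<tau> {..x (r n)})"
  proof (cases "incseq (x \<circ> r)")
    case True
    then show ?thesis
      by (intro signed_measures_incseq[OF t]) (auto simp: incseq_def intro: order_trans)
  next
    case False
    with r(2) have "decseq (x \<circ> r)" by (simp add: monoseq_iff)
    then have "convergent (\<lambda>n. \<tau> {x (r n)<..})"
      by (intro signed_measures_incseq[OF t]) (auto simp: decseq_def incseq_def intro: le_less_trans)
    then have "convergent (\<lambda>n. \<tau> UNIV - \<tau> {x (r n)<..})"
      by (intro convergent_diff convergent_const)
    moreover have "\<tau> {..y} = \<tau> UNIV - \<tau> {y<..}" for y
    proof -
      have "{..y} \<union> {y<..} = UNIV" "{..y} \<inter> {y<..} = {}" by auto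
      with signed_measures_Un[OF t, of "{..y}" "{y<..}"] show ?thesis by simp
    qed
    ultimately show ?thesis by simp
  qed
  then have "Bseq (\<lambda>n. \<tau> {..x (r n)})" by (rule convergent_imp_Bseq)
  then obtain K where K: "\<And>n. \<bar>\<tau> {..x (r n)}\<bar> \<le> K" by (auto simp: Bseq_def)
  obtain n where "K < real n" using reals_Archimedean2 by blast
  moreover have "n \<le> r n" using r(1) by (rule strict_mono_imp_increasing)
  ultimately show False using K[of n] x[of "r n"] by linarith
qed

lemma signed_measures_eqI:
  assumes s: "\<sigma> \<in> signed_measures" and t: "\<tau> \<in> signed_measures"
    and eq: "\<And>x. \<sigma> {..x} = \<tau> {..x}"
  shows "\<sigma> = \<tau>"
proof
  fix A :: "real set"
  have st: "Int_stable (range atMost :: real set set)"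
    by (auto simp: Int_stable_def)
  have sets: "sets borel = sigma_sets UNIV (range atMost :: real set set)"
    unfolding borel_eq_atMost by (rule sets_measure_of) simp
  have "\<sigma> UNIV = \<tau> UNIV"
  proof -
    have inc: "(\<lambda>n. \<rho> {..real n}) \<longlonglongrightarrow> \<rho> UNIV" if r: "\<rho> \<in> signed_measures" for \<rho>
    proof -
      define D where "D n = (if n = 0 then {..0} else {real n - 1<..real n})" for n
      have "disjoint_family D"
        unfolding disjoint_family_on_def D_def
      proof (intro ballI impI)
        fix m n :: nat assume "m \<noteq> n"
        then have "real m + 1 \<le> real n \<or> real n + 1 \<le> real m"
          by (metis Suc_leI linorder_neqE_nat of_nat_Suc of_nat_le_iff add.commute)
        then show "(if m = 0 then {..0} else {real m - 1<..real m}) \<inter>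
            (if n = 0 then {..0} else {real n - 1<..real n}) = {}" by auto
      qed
      moreover have "range D \<subseteq> sets borel" by (auto simp: D_def)
      ultimately have "(\<lambda>n. \<rho> (D n)) sums \<rho> (\<Union>n. D n)" by (intro signed_measures_sums[OF r])
      moreover have part: "(\<Sum>i<Suc n. \<rho> (D i)) = \<rho> {..real n}" for n
      proof (induction n)
        case (Suc n)
        have "{..real (Suc n)} = {..real n} \<union> D (Suc n)" by (auto simp: D_def)
        moreover have "{..real n} \<inter> D (Suc n) = {}" by (auto simp: D_def)
        ultimately have "\<rho> {..real (Suc n)} = \<rho> {..real n} + \<rho> (D (Suc n))"
          using signed_measures_Un[OF r, of "{..real n}" "D (Suc n)"] by (simp add: D_def)
        then show ?case using Suc by simp
      qed (simp add: D_def)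
      moreover have "(\<Union>n. D n) = UNIV"
      proof -
        have "x \<in> (\<Union>n. D n)" for x :: real
        proof (cases "x \<le> 0")
          case True then show ?thesis by (auto simp: D_def)
        next
          case False
          then have "x \<in> D (nat \<lceil>x\<rceil>)" unfolding D_def by simp linarith
          then show ?thesis by blast
        qed
        then show ?thesis by blast
      qed
      ultimately have "(\<lambda>n. \<Sum>i<n. \<rho> (D i)) \<longlonglongrightarrow> \<rho> UNIV" by (simp add: sums_def)
      then have "(\<lambda>n. \<Sum>i<Suc n. \<rho> (D i)) \<longlonglongrightarrow> \<rho> UNIV" by (rule LIMSEQ_Suc)
      then show ?thesis unfolding part .
    qed
    show ?thesis using inc[OF s] inc[OF t] unfolding eq by (rule LIMSEQ_unique)
  qed
  note U = this
  show "\<sigma> A = \<tau> A"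
  proof (cases "A \<in> sets borel")
    case True
    then have *: "A \<in> sigma_sets UNIV (range atMost)" by (simp only: sets)
    have "range atMost \<subseteq> Pow (UNIV :: real set)" by simp
    from this * show ?thesis
    proof (induction rule: sigma_sets_induct_disjoint[OF st, consumes 2, case_names basic empty compl union])
      case (compl A)
      then have A: "A \<in> sets borel" unfolding sets by simp
      have *: "\<rho> (UNIV - A) = \<rho> UNIV - \<rho> A" if "\<rho> \<in> signed_measures" for \<rho>
        using signed_measures_Un[OF that A, of "UNIV - A"] A by auto
      show ?case using compl U by (simp add: *[OF s] *[OF t])
    next
      case (union A)
      then have "range A \<subseteq> sets borel" unfolding sets by simp
      with union signed_measures_sums[OF s, of A] signed_measures_sums[OF t, of A]
      show ?case by (simp add: sums_iff)
    qed (auto simp: eq signed_measures_empty[OF s] signed_measures_empty[OF t])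
  next
    case False
    then show ?thesis using s t by (simp add: signed_measures_def)
  qed
qed

typedef signed_measure = signed_measures
  morphisms sm_apply Sm
  by (rule exI[of _ "\<lambda>_. 0"]) (simp add: signed_measures_def)

setup_lifting type_definition_signed_measure

instantiation signed_measure :: real_vector
begin

lift_definition zero_signed_measure :: signed_measure is "\<lambda>_. 0"
  by (simp add: signed_measures_def)
lift_definition plus_signed_measure :: "signed_measure \<Rightarrow> signed_measure \<Rightarrow> signed_measure"
  is "\<lambda>\<sigma> \<tau> A. \<sigma> A + \<tau> A" by (auto simp: signed_measures_def intro!: sums_add)
lift_definition minus_signed_measure :: "signed_measure \<Rightarrow> signed_measure \<Rightarrow> signed_measure"
  is "\<lambda>\<sigma> \<tau> A. \<sigma> A - \<tau> A" by (auto simp: signed_measures_def intro!: sums_diff)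
lift_definition uminus_signed_measure :: "signed_measure \<Rightarrow> signed_measure"
  is "\<lambda>\<tau> A. - \<tau> A" by (auto simp: signed_measures_def intro!: sums_minus)
lift_definition scaleR_signed_measure :: "real \<Rightarrow> signed_measure \<Rightarrow> signed_measure"
  is "\<lambda>c \<tau> A. c * \<tau> A" by (auto simp: signed_measures_def intro!: sums_mult)

instance
  by standard (transfer; simp add: algebra_simps)+

end

instantiation signed_measure :: real_normed_vector
begin

definition norm_signed_measure :: "signed_measure \<Rightarrow> real" where
  "norm_signed_measure \<tau> = (SUP x. \<bar>sm_apply \<tau> {..x}\<bar>)"
definition dist_signed_measure :: "signed_measure \<Rightarrow> signed_measure \<Rightarrow> real" where
  "dist_signed_measure \<sigma> \<tau> = norm (\<sigma> - \<tau>)"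
definition sgn_signed_measure :: "signed_measure \<Rightarrow> signed_measure" where
  "sgn_signed_measure \<tau> = \<tau> /\<^sub>R norm \<tau>"
definition uniformity_signed_measure :: "(signed_measure \<times> signed_measure) filter" where
  "uniformity_signed_measure = (INF e\<in>{0<..}. principal {(x, y). dist x y < e})"
definition open_signed_measure :: "signed_measure set \<Rightarrow> bool" where
  "open_signed_measure U \<longleftrightarrow> (\<forall>x\<in>U. eventually (\<lambda>(x', y). x' = x \<longrightarrow> y \<in> U) uniformity)"

lemma norm_signed_measure_upper: "\<bar>sm_apply \<tau> {..x}\<bar> \<le> norm \<tau>"
proof -
  obtain B where "\<And>x. \<bar>sm_apply \<tau> {..x}\<bar> \<le> B" using signed_measures_bounded[OF sm_apply] by blast
  then show ?thesis unfolding norm_signed_measure_def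
    by (intro cSUP_upper) (auto intro!: bdd_aboveI)
qed

lemma norm_signed_measure_least: "(\<And>x. \<bar>sm_apply \<tau> {..x}\<bar> \<le> B) \<Longrightarrow> norm \<tau> \<le> B"
  unfolding norm_signed_measure_def by (rule cSUP_least) auto

lemma norm_signed_measure_scale_le: "norm (a *\<^sub>R \<tau>) \<le> \<bar>a\<bar> * norm (\<tau> :: signed_measure)"
  by (rule norm_signed_measure_least)
    (simp add: scaleR_signed_measure.rep_eq abs_mult mult_left_mono norm_signed_measure_upper)

instance
proof
  fix \<sigma> \<tau> :: signed_measure and a :: real
  show n0: "norm \<tau> = 0 \<longleftrightarrow> \<tau> = 0"
  proof
    assume "norm \<tau> = 0"
    then have "sm_apply \<tau> {..x} = sm_apply 0 {..x}" for x
      using norm_signed_measure_upper[of \<tau> x] by (simp add: zero_signed_measure.rep_eq)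
    then have "sm_apply \<tau> = sm_apply 0" by (intro signed_measures_eqI sm_apply)
    then show "\<tau> = 0" by (simp add: sm_apply_inject)
  qed (simp add: norm_signed_measure_def zero_signed_measure.rep_eq)
  show "norm (\<sigma> + \<tau>) \<le> norm \<sigma> + norm \<tau>"
  proof (rule norm_signed_measure_least)
    fix x show "\<bar>sm_apply (\<sigma> + \<tau>) {..x}\<bar> \<le> norm \<sigma> + norm \<tau>"
      using norm_signed_measure_upper[of \<sigma> x] norm_signed_measure_upper[of \<tau> x]
      by (simp add: plus_signed_measure.rep_eq)
  qed
  show "norm (a *\<^sub>R \<tau>) = \<bar>a\<bar> * norm \<tau>"
  proof (cases "a = 0")
    case True then show ?thesis by (simp add: norm_signed_measure_def zero_signed_measure.rep_eq)
  next
    case False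
    have "\<bar>a\<bar> * norm \<tau> = \<bar>a\<bar> * norm (inverse a *\<^sub>R (a *\<^sub>R \<tau>))" using False by simp
    also have "\<dots> \<le> \<bar>a\<bar> * (\<bar>inverse a\<bar> * norm (a *\<^sub>R \<tau>))"
      by (intro mult_left_mono norm_signed_measure_scale_le) simp
    also have "\<dots> = norm (a *\<^sub>R \<tau>)" using False by (simp add: abs_inverse)
    finally show ?thesis using norm_signed_measure_scale_le[of a \<tau>] by simp
  qed
qed (simp_all add: dist_signed_measure_def sgn_signed_measure_def uniformity_signed_measure_def
    open_signed_measure_def)

end

definition law_signed :: "real measure \<Rightarrow> signed_measure" where
  "law_signed P = Sm (measure P)"

lemma law_signed_apply:
  assumes "law P"
  shows "sm_apply (law_signed P) = measure P"
proof -
  interpret prob_space P using assms by (simp add: law_def)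
  have s: "sets P = sets borel" using assms by (simp add: law_def)
  have "measure P A = 0" if "A \<notin> sets borel" for A
    using that s by (simp add: measure_notin_sets)
  moreover have "(\<lambda>n. measure P (A n)) sums measure P (\<Union>n. A n)"
    if "range A \<subseteq> sets borel" "disjoint_family A" for A :: "nat \<Rightarrow> real set"
    using that s by (intro finite_measure_UNION) auto
  ultimately have "measure P \<in> signed_measures" by (simp add: signed_measures_def)
  then show ?thesis by (simp add: law_signed_def Sm_inverse)
qed


section \<open>Symmetric matrices\<close>

typedef 'n symmat = "{A :: real^'n::finite^'n. transpose A = A}"
  morphisms mat_of symmat_of
  by (rule exI[of _ 0]) (simp add: transpose_def vec_eq_iff)

setup_lifting type_definition_symmat

instantiation symmat :: (finite) real_vector
begin

lift_definition zero_symmat :: "'a symmat" is 0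
  by (simp add: transpose_def vec_eq_iff)
lift_definition plus_symmat :: "'a symmat \<Rightarrow> 'a symmat \<Rightarrow> 'a symmat" is "(+)"
  by (simp add: transpose_def vec_eq_iff)
lift_definition minus_symmat :: "'a symmat \<Rightarrow> 'a symmat \<Rightarrow> 'a symmat" is "(-)"
  by (simp add: transpose_def vec_eq_iff)
lift_definition uminus_symmat :: "'a symmat \<Rightarrow> 'a symmat" is uminus
  by (simp add: transpose_def vec_eq_iff)
lift_definition scaleR_symmat :: "real \<Rightarrow> 'a symmat \<Rightarrow> 'a symmat" is "scaleR"
  by (simp add: transpose_def vec_eq_iff)

instance
  by standard (transfer; simp add: algebra_simps)+

end

instantiation symmat :: (finite) real_normed_vector
begin

lift_definition norm_symmat :: "'a symmat \<Rightarrow> real" is norm .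
definition dist_symmat :: "'a symmat \<Rightarrow> 'a symmat \<Rightarrow> real" where "dist_symmat A B = norm (A - B)"
definition sgn_symmat :: "'a symmat \<Rightarrow> 'a symmat" where "sgn_symmat A = A /\<^sub>R norm A"
definition uniformity_symmat :: "('a symmat \<times> 'a symmat) filter" where
  "uniformity_symmat = (INF e\<in>{0<..}. principal {(x, y). dist x y < e})"
definition open_symmat :: "'a symmat set \<Rightarrow> bool" where
  "open_symmat U \<longleftrightarrow> (\<forall>x\<in>U. eventually (\<lambda>(x', y). x' = x \<longrightarrow> y \<in> U) uniformity)"

instance
proof
  fix A B :: "'a symmat" and c :: real
  show "norm A = 0 \<longleftrightarrow> A = 0" by transfer simp
  show "norm (A + B) \<le> norm A + norm B" by transfer (rule norm_triangle_ineq)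
  show "norm (c *\<^sub>R A) = \<bar>c\<bar> * norm A" by transfer simp
qed (simp_all add: dist_symmat_def sgn_symmat_def uniformity_symmat_def open_symmat_def)

end

definition pos_def :: "'n::finite symmat set" where
  "pos_def = {A. \<forall>x. x \<noteq> 0 \<longrightarrow> 0 < x \<bullet> (mat_of A *v x)}"

lemma matrix_inv_right_left:
  assumes "invertible A"
  shows "A ** matrix_inv A = mat 1" "matrix_inv A ** A = mat 1"
proof -
  have "A ** matrix_inv A = mat 1 \<and> matrix_inv A ** A = mat 1"
    using assms unfolding matrix_inv_def invertible_def by (rule someI_ex)
  then show "A ** matrix_inv A = mat 1" "matrix_inv A ** A = mat 1" by auto
qed

lemma matrix_inv_symmetric:
  fixes A :: "real^'n::finite^'n"
  assumes "transpose A = A" "invertible A"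
  shows "transpose (matrix_inv A) = matrix_inv A"
proof -
  let ?B = "matrix_inv A"
  have "A ** transpose ?B = transpose (?B ** A)"
    by (simp only: matrix_transpose_mul assms(1))
  also have "\<dots> = mat 1"
    by (simp only: matrix_inv_right_left(2)[OF assms(2)] transpose_mat)
  finally have "?B ** (A ** transpose ?B) = ?B ** mat 1" by (rule arg_cong)
  then show ?thesis
    unfolding matrix_mul_assoc matrix_inv_right_left(2)[OF assms(2)]
    by (simp only: matrix_mul_lid matrix_mul_rid)
qed

text \<open>
  The value for singular matrices is irrelevant; \<^const>\<open>matrix_inv\<close> is unspecified there and
  need not be symmetric.
\<close>

lift_definition symmat_inv :: "'n::finite symmat \<Rightarrow> 'n symmat"
  is "\<lambda>A. if invertible A then matrix_inv A else 0"
  by (auto simp: matrix_inv_symmetric) (simp add: transpose_def vec_eq_iff)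


section \<open>The t functionals\<close>

lift_definition t_G :: "real \<Rightarrow> real^'n::finite \<Rightarrow> 'n symmat \<Rightarrow> 'n symmat"
  is "\<lambda>\<nu> y A. - (1/2) *\<^sub>R A +
        ((\<nu> + real CARD('n)) / (2 * (\<nu> + y \<bullet> (matrix_inv A *v y)))) *\<^sub>R
          ((columnvector y :: real^1^'n) ** (rowvector y :: real^'n^1))"
proof -
  fix \<nu> :: real and y :: "real^'n" and A :: "real^'n^'n"
  assume A: "transpose A = A"
  let ?Y = "(columnvector y :: real^1^'n) ** (rowvector y :: real^'n^1)"
  have Y: "transpose ?Y = ?Y"
    by (simp add: matrix_transpose_mul transpose_columnvector transpose_rowvector)
  have "transpose (a *\<^sub>R A + b *\<^sub>R ?Y) = a *\<^sub>R transpose A + b *\<^sub>R transpose ?Y" for a b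
    by (simp add: transpose_def vec_eq_iff)
  then show "transpose (- (1/2) *\<^sub>R A +
        ((\<nu> + real CARD('n)) / (2 * (\<nu> + y \<bullet> (matrix_inv A *v y)))) *\<^sub>R ?Y) =
      - (1/2) *\<^sub>R A + ((\<nu> + real CARD('n)) / (2 * (\<nu> + y \<bullet> (matrix_inv A *v y)))) *\<^sub>R ?Y"
    unfolding A Y .
qed

text \<open>
  By \<open>t_G_bl\<close> below, \<^const>\<open>Bl\<close> is applied to bounded Lipschitz functions only, whenever
  \<open>0 < \<nu>\<close> and \<open>A \<in> pos_def\<close>.
\<close>

definition t_F :: "real \<Rightarrow> (real^'n::finite) bl_dual \<Rightarrow> 'n symmat \<Rightarrow> 'n symmat" where
  "t_F \<nu> \<phi> A = symmat_of (\<chi> i j. blinfun_apply \<phi> (Bl (\<lambda>y. mat_of (t_G \<nu> y A) $ i $ j)))"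

definition t_rho :: "real \<Rightarrow> nat \<Rightarrow> real \<Rightarrow> real" where
  "t_rho \<nu> d s = (\<nu> + real d) / 2 * ln ((\<nu> + s) / \<nu>)"

definition scatter_objective :: "real \<Rightarrow> (real^'n::finite) measure \<Rightarrow> 'n symmat \<Rightarrow> real" where
  "scatter_objective \<nu> Q A = ln (det (mat_of A)) / 2 +
     (\<integral>y. t_rho \<nu> CARD('n) (y \<bullet> (matrix_inv (mat_of A) *v y)) - t_rho \<nu> CARD('n) (y \<bullet> y) \<partial>Q)"

definition t_scatter :: "real \<Rightarrow> (real^'n::finite) measure \<Rightarrow> 'n symmat" where
  "t_scatter \<nu> Q = (THE A. is_arg_min (scatter_objective \<nu> Q) (\<lambda>A. A \<in> pos_def) A)"

definition location_scatter_objective ::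
    "real \<Rightarrow> (real^'n::finite) measure \<Rightarrow> (real^'n) \<times> 'n symmat \<Rightarrow> real" where
  "location_scatter_objective \<nu> P = (\<lambda>(\<mu>, \<Sigma>). ln (det (mat_of \<Sigma>)) / 2 +
     (\<integral>y. t_rho \<nu> CARD('n) ((y - \<mu>) \<bullet> (matrix_inv (mat_of \<Sigma>) *v (y - \<mu>)))
         - t_rho \<nu> CARD('n) (y \<bullet> y) \<partial>P))"

definition t_location_scatter ::
    "real \<Rightarrow> (real^'n::finite) measure \<Rightarrow> (real^'n) \<times> 'n symmat" where
  "t_location_scatter \<nu> P =
     (THE p. is_arg_min (location_scatter_objective \<nu> P) (\<lambda>p. p \<in> UNIV \<times> pos_def) p)"

text \<open>
  In dimension one, a law on \<^typ>\<open>real\<close> is transported to the space of vectors with one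
  component, and the results are read off as real numbers.
\<close>

definition t_location_real :: "real \<Rightarrow> real measure \<Rightarrow> real" where
  "t_location_real \<nu> P = fst (t_location_scatter \<nu> (distr P borel (vec :: real \<Rightarrow> real^1))) $ 1"

definition t_scatter_real :: "real \<Rightarrow> real measure \<Rightarrow> real" where
  "t_scatter_real \<nu> P =
     mat_of (snd (t_location_scatter \<nu> (distr P borel (vec :: real \<Rightarrow> real^1)))) $ 1 $ 1"

lemma pos_def_invertible:
  fixes A :: "'n::finite symmat"
  assumes "A \<in> pos_def" shows "invertible (mat_of A)"
proof -
  have "x = 0" if "mat_of A *v x = 0" for x
  proof (rule ccontr)
    assume "x \<noteq> 0"
    with assms have "0 < x \<bullet> (mat_of A *v x)" by (simp add: pos_def_def)
    with that show False by simp
  qed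
  then show ?thesis
    using invertible_left_inverse[of "mat_of A"] matrix_left_invertible_ker[of "mat_of A"] by blast
qed

lemma symmat_inv_pos_def:
  fixes A :: "'n::finite symmat"
  assumes "A \<in> pos_def"
  shows "mat_of (symmat_inv A) = matrix_inv (mat_of A)" "symmat_inv A \<in> pos_def"
proof -
  have inv: "invertible (mat_of A)" by (rule pos_def_invertible[OF assms])
  show eq: "mat_of (symmat_inv A) = matrix_inv (mat_of A)" using inv by (simp add: symmat_inv.rep_eq)
  show "symmat_inv A \<in> pos_def"
    unfolding pos_def_def mem_Collect_eq eq
  proof (intro allI impI)
    fix x :: "real^'n" assume "x \<noteq> 0"
    define w where "w = matrix_inv (mat_of A) *v x"
    have x: "x = mat_of A *v w"
      unfolding w_def by (simp add: matrix_vector_mul_assoc matrix_inv_right_left[OF inv])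
    with \<open>x \<noteq> 0\<close> have "w \<noteq> 0" by auto
    with assms have "0 < w \<bullet> (mat_of A *v w)" by (simp add: pos_def_def)
    then show "0 < x \<bullet> (matrix_inv (mat_of A) *v x)"
      unfolding w_def[symmetric] x[symmetric] by (simp add: inner_commute)
  qed
qed

lemma pos_def_coercive:
  fixes A :: "'n::finite symmat"
  assumes "A \<in> pos_def"
  obtains c where "0 < c" "\<And>x. c * (norm x)\<^sup>2 \<le> x \<bullet> (mat_of A *v x)"
proof -
  have "continuous_on (sphere 0 1) (\<lambda>x. x \<bullet> (mat_of A *v x))"
    by (intro continuous_intros linear_continuous_on_compose matrix_vector_mul_linear)
  moreover have "sphere (0 :: real^'n) 1 \<noteq> {}" by simp
  ultimately have "\<exists>u\<in>sphere 0 1. \<forall>x\<in>sphere 0 1. u \<bullet> (mat_of A *v u) \<le> x \<bullet> (mat_of A *v x)"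
    by (intro continuous_attains_inf compact_sphere)
  then obtain u where u: "u \<in> sphere 0 1"
      "\<And>x. x \<in> sphere 0 1 \<Longrightarrow> u \<bullet> (mat_of A *v u) \<le> x \<bullet> (mat_of A *v x)"
    by blast
  have "u \<bullet> (mat_of A *v u) * (norm x)\<^sup>2 \<le> x \<bullet> (mat_of A *v x)" for x
  proof (cases "x = 0")
    case False
    define v where "v = x /\<^sub>R norm x"
    have x: "x = norm x *\<^sub>R v" and v: "v \<in> sphere 0 1" using False by (auto simp: v_def)
    have "x \<bullet> (mat_of A *v x) = (norm x)\<^sup>2 * (v \<bullet> (mat_of A *v v))"
      by (subst (1 2) x) (simp add: matrix_vector_mult_scaleR power2_eq_square)
    with mult_left_mono[OF u(2)[OF v], of "(norm x)\<^sup>2"] show ?thesis by (simp add: mult.commute)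
  qed simp
  moreover have "0 < u \<bullet> (mat_of A *v u)"
  proof -
    have "u \<noteq> 0" using u(1) by auto
    with assms show ?thesis unfolding pos_def_def by blast
  qed
  ultimately show ?thesis using that by blast
qed

lemma t_G_bl:
  fixes A :: "'n::finite symmat"
  assumes "0 < \<nu>" "A \<in> pos_def"
  shows "(\<lambda>y. mat_of (t_G \<nu> y A) $ i $ j) \<in> bl_functions"
proof -
  define C where "C = matrix_inv (mat_of A)"
  define q where "q y = y \<bullet> (C *v y)" for y
  define f where "f y = y $ i * y $ j / (\<nu> + q y)" for y
  have C: "mat_of (symmat_inv A) = C" "symmat_inv A \<in> pos_def"
    using symmat_inv_pos_def[OF assms(2)] by (auto simp: C_def)
  obtain c where c: "0 < c" "\<And>x. c * (norm x)\<^sup>2 \<le> q x"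
    using pos_def_coercive[OF C(2)] unfolding C(1) q_def by blast
  obtain K where K: "0 < K" "\<And>x. norm (C *v x) \<le> norm x * K"
    using bounded_linear.pos_bounded[OF matrix_vector_mul_bounded_linear[of C]] by blast
  have q0: "0 \<le> q x" for x using c by (smt (verit) mult_nonneg_nonneg zero_le_power2)
  have den: "0 < \<nu> + q x" for x using q0[of x] assms(1) by linarith
  have quad: "(norm x)\<^sup>2 / (\<nu> + q x) \<le> 1 / c" for x
    using c den[of x] assms(1) by (simp add: divide_simps mult.commute) (smt (verit) c(2))
  have lin: "norm x / (\<nu> + q x) \<le> 1 / \<nu> + 1 / c" for x
  proof (cases "norm x \<le> 1")
    case True
    have "norm x / (\<nu> + q x) \<le> 1 / \<nu>"
      using True assms(1) q0[of x] by (intro frac_le) auto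
    then show ?thesis using c(1) by (smt (verit) divide_pos_pos)
  next
    case False
    then have "norm x \<le> (norm x)\<^sup>2" by (simp add: power2_eq_square mult_le_cancel_left1)
    then have "norm x / (\<nu> + q x) \<le> (norm x)\<^sup>2 / (\<nu> + q x)"
      using den[of x] by (intro divide_right_mono) auto
    then show ?thesis using quad[of x] assms(1) by (smt (verit) divide_pos_pos)
  qed
  have prod: "\<bar>x $ i * x $ j\<bar> \<le> (norm x)\<^sup>2" for x :: "real^'n"
    unfolding abs_mult power2_eq_square by (intro mult_mono component_le_norm_cart) auto
  have fb: "\<bar>f x\<bar> \<le> 1 / c" for x
  proof -
    have "\<bar>f x\<bar> \<le> (norm x)\<^sup>2 / (\<nu> + q x)"
      using den[of x] prod[of x] by (simp add: f_def divide_right_mono abs_divide)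
    then show ?thesis using quad[of x] by linarith
  qed
  define L where "L = (2 + 2 * K / c) * (1 / \<nu> + 1 / c)"
  have fl: "\<bar>f y - f z\<bar> \<le> L * norm (y - z)" if le: "norm z \<le> norm y" for y z
  proof -
    have 1: "\<bar>y $ i * y $ j - z $ i * z $ j\<bar> \<le> 2 * norm y * norm (y - z)"
    proof -
      have "y $ i * y $ j - z $ i * z $ j = y $ i * (y - z) $ j + (y - z) $ i * z $ j"
        by (simp add: algebra_simps)
      also have "\<bar>\<dots>\<bar> \<le> \<bar>y $ i * (y - z) $ j\<bar> + \<bar>(y - z) $ i * z $ j\<bar>"
        by (rule abs_triangle_ineq)
      also have "\<dots> \<le> norm y * norm (y - z) + norm (y - z) * norm y"
        unfolding abs_mult using component_le_norm_cart[of z j] le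
        by (intro add_mono mult_mono component_le_norm_cart) auto
      finally show ?thesis by simp
    qed
    have 2: "\<bar>q z - q y\<bar> \<le> 2 * K * norm y * norm (y - z)"
    proof -
      have "q z - q y = z \<bullet> (C *v (z - y)) + (z - y) \<bullet> (C *v y)"
        by (simp add: q_def matrix_vector_mult_diff_distrib inner_diff_left inner_diff_right)
      also have "\<bar>\<dots>\<bar> \<le> \<bar>z \<bullet> (C *v (z - y))\<bar> + \<bar>(z - y) \<bullet> (C *v y)\<bar>"
        by (rule abs_triangle_ineq)
      also have "\<dots> \<le> norm z * norm (C *v (z - y)) + norm (z - y) * norm (C *v y)"
        by (intro add_mono Cauchy_Schwarz_ineq2)
      also have "\<dots> \<le> norm y * (norm (z - y) * K) + norm (z - y) * (norm y * K)"
        using le K by (intro add_mono mult_mono) auto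
      finally show ?thesis by (simp add: norm_minus_commute algebra_simps)
    qed
    have eq: "f y - f z = (y $ i * y $ j - z $ i * z $ j) / (\<nu> + q y) + f z * ((q z - q y) / (\<nu> + q y))"
    proof -
      have "a / s - b / t = (a - b) / s + b / t * ((t - s) / s)" if "0 < s" "0 < t" for a b s t :: real
        using that by (simp add: field_simps)
      from this[OF den[of y] den[of z]] show ?thesis by (simp add: f_def)
    qed
    have "\<bar>f y - f z\<bar> \<le> \<bar>(y $ i * y $ j - z $ i * z $ j) / (\<nu> + q y)\<bar> + \<bar>f z * ((q z - q y) / (\<nu> + q y))\<bar>"
      unfolding eq by (rule abs_triangle_ineq)
    also have "\<dots> = \<bar>y $ i * y $ j - z $ i * z $ j\<bar> / (\<nu> + q y) + \<bar>f z\<bar> * (\<bar>q z - q y\<bar> / (\<nu> + q y))"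
      using den[of y] by (simp add: abs_mult abs_divide)
    also have "\<dots> \<le> (2 * norm y * norm (y - z)) / (\<nu> + q y)
        + 1 / c * ((2 * K * norm y * norm (y - z)) / (\<nu> + q y))"
      using den[of y] 1 2 fb[of z] c(1) by (intro add_mono mult_mono divide_right_mono) auto
    also have "\<dots> = (2 + 2 * K / c) * norm (y - z) * (norm y / (\<nu> + q y))"
      by (simp add: divide_inverse algebra_simps)
    also have "\<dots> \<le> (2 + 2 * K / c) * norm (y - z) * (1 / \<nu> + 1 / c)"
      using lin[of y] K(1) c(1) by (intro mult_left_mono) auto
    finally show ?thesis by (simp add: L_def mult_ac)
  qed
  have "f \<in> bl_functions"
  proof (rule bl_functionsI[OF fb])
    fix x y
    show "\<bar>f x - f y\<bar> \<le> L * norm (x - y)"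
      using fl[of x y] fl[of y x] by (cases "norm x \<le> norm y") (auto simp: norm_minus_commute abs_minus_commute)
  qed
  moreover have "(\<lambda>y :: real^'n. k) \<in> bl_functions" for k
    by (rule bl_functionsI[of _ "\<bar>k\<bar>" 0]) auto
  ultimately have "(\<lambda>y. - (mat_of A $ i $ j) / 2 + (\<nu> + real CARD('n)) / 2 * f y) \<in> bl_functions"
    by (intro bl_functions_add bl_functions_scale)
  moreover have "mat_of (t_G \<nu> y A) $ i $ j =
      - (mat_of A $ i $ j) / 2 + (\<nu> + real CARD('n)) / 2 * f y" for y
    using den[of y] by (simp add: t_G.rep_eq f_def q_def C_def matrix_matrix_mult_def
      columnvector_def rowvector_def)
  ultimately show ?thesis by simp
qed

lemma t_F_entry:
  "mat_of (t_F \<nu> \<phi> A) $ i $ j = blinfun_apply \<phi> (Bl (\<lambda>y. mat_of (t_G \<nu> y A) $ i $ j))"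
proof -
  have "mat_of B $ i $ j = mat_of B $ j $ i" for B :: "'a symmat" and i j
    using mat_of[of B] by (simp add: transpose_def vec_eq_iff) 
  then show ?thesis unfolding t_F_def
    by (subst symmat_of_inverse) (auto simp: transpose_def vec_eq_iff)
qed

end

theory Submission
  imports Defs "HOL-Combinatorics.Permutations"
begin

text \<open>
  The scatter matrix solves an equation, and this equation becomes quadratic once enough auxiliary
  unknowns are admitted. Quadratic equations in Banach spaces have solutions given by explicit
  convergent power series, so no implicit function theorem for analytic maps is needed.

  \<^emph>\<open>Quadratic equations.\<close> For \<open>l\<close> bounded linear and \<open>b\<close> bounded bilinear, the equation
  \<open>z = l q + b z z\<close> is solved near \<open>q = 0\<close> by a series \<open>z = \<Sum>n. m n (q, \<dots>, q)\<close> whose terms obey the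
  recursion of the Catalan numbers; the same recursion bounds them geometrically
  (\<open>quadratic_fixed_point\<close>, \<open>quadratic_system\<close>), and a geometrically bounded power series is analytic
  (\<open>power_series_analytic\<close>).

  \<^emph>\<open>The estimating equation is quadratic.\<close> Put \<open>C = A\<^sup>-\<^sup>1\<close>, \<open>\<kappa> = \<nu> + d\<close>, and let \<open>h C\<close> be the matrix of
  functions \<open>y y' / (\<nu> + y' C y)\<close>. For a law \<open>\<phi>\<close> the equation \<open>F(\<phi>, A) = 0\<close> reads \<open>A = \<kappa> \<phi>(h C)\<close>.
  Fix \<open>C0\<close> and let \<open>u = y' (C - C0) y / (\<nu> + y' C0 y)\<close>, which is a linear combination of the entries of
  \<open>h C0\<close> with coefficients \<open>C - C0\<close>. Then \<open>h C0 = (1 + u) h C\<close>. As bounded Lipschitz functions form an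
  algebra, they act on their dual, and \<open>\<phi>(h C) = \<psi>(h C0)\<close> as soon as \<open>\<psi> + u \<cdot> \<psi> = \<phi>\<close>
  (\<open>pairing_kernel_transfer\<close>). Hence the estimating equation is equivalent to the three equations
  \<open>A C = 1\<close>, \<open>\<psi> + u \<cdot> \<psi> = \<phi>\<close>, \<open>A = \<kappa> \<psi>(h C0)\<close>, which are of degree two in \<open>(A, C, \<psi>)\<close>. The first two,
  with \<open>A\<close> and \<open>\<phi>\<close> given, show that \<open>F\<close> is analytic (\<open>estimating_function_system\<close>). All three, with
  \<open>\<phi>\<close> given, show that the solution \<open>A\<close> is analytic in \<open>\<phi>\<close>, provided that the linear part in \<open>C\<close> can be
  inverted (\<open>scatter_system\<close>, \<open>scatter_local_solution\<close>).

  \<^emph>\<open>Invertibility.\<close> The linear part is \<open>c \<mapsto> A c A - \<kappa> \<integral> (y' c y) y y' / (\<nu> + y' C y)\<^sup>2 dQ\<close>, and it is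
  twice the derivative of \<open>F\<close> in \<open>C\<close>. Pairing it with \<open>c\<close> and applying the Cauchy-Schwarz inequality
  for the form \<open>A\<close>, the strict inequality \<open>y' C y < \<nu> + y' C y\<close> leaves a positive rest unless \<open>Q\<close> is
  concentrated on the kernel of \<open>c\<close>; this is excluded for spread laws (\<open>linearization_injective\<close>).

  \<^emph>\<open>The functional is the critical point.\<close> Simultaneous diagonalization turns the comparison of the
  objective at two matrices into Jensen's inequality for the logarithm, so a critical point is the
  strict global minimum (\<open>critical_minimal\<close>); a minimum is critical because replacing \<open>A\<close> by its
  weighted covariance would otherwise decrease the objective (\<open>minimal_critical\<close>); and a minimum
  exists because the mass conditions make the objective coercive (\<open>coercive\<close>).

  \<^emph>\<open>Location.\<close> Under \<open>y \<mapsto> (y, 1)\<close> the location-scatter problem in dimension \<open>d\<close> with parameter \<open>\<nu>\<close>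
  becomes the scatter problem in dimension \<open>d + 1\<close> with parameter \<open>\<nu> - 1\<close>
  (\<open>t_location_scatter_eq\<close>). Location and scatter are a linear and a quadratic function of the larger
  scatter matrix.

  \<^emph>\<open>The Kolmogorov norm.\<close> A bounded Lipschitz function on the line can have infinite variation, so its
  integral need not be controlled by the Kolmogorov norm. The kernels of the extended problem, however,
  are values at \<open>(x, 1)\<close> of functions that are homogeneous of degree zero, and may as well be evaluated at
  the point \<open>(sin \<theta>, cos \<theta>)\<close> of the unit half-circle on the same ray, with \<open>x = tan \<theta>\<close>. On the half-circle
  Lipschitz functions have bounded variation, and Stieltjes integration maps signed measures continuously to the dual of the bounded Lipschitz functions
  (\<open>bounded_linear_circle_functional\<close>), where the same local solution applies
  (\<open>line_scatter_analytic\<close>).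
\<close>

section \<open>Rearranging double series\<close>

text \<open>
  Summing along antidiagonals is the reindexing of an absolutely summable family over pairs. It is
  used twice: to expand a power series about another point, and to multiply two power series.
\<close>

lemma sums_antidiagonal:
  fixes t :: "nat \<Rightarrow> nat \<Rightarrow> 'b::banach"
  assumes "summable (\<lambda>n. \<Sum>i\<le>n. norm (t i (n - i)))"
  shows "\<And>k. summable (\<lambda>j. norm (t j k))"
    and "(\<lambda>k. \<Sum>j. t j k) sums (\<Sum>n. \<Sum>i\<le>n. t i (n - i))"
proof -
  define B where "B n = {..n}" for n :: nat
  define g where "g = (\<lambda>(n, i). t i (n - i))"
  have g: "(\<lambda>x. norm (g x)) summable_on Sigma UNIV B"
  proof (subst Infinite_Sum.abs_summable_on_Sigma_iff, intro conjI ballI)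
    show "(\<lambda>i. norm (g (n, i))) summable_on B n" for n by (simp add: B_def)
    have "(\<lambda>n. norm (\<Sum>i\<le>n. norm (t i (n - i)))) summable_on UNIV"
      using norm_summable_imp_summable_on[of "\<lambda>n. norm (\<Sum>i\<le>n. norm (t i (n - i)))"] assms
      by (simp add: sum_nonneg)
    then show "(\<lambda>n. norm (\<Sum>\<^sub>\<infinity>i\<in>B n. norm (g (n, i)))) summable_on UNIV"
      by (simp add: B_def g_def)
  qed
  have "(\<lambda>x. norm (g x)) summable_on Sigma UNIV B \<longleftrightarrow>
      (\<lambda>(k, j). norm (t j k)) summable_on UNIV \<times> UNIV"
    by (rule summable_on_reindex_bij_witness[of _ "\<lambda>(k, j). (j + k, j)" "\<lambda>(n, i). (n - i, i)"])
      (auto simp: B_def g_def)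
  with g have abs: "(\<lambda>x. norm (case x of (k, j) \<Rightarrow> t j k)) summable_on UNIV \<times> UNIV" by (simp add: case_prod_unfold)
  have row: "(\<lambda>j. norm (t j k)) summable_on UNIV" for k
    using abs unfolding Infinite_Sum.abs_summable_on_Sigma_iff by simp
  then show "summable (\<lambda>j. norm (t j k))" for k
    using summable_on_UNIV_nonneg_real_iff[of "\<lambda>j. norm (t j k)"] by simp
  obtain S where T: "((\<lambda>(k, j). t j k) has_sum S) (UNIV \<times> UNIV)"
    using abs_summable_summable[OF abs] by (auto simp: summable_on_def)
  have suminf: "((\<lambda>j. t j k) has_sum (\<Sum>j. t j k)) UNIV" for k
  proof (rule norm_summable_imp_has_sum)
    show s: "summable (\<lambda>j. norm (t j k))" by fact
    show "(\<lambda>j. t j k) sums (\<Sum>j. t j k)" by (rule summable_sums[OF summable_norm_cancel[OF s]])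
  qed
  have "((\<lambda>k. \<Sum>j. t j k) has_sum S) UNIV"
    by (rule has_sum_SigmaD[OF T]) (simp add: suminf)
  then have 1: "(\<lambda>k. \<Sum>j. t j k) sums S" by (rule has_sum_imp_sums)
  have "(g has_sum S) (Sigma UNIV B) \<longleftrightarrow> ((\<lambda>(k, j). t j k) has_sum S) (UNIV \<times> UNIV)"
    by (rule has_sum_reindex_bij_witness[of _ "\<lambda>(k, j). (j + k, j)" "\<lambda>(n, i). (n - i, i)"])
      (auto simp: B_def g_def)
  then have "(g has_sum S) (Sigma UNIV B)" using T by simp
  then have "((\<lambda>n. \<Sum>i\<le>n. t i (n - i)) has_sum S) UNIV"
    by (rule has_sum_SigmaD) (simp add: B_def g_def)
  then have "(\<lambda>n. \<Sum>i\<le>n. t i (n - i)) sums S" by (rule has_sum_imp_sums)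
  then show "(\<lambda>k. \<Sum>j. t j k) sums (\<Sum>n. \<Sum>i\<le>n. t i (n - i))"
    using 1 by (simp add: sums_iff)
qed

lemma summable_power_times_geometric:
  fixes x :: real
  assumes "0 \<le> x" "x < 1"
  shows "summable (\<lambda>j. real (j + 1) ^ p * x ^ j)"
proof (cases "x = 0")
  case True
  then show ?thesis
    by (intro summable_finite[of "{0}"]) (auto simp: power_0_left)
next
  case False
  have "(\<lambda>n. (real (n + 2) / real (n + 1)) ^ p * x) \<longlonglongrightarrow> 1 ^ p * x"
    by (intro tendsto_intros) real_asymp
  then have "(\<lambda>n. (real (n + 2) / real (n + 1)) ^ p * x) \<longlonglongrightarrow> x" by simp
  moreover have "x < (1 + x) / 2" using assms by simp
  ultimately have "\<forall>\<^sub>F n in sequentially. (real (n + 2) / real (n + 1)) ^ p * x < (1 + x) / 2"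
    by (rule order_tendstoD)
  then obtain N where N: "\<And>n. n \<ge> N \<Longrightarrow> (real (n + 2) / real (n + 1)) ^ p * x < (1 + x) / 2"
    by (auto simp: eventually_sequentially)
  show ?thesis
  proof (rule summable_ratio_test[of "(1 + x) / 2" N])
    show "(1 + x) / 2 < 1" using assms by simp
    fix n assume "N \<le> n"
    have "real (n + 2) ^ p * x = ((real (n + 2) / real (n + 1)) ^ p * x) * real (n + 1) ^ p"
      by (simp add: power_divide)
    also have "\<dots> \<le> (1 + x) / 2 * real (n + 1) ^ p"
      using N[OF \<open>N \<le> n\<close>] by (intro mult_right_mono) auto
    finally have "real (n + 2) ^ p * x * x ^ n \<le> (1 + x) / 2 * real (n + 1) ^ p * x ^ n"
      using assms(1) by (intro mult_right_mono) auto
    then show "norm (real (Suc n + 1) ^ p * x ^ Suc n) \<le> (1 + x) / 2 * norm (real (n + 1) ^ p * x ^ n)"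
      using assms(1) by (simp add: abs_mult mult_ac)
  qed
qed

section \<open>Multilinear maps on lists\<close>

text \<open>
  The terms of a power series are multilinear forms on lists. Boundedness is kept apart, because the
  forms of one series are bounded by a common geometric rate.
\<close>

definition multilinear :: "nat \<Rightarrow> ('a::real_normed_vector list \<Rightarrow> 'b::real_normed_vector) \<Rightarrow> bool" where
  "multilinear k m \<longleftrightarrow> (\<forall>vs i. length vs = k \<longrightarrow> i < k \<longrightarrow> linear (\<lambda>x. m (vs[i := x])))"

lemma multilinear_slot:
  assumes "multilinear k m" "length us + length ws + 1 = k"
  shows "linear (\<lambda>x. m (us @ x # ws))"
proof -
  have "length (us @ 0 # ws) = k" "length us < k" using assms(2) by simp_all
  then have "linear (\<lambda>x. m ((us @ 0 # ws)[length us := x]))"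
    using assms(1) unfolding multilinear_def by blast
  then show ?thesis by simp
qed

lemma multilinear_slotI:
  assumes "\<And>us ws. length us + length ws + 1 = k \<Longrightarrow> linear (\<lambda>x. m (us @ x # ws))"
  shows "multilinear k m"
  unfolding multilinear_def
proof (intro allI impI)
  fix vs :: "'a list" and i assume "length vs = k" "i < k"
  then show "linear (\<lambda>x. m (vs[i := x]))"
    using assms[of "take i vs" "drop (Suc i) vs"] by (simp add: upd_conv_take_nth_drop)
qed

lemma prod_list_norm_nonneg: "0 \<le> prod_list (map norm vs)"
  by (induction vs) auto

text \<open>
  Replacing a form by its average over all permutations changes neither its values on the diagonal nor
  its bound; it makes the derivatives of the power series expressible by one formula.
\<close>

definition symmetrize :: "nat \<Rightarrow> ('a::real_normed_vector list \<Rightarrow> 'b::real_normed_vector) \<Rightarrow> 'a list \<Rightarrow> 'b" where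
  "symmetrize k m vs = (\<Sum>p | p permutes {..<k}. m (permute_list p vs)) /\<^sub>R fact k"

lemma permute_list_update:
  assumes "p permutes {..<length vs}" "i < length vs"
  shows "permute_list p (vs[i := x]) = (permute_list p vs)[inv p i := x]"
proof (rule nth_equalityI)
  fix j assume "j < length (permute_list p (vs[i := x]))"
  then have j: "j < length vs" by simp
  have "p j < length vs" using permutes_in_image[OF assms(1)] j by auto
  moreover have "inv p i = j \<longleftrightarrow> p j = i"
    using permutes_inv_eq[OF assms(1)] by auto
  ultimately show "permute_list p (vs[i := x]) ! j = (permute_list p vs)[inv p i := x] ! j"
    using assms j by (auto simp: permute_list_nth nth_list_update)
qed simp

lemma multilinear_symmetrize:
  assumes "multilinear k m"
  shows "multilinear k (symmetrize k m)"
  unfolding multilinear_def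
proof (intro allI impI)
  fix vs :: "'a list" and i assume vs: "length vs = k" and i: "i < k"
  have "linear (\<lambda>x. m (permute_list p (vs[i := x])))" if "p permutes {..<k}" for p
  proof -
    have "inv p i < k" using permutes_in_image[OF permutes_inv[OF that]] i by auto
    then show ?thesis using assms vs that i unfolding multilinear_def
      by (simp add: permute_list_update)
  qed
  then show "linear (\<lambda>x. symmetrize k m (vs[i := x]))"
    unfolding symmetrize_def by (intro linear_compose_scale_right linear_compose_sum) auto
qed

lemma symmetrize_mset:
  assumes "length vs = k" "mset vs = mset ws"
  shows "symmetrize k m vs = symmetrize k m ws"
proof -
  have len: "length ws = k" using assms mset_eq_length by fastforce
  obtain q where q: "q permutes {..<k}" "permute_list q ws = vs"
    using mset_eq_permutation[OF assms(2)] len by auto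
  have "(\<Sum>p | p permutes {..<k}. m (permute_list p vs)) =
      (\<Sum>p | p permutes {..<k}. m (permute_list (q \<circ> p) ws))"
    by (rule sum.cong) (auto simp: permute_list_compose len q(2)[symmetric])
  also have "\<dots> = (\<Sum>p | p permutes {..<k}. m (permute_list p ws))"
    by (intro sum.reindex_bij_witness[of _ "(\<circ>) (inv q)" "(\<circ>) q"])
      (auto simp: permutes_compose permutes_inv q(1) fun_eq_iff permutes_inverses[OF q(1)])
  finally show ?thesis by (simp add: symmetrize_def)
qed

lemma card_permutes_lessThan: "card {p. p permutes {..<k::nat}} = fact k"
  by (simp add: card_permutations)

lemma symmetrize_bound:
  assumes bd: "\<And>vs. length vs = k \<Longrightarrow> norm (m vs) \<le> K * prod_list (map norm vs)" and "length vs = k"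
  shows "norm (symmetrize k m vs) \<le> K * prod_list (map norm vs)"
proof -
  have "norm (m (permute_list p vs)) \<le> K * prod_list (map norm vs)" if p: "p permutes {..<k}" for p
  proof -
    have "prod_list (map norm (permute_list p vs)) = prod_list (map norm vs)"
      using mset_permute_list[of p vs] p assms(2) by (metis mset_map prod_mset_prod_list)
    then show ?thesis using bd[of "permute_list p vs"] assms(2) by simp
  qed
  then have "norm (\<Sum>p | p permutes {..<k}. m (permute_list p vs)) \<le>
      (\<Sum>p | p permutes {..<k}. K * prod_list (map norm vs))"
    by (intro sum_norm_le) auto
  also have "\<dots> = fact k * (K * prod_list (map norm vs))"
    by (simp add: card_permutes_lessThan)
  finally show ?thesis by (simp add: symmetrize_def divide_simps mult_ac)
qed

lemma symmetrize_replicate: "symmetrize k m (replicate k h) = m (replicate k h)"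
proof -
  have "permute_list p (replicate k h) = replicate k h" if "p permutes {..<k}" for p
  proof -
    have "mset (permute_list p (replicate k h)) = mset (replicate k h)" using that by simp
    then have "set (permute_list p (replicate k h)) = set (replicate k h)" by (rule mset_eq_setD)
    then show ?thesis by (intro replicate_eqI) (auto split: if_splits)
  qed
  then have "(\<Sum>p | p permutes {..<k}. m (permute_list p (replicate k h))) =
      (\<Sum>p | p permutes {..<k}. m (replicate k h))"
    by (intro sum.cong) auto
  then show ?thesis
    by (simp add: symmetrize_def card_permutes_lessThan sum_constant_scaleR del: sum_constant)
qed

section \<open>Convergent power series are analytic\<close>

text \<open>
  The estimate \<open>K * R ^ n\<close> makes \<open>1 / R\<close> a lower bound for the radius of convergence.
\<close>

locale symmetric_power_series =
  fixes m :: "nat \<Rightarrow> 'a::real_normed_vector list \<Rightarrow> 'b::banach" and K R :: real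
  assumes multilin: "multilinear n (m n)"
    and symmetric: "length vs = n \<Longrightarrow> mset vs = mset ws \<Longrightarrow> m n vs = m n ws"
    and bound: "length vs = n \<Longrightarrow> norm (m n vs) \<le> K * R ^ n * prod_list (map norm vs)"
    and R_pos: "0 < R"
begin

lemma K_nonneg: "0 \<le> K"
  using bound[of "[]" 0] by simp (meson norm_ge_zero order_trans)

lemma head_add:
  assumes "Suc (length vs) = n"
  shows "m n ((x + y) # vs) = m n (x # vs) + m n (y # vs)"
proof -
  have "linear (\<lambda>x. m n (x # vs))" using multilinear_slot[OF multilin, of "[]" vs n] assms by simp
  then show ?thesis by (rule linear_add)
qed

lemma bound_replicate:
  assumes "length ws = l"
  shows "norm (m (j + l) (replicate j h @ ws)) \<le> K * R ^ (j + l) * norm h ^ j * prod_list (map norm ws)"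
  using bound[of "replicate j h @ ws" "j + l"] assms by (simp add: mult_ac)

lemma peel_replicate:
  assumes "n = Suc (j + length ws)"
  shows "m n (replicate (Suc j) (h + g) @ ws) =
    m n (replicate j (h + g) @ h # ws) + m n (replicate j (h + g) @ g # ws)"
proof -
  have 1: "m n (replicate (Suc j) (h + g) @ ws) = m n ((h + g) # replicate j (h + g) @ ws)" by simp
  have 2: "m n (x # replicate j (h + g) @ ws) = m n (replicate j (h + g) @ x # ws)" for x
    using assms by (intro symmetric) auto
  show ?thesis unfolding 1 2[symmetric] by (rule head_add) (simp add: assms)
qed

lemma move_replicate:
  assumes "n = Suc (j + length ws)"
  shows "m n (replicate (Suc j) h @ ws) = m n (replicate j h @ h # ws)"
  using assms by (intro symmetric) auto

text \<open>
  Induction on the number of varying arguments: the first one is peeled off by linearity. The factors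
  \<open>norm g / s\<close> and \<open>s ^ j\<close> are written separately so that the estimates, multiplied by \<open>R ^ j\<close>, can be
  summed over \<open>j\<close> when \<open>R * s < 1\<close>.
\<close>

lemma first_difference:
  assumes "norm h + norm g \<le> s" "0 < s" "n = j + length ws"
  shows "norm (m n (replicate j (h + g) @ ws) - m n (replicate j h @ ws)) \<le>
    K * R ^ n * (real j * (norm g / s) * s ^ j) * prod_list (map norm ws)"
  using assms(3)
proof (induction j arbitrary: ws)
  case 0
  then show ?case by simp
next
  case (Suc j)
  let ?P = "prod_list (map norm ws)"
  have n: "n = Suc (j + length ws)" using Suc.prems by simp
  have hs: "norm h \<le> s" and gs: "norm (h + g) \<le> s"
    using assms(1) norm_triangle_ineq[of h g] norm_ge_zero[of g] by linarith+
  have KR: "0 \<le> K * R ^ n" using K_nonneg R_pos by simp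
  have "norm (m n (replicate j (h + g) @ h # ws) - m n (replicate j h @ h # ws)) \<le>
      K * R ^ n * (real j * (norm g / s) * s ^ j) * (norm h * ?P)"
    using Suc.IH[of "h # ws"] n by simp
  also have "\<dots> \<le> K * R ^ n * (real j * (norm g / s) * s ^ j) * (s * ?P)"
    using hs KR assms(2) prod_list_norm_nonneg
    by (intro mult_left_mono mult_right_mono) auto
  finally have 1: "norm (m n (replicate j (h + g) @ h # ws) - m n (replicate j h @ h # ws)) \<le>
      K * R ^ n * (real j * (norm g / s) * s ^ Suc j) * ?P" by (simp only: mult_ac power_Suc)
  have "norm (m n (replicate j (h + g) @ g # ws)) \<le> K * R ^ n * norm (h + g) ^ j * (norm g * ?P)"
    using bound_replicate[of "g # ws" "Suc (length ws)" j "h + g"] n by simp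
  also have "\<dots> \<le> K * R ^ n * s ^ j * (norm g * ?P)"
    using gs KR prod_list_norm_nonneg[of ws] by (intro mult_right_mono mult_left_mono[OF _ KR] power_mono) auto
  also have "\<dots> = K * R ^ n * ((norm g / s) * s ^ Suc j) * ?P"
    using assms(2) by (simp add: field_simps)
  finally have 2: "norm (m n (replicate j (h + g) @ g # ws)) \<le> K * R ^ n * ((norm g / s) * s ^ Suc j) * ?P" .
  have "m n (replicate (Suc j) (h + g) @ ws) - m n (replicate (Suc j) h @ ws) =
      (m n (replicate j (h + g) @ h # ws) - m n (replicate j h @ h # ws)) + m n (replicate j (h + g) @ g # ws)"
    unfolding peel_replicate[OF n] move_replicate[OF n, of h] by simp
  then have "norm (m n (replicate (Suc j) (h + g) @ ws) - m n (replicate (Suc j) h @ ws)) \<le>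
      K * R ^ n * (real j * (norm g / s) * s ^ Suc j) * ?P + K * R ^ n * ((norm g / s) * s ^ Suc j) * ?P"
    using 1 2 by (smt (verit) norm_triangle_ineq)
  also have "\<dots> = K * R ^ n * (real (Suc j) * (norm g / s) * s ^ Suc j) * ?P"
    by (simp add: algebra_simps add_divide_distrib)
  finally show ?case .
qed

lemma second_difference:
  assumes "norm h + norm g \<le> s" "0 < s" "n = j + length ws"
  shows "norm (m n (replicate j (h + g) @ ws) - m n (replicate j h @ ws)
      - real j *\<^sub>R m n (replicate (j - 1) h @ g # ws)) \<le>
    K * R ^ n * (real j ^ 2 * (norm g / s) ^ 2 * s ^ j) * prod_list (map norm ws)"
  using assms(3)
proof (induction j arbitrary: ws)
  case 0
  then show ?case by simp
next
  case (Suc j)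
  let ?P = "prod_list (map norm ws)" and ?q = "norm g / s"
  have n: "n = Suc (j + length ws)" using Suc.prems by simp
  have hs: "norm h \<le> s"
    using assms(1) norm_ge_zero[of g] by linarith
  have KR: "0 \<le> K * R ^ n" using K_nonneg R_pos by simp
  have swap: "real j *\<^sub>R m n (replicate (j - 1) h @ g # h # ws) = real j *\<^sub>R m n (replicate j h @ g # ws)"
  proof (cases j)
    case (Suc i)
    have "m n (replicate i h @ g # h # ws) = m n (replicate (Suc i) h @ g # ws)"
      using n Suc by (intro symmetric) auto
    then show ?thesis using Suc by simp
  qed simp
  have "norm (m n (replicate j (h + g) @ h # ws) - m n (replicate j h @ h # ws)
        - real j *\<^sub>R m n (replicate j h @ g # ws)) \<le>
      K * R ^ n * (real j ^ 2 * ?q ^ 2 * s ^ j) * (norm h * ?P)"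
    using Suc.IH[of "h # ws", unfolded swap] n by simp
  also have "\<dots> \<le> K * R ^ n * (real j ^ 2 * ?q ^ 2 * s ^ j) * (s * ?P)"
    using hs KR assms(2) prod_list_norm_nonneg
    by (intro mult_left_mono mult_right_mono) auto
  finally have 1: "norm (m n (replicate j (h + g) @ h # ws) - m n (replicate j h @ h # ws)
        - real j *\<^sub>R m n (replicate j h @ g # ws)) \<le>
      K * R ^ n * (real j ^ 2 * ?q ^ 2 * s ^ Suc j) * ?P" by (simp only: mult_ac power_Suc)
  have "norm (m n (replicate j (h + g) @ g # ws) - m n (replicate j h @ g # ws)) \<le>
      K * R ^ n * (real j * ?q * s ^ j) * (norm g * ?P)"
    using first_difference[OF assms(1,2), of n j "g # ws"] n by simp
  also have "\<dots> = K * R ^ n * (real j * ?q ^ 2 * s ^ Suc j) * ?P"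
    using assms(2) by (simp add: power2_eq_square field_simps)
  finally have 2: "norm (m n (replicate j (h + g) @ g # ws) - m n (replicate j h @ g # ws)) \<le>
      K * R ^ n * (real j * ?q ^ 2 * s ^ Suc j) * ?P" .
  have "m n (replicate (Suc j) (h + g) @ ws) - m n (replicate (Suc j) h @ ws)
        - real (Suc j) *\<^sub>R m n (replicate (Suc j - 1) h @ g # ws) =
      (m n (replicate j (h + g) @ h # ws) - m n (replicate j h @ h # ws)
        - real j *\<^sub>R m n (replicate j h @ g # ws))
      + (m n (replicate j (h + g) @ g # ws) - m n (replicate j h @ g # ws))"
    unfolding peel_replicate[OF n] move_replicate[OF n, of h] by (simp add: algebra_simps)
  then have "norm (m n (replicate (Suc j) (h + g) @ ws) - m n (replicate (Suc j) h @ ws)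
        - real (Suc j) *\<^sub>R m n (replicate (Suc j - 1) h @ g # ws)) \<le>
      K * R ^ n * (real j ^ 2 * ?q ^ 2 * s ^ Suc j) * ?P + K * R ^ n * (real j * ?q ^ 2 * s ^ Suc j) * ?P"
    using 1 2 by (smt (verit) norm_triangle_ineq)
  also have "\<dots> = K * R ^ n * ((real j ^ 2 + real j) * ?q ^ 2 * s ^ Suc j) * ?P"
    by (simp only: distrib_left distrib_right mult.assoc)
  also have "\<dots> \<le> K * R ^ n * (real (Suc j) ^ 2 * ?q ^ 2 * s ^ Suc j) * ?P"
    using KR assms(2) prod_list_norm_nonneg
    by (intro mult_left_mono mult_right_mono) (auto simp: power2_eq_square algebra_simps)
  finally show ?case .
qed

text \<open>
  The product \<open>(j + 1) * \<dots> * (j + k)\<close> that differentiating \<open>k\<close> times produces from the exponent \<open>j + k\<close>.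
\<close>

definition falling :: "nat \<Rightarrow> nat \<Rightarrow> real" where
  "falling j k = fact (j + k) / fact j"

lemma falling_nonneg: "0 \<le> falling j k" by (simp add: falling_def)

lemma falling_Suc: "falling (Suc j) k * real (Suc j) = falling j (Suc k)"
  by (simp add: falling_def divide_simps del: of_nat_Suc)

lemma falling_le: "falling j k \<le> (real (k + 1) * real (j + 1)) ^ k"
proof (induction k)
  case (Suc k)
  have "falling j (Suc k) = falling j k * real (j + k + 1)" by (simp add: falling_def)
  also have "\<dots> \<le> (real (k + 1) * real (j + 1)) ^ k * (real (k + 2) * real (j + 1))"
    using Suc.IH falling_nonneg by (intro mult_mono) (auto simp: algebra_simps)
  also have "\<dots> \<le> (real (k + 2) * real (j + 1)) ^ k * (real (k + 2) * real (j + 1))"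
    by (intro mult_right_mono power_mono) auto
  finally show ?case by (simp add: mult_ac)
qed (simp add: falling_def)

lemma summable_falling:
  assumes "0 \<le> x" "x < 1"
  shows "summable (\<lambda>j. falling j k * ((real j)\<^sup>2 + 1) * x ^ j)"
proof (rule summable_comparison_test')
  show "summable (\<lambda>j. real (k + 1) ^ k * (real (j + 1) ^ (k + 2) * x ^ j))"
    using assms by (intro summable_mult summable_power_times_geometric)
  fix j :: nat
  have "falling j k * ((real j)\<^sup>2 + 1) \<le> (real (k + 1) * real (j + 1)) ^ k * (real (j + 1))\<^sup>2"
    using falling_le[of j k] falling_nonneg by (intro mult_mono) (auto simp: power2_eq_square algebra_simps)
  also have "\<dots> = real (k + 1) ^ k * real (j + 1) ^ (k + 2)"
    by (simp add: power_mult_distrib power_add mult_ac power2_eq_square)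
  finally have "falling j k * ((real j)\<^sup>2 + 1) * x ^ j \<le> real (k + 1) ^ k * real (j + 1) ^ (k + 2) * x ^ j"
    using assms(1) by (intro mult_right_mono) auto
  then show "norm (falling j k * ((real j)\<^sup>2 + 1) * x ^ j) \<le> real (k + 1) ^ k * (real (j + 1) ^ (k + 2) * x ^ j)"
    using assms(1) falling_nonneg[of j k] by (simp only: mult.assoc real_norm_def abs_mult) simp
qed

text \<open>
  The \<open>k\<close>-th derivative of \<open>\<Sum>n. m n (h, \<dots>, h)\<close>, differentiated term by term.
\<close>

definition derivs :: "nat \<Rightarrow> 'a \<Rightarrow> 'a list \<Rightarrow> 'b" where
  "derivs k h vs = (\<Sum>j. falling j k *\<^sub>R m (j + k) (replicate j h @ vs))"

lemma derivs_term_bound: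
  assumes "length vs = k"
  shows "norm (falling j k *\<^sub>R m (j + k) (replicate j h @ vs)) \<le>
    falling j k * ((real j)\<^sup>2 + 1) * (R * norm h) ^ j * (K * R ^ k * prod_list (map norm vs))"
proof -
  have "norm (falling j k *\<^sub>R m (j + k) (replicate j h @ vs)) \<le>
      falling j k * (K * R ^ (j + k) * norm h ^ j * prod_list (map norm vs))"
    using bound_replicate[OF assms, of j h] falling_nonneg by (simp add: mult_left_mono)
  also have "\<dots> = 1 * (falling j k * (R * norm h) ^ j * (K * R ^ k * prod_list (map norm vs)))"
    by (simp add: power_add power_mult_distrib mult_ac)
  also have "\<dots> \<le> ((real j)\<^sup>2 + 1) * (falling j k * (R * norm h) ^ j * (K * R ^ k * prod_list (map norm vs)))"
    using falling_nonneg K_nonneg R_pos prod_list_norm_nonneg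
    by (intro mult_right_mono mult_nonneg_nonneg) auto
  finally show ?thesis by (simp add: mult_ac)
qed

text \<open>
  The superfluous factor \<open>(real j)\<^sup>2 + 1\<close> lets one comparison series serve also for the second order
  remainder in \<open>derivs_differentiable\<close>.
\<close>

lemma derivs_summable:
  assumes "length vs = k" "R * norm h < 1"
  shows "summable (\<lambda>j. falling j k *\<^sub>R m (j + k) (replicate j h @ vs))"
    and "norm (derivs k h vs) \<le>
      (\<Sum>j. falling j k * ((real j)\<^sup>2 + 1) * (R * norm h) ^ j) * (K * R ^ k) * prod_list (map norm vs)"
proof -
  let ?b = "\<lambda>j. falling j k * ((real j)\<^sup>2 + 1) * (R * norm h) ^ j"
  have s: "summable ?b" using assms(2) R_pos by (intro summable_falling) auto
  then have s': "summable (\<lambda>j. ?b j * (K * R ^ k * prod_list (map norm vs)))" by (rule summable_mult2)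
  show "summable (\<lambda>j. falling j k *\<^sub>R m (j + k) (replicate j h @ vs))"
    by (rule summable_comparison_test'[OF s']) (rule derivs_term_bound[OF assms(1)])
  have sn: "summable (\<lambda>j. norm (falling j k *\<^sub>R m (j + k) (replicate j h @ vs)))"
    by (rule summable_comparison_test'[OF s'])
      (simp only: real_norm_def abs_norm_cancel, rule derivs_term_bound[OF assms(1)])
  have "norm (derivs k h vs) \<le> (\<Sum>j. norm (falling j k *\<^sub>R m (j + k) (replicate j h @ vs)))"
    unfolding derivs_def by (rule summable_norm[OF sn])
  also have "\<dots> \<le> (\<Sum>j. ?b j * (K * R ^ k * prod_list (map norm vs)))"
    by (rule suminf_le[OF derivs_term_bound[OF assms(1)] sn s'])
  also have "\<dots> = suminf ?b * (K * R ^ k * prod_list (map norm vs))"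
    by (rule suminf_mult2[OF s, symmetric])
  finally show "norm (derivs k h vs) \<le> suminf ?b * (K * R ^ k) * prod_list (map norm vs)"
    by (simp add: mult.assoc)
qed

lemma derivs_bounded_multilinear:
  assumes "R * norm h < 1"
  shows "bounded_multilinear k (derivs k h)"
  unfolding bounded_multilinear_def
proof (intro conjI)
  have "multilinear k (derivs k h)"
  proof (rule multilinear_slotI)
    fix us ws :: "'a list" assume len: "length us + length ws + 1 = k"
    have s: "summable (\<lambda>j. falling j k *\<^sub>R m (j + k) (replicate j h @ us @ x # ws))" for x
      using len by (intro derivs_summable(1)[OF _ assms]) auto
    have lin: "linear (\<lambda>x. m (j + k) (replicate j h @ us @ x # ws))" for j
      using multilinear_slot[OF multilin, of "replicate j h @ us" ws "j + k"] len by simp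
    show "linear (\<lambda>x. derivs k h (us @ x # ws))"
    proof (rule linearI)
      fix x y :: 'a and c :: real
      show "derivs k h (us @ (x + y) # ws) = derivs k h (us @ x # ws) + derivs k h (us @ y # ws)"
        unfolding derivs_def suminf_add[OF s s]
        by (simp add: linear_add[OF lin] scaleR_right_distrib)
      show "derivs k h (us @ (c *\<^sub>R x) # ws) = c *\<^sub>R derivs k h (us @ x # ws)"
        unfolding derivs_def suminf_scaleR_right[OF s]
        by (simp add: linear_scale[OF lin] mult.commute)
    qed
  qed
  then show "\<forall>vs i. length vs = k \<longrightarrow> i < k \<longrightarrow> linear (\<lambda>x. derivs k h (vs[i := x]))"
    by (simp add: multilinear_def)
  show "\<exists>K. \<forall>vs. length vs = k \<longrightarrow> norm (derivs k h vs) \<le> K * prod_list (map norm vs)"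
    using derivs_summable(2)[OF _ assms] by blast
qed

text \<open>
  Each term has a remainder that is quadratic in \<open>g\<close>, by \<open>second_difference\<close>, with constants summable as
  long as \<open>norm h + norm g\<close> stays below a fixed radius \<open>s < 1 / R\<close>.
\<close>

lemma derivs_differentiable:
  assumes "R * norm h < 1" "0 < e"
  shows "\<exists>\<delta>>0. \<forall>g. norm g < \<delta> \<longrightarrow> R * norm (h + g) < 1 \<and> (\<forall>vs. length vs = k \<longrightarrow>
    norm (derivs k (h + g) vs - derivs k h vs - derivs (Suc k) h (g # vs))
      \<le> e * norm g * prod_list (map norm vs))"
proof -
  (* a radius strictly between \<open>norm h\<close> and \<open>1 / R\<close>, common to all small \<open>g\<close> *)
  define s where "s = (norm h + 1 / R) / 2"
  have hR: "norm h < 1 / R" using assms(1) R_pos by (simp add: field_simps)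
  then have hs: "norm h < s" and sR: "s < 1 / R" by (simp_all add: s_def)
  have s0: "0 < s" using hs norm_ge_zero[of h] by linarith
  have Rs: "0 \<le> R * s" "R * s < 1" using sR R_pos s0 by (simp_all add: field_simps)
  define c where "c = (\<Sum>j. falling j k * ((real j)\<^sup>2 + 1) * (R * s) ^ j) * (K * R ^ k / s\<^sup>2)"
  have sf: "summable (\<lambda>j. falling j k * ((real j)\<^sup>2 + 1) * (R * s) ^ j)"
    by (rule summable_falling[OF Rs])
  have c0: "0 \<le> c" unfolding c_def
    using falling_nonneg Rs K_nonneg R_pos by (intro mult_nonneg_nonneg suminf_nonneg[OF sf]) auto
  define \<delta> where "\<delta> = min (s - norm h) (e / (c + 1))"
  have "0 < \<delta>" using hs assms(2) c0 by (simp add: \<delta>_def)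
  moreover have "R * norm (h + g) < 1 \<and> (\<forall>vs. length vs = k \<longrightarrow>
    norm (derivs k (h + g) vs - derivs k h vs - derivs (Suc k) h (g # vs))
      \<le> e * norm g * prod_list (map norm vs))" if g: "norm g < \<delta>" for g
  proof (intro conjI allI impI)
    have hg: "norm h + norm g \<le> s" using g by (simp add: \<delta>_def)
    have "R * norm (h + g) \<le> R * s"
      using hg norm_triangle_ineq[of h g] R_pos by (intro mult_left_mono) auto
    then show Rhg: "R * norm (h + g) < 1" using Rs by linarith
    fix vs :: "'a list" assume vs: "length vs = k"
    let ?P = "prod_list (map norm vs)"
    let ?d = "\<lambda>j. falling j k *\<^sub>R (m (j + k) (replicate j (h + g) @ vs) - m (j + k) (replicate j h @ vs)
      - real j *\<^sub>R m (j + k) (replicate (j - 1) h @ g # vs))"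
    have "(\<lambda>j. falling j (Suc k) *\<^sub>R m (j + Suc k) (replicate j h @ g # vs)) sums derivs (Suc k) h (g # vs)"
      unfolding derivs_def using vs by (intro summable_sums derivs_summable(1)[OF _ assms(1)]) auto
    then have "(\<lambda>j. falling (Suc j) k *\<^sub>R real (Suc j) *\<^sub>R m (Suc j + k) (replicate (Suc j - 1) h @ g # vs))
        sums derivs (Suc k) h (g # vs)"
      by (simp add: falling_Suc[symmetric] del: of_nat_Suc)
    then have "(\<lambda>j. falling j k *\<^sub>R real j *\<^sub>R m (j + k) (replicate (j - 1) h @ g # vs))
        sums (derivs (Suc k) h (g # vs) + falling 0 k *\<^sub>R real 0 *\<^sub>R m (0 + k) (replicate (0 - 1) h @ g # vs))"
      by (rule sums_Suc)
    then have d3: "(\<lambda>j. falling j k *\<^sub>R real j *\<^sub>R m (j + k) (replicate (j - 1) h @ g # vs))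
        sums derivs (Suc k) h (g # vs)" by simp
    have d1: "(\<lambda>j. falling j k *\<^sub>R m (j + k) (replicate j (h + g) @ vs)) sums derivs k (h + g) vs"
      and d2: "(\<lambda>j. falling j k *\<^sub>R m (j + k) (replicate j h @ vs)) sums derivs k h vs"
      unfolding derivs_def
      by (intro summable_sums derivs_summable(1)[OF vs Rhg] derivs_summable(1)[OF vs assms(1)])+
    have d: "?d sums (derivs k (h + g) vs - derivs k h vs - derivs (Suc k) h (g # vs))"
      using sums_diff[OF sums_diff[OF d1 d2] d3] by (simp add: scaleR_right_diff_distrib)
    have le: "norm (?d j) \<le> falling j k * ((real j)\<^sup>2 + 1) * (R * s) ^ j * (K * R ^ k / s\<^sup>2 * (norm g)\<^sup>2 * ?P)" for j
    proof -
      have "norm (?d j) \<le> falling j k *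
          (K * R ^ (j + k) * ((real j)\<^sup>2 * (norm g / s)\<^sup>2 * s ^ j) * ?P)"
        using second_difference[OF hg s0, of "j + k" j vs] vs falling_nonneg[of j k]
        by (simp add: mult_left_mono)
      also have "\<dots> = (real j)\<^sup>2 * (falling j k * (R * s) ^ j * (K * R ^ k / s\<^sup>2 * (norm g)\<^sup>2 * ?P))"
        by (simp add: power_add power_mult_distrib power_divide mult_ac)
      also have "\<dots> \<le> ((real j)\<^sup>2 + 1) * (falling j k * (R * s) ^ j * (K * R ^ k / s\<^sup>2 * (norm g)\<^sup>2 * ?P))"
        using falling_nonneg K_nonneg R_pos Rs prod_list_norm_nonneg by (intro mult_right_mono mult_nonneg_nonneg) auto
      finally show ?thesis by (simp add: mult_ac)
    qed
    have sb: "summable (\<lambda>j. falling j k * ((real j)\<^sup>2 + 1) * (R * s) ^ j * (K * R ^ k / s\<^sup>2 * (norm g)\<^sup>2 * ?P))"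
      by (rule summable_mult2[OF sf])
    have sn: "summable (\<lambda>j. norm (?d j))"
      by (rule summable_comparison_test'[OF sb]) (simp only: real_norm_def abs_norm_cancel, rule le)
    have "norm (derivs k (h + g) vs - derivs k h vs - derivs (Suc k) h (g # vs)) \<le> (\<Sum>j. norm (?d j))"
      using summable_norm[OF sn] sums_unique[OF d] by simp
    also have "\<dots> \<le> (\<Sum>j. falling j k * ((real j)\<^sup>2 + 1) * (R * s) ^ j * (K * R ^ k / s\<^sup>2 * (norm g)\<^sup>2 * ?P))"
      by (rule suminf_le[OF le sn sb])
    also have "\<dots> = c * (norm g)\<^sup>2 * ?P"
      unfolding suminf_mult2[OF sf, symmetric] by (simp add: c_def mult_ac)
    also have "\<dots> \<le> e * norm g * ?P"
    proof -
      have "norm g < e / (c + 1)" using g by (simp add: \<delta>_def)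
      then have "(c + 1) * norm g < e" using c0 by (simp add: field_simps)
      then have "c * norm g \<le> e" using norm_ge_zero[of g] unfolding distrib_right by linarith
      then have "c * norm g * norm g \<le> e * norm g" by (rule mult_right_mono) simp
      then show ?thesis using prod_list_norm_nonneg by (intro mult_right_mono) (simp_all add: power2_eq_square mult_ac)
    qed
    finally show "norm (derivs k (h + g) vs - derivs k h vs - derivs (Suc k) h (g # vs)) \<le> e * norm g * ?P" .
  qed
  ultimately show ?thesis by blast
qed

lemma binomial_expansion:
  assumes "n = j + length ws"
  shows "m n (replicate j (h + g) @ ws) =
    (\<Sum>i\<le>j. real (j choose i) *\<^sub>R m n (replicate i h @ replicate (j - i) g @ ws))"
  using assms
proof (induction j arbitrary: ws)
  case 0
  then show ?case by simp
next
  case (Suc j)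
  have n: "n = Suc (j + length ws)" using Suc.prems by simp
  let ?a = "\<lambda>i. m n (replicate i h @ replicate (Suc j - i) g @ ws)"
  have 1: "m n (replicate i h @ replicate (j - i) g @ h # ws) = ?a (Suc i)" if "i \<le> j" for i
    using n that by (intro symmetric) auto
  have 2: "m n (replicate i h @ replicate (j - i) g @ g # ws) = ?a i" if "i \<le> j" for i
    using n that by (intro symmetric) (auto simp: Suc_diff_le)
  have "m n (replicate j (h + g) @ h # ws) =
      (\<Sum>i\<le>j. real (j choose i) *\<^sub>R m n (replicate i h @ replicate (j - i) g @ h # ws))"
    by (rule Suc.IH) (simp add: n)
  also have "\<dots> = (\<Sum>i\<le>j. real (j choose i) *\<^sub>R ?a (Suc i))"
    by (intro sum.cong refl) (simp only: 1 atMost_iff)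
  finally have e1: "m n (replicate j (h + g) @ h # ws) = (\<Sum>i\<le>j. real (j choose i) *\<^sub>R ?a (Suc i))" .
  have "m n (replicate j (h + g) @ g # ws) =
      (\<Sum>i\<le>j. real (j choose i) *\<^sub>R m n (replicate i h @ replicate (j - i) g @ g # ws))"
    by (rule Suc.IH) (simp add: n)
  also have "\<dots> = (\<Sum>i\<le>j. real (j choose i) *\<^sub>R ?a i)"
    by (intro sum.cong refl) (simp only: 2 atMost_iff)
  finally have e2: "m n (replicate j (h + g) @ g # ws) = (\<Sum>i\<le>j. real (j choose i) *\<^sub>R ?a i)" .
  have "m n (replicate (Suc j) (h + g) @ ws) =
      (\<Sum>i\<le>j. real (j choose i) *\<^sub>R ?a (Suc i)) + (\<Sum>i\<le>j. real (j choose i) *\<^sub>R ?a i)"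
    by (simp only: peel_replicate[OF n] e1 e2)
  also have "(\<Sum>i\<le>j. real (j choose i) *\<^sub>R ?a i) = ?a 0 + (\<Sum>i\<le>j. real (j choose Suc i) *\<^sub>R ?a (Suc i))"
  proof -
    have "(\<Sum>i\<le>j. real (j choose i) *\<^sub>R ?a i) = (\<Sum>i\<le>Suc j. real (j choose i) *\<^sub>R ?a i)" by simp
    also have "\<dots> = real (j choose 0) *\<^sub>R ?a 0 + (\<Sum>i\<le>j. real (j choose Suc i) *\<^sub>R ?a (Suc i))"
      by (rule sum.atMost_Suc_shift)
    finally show ?thesis by simp
  qed
  also have "(\<Sum>i\<le>j. real (j choose i) *\<^sub>R ?a (Suc i)) +
      (?a 0 + (\<Sum>i\<le>j. real (j choose Suc i) *\<^sub>R ?a (Suc i))) =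
      ?a 0 + (\<Sum>i\<le>j. real (Suc j choose Suc i) *\<^sub>R ?a (Suc i))"
    by (simp add: sum.distrib scaleR_left_distrib)
  also have "\<dots> = (\<Sum>i\<le>Suc j. real (Suc j choose i) *\<^sub>R ?a i)"
    by (simp only: sum.atMost_Suc_shift binomial_n_0 of_nat_1 scaleR_one)
  finally show ?case .
qed

text \<open>
  Expanding \<open>m n (h + g, \<dots>, h + g)\<close> by the binomial theorem gives a double series, absolutely summable
  because the norms are dominated by the powers of \<open>R * (norm h + norm g)\<close>. Summing it by powers of \<open>g\<close>
  produces the derivatives at \<open>h\<close>.
\<close>

lemma taylor_expansion:
  assumes "R * (norm h + norm g) < 1"
  shows "(\<lambda>k. derivs k h (replicate k g) /\<^sub>R fact k) sums (\<Sum>n. m n (replicate n (h + g)))"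
proof -
  define t where "t j k = real (j + k choose j) *\<^sub>R m (j + k) (replicate j h @ replicate k g)" for j k
  have t_bound: "norm (t i (n - i)) \<le> K * R ^ n * (real (n choose i) * norm h ^ i * norm g ^ (n - i))" if "i \<le> n" for i n
    using bound_replicate[of "replicate (n - i) g" "n - i" i h] that
    by (simp add: t_def mult_left_mono mult_ac)
  have "summable (\<lambda>n. \<Sum>i\<le>n. norm (t i (n - i)))"
  proof (rule summable_comparison_test')
    show "summable (\<lambda>n. K * (R * (norm h + norm g)) ^ n)"
      using assms R_pos by (intro summable_mult summable_geometric) auto
    fix n :: nat
    have "(\<Sum>i\<le>n. norm (t i (n - i))) \<le> (\<Sum>i\<le>n. K * R ^ n * (real (n choose i) * norm h ^ i * norm g ^ (n - i)))"
      by (intro sum_mono t_bound) auto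
    also have "\<dots> = K * (R * (norm h + norm g)) ^ n"
      by (simp add: sum_distrib_left[symmetric] binomial_ring power_mult_distrib mult_ac)
    finally show "norm (\<Sum>i\<le>n. norm (t i (n - i))) \<le> K * (R * (norm h + norm g)) ^ n"
      by (simp add: sum_nonneg)
  qed
  then have "(\<lambda>k. \<Sum>j. t j k) sums (\<Sum>n. \<Sum>i\<le>n. t i (n - i))" by (rule sums_antidiagonal(2))
  moreover have "(\<Sum>i\<le>n. t i (n - i)) = m n (replicate n (h + g))" for n
    using binomial_expansion[of n n "[]" h g] by (simp add: t_def)
  moreover have "(\<Sum>j. t j k) = derivs k h (replicate k g) /\<^sub>R fact k" for k
  proof -
    have "R * norm h < 1" using assms R_pos by (smt (verit) mult_left_mono norm_ge_zero)
    then have s: "summable (\<lambda>j. falling j k *\<^sub>R m (j + k) (replicate j h @ replicate k g))"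
      by (intro derivs_summable) auto
    have "t j k = (falling j k *\<^sub>R m (j + k) (replicate j h @ replicate k g)) /\<^sub>R fact k" for j
      by (simp add: t_def falling_def binomial_fact field_simps)
    then show ?thesis unfolding derivs_def by (simp add: suminf_scaleR_right[OF s])
  qed
  ultimately show ?thesis by simp
qed

theorem analytic_on_ball:
  assumes f: "\<And>h. norm h < 1 / R \<Longrightarrow> (\<lambda>n. m n (replicate n h)) sums f (x0 + h)"
  shows "frechet_analytic_on (ball x0 (1 / R)) f"
  unfolding frechet_analytic_on_def
proof (intro conjI ballI)
  have mem: "x \<in> ball x0 (1 / R) \<longleftrightarrow> R * norm (x - x0) < 1" for x
    using R_pos by (simp add: dist_norm norm_minus_commute field_simps)
  have f': "f x = (\<Sum>n. m n (replicate n (x - x0)))" if "x \<in> ball x0 (1 / R)" for x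
    using f[of "x - x0"] that by (simp add: dist_norm norm_minus_commute sums_iff)
  have f0: "derivs 0 (x - x0) [] = f x" if "x \<in> ball x0 (1 / R)" for x
    using f'[OF that] by (simp add: derivs_def falling_def)
  show "open (ball x0 (1 / R))" by simp
  show "frechet_smooth_on (ball x0 (1 / R)) f"
    unfolding frechet_smooth_on_def
  proof (intro exI[of _ "\<lambda>k x. derivs k (x - x0)"] conjI ballI allI impI)
    fix k x and e :: real assume x: "x \<in> ball x0 (1 / R)" and e: "0 < e"
    obtain \<delta> where \<delta>: "\<delta> > 0" "\<And>g vs. norm g < \<delta> \<Longrightarrow> length vs = k \<Longrightarrow>
      norm (derivs k (x - x0 + g) vs - derivs k (x - x0) vs - derivs (Suc k) (x - x0) (g # vs))
        \<le> e * norm g * prod_list (map norm vs)"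
      using derivs_differentiable[of "x - x0" e k] x e unfolding mem by blast
    show "\<forall>\<^sub>F y in at x. \<forall>vs. length vs = k \<longrightarrow>
        norm (derivs k (y - x0) vs - derivs k (x - x0) vs - derivs (Suc k) (x - x0) ((y - x) # vs))
        \<le> e * norm (y - x) * prod_list (map norm vs)"
      unfolding eventually_at
    proof (intro exI[of _ \<delta>] conjI ballI impI allI)
      fix y and vs :: "'a list" assume "y \<noteq> x \<and> dist y x < \<delta>" "length vs = k"
      then show "norm (derivs k (y - x0) vs - derivs k (x - x0) vs - derivs (Suc k) (x - x0) ((y - x) # vs))
        \<le> e * norm (y - x) * prod_list (map norm vs)"
        using \<delta>(2)[of "y - x" vs] by (simp add: dist_norm)
    qed (fact \<delta>(1))
  qed (auto intro!: derivs_bounded_multilinear simp: f0 mem simp del: mem_ball)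
  fix x assume x: "x \<in> ball x0 (1 / R)"
  show "\<exists>r>0. \<exists>V. (\<forall>k\<ge>1. homogeneous_polynomial k (V k)) \<and>
    (\<forall>v. norm (v - x) < r \<longrightarrow> v \<in> ball x0 (1 / R) \<and> (\<lambda>k. V (Suc k) (v - x)) sums (f v - f x))"
  proof (intro exI[of _ "1 / R - norm (x - x0)"] conjI
      exI[of _ "\<lambda>k g. derivs k (x - x0) (replicate k g) /\<^sub>R fact k"] allI impI)
    show "1 / R - norm (x - x0) > 0" using x by (simp add: dist_norm norm_minus_commute)
    fix k :: nat
    have "bounded_multilinear k (\<lambda>vs. derivs k (x - x0) vs /\<^sub>R fact k)"
      using derivs_bounded_multilinear[OF x[unfolded mem], of k] unfolding bounded_multilinear_def
    proof (elim conjE exE, intro conjI allI impI)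
      fix K' i and vs :: "'a list"
      assume "\<forall>vs i. length vs = k \<longrightarrow> i < k \<longrightarrow> linear (\<lambda>y. derivs k (x - x0) (vs[i := y]))"
        and "length vs = k" "i < k"
      then show "linear (\<lambda>y. derivs k (x - x0) (vs[i := y]) /\<^sub>R fact k)"
        by (intro linear_compose_scale_right) auto
    next
      fix K'
      assume K': "\<forall>vs. length vs = k \<longrightarrow> norm (derivs k (x - x0) vs) \<le> K' * prod_list (map norm vs)"
      show "\<exists>K. \<forall>vs. length vs = k \<longrightarrow> norm (derivs k (x - x0) vs /\<^sub>R fact k) \<le> K * prod_list (map norm vs)"
        by (rule exI[of _ "K' / fact k"]) (use K' in \<open>auto simp: divide_simps\<close>)
    qed
    then show "homogeneous_polynomial k (\<lambda>g. derivs k (x - x0) (replicate k g) /\<^sub>R fact k)"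
      unfolding homogeneous_polynomial_def by blast
  next
    fix v assume v: "norm (v - x) < 1 / R - norm (x - x0)"
    have "norm (v - x0) \<le> norm (v - x) + norm (x - x0)" using norm_triangle_ineq[of "v - x" "x - x0"] by simp
    then show vb: "v \<in> ball x0 (1 / R)" using v by (simp add: dist_norm norm_minus_commute)
    have "R * (norm (x - x0) + norm (v - x)) < 1" using v R_pos by (simp add: field_simps)
    from taylor_expansion[OF this]
    have "(\<lambda>k. derivs k (x - x0) (replicate k (v - x)) /\<^sub>R fact k) sums f v" by (simp add: f'[OF vb])
    then have "(\<lambda>k. derivs (Suc k) (x - x0) (replicate (Suc k) (v - x)) /\<^sub>R fact (Suc k)) sums
        (f v - derivs 0 (x - x0) (replicate 0 (v - x)) /\<^sub>R fact 0)"
      by (subst sums_Suc_iff)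
        simp
    then show "(\<lambda>k. derivs (Suc k) (x - x0) (replicate (Suc k) (v - x)) /\<^sub>R fact (Suc k)) sums (f v - f x)"
      by (simp add: f0[OF x])
  qed
qed

end

text \<open>
  Symmetrizing the forms reduces this to a symmetric power series without changing the sum.
\<close>

theorem power_series_analytic:
  fixes m :: "nat \<Rightarrow> 'a::real_normed_vector list \<Rightarrow> 'b::banach"
  assumes lin: "\<And>n. multilinear n (m n)"
    and bd: "\<And>n vs. length vs = n \<Longrightarrow> norm (m n vs) \<le> K * R ^ n * prod_list (map norm vs)"
    and "0 < R"
    and f: "\<And>h. norm h < 1 / R \<Longrightarrow> (\<lambda>n. m n (replicate n h)) sums f (x0 + h)"
  shows "frechet_analytic_on (ball x0 (1 / R)) f"
proof -
  interpret symmetric_power_series "\<lambda>n. symmetrize n (m n)" K R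
  proof
    show "norm (symmetrize n (m n) vs) \<le> K * R ^ n * prod_list (map norm vs)" if "length vs = n" for n vs
      by (rule symmetrize_bound[OF bd that])
  qed (use lin \<open>0 < R\<close> in \<open>auto intro: multilinear_symmetrize symmetrize_mset\<close>)
  show ?thesis by (rule analytic_on_ball) (simp add: symmetrize_replicate f)
qed

section \<open>Closure properties of analytic maps\<close>

lemma frechet_smooth_on_subset:
  assumes "frechet_smooth_on U f" "V \<subseteq> U"
  shows "frechet_smooth_on V f"
proof -
  obtain D where D: "\<forall>x\<in>U. D 0 x [] = f x" "\<forall>k. \<forall>x\<in>U. bounded_multilinear k (D k x)"
     "\<forall>k. \<forall>x\<in>U. \<forall>e>0. \<forall>\<^sub>F y in at x. \<forall>vs. length vs = k \<longrightarrow>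
           norm (D k y vs - D k x vs - D (Suc k) x ((y - x) # vs))
             \<le> e * norm (y - x) * prod_list (map norm vs)"
    using assms(1) unfolding frechet_smooth_on_def by blast
  show ?thesis unfolding frechet_smooth_on_def
    by (intro exI[of _ D]) (use D assms(2) in \<open>simp add: subset_eq\<close>)
qed

lemma frechet_analytic_on_cong:
  assumes "frechet_analytic_on U f" "\<And>x. x \<in> U \<Longrightarrow> f x = g x"
  shows "frechet_analytic_on U g"
proof -
  have "frechet_smooth_on U g" using assms unfolding frechet_analytic_on_def frechet_smooth_on_def by simp
  moreover have "\<exists>r>0. \<exists>V. (\<forall>k\<ge>1. homogeneous_polynomial k (V k)) \<and>
      (\<forall>v. norm (v - x) < r \<longrightarrow> v \<in> U \<and> (\<lambda>k. V (Suc k) (v - x)) sums (g v - g x))" if "x \<in> U" for x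
  proof -
    obtain r W where r: "r > 0" "\<And>k. k \<ge> 1 \<Longrightarrow> homogeneous_polynomial k (W k)"
      "\<And>v. norm (v - x) < r \<Longrightarrow> v \<in> U"
      "\<And>v. norm (v - x) < r \<Longrightarrow> (\<lambda>k. W (Suc k) (v - x)) sums (f v - f x)"
      using assms(1) \<open>x \<in> U\<close> unfolding frechet_analytic_on_def by blast
    have "(\<lambda>k. W (Suc k) (v - x)) sums (g v - g x)" if "norm (v - x) < r" for v
      using r(4)[OF that] assms(2) r(3)[OF that] \<open>x \<in> U\<close> by simp
    with r show ?thesis by blast
  qed
  ultimately show ?thesis using assms(1) unfolding frechet_analytic_on_def by blast
qed

lemma frechet_analytic_on_subset:
  assumes "frechet_analytic_on U f" "V \<subseteq> U" "open V"
  shows "frechet_analytic_on V f"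
  unfolding frechet_analytic_on_def
proof (intro conjI ballI)
  show "open V" by fact
  show "frechet_smooth_on V f"
    using assms by (auto simp: frechet_analytic_on_def intro: frechet_smooth_on_subset)
  fix x assume x: "x \<in> V"
  then obtain r W where r: "r > 0" "\<And>k. k \<ge> 1 \<Longrightarrow> homogeneous_polynomial k (W k)"
      "\<And>v. norm (v - x) < r \<Longrightarrow> (\<lambda>k. W (Suc k) (v - x)) sums (f v - f x)"
    using assms(1) subsetD[OF assms(2) x] unfolding frechet_analytic_on_def by blast
  obtain e where e: "e > 0" "ball x e \<subseteq> V" using assms(3) x unfolding open_contains_ball by blast
  show "\<exists>r>0. \<exists>W. (\<forall>k\<ge>1. homogeneous_polynomial k (W k)) \<and>
      (\<forall>v. norm (v - x) < r \<longrightarrow> v \<in> V \<and> (\<lambda>k. W (Suc k) (v - x)) sums (f v - f x))"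
    using r e by (intro exI[of _ "min r e"] conjI exI[of _ W])
      (auto simp: subset_eq dist_norm norm_minus_commute)
qed

lemma bounded_multilinear_compose_left:
  assumes "bounded_linear L" "bounded_multilinear k m"
  shows "bounded_multilinear k (\<lambda>vs. L (m vs))"
  unfolding bounded_multilinear_def
proof (intro conjI allI impI)
  interpret L: bounded_linear L by fact
  show "linear (\<lambda>x. L (m (vs[i := x])))" if "length vs = k" "i < k" for vs i
    using assms(2) that L.linear_axioms linear_compose[of "\<lambda>x. m (vs[i := x])" L]
    by (auto simp: bounded_multilinear_def o_def)
  obtain B where B: "B > 0" "\<And>x. norm (L x) \<le> norm x * B" using L.pos_bounded by blast
  obtain K where K: "\<And>vs. length vs = k \<Longrightarrow> norm (m vs) \<le> K * prod_list (map norm vs)"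
    using assms(2) by (auto simp: bounded_multilinear_def)
  have "norm (L (m vs)) \<le> (K * B) * prod_list (map norm vs)" if "length vs = k" for vs
  proof -
    have "norm (L (m vs)) \<le> norm (m vs) * B" by (rule B)
    also have "\<dots> \<le> (K * prod_list (map norm vs)) * B" using K[OF that] B(1) by (intro mult_right_mono) auto
    finally show ?thesis by (simp add: mult_ac)
  qed
  then show "\<exists>K. \<forall>vs. length vs = k \<longrightarrow> norm (L (m vs)) \<le> K * prod_list (map norm vs)" by blast
qed

lemma bounded_multilinear_compose_right:
  fixes J :: "'a::real_normed_vector \<Rightarrow> 'c::real_normed_vector"
    and m :: "'c list \<Rightarrow> 'b::real_normed_vector"
  assumes "bounded_linear J" "bounded_multilinear k m"
  shows "bounded_multilinear k (\<lambda>vs. m (map J vs))"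
  unfolding bounded_multilinear_def
proof (intro conjI allI impI)
  interpret J: bounded_linear J by fact
  show "linear (\<lambda>x. m (map J (vs[i := x])))" if "length vs = k" "i < k" for vs i
  proof -
    have "linear (\<lambda>x. m ((map J vs)[i := x]))"
      using assms(2) that by (auto simp: bounded_multilinear_def)
    then show ?thesis
      using linear_compose[OF J.linear_axioms, of "\<lambda>x. m ((map J vs)[i := x])"] by (simp add: o_def map_update)
  qed
  obtain B where B: "B > 0" "\<And>x. norm (J x) \<le> norm x * B" using J.pos_bounded by blast
  obtain K0 where K0: "\<And>vs. length vs = k \<Longrightarrow> norm (m vs) \<le> K0 * prod_list (map norm vs)"
    using assms(2) by (auto simp: bounded_multilinear_def)
  define K where "K = \<bar>K0\<bar>"
  have nn: "0 \<le> prod_list (map norm ws)" for ws :: "'c list" by (induction ws) auto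
  have K: "norm (m vs) \<le> K * prod_list (map norm vs)" if "length vs = k" for vs
    using K0[OF that] mult_right_mono[OF abs_ge_self nn, of K0 vs] unfolding K_def by linarith
  have J: "prod_list (map norm (map J vs)) \<le> B ^ length vs * prod_list (map norm vs)" for vs
  proof (induction vs)
    case (Cons v vs)
    have "norm (J v) * prod_list (map norm (map J vs)) \<le> (norm v * B) * (B ^ length vs * prod_list (map norm vs))"
      using B Cons by (intro mult_mono) (simp_all add: prod_list_norm_nonneg del: map_map)
    then show ?case by (simp add: mult_ac)
  qed simp
  have "norm (m (map J vs)) \<le> (K * B ^ k) * prod_list (map norm vs)" if "length vs = k" for vs
  proof -
    have "norm (m (map J vs)) \<le> K * prod_list (map norm (map J vs))" using that by (intro K) simp
    also have "\<dots> \<le> K * (B ^ k * prod_list (map norm vs))"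
      using J[of vs] that by (intro mult_left_mono) (auto simp: K_def)
    finally show ?thesis by (simp add: mult.assoc)
  qed
  then show "\<exists>K. \<forall>vs. length vs = k \<longrightarrow> norm (m (map J vs)) \<le> K * prod_list (map norm vs)" by blast
qed

lemma frechet_analytic_on_compose_linear:
  assumes "bounded_linear L" "frechet_analytic_on U f"
  shows "frechet_analytic_on U (\<lambda>x. c + L (f x))"
  unfolding frechet_analytic_on_def
proof (intro conjI ballI)
  interpret L: bounded_linear L by fact
  show "open U" using assms(2) by (simp add: frechet_analytic_on_def)
  obtain B where B: "B > 0" "\<And>x. norm (L x) \<le> norm x * B" using L.pos_bounded by blast
  obtain D where D: "\<And>x. x \<in> U \<Longrightarrow> D 0 x [] = f x"
     "\<And>k x. x \<in> U \<Longrightarrow> bounded_multilinear k (D k x)"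
     "\<And>k x e. x \<in> U \<Longrightarrow> e > 0 \<Longrightarrow> \<forall>\<^sub>F y in at x. \<forall>vs. length vs = k \<longrightarrow>
           norm (D k y vs - D k x vs - D (Suc k) x ((y - x) # vs))
             \<le> e * norm (y - x) * prod_list (map norm vs)"
    using assms(2) unfolding frechet_analytic_on_def frechet_smooth_on_def by blast
  define D' where "D' k x vs = (if k = 0 then c else 0) + L (D k x vs)" for k x vs
  show "frechet_smooth_on U (\<lambda>x. c + L (f x))"
    unfolding frechet_smooth_on_def
  proof (intro exI[of _ D'] conjI ballI allI impI)
    show "D' 0 x [] = c + L (f x)" if "x \<in> U" for x using D(1)[OF that] by (simp add: D'_def)
    show "bounded_multilinear k (D' k x)" if "x \<in> U" for x k
    proof (cases "k = 0")
      case True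
      then show ?thesis by (auto simp: bounded_multilinear_def)
    next
      case False
      then show ?thesis using bounded_multilinear_compose_left[OF assms(1) D(2)[OF that]]
        by (simp add: D'_def[abs_def])
    qed
    fix k x and e :: real assume x: "x \<in> U" "e > 0"
    have "\<forall>\<^sub>F y in at x. \<forall>vs. length vs = k \<longrightarrow>
           norm (D k y vs - D k x vs - D (Suc k) x ((y - x) # vs))
             \<le> e / B * norm (y - x) * prod_list (map norm vs)"
      by (rule D(3)) (use x B in auto)
    then show "\<forall>\<^sub>F y in at x. \<forall>vs. length vs = k \<longrightarrow>
           norm (D' k y vs - D' k x vs - D' (Suc k) x ((y - x) # vs))
             \<le> e * norm (y - x) * prod_list (map norm vs)"
    proof (rule eventually_mono, intro allI impI)
      fix y and vs :: "'c list" assume H: "\<forall>vs. length vs = k \<longrightarrow>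
           norm (D k y vs - D k x vs - D (Suc k) x ((y - x) # vs))
             \<le> e / B * norm (y - x) * prod_list (map norm vs)" and vs: "length vs = k"
      have "norm (D' k y vs - D' k x vs - D' (Suc k) x ((y - x) # vs)) =
          norm (L (D k y vs - D k x vs - D (Suc k) x ((y - x) # vs)))"
        by (simp add: D'_def L.diff)
      also have "\<dots> \<le> norm (D k y vs - D k x vs - D (Suc k) x ((y - x) # vs)) * B" by (rule B)
      also have "\<dots> \<le> (e / B * norm (y - x) * prod_list (map norm vs)) * B"
        using H vs B(1) by (intro mult_right_mono) auto
      finally show "norm (D' k y vs - D' k x vs - D' (Suc k) x ((y - x) # vs))
             \<le> e * norm (y - x) * prod_list (map norm vs)" using B(1) by simp
    qed
  qed
  fix x assume "x \<in> U"
  then obtain r W where r: "r > 0" "\<And>k. k \<ge> 1 \<Longrightarrow> homogeneous_polynomial k (W k)"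
      "\<And>v. norm (v - x) < r \<Longrightarrow> v \<in> U"
      "\<And>v. norm (v - x) < r \<Longrightarrow> (\<lambda>k. W (Suc k) (v - x)) sums (f v - f x)"
    using assms(2) unfolding frechet_analytic_on_def by blast
  have "homogeneous_polynomial k (\<lambda>v. L (W k v))" if k: "k \<ge> 1" for k
  proof -
    obtain m where "bounded_multilinear k m" "\<And>x. W k x = m (replicate k x)"
      using r(2)[OF k] unfolding homogeneous_polynomial_def by blast
    then show ?thesis using bounded_multilinear_compose_left[OF assms(1)]
      unfolding homogeneous_polynomial_def by (intro exI[of _ "\<lambda>vs. L (m vs)"]) simp
  qed
  moreover have "(\<lambda>k. L (W (Suc k) (v - x))) sums (c + L (f v) - (c + L (f x)))" if "norm (v - x) < r" for v
    using L.sums[OF r(4)[OF that]] by (simp add: L.diff)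
  ultimately show "\<exists>r>0. \<exists>V. (\<forall>k\<ge>1. homogeneous_polynomial k (V k)) \<and>
      (\<forall>v. norm (v - x) < r \<longrightarrow> v \<in> U \<and> (\<lambda>k. V (Suc k) (v - x)) sums (c + L (f v) - (c + L (f x))))"
    using r by (intro exI[of _ r] conjI exI[of _ "\<lambda>k v. L (W k v)"]) auto
qed

lemma frechet_analytic_on_precompose_affine:
  fixes J :: "'a::real_normed_vector \<Rightarrow> 'c::real_normed_vector" and f :: "'c \<Rightarrow> 'b::real_normed_vector"
  assumes "bounded_linear J" "frechet_analytic_on U f"
  shows "frechet_analytic_on {x. J x + c \<in> U} (\<lambda>x. f (J x + c))"
  unfolding frechet_analytic_on_def
proof (intro conjI ballI)
  interpret J: bounded_linear J by fact
  have cont: "continuous_on UNIV (\<lambda>x. J x + c)"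
    by (intro continuous_intros J.continuous_on continuous_on_id)
  have oU: "open U" using assms(2) by (simp add: frechet_analytic_on_def)
  show "open {x. J x + c \<in> U}" using open_vimage[OF oU cont] by (simp add: vimage_def)
  obtain B where B: "B > 0" "\<And>x. norm (J x) \<le> norm x * B" using J.pos_bounded by blast
  obtain D where D: "\<And>x. x \<in> U \<Longrightarrow> D 0 x [] = f x"
     "\<And>k x. x \<in> U \<Longrightarrow> bounded_multilinear k (D k x)"
     "\<And>k x e. x \<in> U \<Longrightarrow> e > 0 \<Longrightarrow> \<forall>\<^sub>F y in at x. \<forall>vs. length vs = k \<longrightarrow>
           norm (D k y vs - D k x vs - D (Suc k) x ((y - x) # vs))
             \<le> e * norm (y - x) * prod_list (map norm vs)"
    using assms(2) unfolding frechet_analytic_on_def frechet_smooth_on_def by blast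
  define D' where "D' k x vs = D k (J x + c) (map J vs)" for k x vs
  have nn: "0 \<le> prod_list (map norm ws)" for ws :: "'a list" by (induction ws) auto
  have nn': "0 \<le> prod_list (map norm ws)" for ws :: "'b list" by (induction ws) auto
  have JB: "prod_list (map norm (map J vs)) \<le> B ^ length vs * prod_list (map norm vs)" for vs
  proof (induction vs)
    case (Cons v vs)
    have "norm (J v) * prod_list (map norm (map J vs)) \<le> (norm v * B) * (B ^ length vs * prod_list (map norm vs))"
      using B Cons by (intro mult_mono) (simp_all add: prod_list_norm_nonneg del: map_map)
    then show ?case by (simp add: mult_ac)
  qed simp
  show "frechet_smooth_on {x. J x + c \<in> U} (\<lambda>x. f (J x + c))"
    unfolding frechet_smooth_on_def
  proof (intro exI[of _ D'] conjI ballI allI impI)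
    show "D' 0 x [] = f (J x + c)" if "x \<in> {x. J x + c \<in> U}" for x using D(1) that by (simp add: D'_def)
    show "bounded_multilinear k (D' k x)" if "x \<in> {x. J x + c \<in> U}" for x k
      using bounded_multilinear_compose_right[OF assms(1) D(2), of "J x + c" k] that
      by (simp add: D'_def[abs_def])
    fix k x and e :: real assume x: "x \<in> {x. J x + c \<in> U}" "e > 0"
    let ?x = "J x + c"
    define e' where "e' = e / (B * B ^ k)"
    have e': "e' > 0" using x B by (simp add: e'_def)
    have "\<forall>\<^sub>F y in at ?x. \<forall>vs. length vs = k \<longrightarrow>
           norm (D k y vs - D k ?x vs - D (Suc k) ?x ((y - ?x) # vs))
             \<le> e' * norm (y - ?x) * prod_list (map norm vs)"
      by (rule D(3)) (use x e' in auto)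
    then obtain d where d: "d > 0" "\<And>y vs. y \<noteq> ?x \<Longrightarrow> dist y ?x < d \<Longrightarrow> length vs = k \<Longrightarrow>
           norm (D k y vs - D k ?x vs - D (Suc k) ?x ((y - ?x) # vs))
             \<le> e' * norm (y - ?x) * prod_list (map norm vs)"
      unfolding eventually_at by blast
    have Dx: "bounded_multilinear (Suc k) (D (Suc k) ?x)" using D(2) x by simp
    have lin0: "D (Suc k) ?x (0 # vs) = 0" if "length vs = k" for vs
    proof -
      have "linear (\<lambda>v. D (Suc k) ?x ((0 # vs)[0 := v]))"
        using Dx that unfolding bounded_multilinear_def
        by (elim conjE allE[of _ "0 # vs"] allE[of _ 0]) simp
      from linear_0[OF this] show ?thesis by simp
    qed
    show "\<forall>\<^sub>F y in at x. \<forall>vs. length vs = k \<longrightarrow>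
           norm (D' k y vs - D' k x vs - D' (Suc k) x ((y - x) # vs))
             \<le> e * norm (y - x) * prod_list (map norm vs)"
      unfolding eventually_at
    proof (intro exI[of _ "d / B"] conjI ballI impI allI)
      show "0 < d / B" using d B by simp
      fix y and vs :: "'a list" assume y: "y \<noteq> x \<and> dist y x < d / B" and vs: "length vs = k"
      have sub: "J y + c - ?x = J (y - x)" by (simp add: J.diff)
      have "norm (D k (J y + c) (map J vs) - D k ?x (map J vs) - D (Suc k) ?x ((J y + c - ?x) # map J vs))
             \<le> e' * norm (J y + c - ?x) * prod_list (map norm (map J vs))"
      proof (cases "J y + c = ?x")
        case True
        then show ?thesis using lin0[of "map J vs"] vs by simp
      next
        case False
        have "norm (J (y - x)) \<le> norm (y - x) * B" by (rule B)
        also have "\<dots> < d" using y B by (simp add: dist_norm field_simps)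
        finally have "dist (J y + c) ?x < d" by (simp add: dist_norm J.diff)
        with False show ?thesis using vs by (intro d(2)) auto
      qed
      also have "\<dots> \<le> e' * (norm (y - x) * B) * (B ^ k * prod_list (map norm vs))"
        unfolding sub using B e' JB[of vs] vs
          by (intro mult_mono) (simp_all add: prod_list_norm_nonneg del: map_map)
      also have "\<dots> = e * norm (y - x) * prod_list (map norm vs)"
        using B(1) by (simp add: e'_def)
      finally show "norm (D' k y vs - D' k x vs - D' (Suc k) x ((y - x) # vs))
             \<le> e * norm (y - x) * prod_list (map norm vs)"
        by (simp add: D'_def J.diff)
    qed
  qed
  fix x assume x: "x \<in> {x. J x + c \<in> U}"
  then obtain r W where r: "r > 0" "\<And>k. k \<ge> 1 \<Longrightarrow> homogeneous_polynomial k (W k)"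
      "\<And>v. norm (v - (J x + c)) < r \<Longrightarrow> v \<in> U"
      "\<And>v. norm (v - (J x + c)) < r \<Longrightarrow> (\<lambda>k. W (Suc k) (v - (J x + c))) sums (f v - f (J x + c))"
    using assms(2) unfolding frechet_analytic_on_def by blast
  have hom: "homogeneous_polynomial k (\<lambda>v. W k (J v))" if k: "k \<ge> 1" for k
  proof -
    obtain m where "bounded_multilinear k m" "\<And>x. W k x = m (replicate k x)"
      using r(2)[OF k] unfolding homogeneous_polynomial_def by blast
    then show ?thesis using bounded_multilinear_compose_right[OF assms(1)]
      unfolding homogeneous_polynomial_def by (intro exI[of _ "\<lambda>vs. m (map J vs)"]) simp
  qed
  have near: "norm (J v + c - (J x + c)) < r" if "norm (v - x) < r / B" for v
  proof -
    have "norm (J (v - x)) \<le> norm (v - x) * B" by (rule B)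
    also have "\<dots> < r" using that B by (simp add: field_simps)
    finally show ?thesis by (simp add: J.diff)
  qed
  have "(\<lambda>k. W (Suc k) (J (v - x))) sums (f (J v + c) - f (J x + c))" if "norm (v - x) < r / B" for v
    using r(4)[OF near[OF that]] by (simp add: J.diff)
  then show "\<exists>r>0. \<exists>V. (\<forall>k\<ge>1. homogeneous_polynomial k (V k)) \<and>
      (\<forall>v. norm (v - x) < r \<longrightarrow> v \<in> {x. J x + c \<in> U} \<and> (\<lambda>k. V (Suc k) (v - x)) sums (f (J v + c) - f (J x + c)))"
    using r hom near B(1) by (intro exI[of _ "r / B"] conjI exI[of _ "\<lambda>k v. W k (J v)"]) auto
qed

text \<open>
  Smoothness asks for one family of derivatives on the whole domain, while local arguments provide
  one on each ball. They are glued by expressing all of them through the function alone, as iterated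
  directional derivatives.
\<close>

primrec dir_derivs :: "('a::real_normed_vector \<Rightarrow> 'b::real_normed_vector) \<Rightarrow> 'a list \<Rightarrow> 'a \<Rightarrow> 'b" where
  "dir_derivs f [] x = f x"
| "dir_derivs f (v # vs) x = vector_derivative (\<lambda>t. dir_derivs f vs (x + t *\<^sub>R v)) (at 0)"

lemma dir_derivs_eq:
  assumes U: "open U" and D0: "\<And>x. x \<in> U \<Longrightarrow> D 0 x [] = f x"
    and Dm: "\<And>k x. x \<in> U \<Longrightarrow> bounded_multilinear k (D k x)"
    and D: "\<And>k x e. x \<in> U \<Longrightarrow> e > 0 \<Longrightarrow> \<forall>\<^sub>F y in at x. \<forall>vs. length vs = k \<longrightarrow>
           norm (D k y vs - D k x vs - D (Suc k) x ((y - x) # vs))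
             \<le> e * norm (y - x) * prod_list (map norm vs)"
    and "x \<in> U"
  shows "dir_derivs f vs x = D (length vs) x vs"
  using \<open>x \<in> U\<close>
proof (induction vs arbitrary: x)
  case Nil
  then show ?case by (simp add: D0)
next
  case (Cons v vs)
  let ?k = "length vs"
  have lin: "linear (\<lambda>u. D (Suc ?k) x (u # vs))"
  proof -
    have "linear (\<lambda>u. D (Suc ?k) x ((0 # vs)[0 := u]))"
      using Dm[OF Cons.prems, of "Suc ?k"] unfolding bounded_multilinear_def
      by (elim conjE allE[of _ "0 # vs"] allE[of _ 0]) simp
    then show ?thesis by simp
  qed
  define P where "P = prod_list (map norm vs)"
  have P0: "0 \<le> P" unfolding P_def by (induction vs) auto
  have "((\<lambda>t. dir_derivs f vs (x + t *\<^sub>R v)) has_vector_derivative D (Suc ?k) x (v # vs)) (at 0)"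
    unfolding has_vector_derivative_def has_derivative_iff_norm
  proof (intro conjI)
    show "bounded_linear (\<lambda>t. t *\<^sub>R D (Suc ?k) x (v # vs))" by (rule bounded_linear_scaleR_left)
    show "((\<lambda>t. norm (dir_derivs f vs (x + t *\<^sub>R v) - dir_derivs f vs (x + 0 *\<^sub>R v)
        - (t - 0) *\<^sub>R D (Suc ?k) x (v # vs)) / norm (t - 0)) \<longlongrightarrow> 0) (at 0)"
    proof (rule tendstoI)
      fix e :: real assume e: "e > 0"
      define e' where "e' = e / (2 * (norm v * P + 1))"
      have pos: "0 < norm v * P + 1" using P0 by (simp add: add_nonneg_pos)
      then have e': "e' > 0" using e by (simp add: e'_def)
      obtain d where d: "d > 0" "\<And>y. y \<noteq> x \<Longrightarrow> dist y x < d \<Longrightarrow>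
           norm (D ?k y vs - D ?k x vs - D (Suc ?k) x ((y - x) # vs)) \<le> e' * norm (y - x) * P"
        using D[OF Cons.prems e', of ?k] unfolding eventually_at P_def by blast
      obtain d' where d': "d' > 0" "ball x d' \<subseteq> U" using U Cons.prems unfolding open_contains_ball by blast
      have "0 < min d d' / (norm v + 1)" using d d' by (simp add: add_nonneg_pos)
      moreover have "dist (norm (dir_derivs f vs (x + t *\<^sub>R v) - dir_derivs f vs (x + 0 *\<^sub>R v)
        - (t - 0) *\<^sub>R D (Suc ?k) x (v # vs)) / norm (t - 0)) 0 < e"
        if t: "t \<noteq> 0" "dist t 0 < min d d' / (norm v + 1)" for t
      proof -
        have "\<bar>t\<bar> * (norm v + 1) < min d d'" using t by (simp add: pos_less_divide_eq add_nonneg_pos)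
        then have tv: "norm (t *\<^sub>R v) < min d d'"
          using abs_ge_zero[of t] unfolding distrib_left norm_scaleR by linarith
        then have "x + t *\<^sub>R v \<in> U" using d' by (intro subsetD[OF d'(2)]) (simp add: dist_norm)
        then have eq: "dir_derivs f vs (x + t *\<^sub>R v) = D ?k (x + t *\<^sub>R v) vs"
            "dir_derivs f vs x = D ?k x vs" using Cons by auto
        have "norm (D ?k (x + t *\<^sub>R v) vs - D ?k x vs - D (Suc ?k) x ((t *\<^sub>R v) # vs)) \<le> e' * norm (t *\<^sub>R v) * P"
        proof (cases "t *\<^sub>R v = 0")
          case True then show ?thesis using linear_0[OF lin] by (auto simp: mult.assoc)
        next
          case False
          then show ?thesis using d(2)[of "x + t *\<^sub>R v"] tv by (simp add: dist_norm)
        qed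
        also have "D (Suc ?k) x ((t *\<^sub>R v) # vs) = t *\<^sub>R D (Suc ?k) x (v # vs)"
          using linear_scale[OF lin] by simp
        finally have "norm (dir_derivs f vs (x + t *\<^sub>R v) - dir_derivs f vs (x + 0 *\<^sub>R v)
          - (t - 0) *\<^sub>R D (Suc ?k) x (v # vs)) / norm (t - 0) \<le> e' * (norm v * P)"
          using t(1) eq by (simp add: divide_simps mult_ac)
        also have "\<dots> \<le> e' * (norm v * P + 1)" using e' by simp
        also have "\<dots> = e / 2" using pos by (simp add: e'_def divide_simps del: distrib_left_numeral)
        also have "\<dots> < e" using e by simp
        finally show ?thesis by simp
      qed
      ultimately show "\<forall>\<^sub>F t in at 0. dist (norm (dir_derivs f vs (x + t *\<^sub>R v) - dir_derivs f vs (x + 0 *\<^sub>R v)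
        - (t - 0) *\<^sub>R D (Suc ?k) x (v # vs)) / norm (t - 0)) 0 < e"
        unfolding eventually_at by blast
    qed
  qed
  then show ?case by (simp add: vector_derivative_at)
qed

lemma frechet_analytic_on_local:
  assumes "open U" "\<And>x. x \<in> U \<Longrightarrow> \<exists>r>0. frechet_analytic_on (ball x r) f"
  shows "frechet_analytic_on U f"
  unfolding frechet_analytic_on_def
proof (intro conjI ballI)
  show "open U" by fact
  have loc: "(\<forall>k. bounded_multilinear k (\<lambda>vs. dir_derivs f (if length vs = k then vs else []) x)) \<and>
        (\<forall>k. \<forall>e>0. \<forall>\<^sub>F y in at x. \<forall>vs. length vs = k \<longrightarrow>
           norm (dir_derivs f vs y - dir_derivs f vs x - dir_derivs f ((y - x) # vs) x)
             \<le> e * norm (y - x) * prod_list (map norm vs))" if x: "x \<in> U" for x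
  proof -
    obtain r where r: "r > 0" "frechet_analytic_on (ball x r) f" using assms(2)[OF x] by blast
    obtain D where D: "\<And>y. y \<in> ball x r \<Longrightarrow> D 0 y [] = f y"
     "\<And>k y. y \<in> ball x r \<Longrightarrow> bounded_multilinear k (D k y)"
     "\<And>k y e. y \<in> ball x r \<Longrightarrow> e > 0 \<Longrightarrow> \<forall>\<^sub>F z in at y. \<forall>vs. length vs = k \<longrightarrow>
           norm (D k z vs - D k y vs - D (Suc k) y ((z - y) # vs))
             \<le> e * norm (z - y) * prod_list (map norm vs)"
      using r(2) unfolding frechet_analytic_on_def frechet_smooth_on_def by blast
    have eq: "dir_derivs f vs y = D (length vs) y vs" if "y \<in> ball x r" for y vs
      by (rule dir_derivs_eq[of "ball x r"]) (use D that in auto)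
    have xb: "x \<in> ball x r" using r by simp
    show ?thesis
    proof (intro conjI allI impI)
      show "bounded_multilinear k (\<lambda>vs. dir_derivs f (if length vs = k then vs else []) x)" for k
        using D(2)[OF xb, of k] unfolding eq[OF xb] bounded_multilinear_def by simp
      fix k and e :: real assume "e > 0"
      have "\<forall>\<^sub>F y in at x. y \<in> ball x r"
        using r(1) by (intro eventually_at_in_open') auto
      with D(3)[OF xb \<open>e > 0\<close>, of k]
      show "\<forall>\<^sub>F y in at x. \<forall>vs. length vs = k \<longrightarrow>
           norm (dir_derivs f vs y - dir_derivs f vs x - dir_derivs f ((y - x) # vs) x)
             \<le> e * norm (y - x) * prod_list (map norm vs)"
        by eventually_elim (use xb in \<open>auto simp: eq simp del: dir_derivs.simps\<close>)
    qed
  qed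
  show "frechet_smooth_on U f"
    unfolding frechet_smooth_on_def
    by (intro exI[of _ "\<lambda>k x vs. dir_derivs f (if length vs = k then vs else []) x"] conjI ballI allI impI)
      (use loc in \<open>auto simp del: dir_derivs.simps(2)\<close>)
  fix x assume x: "x \<in> U"
  obtain r where r: "r > 0" "frechet_analytic_on (ball x r) f" using assms(2)[OF x] by blast
  obtain e where e: "e > 0" "ball x e \<subseteq> U" using assms(1) x unfolding open_contains_ball by blast
  have "frechet_analytic_on (ball x (min r e)) f"
    by (rule frechet_analytic_on_subset[OF r(2)]) auto
  then have *: "\<exists>r'>0. \<exists>V. (\<forall>k\<ge>1. homogeneous_polynomial k (V k)) \<and>
      (\<forall>v. norm (v - x) < r' \<longrightarrow> v \<in> ball x (min r e) \<and> (\<lambda>k. V (Suc k) (v - x)) sums (f v - f x))"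
    using r e unfolding frechet_analytic_on_def by auto
  show "\<exists>r>0. \<exists>V. (\<forall>k\<ge>1. homogeneous_polynomial k (V k)) \<and>
      (\<forall>v. norm (v - x) < r \<longrightarrow> v \<in> U \<and> (\<lambda>k. V (Suc k) (v - x)) sums (f v - f x))"
  proof -
    have "ball x (min r e) \<subseteq> U" using e(2) by auto
    with * show ?thesis by blast
  qed
qed

section \<open>The quadratic fixed point equation\<close>

text \<open>
  Comparing the parts of degree \<open>n\<close> in \<open>z q = l q + b (z q) (z q)\<close> determines the power series of the
  solution. The argument list is cut into two consecutive blocks, so that every term is multilinear.
\<close>

function quadratic_coeff :: "('a \<Rightarrow> 'z::comm_monoid_add) \<Rightarrow> ('z \<Rightarrow> 'z \<Rightarrow> 'z) \<Rightarrow> nat \<Rightarrow> 'a list \<Rightarrow> 'z" where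
  "quadratic_coeff l b n vs =
     (if n = 0 then 0 else if n = 1 then l (hd vs)
      else \<Sum>i\<in>{1..<n}. b (quadratic_coeff l b i (take i vs)) (quadratic_coeff l b (n - i) (drop i vs)))"
  by auto
termination by (relation "Wellfounded.measure (\<lambda>(l, b, n, vs). n)") auto

declare quadratic_coeff.simps[simp del]

lemma quadratic_coeff_0: "quadratic_coeff l b 0 vs = 0"
  and quadratic_coeff_1: "quadratic_coeff l b (Suc 0) vs = l (hd vs)"
  by (simp_all add: quadratic_coeff.simps)

lemma quadratic_coeff_step:
  "n \<ge> 2 \<Longrightarrow> quadratic_coeff l b n vs =
    (\<Sum>i\<in>{1..<n}. b (quadratic_coeff l b i (take i vs)) (quadratic_coeff l b (n - i) (drop i vs)))"
  by (subst quadratic_coeff.simps) simp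

lemma multilinear_quadratic_coeff:
  fixes l :: "'a::real_normed_vector \<Rightarrow> 'z::real_normed_vector"
  assumes "linear l" "bounded_bilinear b"
  shows "multilinear n (quadratic_coeff l b n)"
proof (induction n rule: less_induct)
  case (less n)
  interpret b: bounded_bilinear b by fact
  consider "n = 0" | "n = 1" | "n \<ge> 2" by linarith
  then show ?case
  proof cases
    case 2
    then show ?thesis
    proof (simp, intro multilinear_slotI)
      fix us ws :: "'a list" assume "length us + length ws + 1 = Suc 0"
      then show "linear (\<lambda>x. quadratic_coeff l b (Suc 0) (us @ x # ws))"
        using assms(1) by (simp add: quadratic_coeff_1)
    qed
  next
    case 3
    show ?thesis
      unfolding multilinear_def
    proof (intro allI impI)
      fix vs :: "'a list" and p assume vs: "length vs = n" "p < n"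
      have "linear (\<lambda>x. b (quadratic_coeff l b i (take i (vs[p := x])))
          (quadratic_coeff l b (n - i) (drop i (vs[p := x]))))" if i: "i \<in> {1..<n}" for i
      proof (cases "p < i")
        case True
        have "linear (\<lambda>x. quadratic_coeff l b i ((take i vs)[p := x]))"
          using less[of i] i True vs unfolding multilinear_def by simp
        then have "linear (\<lambda>x. b (quadratic_coeff l b i ((take i vs)[p := x])) (quadratic_coeff l b (n - i) (drop i vs)))"
          using linear_compose[OF _ bounded_linear.linear[OF b.bounded_linear_left]] by (fastforce simp: o_def)
        then show ?thesis using True by (simp add: take_update_swap drop_update_cancel)
      next
        case False
        have "linear (\<lambda>x. quadratic_coeff l b (n - i) ((drop i vs)[p - i := x]))"
          using less[of "n - i"] i False vs unfolding multilinear_def by simp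
        then have "linear (\<lambda>x. b (quadratic_coeff l b i (take i vs)) (quadratic_coeff l b (n - i) ((drop i vs)[p - i := x])))"
          using linear_compose[OF _ bounded_linear.linear[OF b.bounded_linear_right]] by (fastforce simp: o_def)
        then show ?thesis using False by (simp add: take_update_cancel drop_update_swap)
      qed
      then show "linear (\<lambda>x. quadratic_coeff l b n (vs[p := x]))"
        unfolding quadratic_coeff_step[OF 3] by (intro linear_compose_sum) auto
    qed
  qed (simp add: multilinear_def)
qed

text \<open>
  The recursion of the norms is the same recursion for scalars: \<open>catalan_bound L B n\<close> is
  \<open>L ^ n * B ^ (n - 1)\<close> times a Catalan number. Here all linear values are \<open>L\<close>, and the list of arguments
  is irrelevant.
\<close>

abbreviation catalan_bound :: "real \<Rightarrow> real \<Rightarrow> nat \<Rightarrow> real" where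
  "catalan_bound L B n \<equiv> quadratic_coeff (\<lambda>_. L) (\<lambda>x y. B * (x * y)) n ([] :: unit list)"

lemma catalan_bound_step:
  assumes "n \<ge> 2"
  shows "catalan_bound L B n = (\<Sum>i\<in>{1..<n}. B * (catalan_bound L B i * catalan_bound L B (n - i)))"
  by (simp add: quadratic_coeff_step[OF assms])

lemma catalan_bound_nonneg:
  assumes "0 \<le> L" "0 \<le> B"
  shows "0 \<le> catalan_bound L B n"
proof (induction n rule: less_induct)
  case (less n)
  consider "n = 0" | "n = 1" | "n \<ge> 2" by linarith
  then show ?case
    by cases (use assms less in \<open>auto simp: quadratic_coeff_0 quadratic_coeff_1 quadratic_coeff_step intro!: sum_nonneg mult_nonneg_nonneg\<close>)
qed

lemma quadratic_coeff_bound: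
  assumes l: "\<And>x. norm (l x) \<le> norm x * L" and b: "\<And>x y. norm (b x y) \<le> norm x * norm y * B"
    and "0 \<le> L" "0 \<le> B" "length vs = n"
  shows "norm (quadratic_coeff l b n vs) \<le> catalan_bound L B n * prod_list (map norm vs)"
  using \<open>length vs = n\<close>
proof (induction n arbitrary: vs rule: less_induct)
  case (less n)
  have nn: "0 \<le> prod_list (map norm ws)" for ws :: "'a list" by (induction ws) auto
  consider "n = 0" | "n = 1" | "n \<ge> 2" by linarith
  then show ?case
  proof cases
    case 1 then show ?thesis by (simp add: quadratic_coeff_0)
  next
    case 2
    then obtain v where "vs = [v]" using less.prems by (metis One_nat_def length_0_conv length_Suc_conv)
    then show ?thesis using 2 l[of v] by (simp add: quadratic_coeff_1 mult.commute)
  next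
    case 3
    have "norm (quadratic_coeff l b n vs) \<le>
        (\<Sum>i\<in>{1..<n}. B * (catalan_bound L B i * catalan_bound L B (n - i)) * prod_list (map norm vs))"
      unfolding quadratic_coeff_step[OF 3]
    proof (rule sum_norm_le)
      fix i assume i: "i \<in> {1..<n}"
      let ?x = "quadratic_coeff l b i (take i vs)" and ?y = "quadratic_coeff l b (n - i) (drop i vs)"
      have "norm (b ?x ?y) \<le> norm ?x * norm ?y * B" by (rule b)
      also have "\<dots> \<le> (catalan_bound L B i * prod_list (map norm (take i vs))) *
          (catalan_bound L B (n - i) * prod_list (map norm (drop i vs))) * B"
        using less.IH[of i "take i vs"] less.IH[of "n - i" "drop i vs"] i less.prems assms(3,4)
        by (intro mult_right_mono mult_mono) (auto intro!: mult_nonneg_nonneg nn catalan_bound_nonneg)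
      also have "\<dots> = B * (catalan_bound L B i * catalan_bound L B (n - i)) *
          (prod_list (map norm (take i vs)) * prod_list (map norm (drop i vs)))" by (simp add: mult_ac)
      also have "prod_list (map norm (take i vs)) * prod_list (map norm (drop i vs)) = prod_list (map norm vs)"
        by (metis append_take_drop_id map_append prod_list.append)
      finally show "norm (b ?x ?y) \<le> B * (catalan_bound L B i * catalan_bound L B (n - i)) * prod_list (map norm vs)" .
    qed
    then show ?thesis by (simp only: catalan_bound_step[OF 3] sum_distrib_right)
  qed
qed

text \<open>
  Instead of the growth of the Catalan numbers, the scalar equation is used: the partial sums satisfy
  \<open>s (N + 1) \<le> L * r + B * (s N)\<^sup>2\<close>, and \<open>1 / (2 * B)\<close> is preserved by this map exactly if
  \<open>4 * B * L * r \<le> 1\<close>.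
\<close>

lemma catalan_bound_sum:
  assumes "0 \<le> L" "0 < B" "0 \<le> r" "4 * B * L * r \<le> 1"
  shows "(\<Sum>n\<le>N. catalan_bound L B n * r ^ n) \<le> 1 / (2 * B)"
proof (induction N)
  case 0
  then show ?case using assms by (simp add: quadratic_coeff_0)
next
  case (Suc N)
  let ?a = "\<lambda>n. catalan_bound L B n * r ^ n"
  have a0: "0 \<le> ?a n" for n using assms catalan_bound_nonneg[of L B n] by simp
  have conv: "?a n \<le> (if n = 1 then L * r else 0) + B * (\<Sum>i\<le>n. ?a i * ?a (n - i))" for n
  proof -
    consider "n = 0" | "n = 1" | "n \<ge> 2" by linarith
    then show ?thesis
    proof cases
      case 3
      have "?a n = (\<Sum>i\<in>{1..<n}. B * (?a i * ?a (n - i)))"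
        unfolding catalan_bound_step[OF 3] sum_distrib_right
      proof (rule sum.cong[OF refl])
        fix i assume "i \<in> {1..<n}"
        then have "r ^ n = r ^ i * r ^ (n - i)" by (simp add: power_add[symmetric])
        then show "B * (catalan_bound L B i * catalan_bound L B (n - i)) * r ^ n = B * (?a i * ?a (n - i))"
          by simp
      qed
      also have "\<dots> = B * (\<Sum>i\<in>{1..<n}. ?a i * ?a (n - i))" by (simp add: sum_distrib_left)
      also have "\<dots> \<le> B * (\<Sum>i\<le>n. ?a i * ?a (n - i))"
        using assms(2) mult_nonneg_nonneg[OF a0 a0] by (intro mult_left_mono sum_mono2) auto
      finally show ?thesis using 3 by simp
    qed (use assms a0 in \<open>auto simp: quadratic_coeff_0 quadratic_coeff_1 intro!: mult_nonneg_nonneg sum_nonneg\<close>)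
  qed
  have "(\<Sum>n\<le>Suc N. ?a n) \<le> (\<Sum>n\<le>Suc N. (if n = 1 then L * r else 0) + B * (\<Sum>i\<le>n. ?a i * ?a (n - i)))"
    by (intro sum_mono conv)
  also have "\<dots> = L * r + B * (\<Sum>n\<le>Suc N. \<Sum>i\<le>n. ?a i * ?a (n - i))"
    by (simp add: sum.distrib sum_distrib_left sum.delta del: sum.atMost_Suc)
  also have "(\<Sum>n\<le>Suc N. \<Sum>i\<le>n. ?a i * ?a (n - i)) = (\<Sum>(i, j)\<in>{(i, j). i + j \<le> Suc N}. ?a i * ?a j)"
    using sum.triangle_reindex_eq[of "\<lambda>i j. ?a i * ?a j" "Suc N"] by simp
  also have "\<dots> = (\<Sum>(i, j)\<in>{(i, j). i + j \<le> Suc N \<and> 0 < i \<and> 0 < j}. ?a i * ?a j)"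
  proof (rule sum.mono_neutral_right)
    have "{(i, j). i + j \<le> Suc N} \<subseteq> {..Suc N} \<times> {..Suc N}" by auto
    then show "finite {(i, j). i + j \<le> Suc N}" by (rule finite_subset) auto
  qed (auto simp: quadratic_coeff_0 intro!: Nat.gr0I)
  also have "\<dots> \<le> (\<Sum>(i, j)\<in>{..N} \<times> {..N}. ?a i * ?a j)"
  proof (rule sum_mono2)
    show "0 \<le> (case x of (i, j) \<Rightarrow> ?a i * ?a j)" for x
      using mult_nonneg_nonneg[OF a0 a0] by (cases x) simp
  qed auto
  also have "\<dots> = (\<Sum>n\<le>N. ?a n) * (\<Sum>n\<le>N. ?a n)"
    by (simp add: sum_product sum.cartesian_product)
  finally have "(\<Sum>n\<le>Suc N. ?a n) \<le> L * r + B * ((\<Sum>n\<le>N. ?a n) * (\<Sum>n\<le>N. ?a n))" using assms(2) by simp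
  also have "\<dots> \<le> L * r + B * (1 / (2 * B) * (1 / (2 * B)))"
    using Suc assms(2) a0 by (intro add_left_mono mult_left_mono mult_mono sum_nonneg) auto
  also have "\<dots> \<le> 1 / (2 * B)"
    using assms by (simp add: field_simps)
  finally show ?case .
qed

text \<open>
  The linear bound on \<open>z\<close> makes the solution small with \<open>q\<close>; with it, the derivative at zero can be
  read off from the equation.
\<close>

theorem quadratic_fixed_point:
  fixes l :: "'a::real_normed_vector \<Rightarrow> 'z::banach"
  assumes "bounded_linear l" "bounded_bilinear b"
  shows "\<exists>r>0. \<exists>C z. frechet_analytic_on (ball 0 r) z \<and>
    (\<forall>q. norm q < r \<longrightarrow> norm (z q) \<le> C * norm q \<and> z q = l q + b (z q) (z q))"
proof -
  interpret l: bounded_linear l by fact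
  interpret b: bounded_bilinear b by fact
  obtain L where L: "0 < L" "\<And>x. norm (l x) \<le> norm x * L" using l.pos_bounded by blast
  obtain B where B: "0 < B" "\<And>x y. norm (b x y) \<le> norm x * norm y * B" using b.pos_bounded by blast
  define r where "r = 1 / (4 * B * L)"
  have r0: "0 < r" using L B by (simp add: r_def)
  have r1: "4 * B * L * r \<le> 1" using L B by (simp add: r_def)
  define K where "K = 1 / (2 * B)"
  have cat: "catalan_bound L B n \<le> K * (1 / r) ^ n" for n
  proof -
    have "catalan_bound L B n * r ^ n \<le> (\<Sum>i\<le>n. catalan_bound L B i * r ^ i)"
      using L B r0 by (intro member_le_sum) (auto intro!: catalan_bound_nonneg mult_nonneg_nonneg)
    also have "\<dots> \<le> K" unfolding K_def using L B r0 r1 by (intro catalan_bound_sum) auto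
    finally show ?thesis using r0 by (simp add: power_divide field_simps)
  qed
  define m where "m = quadratic_coeff l b"
  have nn: "0 \<le> prod_list (map norm ws)" for ws :: "'a list" by (induction ws) auto
  have mb: "norm (m n vs) \<le> K * (1 / r) ^ n * prod_list (map norm vs)" if "length vs = n" for n vs
  proof -
    have "norm (m n vs) \<le> catalan_bound L B n * prod_list (map norm vs)"
      unfolding m_def by (rule quadratic_coeff_bound[OF L(2) B(2) _ _ that]) (use L B in auto)
    also have "\<dots> \<le> K * (1 / r) ^ n * prod_list (map norm vs)" by (intro mult_right_mono cat nn)
    finally show ?thesis .
  qed
  define x where "x q n = m n (replicate n q)" for q n
  define z where "z q = (\<Sum>n. x q n)" for q
  have xb: "norm (x q n) \<le> K * (norm q / r) ^ n" for q n
    using mb[of "replicate n q" n] by (simp add: x_def power_divide)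
  have K0: "0 \<le> K" using B by (simp add: K_def)
  have sn: "summable (\<lambda>n. norm (x q n))" if "norm q < r" for q
  proof (rule summable_comparison_test')
    show "summable (\<lambda>n. K * (norm q / r) ^ n)"
      using that r0 by (intro summable_mult summable_geometric) auto
  qed (simp add: xb)
  have s: "summable (x q)" if "norm q < r" for q
    using sn[OF that] by (rule summable_norm_cancel)
  have "frechet_analytic_on (ball 0 (1 / (1 / r))) z"
  proof (rule power_series_analytic[where m = m and K = K])
    show "multilinear n (m n)" for n
      unfolding m_def by (rule multilinear_quadratic_coeff[OF l.linear_axioms assms(2)])
    show "(\<lambda>n. m n (replicate n h)) sums z (0 + h)" if "norm h < 1 / (1 / r)" for h
      using summable_sums[OF s[of h]] that by (simp add: z_def x_def[abs_def])
  qed (use mb r0 in auto)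
  then have an: "frechet_analytic_on (ball 0 r) z" by simp
  have eq: "z q = l q + b (z q) (z q)" if q: "norm q < r" for q
  proof -
    define t where "t i j = b (x q i) (x q j)" for i j
    have "summable (\<lambda>n. \<Sum>i\<le>n. norm (t i (n - i)))"
    proof (rule summable_comparison_test')
      show "summable (\<lambda>n. B * (\<Sum>i\<le>n. norm (x q i) * norm (x q (n - i))))"
        by (intro summable_mult summable_Cauchy_product) (simp_all add: sn[OF q])
      show "norm (\<Sum>i\<le>n. norm (t i (n - i))) \<le> B * (\<Sum>i\<le>n. norm (x q i) * norm (x q (n - i)))" for n
        unfolding sum_distrib_left using B(2)
        by (simp add: sum_nonneg t_def mult.commute[of B]) (intro sum_mono B(2))
    qed
    from sums_antidiagonal[OF this]
    have "(\<lambda>k. \<Sum>j. t j k) sums (\<Sum>n. \<Sum>i\<le>n. t i (n - i))" by blast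
    moreover have "(\<Sum>j. t j k) = b (z q) (x q k)" for k
      unfolding t_def z_def by (rule bounded_linear.suminf[OF b.bounded_linear_left s[OF q], symmetric])
    moreover have "(\<lambda>k. b (z q) (x q k)) sums b (z q) (z q)"
      unfolding z_def by (rule bounded_linear.sums[OF b.bounded_linear_right summable_sums[OF s[OF q]]])
    ultimately have bz: "b (z q) (z q) = (\<Sum>n. \<Sum>i\<le>n. t i (n - i))"
      by (simp add: sums_iff)
    have conv: "(\<Sum>i\<le>n. t i (n - i)) = x q n - (if n = 1 then l q else 0)" for n
    proof -
      have x0: "x q 0 = 0" by (simp add: x_def m_def quadratic_coeff_0)
      consider "n = 0" | "n = 1" | "n \<ge> 2" by linarith
      then show ?thesis
      proof cases
        case 1 then show ?thesis by (simp add: t_def x0 b.zero_left)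
      next
        case 2 then show ?thesis
          by (simp add: t_def x0 b.zero_left b.zero_right) (simp add: x_def m_def quadratic_coeff_1)
      next
        case 3
        have "(\<Sum>i\<le>n. t i (n - i)) = (\<Sum>i\<in>{1..<n}. t i (n - i))"
          by (rule sum.mono_neutral_right) (auto simp: t_def x0 b.zero_left b.zero_right Suc_le_eq not_less le_antisym)
        also have "\<dots> = x q n"
          unfolding x_def m_def quadratic_coeff_step[OF 3]
          by (rule sum.cong) (auto simp: t_def x_def m_def min_def)
        finally show ?thesis using 3 by simp
      qed
    qed
    have "(\<lambda>n. x q n - (if n = 1 then l q else 0)) sums (z q - l q)"
      unfolding z_def by (intro sums_diff summable_sums s q) (use sums_single[of 1 "\<lambda>_. l q"] in simp)
    then show ?thesis using bz conv by (simp add: sums_iff)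
  qed
  have small: "norm (z q) \<le> (2 * K / r) * norm q" if q: "norm q < r / 2" for q
  proof -
    let ?y = "norm q / r"
    have y: "0 \<le> ?y" "?y < 1 / 2" "\<bar>?y\<bar> < 1" using q r0 by (simp_all add: field_simps)
    have x0: "x q 0 = 0" by (simp add: x_def m_def quadratic_coeff_0)
    have qr: "norm q < r" using q r0 by simp
    have "norm (z q) \<le> (\<Sum>n. norm (x q n))" unfolding z_def by (rule summable_norm[OF sn[OF qr]])
    also have "\<dots> = (\<Sum>n. norm (x q (Suc n)))"
      using suminf_split_head[OF sn[OF qr]] x0 by simp
    also have "\<dots> \<le> (\<Sum>n. K * ?y * ?y ^ n)"
    proof (rule suminf_le)
      show "norm (x q (Suc n)) \<le> K * ?y * ?y ^ n" for n using xb[of q "Suc n"] by (simp add: mult.assoc)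
      show "summable (\<lambda>n. norm (x q (Suc n)))" using sn[OF qr] by (subst summable_Suc_iff)
      show "summable (\<lambda>n. K * ?y * ?y ^ n)" using y by (intro summable_mult summable_geometric) auto
    qed
    also have "\<dots> = K * ?y * (1 / (1 - ?y))"
      using y by (subst suminf_mult) (auto simp: suminf_geometric intro!: summable_geometric)
    also have "\<dots> \<le> K * ?y * 2"
      using y K0 by (intro mult_left_mono mult_nonneg_nonneg) (use r0 q in \<open>simp_all add: divide_simps\<close>)
    finally show ?thesis by (simp add: mult_ac)
  qed
  have an2: "frechet_analytic_on (ball 0 (r / 2)) z"
    by (rule frechet_analytic_on_subset[OF an]) (use r0 in auto)
  show ?thesis
    by (intro exI[of _ "r / 2"] conjI exI[of _ "2 * K / r"] exI[of _ z] allI impI)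
      (use r0 an2 small eq in auto)
qed

text \<open>
  A quadratic function \<open>v\<close> of the solution is itself part of the solution of a larger system: substituting the
  equation once, \<open>v = pr (l q) + (pr (b z z) + \<beta> z z)\<close> is linear in \<open>q\<close> plus bilinear in \<open>z\<close>. So products
  of analytic maps need not be considered.
\<close>

theorem quadratic_system:
  fixes l :: "'a::real_normed_vector \<Rightarrow> 'z::banach" and pr :: "'z \<Rightarrow> 'v::banach"
  assumes l: "bounded_linear l" and b: "bounded_bilinear b" and pr: "bounded_linear pr" and \<beta>: "bounded_bilinear \<beta>"
  shows "\<exists>r>0. \<exists>C z. frechet_analytic_on (ball 0 r) (\<lambda>q. pr (z q) + \<beta> (z q) (z q)) \<and>
    ((\<lambda>q. pr (z q) + \<beta> (z q) (z q)) has_derivative (\<lambda>q. pr (l q))) (at 0) \<and>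
    (\<forall>q. norm q < r \<longrightarrow> norm (z q) \<le> C * norm q \<and> z q = l q + b (z q) (z q))"
proof -
  interpret pr: bounded_linear pr by fact
  interpret b: bounded_bilinear b by fact
  interpret \<beta>: bounded_bilinear \<beta> by fact
  define l' where "l' q = (l q, pr (l q))" for q
  define b' :: "'z \<times> 'v \<Rightarrow> 'z \<times> 'v \<Rightarrow> 'z \<times> 'v"
    where "b' x y = (b (fst x) (fst y), pr (b (fst x) (fst y)) + \<beta> (fst x) (fst y))" for x y
  have l': "bounded_linear l'"
    unfolding l'_def by (intro bounded_linear_Pair l bounded_linear_compose[OF pr l])
  obtain Bb where Bb: "0 < Bb" "\<And>x y. norm (b x y) \<le> norm x * norm y * Bb" using b.pos_bounded by blast
  obtain B\<beta> where B\<beta>: "0 < B\<beta>" "\<And>x y. norm (\<beta> x y) \<le> norm x * norm y * B\<beta>" using \<beta>.pos_bounded by blast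
  obtain L where L: "0 < L" "\<And>x. norm (pr x) \<le> norm x * L" using pr.pos_bounded by blast
  have b': "bounded_bilinear b'"
  proof
    show "\<exists>K. \<forall>x y. norm (b' x y) \<le> norm x * norm y * K"
    proof (intro exI allI)
      fix x y :: "'z \<times> 'v"
      let ?n = "norm (fst x) * norm (fst y)"
      have "norm (b' x y) \<le> norm (b (fst x) (fst y)) + (norm (pr (b (fst x) (fst y))) + norm (\<beta> (fst x) (fst y)))"
        unfolding b'_def by (rule order_trans[OF norm_Pair_le] add_left_mono norm_triangle_ineq)+
      also have "\<dots> \<le> ?n * Bb + (?n * Bb * L + ?n * B\<beta>)"
        using L Bb B\<beta> by (intro add_mono order_trans[OF L(2)] mult_right_mono) auto
      also have "\<dots> = ?n * (Bb + Bb * L + B\<beta>)" by (simp add: algebra_simps)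
      also have "\<dots> \<le> norm x * norm y * (Bb + Bb * L + B\<beta>)"
        using L Bb B\<beta> using norm_fst_le[of "fst x" "snd x"] norm_fst_le[of "fst y" "snd y"]
          by (intro mult_right_mono mult_mono) auto
      finally show "norm (b' x y) \<le> norm x * norm y * (Bb + Bb * L + B\<beta>)" .
    qed
  qed (simp_all add: b'_def b.add_left b.add_right \<beta>.add_left \<beta>.add_right b.scaleR_left b.scaleR_right
      \<beta>.scaleR_left \<beta>.scaleR_right pr.add pr.scaleR algebra_simps)
  obtain r C z' where r: "r > 0" "frechet_analytic_on (ball 0 r) z'"
    and z': "\<And>q. norm q < r \<Longrightarrow> norm (z' q) \<le> C * norm q"
      "\<And>q. norm q < r \<Longrightarrow> z' q = l' q + b' (z' q) (z' q)"
    using quadratic_fixed_point[OF l' b'] by blast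
  define z where "z q = fst (z' q)" for q
  have z: "z q = l q + b (z q) (z q)" if "norm q < r" for q
    using arg_cong[OF z'(2)[OF that], of fst] by (simp add: z_def l'_def b'_def)
  have v: "snd (z' q) = pr (z q) + \<beta> (z q) (z q)" if "norm q < r" for q
  proof -
    have "snd (z' q) = pr (l q + b (z q) (z q)) + \<beta> (z q) (z q)"
      using arg_cong[OF z'(2)[OF that], of snd] by (simp add: z_def l'_def b'_def pr.add)
    then show ?thesis using z[OF that] by simp
  qed
  have zb: "norm (z q) \<le> C * norm q" if "norm q < r" for q
    using z'(1)[OF that] norm_fst_le[of "fst (z' q)" "snd (z' q)"] by (simp add: z_def)
  have "frechet_analytic_on (ball 0 r) (\<lambda>q. 0 + snd (z' q))"
    by (rule frechet_analytic_on_compose_linear[OF bounded_linear_snd r(2)])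
  then have an: "frechet_analytic_on (ball 0 r) (\<lambda>q. pr (z q) + \<beta> (z q) (z q))"
    by (rule frechet_analytic_on_cong) (simp add: v)
  have "((\<lambda>q. pr (z q) + \<beta> (z q) (z q)) has_derivative (\<lambda>q. pr (l q))) (at 0)"
    unfolding has_derivative_iff_norm
  proof (intro conjI)
    show "bounded_linear (\<lambda>q. pr (l q))" by (rule bounded_linear_compose[OF pr l])
    have C0: "z 0 = 0" using zb[of 0] r(1) by simp
    define M where "M = Bb * C\<^sup>2 * L + B\<beta> * C\<^sup>2"
    have bd: "norm (pr (z q) + \<beta> (z q) (z q) - pr (l q)) \<le> M * norm q * norm q" if q: "norm q < r" for q
    proof -
      have zz: "norm (z q) * norm (z q) \<le> (C * norm q) * (C * norm q)"
        using zb[OF q] by (intro mult_mono) (auto intro: order_trans[OF norm_ge_zero])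
      have "pr (z q) + \<beta> (z q) (z q) - pr (l q) = pr (b (z q) (z q)) + \<beta> (z q) (z q)"
      proof -
        have "pr (z q) = pr (l q) + pr (b (z q) (z q))" by (subst z[OF q]) (rule pr.add)
        then show ?thesis by simp
      qed
      also have "norm \<dots> \<le> norm (pr (b (z q) (z q))) + norm (\<beta> (z q) (z q))" by (rule norm_triangle_ineq)
      also have "\<dots> \<le> norm (z q) * norm (z q) * Bb * L + norm (z q) * norm (z q) * B\<beta>"
        using L Bb B\<beta> by (intro add_mono order_trans[OF L(2)] mult_right_mono) auto
      also have "\<dots> = (norm (z q) * norm (z q)) * (Bb * L + B\<beta>)" by (simp add: algebra_simps)
      also have "\<dots> \<le> ((C * norm q) * (C * norm q)) * (Bb * L + B\<beta>)"
        using zz L Bb B\<beta> by (intro mult_right_mono) auto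
      also have "\<dots> = M * norm q * norm q" by (simp add: M_def power2_eq_square algebra_simps)
      finally show ?thesis .
    qed
    show "((\<lambda>q. norm (pr (z q) + \<beta> (z q) (z q) - (pr (z 0) + \<beta> (z 0) (z 0)) - pr (l (q - 0))) / norm (q - 0)) \<longlongrightarrow> 0) (at 0)"
    proof (rule Lim_null_comparison)
      show "((\<lambda>q::'a. M * norm q) \<longlongrightarrow> 0) (at 0)"
        by (rule tendsto_eq_intros refl)+ simp
      have "\<forall>\<^sub>F q in at 0. q \<in> ball (0::'a) r - {0}"
        using r(1) by (intro eventually_at_in_open) auto
      then show "\<forall>\<^sub>F q in at 0. norm (norm (pr (z q) + \<beta> (z q) (z q) - (pr (z 0) + \<beta> (z 0) (z 0)) - pr (l (q - 0))) / norm (q - 0)) \<le> M * norm q"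
      proof eventually_elim
        case (elim q)
        then show ?case using bd[of q] C0 by (simp add: pr.zero \<beta>.zero_left divide_le_eq)
      qed
    qed
  qed
  then show ?thesis using r(1) an z zb by blast
qed

section \<open>Symmetric and positive definite matrices\<close>

lemma inner_transpose_mult:
  fixes A :: "real^'m^'n"
  shows "x \<bullet> (transpose A *v y) = (A *v x) \<bullet> y"
  using dot_lmul_matrix[of y A x] by (simp add: inner_commute)

lemma sum_eq_single:
  assumes "finite S" "a \<in> S" "\<And>x. x \<in> S \<Longrightarrow> x \<noteq> a \<Longrightarrow> f x = (0::'a::comm_monoid_add)"
  shows "sum f S = f a"
  using assms by (metis (no_types, lifting) Diff_iff add.right_neutral singletonI sum.neutral sum.remove)

definition diagonal :: "('n \<Rightarrow> real) \<Rightarrow> real^'n::finite^'n" where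
  "diagonal k = (\<chi> i j. if i = j then k i else 0)"

lemma diagonal_nth [simp]: "diagonal k $ i $ j = (if i = j then k i else 0)"
  by (simp add: diagonal_def)

lemma diagonal_mult_vec: "diagonal k *v x = (\<chi> i. k i * x $ i)"
proof -
  have "(\<Sum>j\<in>UNIV. (if i = j then k i else 0) * x $ j) = k i * x $ i" for i
    by (subst sum_eq_single[of _ i]) auto
  then show ?thesis by (simp add: vec_eq_iff matrix_vector_mult_def)
qed

lemma diagonal_mult: "diagonal k ** diagonal l = diagonal (\<lambda>i. k i * l i)"
  by (simp add: matrix_eq matrix_vector_mul_assoc[symmetric] diagonal_mult_vec vec_eq_iff mult.assoc)

lemma transpose_diagonal [simp]: "transpose (diagonal k) = diagonal k"
  by (simp add: vec_eq_iff transpose_def)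

lemma det_diagonal_prod: "det (diagonal k) = prod k UNIV"
  by (subst det_diagonal) auto

lemma diagonal_one: "diagonal (\<lambda>i. 1) = mat 1"
  by (simp add: vec_eq_iff mat_def)

lemma linear_coefficient_zero:
  fixes b c :: real
  assumes "\<And>t. b * t + c * t\<^sup>2 \<le> 0"
  shows "b = 0"
proof (rule ccontr)
  assume "b \<noteq> 0"
  define e where "e = 1 / (\<bar>c\<bar> + 1)"
  have c: "0 < \<bar>c\<bar> + 1" by linarith
  then have e: "0 < e" "\<bar>c\<bar> * e < 1" by (simp_all add: e_def)
  have "- c * e \<le> \<bar>c\<bar> * e" using e(1) by (intro mult_right_mono) auto
  then have "0 < 1 + c * e" using e(2) by linarith
  moreover have "b * (e * b) + c * (e * b)\<^sup>2 = e * b\<^sup>2 * (1 + c * e)"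
    by (simp add: power2_eq_square algebra_simps)
  moreover have "0 < e * b\<^sup>2" using e \<open>b \<noteq> 0\<close> by simp
  ultimately have "0 < b * (e * b) + c * (e * b)\<^sup>2" by simp
  with assms[of "e * b"] show False by simp
qed

lemma symmetric_inner:
  fixes A :: "real^'n^'n"
  assumes "transpose A = A"
  shows "x \<bullet> (A *v y) = (A *v x) \<bullet> y"
  using inner_transpose_mult[of x A y] assms by simp

text \<open>
  The next eigenvector maximizes the quadratic form over the unit vectors orthogonal to the previous
  ones. The last conjunct records this maximality; it orders the eigenvalues and carries the induction.
\<close>

lemma successive_eigenvectors:
  fixes A :: "real^'n^'n"
  assumes A: "transpose A = A" and "k \<le> CARD('n)"
  shows "\<exists>e :: nat \<Rightarrow> real^'n. \<exists>m :: nat \<Rightarrow> real.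
    (\<forall>i<k. \<forall>j<k. e i \<bullet> e j = (if i = j then 1 else 0)) \<and>
    (\<forall>i<k. A *v e i = m i *\<^sub>R e i) \<and>
    (\<forall>i<k. \<forall>y. (\<forall>j<i. e j \<bullet> y = 0) \<longrightarrow> y \<bullet> (A *v y) \<le> m i * (y \<bullet> y))"
  using \<open>k \<le> CARD('n)\<close>
proof (induction k)
  case 0
  then show ?case by simp
next
  case (Suc k)
  then obtain e m where on: "\<forall>i<k. \<forall>j<k. e i \<bullet> e j = (if i = j then 1 else 0)"
    and eig: "\<forall>i<k. A *v e i = m i *\<^sub>R (e i :: real^'n)"
    and ray: "\<forall>i<k. \<forall>y. (\<forall>j<i. e j \<bullet> y = 0) \<longrightarrow> y \<bullet> (A *v y) \<le> m i * (y \<bullet> y)"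
    by auto
  define S where "S = {y. norm y = 1 \<and> (\<forall>j<k. e j \<bullet> y = 0)}"
  have "dim (e ` {..<k}) \<le> card (e ` {..<k})" by (rule dim_le_card') simp
  also have "\<dots> \<le> k" using card_image_le[of "{..<k}" e] by simp
  finally have "dim (e ` {..<k}) < DIM(real^'n)" using Suc.prems by simp
  then obtain x where x: "x \<noteq> 0" "\<And>y. y \<in> span (e ` {..<k}) \<Longrightarrow> orthogonal x y"
    using orthogonal_to_subspace_exists by blast
  have "orthogonal x (e j)" if "j < k" for j by (rule x(2)[OF span_base]) (use that in simp)
  then have "x /\<^sub>R norm x \<in> S"
    using x(1) by (simp add: S_def orthogonal_def inner_commute)
  then have ne: "S \<noteq> {}" by blast
  have "S = sphere 0 1 \<inter> (\<Inter>j\<in>{..<k}. {y. e j \<bullet> y = 0})" by (auto simp: S_def)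
  then have "compact S"
    by (simp only:) (intro compact_Int_closed compact_sphere closed_INT ballI closed_hyperplane)
  moreover have "continuous_on S (\<lambda>y. y \<bullet> (A *v y))"
    by (intro continuous_intros linear_continuous_on_compose matrix_vector_mul_linear)
  ultimately obtain u where u: "u \<in> S" "\<And>y. y \<in> S \<Longrightarrow> y \<bullet> (A *v y) \<le> u \<bullet> (A *v u)"
    using continuous_attains_sup[OF _ ne] by blast
  define l where "l = u \<bullet> (A *v u)"
  have uu: "u \<bullet> u = 1" and ue: "\<And>j. j < k \<Longrightarrow> e j \<bullet> u = 0"
    using u(1) by (auto simp: S_def power2_norm_eq_inner[symmetric])
  have max: "y \<bullet> (A *v y) \<le> l * (y \<bullet> y)" if y: "\<forall>j<k. e j \<bullet> y = 0" for y
  proof (cases "y = 0")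
    case False
    have "y /\<^sub>R norm y \<in> S" using y False by (simp add: S_def)
    from u(2)[OF this] have "y \<bullet> (A *v y) / (norm y)\<^sup>2 \<le> l"
      by (simp add: l_def matrix_vector_mult_scaleR power2_eq_square divide_inverse mult_ac)
    then show ?thesis using False by (simp add: power2_norm_eq_inner[symmetric] divide_le_eq)
  qed simp
  have ortho: "(A *v u - l *\<^sub>R u) \<bullet> w = 0" if w: "\<forall>j<k. e j \<bullet> w = 0" for w
  proof -
    (* first variation of the form at the maximum \<open>u\<close> in the direction \<open>w\<close> *)
    have "2 * ((A *v u - l *\<^sub>R u) \<bullet> w) = 0"
    proof (rule linear_coefficient_zero[where c = "w \<bullet> (A *v w) - l * (w \<bullet> w)"])
      fix t :: real
      have "(u + t *\<^sub>R w) \<bullet> (A *v (u + t *\<^sub>R w)) \<le> l * ((u + t *\<^sub>R w) \<bullet> (u + t *\<^sub>R w))"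
        using w ue by (intro max) (simp add: inner_add_right)
      moreover have "w \<bullet> (A *v u) = (A *v u) \<bullet> w" "u \<bullet> (A *v w) = (A *v u) \<bullet> w"
        using symmetric_inner[OF A, of u w] by (simp_all add: inner_commute)
      ultimately show "2 * ((A *v u - l *\<^sub>R u) \<bullet> w) * t + (w \<bullet> (A *v w) - l * (w \<bullet> w)) * t\<^sup>2 \<le> 0"
        using uu inner_commute[of w u]
        by (simp add: matrix_vector_right_distrib matrix_vector_mult_scaleR inner_add_left inner_add_right
            inner_diff_left l_def[symmetric] power2_eq_square algebra_simps)
    qed
    then show ?thesis by simp
  qed
  have "e j \<bullet> (A *v u - l *\<^sub>R u) = 0" if "j < k" for j
    using symmetric_inner[OF A, of "e j" u] eig that ue by (simp add: inner_diff_right)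
  then have "(A *v u - l *\<^sub>R u) \<bullet> (A *v u - l *\<^sub>R u) = 0" by (intro ortho) simp
  then have Au: "A *v u = l *\<^sub>R u" by simp
  show ?case
    by (rule exI[of _ "e(k := u)"], rule exI[of _ "m(k := l)"])
      (use on eig ray uu ue Au max in \<open>auto simp: less_Suc_eq inner_commute\<close>)
qed

text \<open>
  The enumeration \<open>idx\<close> of the coordinates makes it possible to speak of decreasing eigenvalues, on which
  the proof of coercivity relies.
\<close>

theorem spectral_decomposition:
  fixes A :: "real^'n^'n" and idx :: "'n \<Rightarrow> nat"
  assumes A: "transpose A = A" and idx: "bij_betw idx UNIV {..<CARD('n)}"
  obtains U :: "real^'n^'n" and m where "orthogonal_matrix U" "A = transpose U ** diagonal m ** U"
    "\<And>i j. idx i \<le> idx j \<Longrightarrow> m j \<le> m i"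
proof -
  obtain e :: "nat \<Rightarrow> real^'n" and m :: "nat \<Rightarrow> real"
    where H: "(\<forall>i<CARD('n). \<forall>j<CARD('n). e i \<bullet> e j = (if i = j then 1 else 0)) \<and>
      (\<forall>i<CARD('n). A *v e i = m i *\<^sub>R e i) \<and>
      (\<forall>i<CARD('n). \<forall>y. (\<forall>j<i. e j \<bullet> y = 0) \<longrightarrow> y \<bullet> (A *v y) \<le> m i * (y \<bullet> y))"
    using successive_eigenvectors[OF A order_refl] by (elim exE)
  then have on: "e i \<bullet> e j = (if i = j then 1 else 0)" if "i < CARD('n)" "j < CARD('n)" for i j
    using that by blast
  have eig: "A *v e i = m i *\<^sub>R e i" if "i < CARD('n)" for i using H that by blast
  have ray: "y \<bullet> (A *v y) \<le> m i * (y \<bullet> y)" if "i < CARD('n)" "\<And>j. j < i \<Longrightarrow> e j \<bullet> y = 0" for i y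
    using H that by blast
  have lt: "idx i < CARD('n)" for i using idx bij_betwE by fastforce
  have inj: "idx i = idx j \<longleftrightarrow> i = j" for i j
    using bij_betw_imp_inj_on[OF idx] by (auto simp: inj_on_def)
  define U :: "real^'n^'n" where "U = (\<chi> i. e (idx i))"
  have UU: "U ** transpose U = mat 1"
    using on[OF lt lt] by (simp add: vec_eq_iff matrix_matrix_mult_def transpose_def mat_def U_def
      inner_vec_def inj)
  then have orth: "orthogonal_matrix U" by (simp add: orthogonal_matrix_def matrix_left_right_inverse)
  then have UU': "transpose U ** U = mat 1" by (simp add: orthogonal_matrix_def)
  have col: "transpose U *v axis i 1 = e (idx i)" for i
    by (simp add: vec_eq_iff matrix_vector_mult_basis column_def U_def transpose_def)
  have "U ** A ** transpose U = diagonal (m \<circ> idx)"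
  proof -
    have "(U *v (A *v (transpose U *v axis j 1))) $ i = diagonal (m \<circ> idx) $ i $ j" for i j
      unfolding col eig[OF lt] by (simp add: matrix_vector_mul_component matrix_vector_mult_scaleR U_def on[OF lt lt] inj)
    then have "(U ** A ** transpose U) *v axis j 1 = diagonal (m \<circ> idx) *v axis j 1" for j
      by (simp add: vec_eq_iff matrix_vector_mul_assoc[symmetric] matrix_vector_mult_basis[of "diagonal (m \<circ> idx)"] column_def del: transpose_matrix_vector)
    then show ?thesis
      by (simp add: vec_eq_iff matrix_vector_mult_basis column_def)
  qed
  then have "transpose U ** (U ** A ** transpose U) ** U = transpose U ** diagonal (m \<circ> idx) ** U" by simp
  moreover have "transpose U ** (U ** A ** transpose U) ** U = (transpose U ** U) ** A ** (transpose U ** U)"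
    by (simp only: matrix_mul_assoc)
  ultimately have "A = transpose U ** diagonal (m \<circ> idx) ** U" by (simp add: UU')
  moreover have "(m \<circ> idx) j \<le> (m \<circ> idx) i" if le: "idx i \<le> idx j" for i j
  proof -
    have "e (idx j) \<bullet> (A *v e (idx j)) \<le> m (idx i) * (e (idx j) \<bullet> e (idx j))"
    proof (rule ray[OF lt])
      fix k assume "k < idx i"
      then show "e k \<bullet> e (idx j) = 0" using on[of k "idx j"] lt[of i] lt[of j] le by simp
    qed
    then show ?thesis using eig[OF lt, of j] on[OF lt lt, of j j] by simp
  qed
  ultimately show ?thesis using that orth by blast
qed

lemma finite_index:
  obtains idx :: "'n::finite \<Rightarrow> nat" where "bij_betw idx UNIV {..<CARD('n)}"
  using ex_bij_betw_finite_nat[of "UNIV :: 'n set"] by (auto simp: atLeast0LessThan)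

text \<open>
  Positive definite elements of \<open>symmat\<close>, as plain matrices: most computations leave the symmetric
  matrices at intermediate steps.
\<close>

definition posdef :: "real^'n^'n \<Rightarrow> bool" where
  "posdef A \<longleftrightarrow> transpose A = A \<and> (\<forall>x. x \<noteq> 0 \<longrightarrow> 0 < x \<bullet> (A *v x))"

lemma transpose_mat_of [simp]: "transpose (mat_of A) = mat_of A"
  using mat_of[of A] by simp

lemma pos_def_iff: "A \<in> pos_def \<longleftrightarrow> posdef (mat_of A)"
  by (simp add: pos_def_def posdef_def)

lemma posdef_symmat:
  assumes "posdef A"
  shows "symmat_of A \<in> pos_def" "mat_of (symmat_of A) = A"
proof -
  show "mat_of (symmat_of A) = A" using assms by (simp add: posdef_def symmat_of_inverse)
  then show "symmat_of A \<in> pos_def" using assms by (simp add: pos_def_iff)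
qed

lemma posdef_invertible: "posdef A \<Longrightarrow> invertible A"
  using pos_def_invertible[OF posdef_symmat(1)] posdef_symmat(2) by metis

lemma posdef_inverse: "posdef A \<Longrightarrow> posdef (matrix_inv A)"
  using symmat_inv_pos_def[OF posdef_symmat(1)] posdef_symmat(2)[of A] by (metis pos_def_iff)

lemma matrix_inv_eqI:
  fixes A B :: "real^'n^'n"
  assumes "A ** B = mat 1"
  shows "matrix_inv A = B" "invertible A"
proof -
  have BA: "B ** A = mat 1" using assms matrix_left_right_inverse by blast
  show inv: "invertible A" using assms BA by (auto simp: invertible_def)
  have "matrix_inv A = matrix_inv A ** (A ** B)" by (simp add: assms)
  also have "\<dots> = B" by (simp add: matrix_mul_assoc matrix_inv_right_left(2)[OF inv])
  finally show "matrix_inv A = B" .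
qed

lemma posdef_coercive:
  assumes "posdef A"
  obtains c where "0 < c" "\<And>x. c * (norm x)\<^sup>2 \<le> x \<bullet> (A *v x)"
  using pos_def_coercive[OF posdef_symmat(1)[OF assms]] posdef_symmat(2)[OF assms] by metis

lemma matrix_inv_inv:
  fixes A :: "real^'n^'n"
  assumes "invertible A"
  shows "matrix_inv (matrix_inv A) = A"
  by (rule matrix_inv_eqI(1)) (rule matrix_inv_right_left(2)[OF assms])

lemma posdef_congruence:
  fixes A R :: "real^'n^'n"
  assumes "posdef A" "invertible R"
  shows "posdef (R ** A ** transpose R)"
  unfolding posdef_def
proof (intro conjI allI impI)
  show "transpose (R ** A ** transpose R) = R ** A ** transpose R"
    using assms(1) by (simp add: matrix_transpose_mul posdef_def matrix_mul_assoc)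
  fix x :: "real^'n" assume "x \<noteq> 0"
  have "transpose (matrix_inv R) ** transpose R = mat 1"
    unfolding matrix_transpose_mul[symmetric] matrix_inv_right_left(1)[OF assms(2)] by (rule transpose_mat)
  then have "transpose (matrix_inv R) *v (transpose R *v x) = x"
    by (simp only: matrix_vector_mul_assoc matrix_vector_mul_lid)
  then have "transpose R *v x \<noteq> 0" using \<open>x \<noteq> 0\<close> by (metis matrix_vector_mult_0_right)
  then have "0 < (transpose R *v x) \<bullet> (A *v (transpose R *v x))"
    using assms(1) unfolding posdef_def by blast
  also have "\<dots> = x \<bullet> ((R ** A ** transpose R) *v x)"
    using inner_transpose_mult[of x "transpose R" "A *v (transpose R *v x)"]
    by (simp only: transpose_transpose matrix_vector_mul_assoc matrix_mul_assoc)
  finally show "0 < x \<bullet> ((R ** A ** transpose R) *v x)" .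
qed

lemma congruence_cancel:
  fixes A B S :: "real^'n^'n"
  assumes "invertible S" "S ** B ** transpose S = S ** A ** transpose S"
  shows "B = A"
proof -
  have "matrix_inv S ** (S ** X ** transpose S) ** transpose (matrix_inv S) = X" for X
  proof -
    have "matrix_inv S ** (S ** X ** transpose S) ** transpose (matrix_inv S) =
        (matrix_inv S ** S) ** X ** transpose (matrix_inv S ** S)"
      by (simp only: matrix_transpose_mul matrix_mul_assoc)
    then show ?thesis by (simp add: matrix_inv_right_left[OF assms(1)] transpose_mat)
  qed
  then show ?thesis using assms(2) by metis
qed

text \<open>
  Take \<open>R0\<close> with \<open>A = R0 R0'\<close> from the spectral decomposition of \<open>A\<close>, then diagonalize \<open>B\<close> in the coordinates
  of \<open>R0\<close> by an orthogonal matrix, which does not affect \<open>A\<close>.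
\<close>

theorem simultaneous_diagonalization:
  fixes A B :: "real^'n^'n"
  assumes A: "posdef A" and B: "transpose B = B"
  obtains R S :: "real^'n^'n" and k where "R ** S = mat 1" "S ** R = mat 1"
    "A = R ** transpose R" "B = R ** diagonal k ** transpose R"
proof -
  obtain idx :: "'n \<Rightarrow> nat" where idx: "bij_betw idx UNIV {..<CARD('n)}" by (rule finite_index)
  obtain U :: "real^'n^'n" and m where U: "orthogonal_matrix U" and AU: "A = transpose U ** diagonal m ** U"
    using spectral_decomposition[OF _ idx, of A] A unfolding posdef_def by blast
  have UU: "transpose U ** U = mat 1" "U ** transpose U = mat 1"
    using U by (auto simp: orthogonal_matrix_def)
  have m: "0 < m i" for i
  proof -
    have ne: "transpose U *v axis i 1 \<noteq> 0"
      by (metis UU(2) axis_eq_0_iff matrix_vector_mul_assoc matrix_vector_mul_lid matrix_vector_mult_0_right zero_neq_one)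
    have "(transpose U *v axis i 1) \<bullet> (A *v (transpose U *v axis i 1)) =
        axis i 1 \<bullet> ((U ** A ** transpose U) *v axis i 1)"
      using inner_transpose_mult[of "axis i 1" "transpose U" "A *v (transpose U *v axis i 1)"]
      by (simp only: transpose_transpose matrix_vector_mul_assoc matrix_mul_assoc)
    also have "U ** A ** transpose U = (U ** transpose U) ** diagonal m ** (U ** transpose U)"
      unfolding AU by (simp only: matrix_mul_assoc)
    also have "axis i 1 \<bullet> (((U ** transpose U) ** diagonal m ** (U ** transpose U)) *v axis i 1) = m i"
      by (simp add: UU diagonal_mult_vec inner_axis' )
    finally show ?thesis using A ne unfolding posdef_def by metis
  qed
  define D where "D = diagonal (\<lambda>i. sqrt (m i))"
  define E where "E = diagonal (\<lambda>i. 1 / sqrt (m i))"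
  have DD: "D ** D = diagonal m" using m less_imp_le[OF m] by (simp add: D_def diagonal_mult)
  have DE: "D ** E = mat 1" "E ** D = mat 1"
    using m by (simp_all add: D_def E_def diagonal_mult less_imp_neq[OF m, symmetric] diagonal_one)
  define R0 where "R0 = transpose U ** D"
  define S0 where "S0 = E ** U"
  have RS0: "R0 ** S0 = mat 1"
  proof -
    have "R0 ** S0 = transpose U ** (D ** E) ** U" by (simp only: R0_def S0_def matrix_mul_assoc)
    then show ?thesis by (simp add: DE UU)
  qed
  have AR: "A = R0 ** transpose R0"
  proof -
    have "R0 ** transpose R0 = transpose U ** (D ** D) ** U"
      by (simp add: R0_def matrix_transpose_mul matrix_mul_assoc D_def)
    then show ?thesis by (simp add: DD AU)
  qed
  define B' where "B' = S0 ** B ** transpose S0"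
  have "transpose B' = B'" by (simp add: B'_def matrix_transpose_mul B matrix_mul_assoc)
  then obtain V :: "real^'n^'n" and k where V: "orthogonal_matrix V" and BV: "B' = transpose V ** diagonal k ** V"
    using spectral_decomposition[OF _ idx, of B'] by blast
  have VV: "transpose V ** V = mat 1" "V ** transpose V = mat 1"
    using V by (auto simp: orthogonal_matrix_def)
  define R where "R = R0 ** transpose V"
  define S where "S = V ** S0"
  have RS: "R ** S = mat 1"
  proof -
    have "R ** S = R0 ** (transpose V ** V) ** S0" by (simp only: R_def S_def matrix_mul_assoc)
    then show ?thesis by (simp add: VV RS0)
  qed
  then have SR: "S ** R = mat 1" using matrix_left_right_inverse by blast
  have "R ** transpose R = R0 ** (transpose V ** V) ** transpose R0"
    by (simp only: R_def matrix_transpose_mul transpose_transpose matrix_mul_assoc)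
  then have 1: "A = R ** transpose R" by (simp add: VV AR)
  have "R ** diagonal k ** transpose R = R0 ** (transpose V ** diagonal k ** V) ** transpose R0"
    by (simp only: R_def matrix_transpose_mul transpose_transpose matrix_mul_assoc)
  also have "\<dots> = (R0 ** S0) ** B ** transpose (R0 ** S0)"
    unfolding BV[symmetric] B'_def by (simp only: matrix_transpose_mul matrix_mul_assoc)
  finally have 2: "B = R ** diagonal k ** transpose R" by (simp add: RS0 transpose_mat)
  show ?thesis using that RS SR 1 2 by blast
qed

text \<open>
  In the coordinates \<open>x = S y\<close> the quadratic forms of the two inverses are sums of squares with weights
  \<open>1\<close> and \<open>1 / k i\<close>, and the ratio of the determinants is the product of the \<open>k i\<close>. This is all that the
  comparison of the objective at \<open>A\<close> and at \<open>B\<close> requires.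
\<close>

lemma simultaneous_coordinates:
  fixes A B :: "real^'n^'n"
  assumes A: "posdef A" and B: "posdef B"
  obtains S :: "real^'n^'n" and k where "invertible S" "\<forall>i. 0 < k i" "S ** A ** transpose S = mat 1" "S ** B ** transpose S = diagonal k"
    "\<forall>y. y \<bullet> (matrix_inv A *v y) = (\<Sum>i\<in>UNIV. ((S *v y) $ i)\<^sup>2)"
    "\<forall>y. y \<bullet> (matrix_inv B *v y) = (\<Sum>i\<in>UNIV. ((S *v y) $ i)\<^sup>2 / k i)"
    "0 < det A" "det B = det A * prod k UNIV"
proof -
  obtain R S :: "real^'n^'n" and k where RS: "R ** S = mat 1" "S ** R = mat 1"
    and AR: "A = R ** transpose R" and BR: "B = R ** diagonal k ** transpose R"
    using simultaneous_diagonalization[OF A, of B] B unfolding posdef_def by blast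
  have inv: "invertible S" using RS by (auto simp: invertible_def)
  have trS: "transpose R ** transpose S = mat 1" "transpose S ** transpose R = mat 1"
    using RS by (simp_all add: matrix_transpose_mul[symmetric] transpose_mat)
  have SA: "S ** A ** transpose S = mat 1"
  proof -
    have "S ** A ** transpose S = (S ** R) ** (transpose R ** transpose S)"
      unfolding AR by (simp only: matrix_mul_assoc)
    then show ?thesis by (simp add: RS trS)
  qed
  have SB: "S ** B ** transpose S = diagonal k"
  proof -
    have "S ** B ** transpose S = (S ** R) ** diagonal k ** (transpose R ** transpose S)"
      unfolding BR by (simp only: matrix_mul_assoc)
    then show ?thesis by (simp add: RS trS)
  qed
  have k: "0 < k i" for i
  proof -
    have "posdef (diagonal k)" using posdef_congruence[OF B inv] SB by simp
    then have "0 < axis i 1 \<bullet> (diagonal k *v axis i 1)"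
      unfolding posdef_def by (metis axis_eq_0_iff zero_neq_one)
    then show ?thesis by (simp add: diagonal_mult_vec inner_axis')
  qed
  have "A ** (transpose S ** S) = R ** (transpose R ** transpose S) ** S"
    unfolding AR by (simp only: matrix_mul_assoc)
  then have "A ** (transpose S ** S) = mat 1" by (simp add: RS trS)
  then have iA: "matrix_inv A = transpose S ** S" by (rule matrix_inv_eqI)
  have "B ** (transpose S ** diagonal (\<lambda>i. 1 / k i) ** S) =
      R ** (diagonal k ** ((transpose R ** transpose S) ** diagonal (\<lambda>i. 1 / k i))) ** S"
    unfolding BR by (simp only: matrix_mul_assoc)
  also have "\<dots> = mat 1"
    using less_imp_neq[OF k, symmetric] by (simp add: trS RS diagonal_mult diagonal_one)
  finally have iB: "matrix_inv B = transpose S ** diagonal (\<lambda>i. 1 / k i) ** S" by (rule matrix_inv_eqI)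
  have qA: "y \<bullet> (matrix_inv A *v y) = (\<Sum>i\<in>UNIV. ((S *v y) $ i)\<^sup>2)" for y
  proof -
    have "y \<bullet> (matrix_inv A *v y) = (S *v y) \<bullet> (S *v y)"
      unfolding iA using inner_transpose_mult[of y S "S *v y"] by (simp only: matrix_vector_mul_assoc)
    then show ?thesis by (simp add: inner_vec_def power2_eq_square)
  qed
  have qB: "y \<bullet> (matrix_inv B *v y) = (\<Sum>i\<in>UNIV. ((S *v y) $ i)\<^sup>2 / k i)" for y
  proof -
    have "y \<bullet> (matrix_inv B *v y) = (S *v y) \<bullet> (diagonal (\<lambda>i. 1 / k i) *v (S *v y))"
      unfolding iB using inner_transpose_mult[of y S "diagonal (\<lambda>i. 1 / k i) *v (S *v y)"]
      by (simp only: matrix_vector_mul_assoc matrix_mul_assoc)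
    then show ?thesis by (simp add: diagonal_mult_vec inner_vec_def power2_eq_square)
  qed
  have dR: "det A = det R * det R" by (simp add: AR det_mul)
  have "det R * det S = 1" using RS det_mul[of R S] by simp
  then have "det R \<noteq> 0" by auto
  then have dA: "0 < det A" unfolding dR by (simp add: mult_neg_neg zero_less_mult_iff linorder_neq_iff disj_commute)
  have dB: "det B = det A * prod k UNIV"
    by (simp add: BR AR det_mul det_diagonal_prod)
  show ?thesis using that[OF inv _ SA SB _ _ dA dB] k qA qB by simp
qed

section \<open>The scatter objective of a law\<close>

definition quad :: "real^'n^'n \<Rightarrow> real^'n \<Rightarrow> real" where
  "quad C y = y \<bullet> (C *v y)"

lemma quad_sum: "quad C y = (\<Sum>i\<in>UNIV. \<Sum>j\<in>UNIV. C $ i $ j * (y $ i * y $ j))"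
  by (simp add: quad_def inner_vec_def matrix_vector_mult_def sum_distrib_left mult_ac)

lemma continuous_quad [continuous_intros]: "continuous_on S (quad C)"
  unfolding quad_def[abs_def]
  by (intro continuous_intros linear_continuous_on_compose matrix_vector_mul_linear)

lemma quad_upper:
  obtains K where "0 < K" "\<And>y. quad C y \<le> K * (norm y)\<^sup>2"
proof -
  obtain K where K: "0 < K" "\<And>x. norm (C *v x) \<le> norm x * K"
    using bounded_linear.pos_bounded[OF matrix_vector_mul_bounded_linear[of C]] by blast
  have "quad C y \<le> K * (norm y)\<^sup>2" for y
  proof -
    have "quad C y \<le> norm y * norm (C *v y)" unfolding quad_def by (rule norm_cauchy_schwarz)
    also have "\<dots> \<le> norm y * (norm y * K)" by (intro mult_left_mono K) auto
    finally show ?thesis by (simp add: power2_eq_square mult_ac)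
  qed
  with K(1) that show ?thesis by blast
qed

lemma quad_nonneg: "posdef C \<Longrightarrow> 0 \<le> quad C y"
  by (cases "y = 0") (auto simp: posdef_def quad_def less_imp_le)

locale law_scatter =
  fixes Q :: "(real^'n) measure" and \<nu> :: real
  assumes law: "law Q" and nu: "0 < \<nu>"
begin

sublocale prob_space Q
  using law by (simp add: law_def)

lemma sets_Q [simp, measurable_cong]: "sets Q = sets borel"
  using law by (simp add: law_def)

lemma space_Q [simp]: "space Q = UNIV"
  using law by (rule law_space)

lemma continuous_measurable:
  "continuous_on UNIV f \<Longrightarrow> f \<in> borel_measurable Q" for f :: "real^'n \<Rightarrow> real"
  using borel_measurable_continuous_onI[of f] measurable_cong_sets[OF sets_Q refl] by blast

lemma continuous_bounded_integrable:
  fixes f :: "real^'n \<Rightarrow> real"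
  assumes "continuous_on UNIV f" "\<And>y. \<bar>f y\<bar> \<le> B"
  shows "integrable Q f"
  by (rule integrable_const_bound[of _ B]) (use assms continuous_measurable in auto)

lemma linear_combination_integral:
  fixes f :: "'k::finite \<Rightarrow> real^'n \<Rightarrow> real"
  assumes "\<And>i. integrable Q (f i)"
  shows "integrable Q (\<lambda>y. \<Sum>i\<in>UNIV. c i * f i y)"
    and "(\<integral>y. (\<Sum>i\<in>UNIV. c i * f i y) \<partial>Q) = (\<Sum>i\<in>UNIV. c i * (\<integral>y. f i y \<partial>Q))"
proof -
  show "integrable Q (\<lambda>y. \<Sum>i\<in>UNIV. c i * f i y)"
    by (intro Bochner_Integration.integrable_sum integrable_mult_right assms)
  have "(\<integral>y. (\<Sum>i\<in>UNIV. c i * f i y) \<partial>Q) = (\<Sum>i\<in>UNIV. \<integral>y. c i * f i y \<partial>Q)"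
    by (intro Bochner_Integration.integral_sum integrable_mult_right assms)
  then show "(\<integral>y. (\<Sum>i\<in>UNIV. c i * f i y) \<partial>Q) = (\<Sum>i\<in>UNIV. c i * (\<integral>y. f i y \<partial>Q))"
    by (simp only: integral_mult_right_zero)
qed

definition dof :: real where "dof = \<nu> + real CARD('n)"

lemma dof_pos: "0 < dof" using nu by (simp add: dof_def add_pos_nonneg)

lemma denominator_pos: "posdef C \<Longrightarrow> 0 < \<nu> + quad C y"
  using quad_nonneg[of C y] nu by linarith

lemma weight_integrable:
  assumes "posdef C"
  shows "integrable Q (\<lambda>y. (y $ i * y $ j) / (\<nu> + quad C y))"
proof -
  obtain c where c: "0 < c" "\<And>x. c * (norm x)\<^sup>2 \<le> quad C x"
    using posdef_coercive[OF assms] unfolding quad_def by blast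
  show ?thesis
  proof (rule continuous_bounded_integrable)
    show "continuous_on UNIV (\<lambda>y. (y $ i * y $ j) / (\<nu> + quad C y))"
      using denominator_pos[OF assms] by (intro continuous_intros) (metis less_irrefl)
    fix y :: "real^'n"
    have "\<bar>y $ i * y $ j\<bar> \<le> (norm y)\<^sup>2"
      unfolding abs_mult power2_eq_square by (intro mult_mono component_le_norm_cart) auto
    moreover have "(norm y)\<^sup>2 \<le> (\<nu> + quad C y) / c" using c nu by (simp add: pos_le_divide_eq mult.commute add_increasing)
    ultimately have "\<bar>y $ i * y $ j\<bar> \<le> 1 / c * (\<nu> + quad C y)" by simp
    then show "\<bar>(y $ i * y $ j) / (\<nu> + quad C y)\<bar> \<le> 1 / c"
      using denominator_pos[OF assms, of y] by (simp add: pos_divide_le_eq)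
  qed
qed

text \<open>
  The map \<open>A \<mapsto> weighted_cov (matrix_inv A)\<close> is one step of the iteratively reweighted covariance
  algorithm. Its fixed points are the zeros of the estimating function.
\<close>

definition weighted_cov :: "real^'n^'n \<Rightarrow> real^'n^'n" where
  "weighted_cov C = (\<chi> i j. dof * (\<integral>y. (y $ i * y $ j) / (\<nu> + quad C y) \<partial>Q))"

definition critical :: "real^'n^'n \<Rightarrow> bool" where
  "critical A \<longleftrightarrow> posdef A \<and> weighted_cov (matrix_inv A) = A"

lemma weighted_cov_congruence:
  assumes "posdef C"
  shows "integrable Q (\<lambda>y. ((S *v y) $ i * (S *v y) $ j) / (\<nu> + quad C y))"
    and "(S ** weighted_cov C ** transpose S) $ i $ j =
      dof * (\<integral>y. ((S *v y) $ i * (S *v y) $ j) / (\<nu> + quad C y) \<partial>Q)"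
proof -
  have expand: "((S *v y) $ i * (S *v y) $ j) / (\<nu> + quad C y) =
      (\<Sum>k\<in>UNIV. \<Sum>l\<in>UNIV. S $ i $ k * S $ j $ l * ((y $ k * y $ l) / (\<nu> + quad C y)))" for y
    by (simp add: matrix_vector_mult_def sum_product sum_divide_distrib mult_ac)
  show "integrable Q (\<lambda>y. ((S *v y) $ i * (S *v y) $ j) / (\<nu> + quad C y))"
    unfolding expand by (intro Bochner_Integration.integrable_sum integrable_mult_right weight_integrable assms)
  have total: "(\<integral>y. ((S *v y) $ i * (S *v y) $ j) / (\<nu> + quad C y) \<partial>Q) =
      (\<Sum>k\<in>UNIV. \<Sum>l\<in>UNIV. S $ i $ k * S $ j $ l * (\<integral>y. (y $ k * y $ l) / (\<nu> + quad C y) \<partial>Q))"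
  proof -
    have "(\<integral>y. ((S *v y) $ i * (S *v y) $ j) / (\<nu> + quad C y) \<partial>Q) = (\<Sum>k\<in>UNIV.
        \<integral>y. (\<Sum>l\<in>UNIV. S $ i $ k * S $ j $ l * ((y $ k * y $ l) / (\<nu> + quad C y))) \<partial>Q)"
      unfolding expand by (rule Bochner_Integration.integral_sum)
        (intro Bochner_Integration.integrable_sum integrable_mult_right weight_integrable assms)
    also have "\<dots> = (\<Sum>k\<in>UNIV. \<Sum>l\<in>UNIV.
        \<integral>y. S $ i $ k * S $ j $ l * ((y $ k * y $ l) / (\<nu> + quad C y)) \<partial>Q)"
      by (intro sum.cong refl Bochner_Integration.integral_sum integrable_mult_right weight_integrable assms)
    finally show ?thesis by (simp only: integral_mult_right_zero)
  qed
  have "(S ** weighted_cov C ** transpose S) $ i $ j =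
      (\<Sum>l\<in>UNIV. \<Sum>k\<in>UNIV. S $ i $ k * S $ j $ l * (dof * (\<integral>y. (y $ k * y $ l) / (\<nu> + quad C y) \<partial>Q)))"
    by (simp add: matrix_matrix_mult_def transpose_def weighted_cov_def sum_distrib_left sum_distrib_right mult_ac)
  also have "\<dots> = (\<Sum>k\<in>UNIV. \<Sum>l\<in>UNIV. S $ i $ k * S $ j $ l * (dof * (\<integral>y. (y $ k * y $ l) / (\<nu> + quad C y) \<partial>Q)))"
    by (rule sum.swap)
  also have "\<dots> = dof * (\<Sum>k\<in>UNIV. \<Sum>l\<in>UNIV. S $ i $ k * S $ j $ l * (\<integral>y. (y $ k * y $ l) / (\<nu> + quad C y) \<partial>Q))"
    by (simp add: sum_distrib_left mult.left_commute)
  finally show "(S ** weighted_cov C ** transpose S) $ i $ j =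
      dof * (\<integral>y. ((S *v y) $ i * (S *v y) $ j) / (\<nu> + quad C y) \<partial>Q)"
    by (simp only: total)
qed

definition log_ratio :: "real^'n^'n \<Rightarrow> real^'n \<Rightarrow> real" where
  "log_ratio C y = ln (\<nu> + quad C y) - ln (\<nu> + y \<bullet> y)"

text \<open>
  Subtracting \<open>ln (\<nu> + y \<bullet> y)\<close> makes the integrand bounded, without any moment condition on \<open>Q\<close>.
\<close>

lemma log_ratio_bounds:
  assumes C: "posdef C" and c: "0 < c" "\<And>x. c * (norm x)\<^sup>2 \<le> quad C x"
  shows "ln (min 1 c) \<le> log_ratio C y"
proof -
  have pos: "0 < \<nu> + y \<bullet> y" using nu by (simp add: add_pos_nonneg)
  have "min 1 c * (\<nu> + y \<bullet> y) \<le> \<nu> + quad C y"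
  proof -
    have "min 1 c * \<nu> \<le> 1 * \<nu>" using nu by (intro mult_right_mono) auto
    moreover have "min 1 c * (y \<bullet> y) \<le> c * (y \<bullet> y)" by (intro mult_right_mono) auto
    ultimately show ?thesis using c(2)[of y] by (simp add: distrib_left power2_norm_eq_inner)
  qed
  then have "ln (min 1 c * (\<nu> + y \<bullet> y)) \<le> ln (\<nu> + quad C y)"
    using c(1) pos denominator_pos[OF C] by (intro ln_mono) auto
  moreover have "ln (min 1 c * (\<nu> + y \<bullet> y)) = ln (min 1 c) + ln (\<nu> + y \<bullet> y)"
    using c(1) pos by (intro ln_mult_pos) auto
  ultimately show ?thesis by (simp add: log_ratio_def)
qed

lemma log_ratio_integrable:
  assumes C: "posdef C"
  shows "integrable Q (log_ratio C)"
proof -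
  obtain c where c: "0 < c" "\<And>x. c * (norm x)\<^sup>2 \<le> quad C x"
    using posdef_coercive[OF assms] unfolding quad_def by blast
  obtain K where K: "0 < K" "\<And>y. quad C y \<le> K * (norm y)\<^sup>2" using quad_upper by blast
  have pos: "0 < \<nu> + y \<bullet> y" for y :: "real^'n" using nu by (simp add: add_pos_nonneg)
  have up: "log_ratio C y \<le> ln (max 1 K)" for y
  proof -
    have "\<nu> + quad C y \<le> max 1 K * (\<nu> + y \<bullet> y)"
    proof -
      have "1 * \<nu> \<le> max 1 K * \<nu>" using nu by (intro mult_right_mono) auto
      moreover have "K * (y \<bullet> y) \<le> max 1 K * (y \<bullet> y)" by (intro mult_right_mono) auto
      ultimately show ?thesis using K(2)[of y] by (simp add: distrib_left power2_norm_eq_inner)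
    qed
    then have "ln (\<nu> + quad C y) \<le> ln (max 1 K * (\<nu> + y \<bullet> y))"
      using pos denominator_pos[OF C] by (intro ln_mono) auto
    moreover have "ln (max 1 K * (\<nu> + y \<bullet> y)) = ln (max 1 K) + ln (\<nu> + y \<bullet> y)"
      using pos[of y] by (intro ln_mult_pos) auto
    ultimately show ?thesis by (simp add: log_ratio_def)
  qed
  show ?thesis
  proof (rule continuous_bounded_integrable)
    show "continuous_on UNIV (log_ratio C)"
      unfolding log_ratio_def[abs_def]
      by (intro continuous_intros) (use pos denominator_pos[OF C] in \<open>auto simp: less_imp_neq[symmetric]\<close>)
    show "\<bar>log_ratio C y\<bar> \<le> max (ln (max 1 K)) (- ln (min 1 c))" for y
      using up[of y] log_ratio_bounds[OF C c, of y] by linarith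
  qed
qed

definition objective :: "real^'n^'n \<Rightarrow> real" where
  "objective A = ln (det A) / 2 + dof / 2 * (\<integral>y. log_ratio (matrix_inv A) y \<partial>Q)"

lemma t_rho_diff:
  assumes "0 \<le> s" "0 \<le> t"
  shows "t_rho \<nu> d s - t_rho \<nu> d t = (\<nu> + real d) / 2 * (ln (\<nu> + s) - ln (\<nu> + t))"
proof -
  have "ln ((\<nu> + s) / \<nu>) = ln (\<nu> + s) - ln \<nu>" "ln ((\<nu> + t) / \<nu>) = ln (\<nu> + t) - ln \<nu>"
    using assms nu by (simp_all add: ln_div)
  then show ?thesis unfolding t_rho_def by (simp add: right_diff_distrib)
qed

lemma scatter_objective_eq:
  assumes "A \<in> pos_def"
  shows "scatter_objective \<nu> Q A = objective (mat_of A)"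
proof -
  have C: "posdef (matrix_inv (mat_of A))" using assms by (simp add: pos_def_iff posdef_inverse)
  show ?thesis
    using quad_nonneg[OF C] unfolding scatter_objective_def objective_def dof_def
    by (simp add: t_rho_diff quad_def[symmetric] log_ratio_def[abs_def])
qed

lemma objective_diff:
  assumes A: "posdef A" and B: "posdef B" and k: "\<And>i::'n. 0 < k i" and det: "0 < det A" "det B = det A * prod k UNIV"
  shows "objective B - objective A = (\<Sum>i\<in>UNIV. ln (k i)) / 2 +
    dof / 2 * (\<integral>y. (ln (\<nu> + quad (matrix_inv B) y) - ln (\<nu> + quad (matrix_inv A) y)) \<partial>Q)"
    and "integrable Q (\<lambda>y. ln (\<nu> + quad (matrix_inv B) y) - ln (\<nu> + quad (matrix_inv A) y))"
proof -
  note i = log_ratio_integrable[OF posdef_inverse[OF A]] log_ratio_integrable[OF posdef_inverse[OF B]]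
  have eq: "ln (\<nu> + quad (matrix_inv B) y) - ln (\<nu> + quad (matrix_inv A) y) =
      log_ratio (matrix_inv B) y - log_ratio (matrix_inv A) y" for y
    by (simp add: log_ratio_def)
  show "integrable Q (\<lambda>y. ln (\<nu> + quad (matrix_inv B) y) - ln (\<nu> + quad (matrix_inv A) y))"
    unfolding eq using i by simp
  have "ln (prod k UNIV) = (\<Sum>i\<in>UNIV. ln (k i))" by (intro ln_prod) (simp_all add: less_imp_neq[OF k, symmetric])
  then have "ln (det B) = ln (det A) + (\<Sum>i\<in>UNIV. ln (k i))"
    using det k by (simp add: ln_mult_pos prod_pos)
  then show "objective B - objective A = (\<Sum>i\<in>UNIV. ln (k i)) / 2 +
    dof / 2 * (\<integral>y. (ln (\<nu> + quad (matrix_inv B) y) - ln (\<nu> + quad (matrix_inv A) y)) \<partial>Q)"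
    unfolding eq using i by (simp add: objective_def algebra_simps add_divide_distrib)
qed

text \<open>
  The numbers \<open>\<nu> / (\<nu> + p)\<close> and \<open>(x i)\<^sup>2 / (\<nu> + p)\<close> are weights with sum one, and \<open>(\<nu> + r) / (\<nu> + p)\<close> is
  the mean of \<open>1\<close> and the \<open>1 / k i\<close> under them, so this is Jensen's inequality for the logarithm. Since
  \<open>1\<close> occurs with the positive weight \<open>\<nu> / (\<nu> + p)\<close>, equality forces every \<open>k i\<close> of positive weight to
  be \<open>1\<close>. This is where \<open>\<nu> > 0\<close> yields uniqueness.
\<close>

lemma log_sum_jensen:
  fixes x k :: "'n \<Rightarrow> real"
  assumes k: "\<And>i. 0 < k i"
  defines "p \<equiv> \<Sum>i\<in>UNIV. (x i)\<^sup>2" and "r \<equiv> \<Sum>i\<in>UNIV. (x i)\<^sup>2 / k i"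
  shows "0 \<le> ln (\<nu> + r) - ln (\<nu> + p) + (\<Sum>i\<in>UNIV. ln (k i) * ((x i)\<^sup>2 / (\<nu> + p)))"
    and "ln (\<nu> + r) - ln (\<nu> + p) + (\<Sum>i\<in>UNIV. ln (k i) * ((x i)\<^sup>2 / (\<nu> + p))) = 0 \<Longrightarrow> k i \<noteq> 1 \<Longrightarrow> x i = 0"
proof -
  have p: "0 < \<nu> + p" using nu by (simp add: p_def add_pos_nonneg sum_nonneg)
  have r: "0 < \<nu> + r" using nu k by (simp add: r_def add_pos_nonneg sum_nonneg less_imp_le)
  define z where "z = (\<nu> + r) / (\<nu> + p)"
  have z: "0 < z" using p r by (simp add: z_def)
  (* the defect of the tangent to the logarithm at the mean \<open>z\<close>; its mean is the Jensen gap *)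
  define g where "g u = u / z - 1 - ln (u / z)" for u
  have g0: "0 \<le> g u" if "0 < u" for u
    using ln_le_minus_one[of "u / z"] that z by (simp add: g_def)
  have g1: "u = z" if "0 < u" "g u = 0" for u
  proof -
    have "ln (u / z) = u / z - 1" using that by (simp add: g_def)
    then have "u / z = 1" using that z by (intro ln_eq_minus_one) auto
    then show ?thesis using z by simp
  qed
  have gk: "(x i)\<^sup>2 * g (1 / k i) = (x i)\<^sup>2 / k i * (1 / z) - (x i)\<^sup>2 + ((x i)\<^sup>2 * ln z + (x i)\<^sup>2 * ln (k i))" for i
    using k[of i] z by (simp add: g_def ln_div ln_mult_pos algebra_simps)
  have g1z: "\<nu> * g 1 = \<nu> / z - \<nu> + \<nu> * ln z" using z by (simp add: g_def ln_div algebra_simps)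
  have "\<nu> * g 1 + (\<Sum>i\<in>UNIV. (x i)\<^sup>2 * g (1 / k i)) =
      (\<nu> + r) / z - (\<nu> + p) + (\<nu> + p) * ln z + (\<Sum>i\<in>UNIV. (x i)\<^sup>2 * ln (k i))"
    unfolding g1z gk sum.distrib sum_subtractf sum_distrib_right[symmetric] p_def[symmetric] r_def[symmetric]
    by (simp add: algebra_simps add_divide_distrib)
  also have "(\<nu> + r) / z = \<nu> + p" using p r by (simp add: z_def)
  finally have "\<nu> * g 1 + (\<Sum>i\<in>UNIV. (x i)\<^sup>2 * g (1 / k i)) =
      (\<nu> + p) * ln z + (\<Sum>i\<in>UNIV. (x i)\<^sup>2 * ln (k i))" by simp
  also have "\<dots> = (\<nu> + p) * (ln z + (\<Sum>i\<in>UNIV. ln (k i) * ((x i)\<^sup>2 / (\<nu> + p))))"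
    using p by (simp add: distrib_left sum_distrib_left mult_ac)
  also have "ln z = ln (\<nu> + r) - ln (\<nu> + p)" using p r by (simp add: z_def ln_div)
  finally have eq: "(\<nu> + p) * (ln (\<nu> + r) - ln (\<nu> + p) + (\<Sum>i\<in>UNIV. ln (k i) * ((x i)\<^sup>2 / (\<nu> + p)))) =
      \<nu> * g 1 + (\<Sum>i\<in>UNIV. (x i)\<^sup>2 * g (1 / k i))" (is "_ * ?T = ?S") ..
  have t: "0 \<le> (x i)\<^sup>2 * g (1 / k i)" for i using g0[of "1 / k i"] k[of i] by simp
  then have s: "0 \<le> (\<Sum>i\<in>UNIV. (x i)\<^sup>2 * g (1 / k i))" by (simp add: sum_nonneg)
  have v: "0 \<le> \<nu> * g 1" using g0[of 1] nu by simp
  have "0 \<le> (\<nu> + p) * ?T" unfolding eq using s v by simp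
  then show "0 \<le> ?T" using p by (simp add: zero_le_mult_iff)
  assume "?T = 0" and ki: "k i \<noteq> 1"
  then have "?S = 0" using eq by simp
  then have "\<nu> * g 1 = 0" "(\<Sum>i\<in>UNIV. (x i)\<^sup>2 * g (1 / k i)) = 0" using s v by linarith+
  then have z1: "z = 1" and "(x i)\<^sup>2 * g (1 / k i) = 0"
    using g1[of 1] nu t by (auto simp: sum_nonneg_eq_0_iff)
  then have "x i = 0 \<or> 1 / k i = z" using g1[of "1 / k i"] k[of i] by auto
  then show "x i = 0" using z1 ki k[of i] by auto
qed

lemma coordinate_subspace:
  fixes S :: "real^'n^'n"
  assumes "invertible S"
  shows "subspace {y. (S *v y) $ i = 0}" "dim {y. (S *v y) $ i = 0} < CARD('n)"
proof -
  let ?H = "{y. (S *v y) $ i = 0}"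
  show sub: "subspace ?H"
    by (auto simp: subspace_def matrix_vector_right_distrib matrix_vector_mult_scaleR)
  have "S *v (matrix_inv S *v axis i 1) = axis i 1"
    by (simp add: matrix_vector_mul_assoc matrix_inv_right_left[OF assms])
  then have "matrix_inv S *v axis i 1 \<notin> ?H" by (simp add: axis_def)
  then have "?H \<noteq> UNIV" by blast
  then have "dim ?H \<noteq> DIM(real^'n)" using sub by (metis dim_eq_full span_eq_iff)
  moreover have "dim ?H \<le> DIM(real^'n)" by (rule dim_subset_UNIV)
  ultimately show "dim ?H < CARD('n)" by simp
qed

end

locale spread_law_scatter = law_scatter Q \<nu> for Q :: "(real^'n) measure" and \<nu> +
  assumes spread: "Q \<in> law_U dof"
begin

lemma subspace_measure:
  assumes "subspace H" "dim H < CARD('n)"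
  shows "measure Q H < 1 - (real CARD('n) - real (dim H)) / dof" "measure Q H < 1"
proof -
  show *: "measure Q H < 1 - (real CARD('n) - real (dim H)) / dof"
    using spread assms by (simp add: law_U_def)
  have "0 \<le> (real CARD('n) - real (dim H)) / dof" using assms(2) dof_pos by simp
  then show "measure Q H < 1" using * by linarith
qed

lemma coordinate_not_ae_zero:
  fixes S :: "real^'n^'n"
  assumes "invertible S" "AE y in Q. (S *v y) $ i = 0"
  shows False
proof -
  let ?H = "{y. (S *v y) $ i = 0}"
  have "closed ?H" using coordinate_subspace(1)[OF assms(1)] by (rule closed_subspace)
  then have "?H \<in> sets Q" by simp
  then have "measure Q ?H = 1"
    using assms(2) prob_eq_1[of ?H] by simp
  then show False using subspace_measure(2)[OF coordinate_subspace[OF assms(1), of i]] by simp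
qed

text \<open>
  At a critical \<open>A\<close> the means of the weights \<open>((S y) $ i)\<^sup>2 / (\<nu> + y \<bullet> (A\<^sup>-\<^sup>1 *v y))\<close> are all \<open>1 / dof\<close>. Integrating
  \<open>log_sum_jensen\<close> therefore turns its last sum into the sum of the \<open>ln (k i)\<close>, which is the difference of
  the log-determinants. In the case of equality a coordinate with \<open>k i \<noteq> 1\<close> vanishes almost surely, which
  spread laws exclude.
\<close>

theorem critical_minimal:
  assumes "critical A" and B: "posdef B"
  shows "objective A \<le> objective B" and "objective B = objective A \<Longrightarrow> B = A"
proof -
  have A: "posdef A" and crit: "weighted_cov (matrix_inv A) = A"
    using assms(1) by (auto simp: critical_def)
  obtain S :: "real^'n^'n" and k where S: "invertible S" and k': "\<forall>i. 0 < k i" and SA: "S ** A ** transpose S = mat 1"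
    and SB: "S ** B ** transpose S = diagonal k"
    and qA': "\<forall>y. y \<bullet> (matrix_inv A *v y) = (\<Sum>i\<in>UNIV. ((S *v y) $ i)\<^sup>2)"
    and qB': "\<forall>y. y \<bullet> (matrix_inv B *v y) = (\<Sum>i\<in>UNIV. ((S *v y) $ i)\<^sup>2 / k i)"
    and det: "0 < det A" "det B = det A * prod k UNIV"
    by (rule simultaneous_coordinates[OF A B])
  note k = spec[OF k'] and qA = spec[OF qA'] and qB = spec[OF qB']
  let ?C = "matrix_inv A" and ?D = "matrix_inv B"
  have C: "posdef ?C" by (rule posdef_inverse[OF A])
  note w = weighted_cov_congruence[OF C, of S]
  have unit: "dof * (\<integral>y. ((S *v y) $ i)\<^sup>2 / (\<nu> + quad ?C y) \<partial>Q) = 1" for i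
    using w(2)[of i i] SA by (simp add: crit mat_def power2_eq_square)
  define T where "T y = ln (\<nu> + quad ?D y) - ln (\<nu> + quad ?C y) +
      (\<Sum>i\<in>UNIV. ln (k i) * (((S *v y) $ i)\<^sup>2 / (\<nu> + quad ?C y)))" for y
  have T0: "0 \<le> T y" for y
    unfolding T_def quad_def qA qB by (rule log_sum_jensen(1)[OF k])
  have T1: "(S *v y) $ i = 0" if "T y = 0" "k i \<noteq> 1" for y i
    using that unfolding T_def quad_def qA qB by (rule log_sum_jensen(2)[OF k])
  have wi: "integrable Q (\<lambda>y. ((S *v y) $ i)\<^sup>2 / (\<nu> + quad ?C y))" for i
    using w(1)[of i i] by (simp add: power2_eq_square)
  note d = objective_diff[OF A B k det]
  have Ti: "integrable Q T"
    unfolding T_def[abs_def] by (rule Bochner_Integration.integrable_add[OF d(2) linear_combination_integral(1)[OF wi]])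
  have "dof * (\<integral>y. T y \<partial>Q) = dof * (\<integral>y. (ln (\<nu> + quad ?D y) - ln (\<nu> + quad ?C y)) \<partial>Q) +
      dof * (\<Sum>i\<in>UNIV. ln (k i) * (\<integral>y. ((S *v y) $ i)\<^sup>2 / (\<nu> + quad ?C y) \<partial>Q))"
    unfolding T_def Bochner_Integration.integral_add[OF d(2) linear_combination_integral(1)[OF wi]]
      linear_combination_integral(2)[OF wi] by (rule distrib_left)
  also have "dof * (\<Sum>i\<in>UNIV. ln (k i) * (\<integral>y. ((S *v y) $ i)\<^sup>2 / (\<nu> + quad ?C y) \<partial>Q)) = (\<Sum>i\<in>UNIV. ln (k i))"
    unfolding sum_distrib_left
  proof (rule sum.cong[OF refl])
    fix i
    show "dof * (ln (k i) * (\<integral>y. ((S *v y) $ i)\<^sup>2 / (\<nu> + quad ?C y) \<partial>Q)) = ln (k i)"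
      using unit[of i] by (simp only: mult.left_commute[of dof] mult_1_right)
  qed
  finally have diff: "objective B - objective A = dof / 2 * (\<integral>y. T y \<partial>Q)"
    unfolding d(1) by (simp add: field_simps)
  have "0 \<le> (\<integral>y. T y \<partial>Q)" using T0 by (intro integral_nonneg_AE) auto
  then show "objective A \<le> objective B" using diff dof_pos by (simp add: algebra_simps) (smt (verit) mult_nonneg_nonneg)
  assume "objective B = objective A"
  then have "(\<integral>y. T y \<partial>Q) = 0" using diff dof_pos by simp
  then have "AE y in Q. T y = 0" using integral_nonneg_eq_0_iff_AE[OF Ti] T0 by simp
  then have "k i = 1" for i
  proof (rule contrapos_pp)
    assume "k i \<noteq> 1"
    show "\<not> (AE y in Q. T y = 0)"
    proof
      assume "AE y in Q. T y = 0"
      then have "AE y in Q. (S *v y) $ i = 0" using T1[OF _ \<open>k i \<noteq> 1\<close>] by auto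
      then show False by (rule coordinate_not_ae_zero[OF S])
    qed
  qed
  then have "S ** B ** transpose S = S ** A ** transpose S"
    using SA SB diagonal_one by (metis ext)
  then show "B = A" by (rule congruence_cancel[OF S])
qed

lemma posdef_weighted_cov:
  assumes C: "posdef C"
  shows "posdef (weighted_cov C)"
  unfolding posdef_def
proof (intro conjI allI impI)
  show "transpose (weighted_cov C) = weighted_cov C"
    by (simp add: weighted_cov_def transpose_def vec_eq_iff mult.commute)
  fix v :: "real^'n" assume v: "v \<noteq> 0"
  let ?f = "\<lambda>y. (v \<bullet> y)\<^sup>2 / (\<nu> + quad C y)"
  define S :: "real^'n^'n" where "S = (\<chi> i. v)"
  have Sy: "(S *v y) $ i = v \<bullet> y" for y i by (simp add: S_def matrix_vector_mul_component)
  have row: "transpose S *v axis i 1 = v" for i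
    by (simp add: vec_eq_iff matrix_vector_mult_basis column_def S_def transpose_def)
  fix i0 :: 'n
  have "v \<bullet> (weighted_cov C *v v) = (S ** weighted_cov C ** transpose S) $ i0 $ i0"
    by (simp add: matrix_matrix_mult_def transpose_def S_def inner_vec_def matrix_vector_mult_def
      sum_distrib_left sum_distrib_right mult_ac weighted_cov_def)
  also have "\<dots> = dof * (\<integral>y. ?f y \<partial>Q)"
    using weighted_cov_congruence(2)[OF C, of S i0 i0] by (simp add: Sy power2_eq_square)
  finally have eq: "v \<bullet> (weighted_cov C *v v) = dof * (\<integral>y. ?f y \<partial>Q)" .
  have fi: "integrable Q ?f"
    using weighted_cov_congruence(1)[OF C, of S i0 i0] by (simp add: Sy power2_eq_square)
  have f0: "0 \<le> ?f y" for y using denominator_pos[OF C, of y] by simp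
  have "(\<integral>y. ?f y \<partial>Q) \<noteq> 0"
  proof
    assume "(\<integral>y. ?f y \<partial>Q) = 0"
    then have "AE y in Q. ?f y = 0" using integral_nonneg_eq_0_iff_AE[OF fi] f0 by simp
    then have ae: "AE y in Q. y \<in> {y. v \<bullet> y = 0}"
    proof eventually_elim
      case (elim y)
      then show ?case using denominator_pos[OF C, of y] by auto
    qed
    have sub: "subspace {y. v \<bullet> y = 0}" by (rule subspace_hyperplane)
    have "closed {y. v \<bullet> y = 0}" by (rule closed_hyperplane)
    then have "{y. v \<bullet> y = 0} \<in> sets Q" by simp
    then have "measure Q {y. v \<bullet> y = 0} = 1" using ae prob_eq_1 by simp
    moreover have "dim {y. v \<bullet> y = 0} < CARD('n)" using dim_hyperplane[OF v] by simp
    ultimately show False using subspace_measure(2)[OF sub] by simp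
  qed
  moreover have "0 \<le> (\<integral>y. ?f y \<partial>Q)" using f0 by (intro integral_nonneg_AE) auto
  ultimately show "0 < v \<bullet> (weighted_cov C *v v)" unfolding eq using dof_pos by simp
qed

text \<open>
  Compare a minimum \<open>A\<close> with \<open>B = weighted_cov (matrix_inv A)\<close>. Bounding the logarithm by its tangent at one gives
  \<open>2 * (objective B - objective A) \<le> (\<Sum>i. ln (k i) + 1 - k i)\<close>, which is negative unless all \<open>k i\<close>
  are \<open>1\<close>. So \<open>B = A\<close>, and no differentiation of the objective is involved.
\<close>

theorem minimal_critical:
  assumes A: "posdef A" and min: "\<And>B. posdef B \<Longrightarrow> objective A \<le> objective B"
  shows "critical A"
proof -
  let ?C = "matrix_inv A"
  have C: "posdef ?C" by (rule posdef_inverse[OF A])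
  define B where "B = weighted_cov ?C"
  have B: "posdef B" unfolding B_def by (rule posdef_weighted_cov[OF C])
  let ?D = "matrix_inv B"
  have D: "posdef ?D" by (rule posdef_inverse[OF B])
  obtain S :: "real^'n^'n" and k where S: "invertible S" and k': "\<forall>i. 0 < k i" and SA: "S ** A ** transpose S = mat 1"
    and SB: "S ** B ** transpose S = diagonal k"
    and qA': "\<forall>y. y \<bullet> (matrix_inv A *v y) = (\<Sum>i\<in>UNIV. ((S *v y) $ i)\<^sup>2)"
    and qB': "\<forall>y. y \<bullet> (matrix_inv B *v y) = (\<Sum>i\<in>UNIV. ((S *v y) $ i)\<^sup>2 / k i)"
    and det: "0 < det A" "det B = det A * prod k UNIV"
    by (rule simultaneous_coordinates[OF A B])
  note k = spec[OF k'] and qA = spec[OF qA'] and qB = spec[OF qB']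
  note w = weighted_cov_congruence[OF C, of S]
  have wi: "integrable Q (\<lambda>y. ((S *v y) $ i)\<^sup>2 / (\<nu> + quad ?C y))" for i
    using w(1)[of i i] by (simp add: power2_eq_square)
  have wk: "dof * (\<integral>y. ((S *v y) $ i)\<^sup>2 / (\<nu> + quad ?C y) \<partial>Q) = k i" for i
    using w(2)[of i i] SB by (simp add: B_def[symmetric] power2_eq_square)
  note d = objective_diff[OF A B k det]
  let ?g = "\<lambda>y. \<Sum>i\<in>UNIV. (1 / k i - 1) * (((S *v y) $ i)\<^sup>2 / (\<nu> + quad ?C y))"
  have gi: "integrable Q ?g" by (rule linear_combination_integral(1)[OF wi])
  have le: "ln (\<nu> + quad ?D y) - ln (\<nu> + quad ?C y) \<le> ?g y" for y
  proof -
    have p: "0 < \<nu> + quad ?C y" and r: "0 < \<nu> + quad ?D y" using denominator_pos C D by auto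
    have "ln (\<nu> + quad ?D y) - ln (\<nu> + quad ?C y) = ln ((\<nu> + quad ?D y) / (\<nu> + quad ?C y))"
      using p r by (simp add: ln_div)
    also have "\<dots> \<le> (\<nu> + quad ?D y) / (\<nu> + quad ?C y) - 1"
      using p r by (intro ln_le_minus_one) auto
    also have "\<dots> = (quad ?D y - quad ?C y) / (\<nu> + quad ?C y)" using p by (simp add: field_simps)
    also have "quad ?D y - quad ?C y = (\<Sum>i\<in>UNIV. (1 / k i - 1) * ((S *v y) $ i)\<^sup>2)"
      by (simp add: quad_def qA qB sum_subtractf[symmetric] algebra_simps)
    finally show ?thesis by (simp add: sum_divide_distrib)
  qed
  have "dof * (\<integral>y. (ln (\<nu> + quad ?D y) - ln (\<nu> + quad ?C y)) \<partial>Q) \<le> dof * (\<integral>y. ?g y \<partial>Q)"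
    using d(2) gi le dof_pos by (intro mult_left_mono integral_mono) auto
  also have "dof * (\<integral>y. ?g y \<partial>Q) = (\<Sum>i\<in>UNIV. (1 / k i - 1) * (dof * (\<integral>y. ((S *v y) $ i)\<^sup>2 / (\<nu> + quad ?C y) \<partial>Q)))"
    unfolding linear_combination_integral(2)[OF wi] by (simp add: sum_distrib_left mult.left_commute)
  also have "\<dots> = (\<Sum>i\<in>UNIV. 1 - k i)"
    unfolding wk using less_imp_neq[OF k, symmetric] by (simp add: left_diff_distrib)
  finally have "2 * (objective B - objective A) \<le> (\<Sum>i\<in>UNIV. ln (k i) + 1 - k i)"
    unfolding d(1) by (simp add: sum.distrib sum_subtractf algebra_simps)
  moreover have "0 \<le> 2 * (objective B - objective A)" using min[OF B] by simp
  ultimately have "0 \<le> (\<Sum>i\<in>UNIV. ln (k i) + 1 - k i)" by (rule order_trans[rotated])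
  also have "\<dots> = - (\<Sum>i\<in>UNIV. k i - 1 - ln (k i))" unfolding sum_negf[symmetric] by (rule sum.cong) auto
  finally have "(\<Sum>i\<in>UNIV. k i - 1 - ln (k i)) \<le> 0" by simp
  moreover have h0: "0 \<le> k i - 1 - ln (k i)" for i using ln_le_minus_one[OF k, of i] by simp
  ultimately have "(\<Sum>i\<in>UNIV. k i - 1 - ln (k i)) = 0" by (simp add: sum_nonneg antisym)
  then have "k i - 1 - ln (k i) = 0" for i
    using h0 by (simp add: sum_nonneg_eq_0_iff)
  then have k1: "k i = 1" for i using ln_eq_minus_one[OF k, of i] by (simp add: algebra_simps)
  have "S ** B ** transpose S = S ** A ** transpose S"
    using SA SB diagonal_one k1 by (metis ext)
  then have "B = A" by (rule congruence_cancel[OF S])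
  then show ?thesis using A by (simp add: critical_def B_def)
qed

end

lemma spread_law_scatterI:
  assumes nu: "0 < \<nu>" and Q: "Q \<in> law_U (\<nu> + real CARD('n))"
  shows "spread_law_scatter (Q :: (real^'n::finite) measure) \<nu>"
proof -
  have "law Q" using Q by (simp add: law_U_def)
  then interpret law_scatter Q \<nu> using nu by unfold_locales
  show ?thesis using Q by unfold_locales (simp add: dof_def)
qed

section \<open>Existence of the scatter matrix\<close>

lemma continuous_on_det: "continuous_on S (det :: real^'n^'n \<Rightarrow> real)"
  unfolding det_def[abs_def] by (intro continuous_intros)

lemma compact_orthogonal_matrices: "compact {U :: real^'n^'n. orthogonal_matrix U}"
proof (rule compact_eq_bounded_closed[THEN iffD2], intro conjI)
  have eq: "{U :: real^'n^'n. orthogonal_matrix U} =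
      (\<Inter>i. \<Inter>j. {U. (\<Sum>k\<in>UNIV. U $ k $ i * U $ k $ j) = (mat 1 :: real^'n^'n) $ i $ j})"
    by (auto simp: orthogonal_matrix vec_eq_iff matrix_matrix_mult_def transpose_def)
  show "closed {U :: real^'n^'n. orthogonal_matrix U}"
    unfolding eq by (intro closed_INT ballI closed_Collect_eq continuous_intros)
  have "norm U \<le> (\<Sum>k\<in>(UNIV::'n set). \<Sum>i\<in>(UNIV::'n set). 1)" if "orthogonal_matrix U" for U :: "real^'n^'n"
  proof -
    have ent: "\<bar>U $ k $ i\<bar> \<le> 1" for k i
    proof -
      have "(U $ k $ i)\<^sup>2 \<le> (\<Sum>k\<in>UNIV. U $ k $ i * U $ k $ i)"
        using member_le_sum[of k UNIV "\<lambda>k. U $ k $ i * U $ k $ i"] by (simp add: power2_eq_square)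
      also have "\<dots> = 1" using that unfolding orthogonal_matrix
        by (simp add: vec_eq_iff matrix_matrix_mult_def transpose_def mat_def)
      finally show ?thesis by (simp add: abs_square_le_1)
    qed
    have "(\<Sum>k\<in>UNIV. \<Sum>i\<in>UNIV. \<bar>U $ k $ i\<bar>) \<le> (\<Sum>k\<in>(UNIV::'n set). \<Sum>i\<in>(UNIV::'n set). 1)" by (intro sum_mono ent)
    moreover have "norm U \<le> (\<Sum>k\<in>UNIV. \<Sum>i\<in>UNIV. \<bar>U $ k $ i\<bar>)"
      using norm_le_l1_cart[of "U $ _"] unfolding norm_vec_def
      by (intro order_trans[OF L2_set_le_sum] sum_mono) (auto intro: norm_le_l1_cart)
    ultimately show ?thesis by linarith
  qed
  then show "bounded {U :: real^'n^'n. orthogonal_matrix U}" by (auto intro!: boundedI)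
qed

text \<open>
  Summation by parts against the rank \<open>r + 1\<close>: it converts bounds for the mass near \<open>r\<close>-codimensional
  subspaces into a bound for the sum of the logarithms of the eigenvalues.
\<close>

lemma decreasing_index_sum:
  fixes m :: "nat \<Rightarrow> real"
  shows "(\<Sum>r<d. (m r - m (Suc r)) * real (Suc r)) = (\<Sum>r<d. m r) - real d * m d"
  by (induction d) (simp_all add: algebra_simps)

lemma sum_telescope_from:
  fixes m :: "nat \<Rightarrow> real"
  assumes "r0 \<le> d"
  shows "(\<Sum>r\<in>{r0..<d}. m r - m (Suc r)) = m r0 - m d"
  using assms by (induction d) (auto simp: le_Suc_eq)

lemma quad_norm_bound:
  fixes C :: "real^'n^'n"
  shows "\<bar>quad C y\<bar> \<le> real CARD('n) * real CARD('n) * norm C * (norm y)\<^sup>2"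
proof -
  have "\<bar>quad C y\<bar> \<le> (\<Sum>i\<in>UNIV. \<Sum>j\<in>UNIV. \<bar>C $ i $ j * (y $ i * y $ j)\<bar>)"
    unfolding quad_sum by (rule order_trans[OF sum_abs] sum_mono sum_abs)+
  also have "\<dots> \<le> (\<Sum>i\<in>(UNIV::'n set). \<Sum>j\<in>(UNIV::'n set). norm C * (norm y * norm y))"
  proof (intro sum_mono)
    fix i j
    have "\<bar>C $ i $ j\<bar> \<le> norm (C $ i)" by (rule component_le_norm_cart)
    also have "\<dots> \<le> norm C" by (rule Finite_Cartesian_Product.norm_nth_le)
    finally show "\<bar>C $ i $ j * (y $ i * y $ j)\<bar> \<le> norm C * (norm y * norm y)"
      unfolding abs_mult by (intro mult_mono component_le_norm_cart) auto
  qed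
  also have "\<dots> = real CARD('n) * real CARD('n) * norm C * (norm y)\<^sup>2" by (simp add: power2_eq_square)
  finally show ?thesis .
qed

context spread_law_scatter
begin

text \<open>
  A slab is a neighbourhood of the subspace of codimension \<open>r\<close> on which the first \<open>r\<close> coordinates in the frame
  \<open>U\<close> vanish. The mass condition on subspaces extends to slabs, with a margin \<open>\<delta>\<close> that is uniform in the frame.
\<close>

definition slab :: "('n \<Rightarrow> nat) \<Rightarrow> real^'n^'n \<Rightarrow> nat \<Rightarrow> real \<Rightarrow> (real^'n) set" where
  "slab idx U r \<delta> = {y. \<forall>i. idx i < r \<longrightarrow> \<bar>(U *v y) $ i\<bar> < \<delta>}"

lemma slab_sets [measurable]: "slab idx U r \<delta> \<in> sets Q"
proof -
  have eq: "slab idx U r \<delta> = (\<Inter>i\<in>{i. idx i < r}. {y. \<bar>(U *v y) $ i\<bar> < \<delta>})"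
    by (auto simp: slab_def)
  have "open (slab idx U r \<delta>)"
    unfolding eq by (intro open_INT ballI open_Collect_less continuous_intros) auto
  then show ?thesis by simp
qed

lemma kernel_measure:
  fixes U :: "real^'n^'n"
  assumes U: "orthogonal_matrix U" and idx: "bij_betw idx UNIV {..<CARD('n)}" and r: "0 < r" "r \<le> CARD('n)"
  shows "measure Q {y. \<forall>i. idx i < r \<longrightarrow> (U *v y) $ i = 0} < 1 - real r / dof"
proof -
  let ?H = "{y. \<forall>i. idx i < r \<longrightarrow> (U *v y) $ i = 0}"
  define I where "I = {i. idx i < r}"
  have inj: "inj_on idx I" using bij_betw_imp_inj_on[OF idx] by (rule inj_on_subset) simp
  have "idx ` I = {..<r}"
  proof -
    have "k \<in> idx ` I" if "k < r" for k
    proof -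
      have "k \<in> idx ` UNIV" using bij_betw_imp_surj_on[OF idx] that r by auto
      then obtain i where "k = idx i" by blast
      then show ?thesis using that by (auto simp: I_def)
    qed
    then show ?thesis by (auto simp: I_def)
  qed
  then have cardI: "card I = r" using card_image[OF inj] by simp
  have sub: "subspace ?H"
    by (auto simp: subspace_def matrix_vector_right_distrib matrix_vector_mult_scaleR)
  have UU: "U ** transpose U = mat 1" "transpose U ** U = mat 1" using U by (auto simp: orthogonal_matrix_def)
  have inv: "invertible U" using UU by (auto simp: invertible_def)
  have "inj ((*v) U)"
  proof (rule injI)
    fix x y assume "U *v x = U *v y"
    then have "transpose U *v (U *v x) = transpose U *v (U *v y)" by (rule arg_cong)
    then show "x = y" by (simp only: matrix_vector_mul_assoc UU matrix_vector_mul_lid)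
  qed
  then have "dim ((*v) U ` ?H) = dim ?H"
    by (intro dim_image_eq[of "(*v) U" ?H] matrix_vector_mul_linear) (auto intro: inj_on_subset)
  moreover have "(*v) U ` ?H \<subseteq> {x. \<forall>i\<in>I. x $ i = 0}" by (auto simp: I_def)
  moreover have "dim {x :: real^'n. \<forall>i\<in>I. x $ i = 0} = card (- I)"
    using dim_substandard_cart[where 'a = real and d = "- I"] by (simp add: Compl_iff Ball_def Bex_def dim_vec_eq)
  ultimately have "dim ?H \<le> card (- I)"
    using dim_subset[of "(*v) U ` ?H" "{x. \<forall>i\<in>I. x $ i = 0}"] by linarith
  then have dH: "dim ?H \<le> CARD('n) - r" by (simp add: Compl_eq_Diff_UNIV card_Diff_subset cardI)
  then have "dim ?H < CARD('n)" using r by linarith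
  from subspace_measure(1)[OF sub this]
  have "measure Q ?H < 1 - (real CARD('n) - real (dim ?H)) / dof" .
  also have "\<dots> \<le> 1 - real r / dof"
    using dH r dof_pos by (simp add: divide_right_mono)
  finally show ?thesis .
qed

text \<open>
  Otherwise there would be frames \<open>U n\<close> and slabs of width \<open>1 / (n + 1)\<close> of too large mass. By compactness of the
  orthogonal group the frames accumulate at some \<open>V\<close>, and the upper limit of the slabs lies in the subspace that
  belongs to \<open>V\<close>.
\<close>

lemma slab_measure_bound:
  assumes idx: "bij_betw idx UNIV {..<CARD('n)}" and r: "0 < r" "r \<le> CARD('n)"
  shows "\<exists>\<delta>>0. \<forall>U. orthogonal_matrix U \<longrightarrow> measure Q (slab idx U r \<delta>) \<le> 1 - real r / dof - \<delta>"
proof (rule ccontr)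
  assume "\<not> ?thesis"
  then have "\<forall>n. \<exists>U. orthogonal_matrix U \<and> measure Q (slab idx U r (1 / real (Suc n))) > 1 - real r / dof - 1 / real (Suc n)"
    by (metis not_le of_nat_0_less_iff zero_less_Suc zero_less_divide_1_iff)
  then obtain U where U: "\<And>n. orthogonal_matrix (U n)"
    and big: "\<And>n. measure Q (slab idx (U n) r (1 / real (Suc n))) > 1 - real r / dof - 1 / real (Suc n)"
    by metis
  obtain V s where V: "orthogonal_matrix V" and s: "strict_mono s" and lim: "(U \<circ> s) \<longlonglongrightarrow> V"
    using compact_orthogonal_matrices U unfolding compact_def by blast
  define E where "E n = slab idx (U (s n)) r (1 / real (Suc (s n)))" for n
  define D where "D N = (\<Union>n\<in>{N..}. E n)" for N
  have Es: "E n \<in> sets Q" for n unfolding E_def by (rule slab_sets)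
  have Ds: "range D \<subseteq> sets Q" using Es by (auto simp: D_def)
  have "decseq D" unfolding decseq_def D_def by fastforce
  then have "(\<lambda>N. measure Q (D N)) \<longlonglongrightarrow> measure Q (\<Inter>N. D N)"
    by (intro finite_Lim_measure_decseq Ds)
  moreover have "(\<lambda>N. 1 - real r / dof - 1 / real (Suc N)) \<longlonglongrightarrow> 1 - real r / dof - 0"
    by (intro tendsto_intros LIMSEQ_Suc lim_1_over_n)
  moreover have "1 - real r / dof - 1 / real (Suc N) \<le> measure Q (D N)" for N
  proof -
    have "N \<le> s N" using s by (rule strict_mono_imp_increasing)
    then have "1 / real (Suc (s N)) \<le> 1 / real (Suc N)" by (simp add: frac_le)
    then have "1 - real r / dof - 1 / real (Suc N) \<le> measure Q (E N)" using big[of "s N"] by (simp add: E_def)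
    also have "\<dots> \<le> measure Q (D N)" using Ds by (intro finite_measure_mono) (auto simp: D_def)
    finally show ?thesis .
  qed
  ultimately have "1 - real r / dof - 0 \<le> measure Q (\<Inter>N. D N)"
    by (intro LIMSEQ_le[of _ _ "\<lambda>N. measure Q (D N)"]) auto
  also have "\<dots> \<le> measure Q {y. \<forall>i. idx i < r \<longrightarrow> (V *v y) $ i = 0}"
  proof (rule finite_measure_mono)
    have eq: "{y. \<forall>i. idx i < r \<longrightarrow> (V *v y) $ i = 0} = (\<Inter>i\<in>{i. idx i < r}. {y. (V *v y) $ i = 0})" by auto
    have "closed {y. \<forall>i. idx i < r \<longrightarrow> (V *v y) $ i = 0}"
      unfolding eq by (intro closed_INT ballI closed_Collect_eq continuous_intros)
    then show "{y. \<forall>i. idx i < r \<longrightarrow> (V *v y) $ i = 0} \<in> sets Q" unfolding sets_Q by (rule borel_closed)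
    show "(\<Inter>N. D N) \<subseteq> {y. \<forall>i. idx i < r \<longrightarrow> (V *v y) $ i = 0}"
    proof (intro subsetI CollectI allI impI)
      fix y i assume y: "y \<in> (\<Inter>N. D N)" and i: "idx i < r"
      have comp: "(\<lambda>n. (U (s n) *v y) $ i) \<longlonglongrightarrow> (V *v y) $ i"
        unfolding matrix_vector_mul_component
        using tendsto_inner[OF tendsto_vec_nth[OF lim, of i] tendsto_const] by (simp add: o_def)
      show "(V *v y) $ i = 0"
      proof (rule ccontr)
        assume nz: "(V *v y) $ i \<noteq> 0"
        define e where "e = \<bar>(V *v y) $ i\<bar> / 2"
        have e: "e > 0" using nz by (simp add: e_def)
        obtain N1 where N1: "\<And>n. n \<ge> N1 \<Longrightarrow> \<bar>(U (s n) *v y) $ i - (V *v y) $ i\<bar> < e"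
          using LIMSEQ_D[OF comp e] by auto
        obtain N2 where N2: "1 / real (Suc N2) < e" using nat_approx_posE[OF e] by blast
        have "y \<in> D (max N1 N2)" using y by blast
        then obtain n where n: "n \<ge> max N1 N2" "y \<in> E n" by (auto simp: D_def)
        have "N2 \<le> s n" using strict_mono_imp_increasing[OF s, of n] n by linarith
        then have "1 / real (Suc (s n)) \<le> 1 / real (Suc N2)" by (simp add: frac_le)
        then have "\<bar>(U (s n) *v y) $ i\<bar> < e" using n(2) i N2 unfolding E_def slab_def by fastforce
        with N1[of n] n(1) show False by (simp add: e_def abs_if split: if_splits)
      qed
    qed
  qed
  also have "\<dots> < 1 - real r / dof" by (rule kernel_measure[OF V idx r])
  finally show False by simp
qed

lemma uniform_slab_bound:
  assumes idx: "bij_betw idx UNIV {..<CARD('n)}"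
  obtains \<delta> where "0 < \<delta>" "\<And>U r. orthogonal_matrix U \<Longrightarrow> 0 < r \<Longrightarrow> r \<le> CARD('n) \<Longrightarrow>
    measure Q (slab idx U r \<delta>) \<le> 1 - real r / dof - \<delta>"
proof -
  have "\<forall>r\<in>{1..CARD('n)}. \<exists>\<delta>>0. \<forall>U. orthogonal_matrix U \<longrightarrow> measure Q (slab idx U r \<delta>) \<le> 1 - real r / dof - \<delta>"
    using slab_measure_bound[OF idx] by simp
  then obtain d where d: "\<And>r. r \<in> {1..CARD('n)} \<Longrightarrow> d r > 0"
    "\<And>r U. r \<in> {1..CARD('n)} \<Longrightarrow> orthogonal_matrix U \<Longrightarrow> measure Q (slab idx U r (d r)) \<le> 1 - real r / dof - d r"
    by metis
  define \<delta> where "\<delta> = Min (d ` {1..CARD('n)})"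
  have fin: "finite (d ` {1..CARD('n)})" "d ` {1..CARD('n)} \<noteq> {}" by (simp_all add: Suc_le_eq)
  have "0 < \<delta>" unfolding \<delta>_def using d(1) by (subst Min_gr_iff[OF fin]) auto
  moreover have "measure Q (slab idx U r \<delta>) \<le> 1 - real r / dof - \<delta>"
    if "orthogonal_matrix U" "0 < r" "r \<le> CARD('n)" for U r
  proof -
    have r: "r \<in> {1..CARD('n)}" using that by simp
    then have le: "\<delta> \<le> d r" unfolding \<delta>_def using fin by (intro Min_le) auto
    have "measure Q (slab idx U r \<delta>) \<le> measure Q (slab idx U r (d r))"
      using le by (intro finite_measure_mono slab_sets) (auto simp: slab_def intro: less_le_trans)
    also have "\<dots> \<le> 1 - real r / dof - d r" by (rule d(2)[OF r that(1)])
    finally show ?thesis using le by linarith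
  qed
  ultimately show ?thesis using that by blast
qed

lemma tail_measure:
  assumes "0 < e"
  obtains R where "0 < R" "measure Q {y. R < norm y} \<le> e"
proof -
  define B where "B n = {y :: real^'n. real n < norm y}" for n
  have "open (B n)" for n unfolding B_def by (intro open_Collect_less continuous_intros)
  then have "range B \<subseteq> sets Q" by auto
  moreover have "decseq B" by (auto simp: decseq_def B_def)
  ultimately have "(\<lambda>n. measure Q (B n)) \<longlonglongrightarrow> measure Q (\<Inter>n. B n)" by (rule finite_Lim_measure_decseq)
  moreover have "(\<Inter>n. B n) = {}"
  proof -
    have "\<exists>n. y \<notin> B n" for y using real_arch_simple[of "norm y"] by (auto simp: B_def not_less)
    then show ?thesis by blast
  qed
  ultimately have "(\<lambda>n. measure Q (B n)) \<longlonglongrightarrow> 0" by simp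
  then have "\<forall>\<^sub>F n in sequentially. measure Q (B n) < e" using assms by (rule order_tendstoD)
  then have "\<forall>\<^sub>F n in sequentially. measure Q (B n) < e \<and> 0 < n"
    using eventually_gt_at_top[of 0] by (rule eventually_conj)
  then obtain n where "measure Q (B n) < e" "0 < n" by (auto simp: eventually_sequentially)
  then show ?thesis using that[of "real n"] by (simp add: B_def)
qed

text \<open>
  Let \<open>m\<close> be the eigenvalues of \<open>C = A\<^sup>-\<^sup>1\<close> in decreasing order and \<open>g r\<close> the positive part of the logarithm of
  the \<open>r\<close>-th one. For \<open>norm y \<le> R\<close>, the log ratio is at least \<open>g r - const\<close> where \<open>r\<close> is the first
  coordinate in which \<open>y\<close> is not small. By the bound on slabs the first large coordinate has index at most \<open>r\<close> with
  probability at least \<open>(r + 1) / dof + \<delta>\<close>; after multiplication by \<open>dof\<close>, summation by parts yields the sum of all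
  \<open>g r\<close>, which offsets the log-determinant, plus a multiple of \<open>g 0\<close>, which is left over. The smallest eigenvalue is
  controlled by the determinant itself: its negative logarithm \<open>n\<close> enters with coefficient one, and the far region
  \<open>norm y > R\<close>, whose mass is at most \<open>1 / (2 * dof)\<close>, uses up only half of it.
\<close>

theorem coercive:
  "\<exists>\<alpha>>0. \<exists>\<beta>. \<forall>A. posdef A \<longrightarrow> objective A \<le> M \<longrightarrow>
    (\<forall>y. \<alpha> * (norm y)\<^sup>2 \<le> quad (matrix_inv A) y \<and> quad (matrix_inv A) y \<le> \<beta> * (norm y)\<^sup>2)"
proof -
  obtain idx :: "'n \<Rightarrow> nat" where idx: "bij_betw idx UNIV {..<CARD('n)}" by (rule finite_index)
  define e where "e = inv_into UNIV idx"
  let ?d = "CARD('n)"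
  have e_idx [simp]: "e (idx i) = i" for i
    using bij_betw_imp_inj_on[OF idx] by (simp add: e_def)
  have idx_e [simp]: "idx (e r) = r" if "r < ?d" for r
    unfolding e_def using idx that by (intro f_inv_into_f) (auto simp: bij_betw_def)
  have lt: "idx i < ?d" for i using idx bij_betwE by fastforce
  obtain \<delta> where \<delta>: "0 < \<delta>" and slab: "\<And>U r. orthogonal_matrix U \<Longrightarrow> 0 < r \<Longrightarrow> r \<le> ?d \<Longrightarrow>
    measure Q (slab idx U r \<delta>) \<le> 1 - real r / dof - \<delta>" using uniform_slab_bound[OF idx] by blast
  obtain R where R: "0 < R" "measure Q {y. R < norm y} \<le> min (\<delta> / 2) (1 / (2 * dof))"
    using tail_measure[of "min (\<delta> / 2) (1 / (2 * dof))"] \<delta> dof_pos by auto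
  (* for \<open>norm y \<le> R\<close>, \<open>c0\<close> bounds the ratio of \<open>\<nu> + quad C y\<close> and \<open>\<nu> + y \<bullet> y\<close> from below,
     up to the eigenvalue of the first large coordinate *)
  define c0 where "c0 = min \<nu> (\<delta>\<^sup>2) / (\<nu> + R\<^sup>2)"
  have c0: "0 < c0" using nu \<delta> R by (simp add: c0_def add_pos_nonneg)
  define K where "K = dof * \<bar>ln c0\<bar>"
  define b where "b = (2 * M + K) / (dof * \<delta> / 2)"
  define a where "a = 2 * (2 * M + K)"
  have main: "exp (- a) * (norm y)\<^sup>2 \<le> quad (matrix_inv A) y \<and> quad (matrix_inv A) y \<le> exp b * (norm y)\<^sup>2"
    if A: "posdef A" and le: "objective A \<le> M" for A y
  proof -
    define C where "C = matrix_inv A"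
    have C: "posdef C" unfolding C_def by (rule posdef_inverse[OF A])
    obtain U :: "real^'n^'n" and m where U: "orthogonal_matrix U" and CU: "C = transpose U ** diagonal m ** U"
      and dec': "\<forall>i j. idx i \<le> idx j \<longrightarrow> m j \<le> m i"
      using spectral_decomposition[OF _ idx, of C] C unfolding posdef_def by blast
    note dec = dec'[rule_format]
    have UU: "U ** transpose U = mat 1" "transpose U ** U = mat 1" using U by (auto simp: orthogonal_matrix_def)
    have q: "quad C y = (\<Sum>i\<in>UNIV. m i * ((U *v y) $ i)\<^sup>2)" for y
    proof -
      have "quad C y = (U *v y) \<bullet> (diagonal m *v (U *v y))"
        unfolding quad_def CU using inner_transpose_mult[of y U "diagonal m *v (U *v y)"]
        by (simp only: matrix_vector_mul_assoc matrix_mul_assoc)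
      then show ?thesis by (simp add: diagonal_mult_vec inner_vec_def power2_eq_square mult_ac)
    qed
    have nU: "(norm y)\<^sup>2 = (\<Sum>i\<in>UNIV. ((U *v y) $ i)\<^sup>2)" for y
    proof -
      have "(norm y)\<^sup>2 = y \<bullet> y" by (rule power2_norm_eq_inner)
      also have "\<dots> = (U *v y) \<bullet> (U *v y)"
        using inner_transpose_mult[of y U "U *v y"] by (simp only: matrix_vector_mul_assoc UU matrix_vector_mul_lid)
      finally show ?thesis by (simp only: inner_vec_def power2_eq_square inner_real_def)
    qed
    have m: "0 < m i" for i
    proof -
      define x where "x = transpose U *v axis i 1"
      have Ux: "U *v x = axis i 1" by (simp add: x_def matrix_vector_mul_assoc UU del: transpose_matrix_vector)
      then have "x \<noteq> 0" by (metis axis_eq_0_iff matrix_vector_mult_0_right zero_neq_one)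
      then have "0 < quad C x" using C by (simp add: posdef_def quad_def)
      also have "quad C x = m i"
        unfolding q Ux by (subst sum_eq_single[of _ i]) (auto simp: axis_def)
      finally show ?thesis .
    qed
    define g where "g r = (if r < ?d then max 0 (ln (m (e r))) else 0)" for r
    have gdec: "g (Suc r) \<le> g r" for r
    proof (cases "Suc r < ?d")
      case True
      then have "m (e (Suc r)) \<le> m (e r)" by (intro dec) simp
      then have "ln (m (e (Suc r))) \<le> ln (m (e r))" using m by (intro ln_mono) auto
      then show ?thesis using True by (auto simp: g_def)
    qed (simp add: g_def)
    have g0: "0 \<le> g r" for r by (simp add: g_def)
    have gd: "g ?d = 0" by (simp add: g_def)
    define l where "l = e (?d - 1)"
    have ml: "m l \<le> m i" for i
      unfolding l_def by (rule dec) (use lt[of i] in simp)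
    define n where "n = max 0 (- ln (m l))"
    have detC: "det C = prod m UNIV"
    proof -
      have "det U * det U = 1"
        using det_mul[of U "transpose U"] UU by (simp add: det_transpose)
      then show ?thesis by (simp add: CU det_mul det_transpose det_diagonal_prod mult_ac)
    qed
    have "A ** C = mat 1" unfolding C_def by (rule matrix_inv_right_left[OF posdef_invertible[OF A]])
    then have "det A * det C = 1" using det_mul[of A C] by simp
    then have "ln (det A) = - ln (det C)"
      using m detC by (simp add: prod_pos ln_div eq_divide_eq mult.commute nonzero_eq_divide_eq
        less_imp_neq[symmetric]) (metis inverse_unique ln_inverse mult.commute)
    then have lnA: "ln (det A) = - (\<Sum>i\<in>UNIV. ln (m i))"
      unfolding detC by (simp add: ln_prod less_imp_neq[OF m, symmetric])
    have sum_ln: "n - (\<Sum>r<?d. g r) \<le> - (\<Sum>i\<in>UNIV. ln (m i))"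
    proof -
      have "(\<Sum>r<?d. g r) = (\<Sum>i\<in>UNIV. max 0 (ln (m i)))"
        by (rule sum.reindex_bij_betw[OF idx, symmetric, THEN trans]) (simp add: g_def lt)
      then have "(\<Sum>r<?d. g r) - (\<Sum>i\<in>UNIV. ln (m i)) = (\<Sum>i\<in>UNIV. max 0 (- ln (m i)))"
        by (simp add: sum_subtractf[symmetric]) (intro sum.cong, auto)
      moreover have "max 0 (- ln (m l)) \<le> (\<Sum>i\<in>UNIV. max 0 (- ln (m i)))"
        by (rule member_le_sum) auto
      ultimately show ?thesis unfolding n_def by linarith
    qed
    define q where "q = measure Q {y. R < norm y}"
    have q0: "0 \<le> q" "q \<le> \<delta> / 2" "q \<le> 1 / (2 * dof)" using R by (auto simp: q_def)
    let ?G = "\<lambda>r y. (g r - g (Suc r)) * indicator (- slab idx U (Suc r) \<delta> - {y. R < norm y}) y"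
    (* a simple function below the log ratio: the sum telescopes to \<open>g r\<close> if \<open>r\<close> is the first large coordinate *)
    define h where "h y = (\<Sum>r<?d. ?G r y) - \<bar>ln c0\<bar> - n * indicator {y. R < norm y} y" for y
    have sR: "{y :: real^'n. R < norm y} \<in> sets Q"
    proof -
      have "open {y :: real^'n. R < norm y}" by (intro open_Collect_less continuous_intros)
      then show ?thesis by simp
    qed
    have sC: "- slab idx U r \<delta> \<in> sets Q" for r
      using sets.compl_sets[OF slab_sets[of idx U r \<delta>]] by (simp add: Compl_eq_Diff_UNIV)
    have sS: "- slab idx U r \<delta> - {y. R < norm y} \<in> sets Q" for r
      by (rule sets.Diff[OF sC sR])
    have hle: "h y \<le> log_ratio C y" for y
    proof (cases "R < norm y")
      case True
      have "m l * (norm x)\<^sup>2 \<le> quad C x" for x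
        unfolding \<open>\<And>y. quad C y = _\<close> nU sum_distrib_left by (intro sum_mono mult_right_mono ml) auto
      from log_ratio_bounds[OF C m this, of y]
      have "ln (min 1 (m l)) \<le> log_ratio C y" .
      moreover have "ln (min 1 (m l)) = - n" using m[of l] by (auto simp: n_def min_def max_def)
      ultimately show ?thesis using True by (simp add: h_def)
    next
      case False
      then have yR: "(norm y)\<^sup>2 \<le> R\<^sup>2" by (intro power_mono) auto
      have pos: "0 < \<nu> + y \<bullet> y" using nu by (simp add: add_pos_nonneg)
      have lr: "ln (c0 * s) \<le> log_ratio C y" if s: "1 \<le> s" "min \<nu> (\<delta>\<^sup>2) * s \<le> \<nu> + quad C y" for s
      proof -
        have "c0 * s * (\<nu> + y \<bullet> y) \<le> c0 * s * (\<nu> + R\<^sup>2)"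
          using c0 s yR by (intro mult_left_mono) (auto simp: power2_norm_eq_inner)
        also have "\<dots> = min \<nu> (\<delta>\<^sup>2) * s" using nu R by (simp add: c0_def add_pos_nonneg less_imp_neq[symmetric])
        also have "\<dots> \<le> \<nu> + quad C y" by (rule s)
        finally have "ln (c0 * s * (\<nu> + y \<bullet> y)) \<le> ln (\<nu> + quad C y)"
          using c0 s pos denominator_pos[OF C] by (intro ln_mono) auto
        moreover have "ln (c0 * s * (\<nu> + y \<bullet> y)) = ln (c0 * s) + ln (\<nu> + y \<bullet> y)"
          using c0 s pos by (intro ln_mult_pos) auto
        ultimately show ?thesis by (simp add: log_ratio_def)
      qed
      have hy: "h y = (\<Sum>r<?d. (g r - g (Suc r)) * indicator (- slab idx U (Suc r) \<delta>) y) - \<bar>ln c0\<bar>"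
        using False by (simp add: h_def indicator_def)
      show ?thesis
      proof (cases "y \<in> slab idx U ?d \<delta>")
        case True
        then have "y \<in> slab idx U (Suc r) \<delta>" if "r < ?d" for r
          using that by (auto simp: slab_def)
        then have "h y = - \<bar>ln c0\<bar>" unfolding hy by simp
        also have "\<dots> \<le> ln (c0 * 1)" by simp
        also have "\<dots> \<le> log_ratio C y"
          by (rule lr) (use quad_nonneg[OF C, of y] in auto)
        finally show ?thesis .
      next
        case False
        define r0 where "r0 = (LEAST r. y \<notin> slab idx U (Suc r) \<delta>)"
        have ex: "y \<notin> slab idx U (Suc (?d - 1)) \<delta>" using False by simp
        have r0: "y \<notin> slab idx U (Suc r0) \<delta>" unfolding r0_def using ex by (rule LeastI)
        have r0d: "r0 < ?d"
        proof -
          have "r0 \<le> ?d - 1" unfolding r0_def using ex by (rule Least_le)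
          then show ?thesis by (metis Suc_pred' le_imp_less_Suc zero_less_card_finite)
        qed
        have small: "y \<in> slab idx U (Suc r) \<delta>" if "r < r0" for r
          using not_less_Least[of r "\<lambda>r. y \<notin> slab idx U (Suc r) \<delta>"] that by (simp add: r0_def)
        have "(\<Sum>r<?d. (g r - g (Suc r)) * indicator (- slab idx U (Suc r) \<delta>) y) =
            (\<Sum>r\<in>{r0..<?d}. (g r - g (Suc r)) * indicator (- slab idx U (Suc r) \<delta>) y)"
          by (rule sum.mono_neutral_right) (auto simp: small)
        also have "\<dots> \<le> (\<Sum>r\<in>{r0..<?d}. g r - g (Suc r))"
          by (intro sum_mono) (use gdec in \<open>auto simp: indicator_def\<close>)
        also have "\<dots> = g r0" using sum_telescope_from[of r0 ?d g] r0d gd by simp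
        finally have h1: "h y \<le> g r0 - \<bar>ln c0\<bar>" unfolding hy by simp
        obtain i where i: "idx i < Suc r0" "\<delta> \<le> \<bar>(U *v y) $ i\<bar>"
          using r0 by (auto simp: slab_def not_less)
        define s where "s = max 1 (m (e r0))"
        have "m (e r0) \<le> m i" using i r0d by (intro dec) simp
        have "\<delta>\<^sup>2 \<le> ((U *v y) $ i)\<^sup>2" using i(2) \<delta> by (metis abs_le_square_iff abs_of_pos)
        then have "m (e r0) * \<delta>\<^sup>2 \<le> m i * ((U *v y) $ i)\<^sup>2"
          using \<open>m (e r0) \<le> m i\<close> m[of i] by (intro mult_mono) (auto simp: less_imp_le)
        also have "\<dots> \<le> quad C y"
          unfolding \<open>\<And>y. quad C y = _\<close> by (rule member_le_sum) (auto simp: less_imp_le[OF m])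
        finally have mq: "m (e r0) * \<delta>\<^sup>2 \<le> quad C y" .
        have "ln (c0 * s) \<le> log_ratio C y"
        proof (rule lr)
          show "1 \<le> s" by (simp add: s_def)
          show "min \<nu> (\<delta>\<^sup>2) * s \<le> \<nu> + quad C y"
          proof (cases "m (e r0) \<le> 1")
            case True
            then show ?thesis using quad_nonneg[OF C, of y] by (simp add: s_def)
          next
            case False
            have "min \<nu> (\<delta>\<^sup>2) * m (e r0) \<le> \<delta>\<^sup>2 * m (e r0)" using m[of "e r0"] by (intro mult_right_mono) auto
            also have "\<delta>\<^sup>2 * m (e r0) \<le> \<nu> + quad C y" using mq nu by (simp add: mult.commute)
            finally show ?thesis using False by (simp add: s_def)
          qed
        qed
        moreover have "ln (c0 * s) = ln c0 + ln s" using c0 by (intro ln_mult_pos) (auto simp: s_def)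
        moreover have "ln s = g r0" using m[of "e r0"] r0d by (auto simp: s_def g_def max_def)
        ultimately show ?thesis using h1 by linarith
      qed
    qed
    have hi: "integrable Q h"
      unfolding h_def using sS sR
      by (intro Bochner_Integration.integrable_diff Bochner_Integration.integrable_sum integrable_mult_right
        integrable_real_indicator) (auto simp: emeasure_eq_measure less_top[symmetric])
    have "(\<integral>y. h y \<partial>Q) = (\<Sum>r<?d. (g r - g (Suc r)) * measure Q (- slab idx U (Suc r) \<delta> - {y. R < norm y})) - \<bar>ln c0\<bar> - n * q"
    proof -
      have ii: "integrable Q (\<lambda>y. indicator S y :: real)" if "S \<in> sets Q" for S
        using that by (intro integrable_real_indicator) (auto simp: emeasure_eq_measure less_top[symmetric])
      have sumi: "integrable Q (\<lambda>y. \<Sum>r<?d. ?G r y)"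
        by (intro Bochner_Integration.integrable_sum integrable_mult_right ii sS)
      have "(\<integral>y. h y \<partial>Q) = (\<integral>y. (\<Sum>r<?d. ?G r y) \<partial>Q) - (\<integral>y. \<bar>ln c0\<bar> \<partial>Q) - (\<integral>y. n * indicator {y. R < norm y} y \<partial>Q)"
        unfolding h_def using sumi ii[OF sR] by simp
      also have "(\<integral>y. (\<Sum>r<?d. ?G r y) \<partial>Q) = (\<Sum>r<?d. \<integral>y. ?G r y \<partial>Q)"
        by (intro Bochner_Integration.integral_sum integrable_mult_right ii sS)
      finally show ?thesis using sS sR by (simp add: prob_space[unfolded space_Q] q_def)
    qed
    moreover have "(\<Sum>r<?d. (g r - g (Suc r)) * (real (Suc r) / dof + \<delta> / 2)) \<le>
        (\<Sum>r<?d. (g r - g (Suc r)) * measure Q (- slab idx U (Suc r) \<delta> - {y. R < norm y}))"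
    proof (intro sum_mono mult_left_mono)
      fix r assume r: "r \<in> {..<?d}"
      let ?S = "slab idx U (Suc r) \<delta>"
      have "1 - measure Q ?S - q \<le> measure Q (- ?S - {y. R < norm y})"
      proof -
        have "measure Q (- ?S) = 1 - measure Q ?S"
          using prob_compl[OF slab_sets[of idx U "Suc r" \<delta>]] by (simp add: Compl_eq_Diff_UNIV)
        moreover have "measure Q (- ?S) \<le> measure Q ((- ?S - {y. R < norm y}) \<union> {y. R < norm y})"
          by (intro finite_measure_mono sets.Un sS sR) auto
        moreover have "\<dots> \<le> measure Q (- ?S - {y. R < norm y}) + q"
          unfolding q_def using sS sR by (intro measure_Un_le)
        ultimately show ?thesis by linarith
      qed
      moreover have "measure Q ?S \<le> 1 - real (Suc r) / dof - \<delta>" using r by (intro slab U) auto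
      ultimately show "real (Suc r) / dof + \<delta> / 2 \<le> measure Q (- ?S - {y. R < norm y})"
        using q0 by linarith
      show "0 \<le> g r - g (Suc r)" using gdec by simp
    qed
    moreover have "dof * (\<Sum>r<?d. (g r - g (Suc r)) * (real (Suc r) / dof + \<delta> / 2)) = (\<Sum>r<?d. g r) + dof * \<delta> / 2 * g 0"
    proof -
      have "dof * (\<Sum>r<?d. (g r - g (Suc r)) * (real (Suc r) / dof + \<delta> / 2)) =
          (\<Sum>r<?d. (g r - g (Suc r)) * real (Suc r)) + dof * \<delta> / 2 * (\<Sum>r<?d. g r - g (Suc r))"
        unfolding sum_distrib_left sum.distrib[symmetric]
      proof (rule sum.cong[OF refl])
        fix r
        have "dof * (x * (y / dof + z)) = x * y + dof * z * x" for x y z :: real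
          using dof_pos by (simp add: field_simps)
        from this[of "g r - g (Suc r)" "real (Suc r)" "\<delta> / 2"]
        show "dof * ((g r - g (Suc r)) * (real (Suc r) / dof + \<delta> / 2)) =
            (g r - g (Suc r)) * real (Suc r) + dof * \<delta> / 2 * (g r - g (Suc r))" by simp
      qed
      then show ?thesis
        using decreasing_index_sum[of g ?d] gd sum_telescope_from[of 0 ?d g] by (simp add: atLeast0LessThan)
    qed
    moreover have "(\<integral>y. h y \<partial>Q) \<le> (\<integral>y. log_ratio C y \<partial>Q)"
      by (rule integral_mono[OF hi log_ratio_integrable[OF C] hle])
    moreover have "2 * objective A = ln (det A) + dof * (\<integral>y. log_ratio C y \<partial>Q)"
      by (simp add: objective_def C_def)
    moreover have "dof * n * q \<le> n / 2"
    proof -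
      have "n * (dof * q) \<le> n * (1 / 2)"
        using q0 dof_pos by (intro mult_left_mono) (auto simp: n_def field_simps)
      then show ?thesis by (simp add: mult_ac)
    qed
    ultimately have bound: "n / 2 + dof * \<delta> / 2 * g 0 \<le> 2 * M + K"
    proof -
      assume int: "(\<integral>y. h y \<partial>Q) = (\<Sum>r<?d. (g r - g (Suc r)) * measure Q (- slab idx U (Suc r) \<delta> - {y. R < norm y})) - \<bar>ln c0\<bar> - n * q"
        and lo: "(\<Sum>r<?d. (g r - g (Suc r)) * (real (Suc r) / dof + \<delta> / 2)) \<le>
        (\<Sum>r<?d. (g r - g (Suc r)) * measure Q (- slab idx U (Suc r) \<delta> - {y. R < norm y}))"
        and eq: "dof * (\<Sum>r<?d. (g r - g (Suc r)) * (real (Suc r) / dof + \<delta> / 2)) = (\<Sum>r<?d. g r) + dof * \<delta> / 2 * g 0"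
        and up: "(\<integral>y. h y \<partial>Q) \<le> (\<integral>y. log_ratio C y \<partial>Q)"
        and ob: "2 * objective A = ln (det A) + dof * (\<integral>y. log_ratio C y \<partial>Q)"
        and nq: "dof * n * q \<le> n / 2"
      have "(\<Sum>r<?d. (g r - g (Suc r)) * (real (Suc r) / dof + \<delta> / 2)) - \<bar>ln c0\<bar> - n * q \<le> (\<integral>y. log_ratio C y \<partial>Q)"
        using int lo up by linarith
      then have "dof * ((\<Sum>r<?d. (g r - g (Suc r)) * (real (Suc r) / dof + \<delta> / 2)) - \<bar>ln c0\<bar> - n * q) \<le> dof * (\<integral>y. log_ratio C y \<partial>Q)"
        using dof_pos by (intro mult_left_mono) auto
      then have "(\<Sum>r<?d. g r) + dof * \<delta> / 2 * g 0 - K - dof * n * q \<le> dof * (\<integral>y. log_ratio C y \<partial>Q)"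
        unfolding right_diff_distrib eq K_def by (simp add: mult.assoc)
      then show ?thesis using ob nq lnA sum_ln le by linarith
    qed
    have gp: "0 \<le> dof * \<delta> / 2 * g 0" using dof_pos \<delta> g0 by simp
    have np: "0 \<le> n" by (simp add: n_def)
    have "dof * \<delta> / 2 * g 0 \<le> 2 * M + K" using bound np by linarith
    then have gb: "g 0 \<le> b" unfolding b_def using dof_pos \<delta> by (simp add: pos_le_divide_eq mult.commute)
    have "n / 2 + 0 \<le> n / 2 + dof * \<delta> / 2 * g 0" by (intro add_left_mono gp)
    then have "n / 2 \<le> 2 * M + K" using bound by (simp only: add_0_right order_trans)
    then have na: "n \<le> a" by (simp add: a_def)
    have hi_m: "m i \<le> exp b" for i
    proof -
      have "m i \<le> m (e 0)" by (rule dec) simp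
      have "ln (m (e 0)) \<le> g 0" by (simp add: g_def)
      then have "ln (m (e 0)) \<le> b" using gb by linarith
      then have "m (e 0) \<le> exp b" using m[of "e 0"] by (metis exp_le_cancel_iff exp_ln)
      then show ?thesis using \<open>m i \<le> m (e 0)\<close> by linarith
    qed
    have lo_m: "exp (- a) \<le> m i" for i
    proof -
      have "- ln (m l) \<le> a" using na by (simp add: n_def)
      then have "- a \<le> ln (m l)" by linarith
      then have "exp (- a) \<le> m l" using m[of l] by (metis exp_le_cancel_iff exp_ln)
      then show ?thesis using ml[of i] by linarith
    qed
    show ?thesis
      unfolding C_def[symmetric] \<open>\<And>y. quad C y = _\<close> nU sum_distrib_left
      by (intro conjI sum_mono mult_right_mono hi_m lo_m) auto
  qed
  show ?thesis
    by (rule exI[of _ "exp (- a)"], intro conjI exI[of _ "exp b"]) (use main in auto)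
qed

lemma compact_quad_bounds:
  "compact {C :: real^'n^'n. transpose C = C \<and> (\<forall>y. \<alpha> * (norm y)\<^sup>2 \<le> quad C y \<and> quad C y \<le> \<beta> * (norm y)\<^sup>2)}"
    (is "compact ?K")
proof (rule compact_eq_bounded_closed[THEN iffD2], intro conjI)
  have cq: "continuous_on UNIV (\<lambda>C :: real^'n^'n. quad C y)" for y
    unfolding quad_sum by (intro continuous_intros)
  have eq: "?K = (\<Inter>i. \<Inter>j. {C. C $ j $ i = C $ i $ j}) \<inter>
      (\<Inter>y. {C. \<alpha> * (norm y)\<^sup>2 \<le> quad C y} \<inter> {C. quad C y \<le> \<beta> * (norm y)\<^sup>2})"
    by (auto simp: vec_eq_iff transpose_def)
  show "closed ?K"
    unfolding eq by (intro closed_Int closed_INT ballI closed_Collect_eq closed_Collect_le continuous_intros cq)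
  define B where "B = 4 * (\<bar>\<alpha>\<bar> + \<bar>\<beta>\<bar>)"
  have "norm C \<le> (\<Sum>k\<in>(UNIV::'n set). \<Sum>i\<in>(UNIV::'n set). B)" if C: "C \<in> ?K" for C
  proof -
    have ent: "\<bar>C $ i $ j\<bar> \<le> B" for i j
    proof -
      have nb: "(norm (axis i 1 + s *\<^sub>R axis j 1 :: real^'n))\<^sup>2 \<le> 4" if "\<bar>s\<bar> = 1" for s :: real
      proof -
        have "norm (axis i 1 + s *\<^sub>R axis j 1 :: real^'n) \<le> 2"
          using norm_triangle_ineq[of "axis i 1" "s *\<^sub>R axis j 1 :: real^'n"] that by simp
        then have "(norm (axis i 1 + s *\<^sub>R axis j 1 :: real^'n))\<^sup>2 \<le> 2\<^sup>2" by (intro power_mono) auto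
        then show ?thesis by simp
      qed
      have qb: "\<bar>quad C (axis i 1 + s *\<^sub>R axis j 1)\<bar> \<le> B" if s: "\<bar>s\<bar> = 1" for s
      proof -
        let ?v = "axis i 1 + s *\<^sub>R axis j 1 :: real^'n"
        have "\<alpha> * (norm ?v)\<^sup>2 \<le> quad C ?v" "quad C ?v \<le> \<beta> * (norm ?v)\<^sup>2" using C by auto
        moreover have "\<bar>x * (norm ?v)\<^sup>2\<bar> \<le> \<bar>x\<bar> * 4" for x
          using nb[OF s] by (simp add: abs_mult mult_left_mono)
        ultimately show ?thesis unfolding B_def by (smt (verit))
      qed
      have sym: "C $ j $ i = C $ i $ j" using C by (auto simp: vec_eq_iff transpose_def)
      have ent: "axis k 1 \<bullet> (C *v axis l 1) = C $ k $ l" for k l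
        by (simp add: inner_axis' matrix_vector_mult_basis column_def)
      have "quad C (axis i 1 + 1 *\<^sub>R axis j 1) - quad C (axis i 1 + (- 1) *\<^sub>R axis j 1) = 4 * C $ i $ j"
        unfolding quad_def by (simp add: matrix_vector_right_distrib matrix_vector_mult_diff_distrib inner_add_left inner_add_right
           inner_diff_left inner_diff_right ent sym)
      then show ?thesis using qb[of 1] qb[of "- 1"] by linarith
    qed
    have "(\<Sum>k\<in>UNIV. \<Sum>i\<in>UNIV. \<bar>C $ k $ i\<bar>) \<le> (\<Sum>k\<in>(UNIV::'n set). \<Sum>i\<in>(UNIV::'n set). B)" by (intro sum_mono ent)
    moreover have "norm C \<le> (\<Sum>k\<in>UNIV. \<Sum>i\<in>UNIV. \<bar>C $ k $ i\<bar>)"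
      unfolding norm_vec_def[of C]
      by (intro order_trans[OF L2_set_le_sum] sum_mono) (auto intro: norm_le_l1_cart)
    ultimately show ?thesis by linarith
  qed
  then show "bounded ?K" by (intro boundedI)
qed

text \<open>
  On matrices bounded below by \<open>\<alpha>\<close> the integrand is Lipschitz in \<open>C\<close> uniformly in \<open>y\<close>.
\<close>

lemma continuous_log_ratio_integral:
  assumes "0 < \<alpha>"
  shows "continuous_on {C. posdef C \<and> (\<forall>y. \<alpha> * (norm y)\<^sup>2 \<le> quad C y)} (\<lambda>C. \<integral>y. log_ratio C y \<partial>Q)"
    (is "continuous_on ?K ?f")
proof -
  define B where "B = real CARD('n) * real CARD('n)"
  have B0: "0 \<le> B" by (simp add: B_def)
  have B: "\<bar>quad C y\<bar> \<le> B * norm C * (norm y)\<^sup>2" for C :: "real^'n^'n" and y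
    unfolding B_def by (rule quad_norm_bound)
  have one: "ln (\<nu> + quad C y) - ln (\<nu> + quad D y) \<le> B / \<alpha> * norm (C - D)"
    if "C \<in> ?K" "D \<in> ?K" for C D y
  proof -
    have p: "0 < \<nu> + quad C y" "0 < \<nu> + quad D y" using that denominator_pos by auto
    have "ln (\<nu> + quad C y) - ln (\<nu> + quad D y) \<le> (\<nu> + quad C y) / (\<nu> + quad D y) - 1"
      using p ln_le_minus_one[of "(\<nu> + quad C y) / (\<nu> + quad D y)"] by (simp add: ln_div)
    also have "\<dots> = quad (C - D) y / (\<nu> + quad D y)"
      using p by (simp add: quad_def matrix_vector_mult_diff_rdistrib inner_diff_right field_simps)
    also have "\<dots> \<le> B / \<alpha> * norm (C - D)"
    proof -
      have "quad (C - D) y \<le> B * norm (C - D) * (norm y)\<^sup>2" using B[of "C - D" y] by linarith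
      also have "\<dots> \<le> B * norm (C - D) * ((\<nu> + quad D y) / \<alpha>)"
      proof (rule mult_left_mono)
        have "\<alpha> * (norm y)\<^sup>2 \<le> \<nu> + quad D y" using that nu by (auto intro: add_increasing)
        then show "(norm y)\<^sup>2 \<le> (\<nu> + quad D y) / \<alpha>" using assms by (simp add: pos_le_divide_eq mult.commute)
      qed (use B0 in simp)
      finally show ?thesis using p by (simp add: pos_divide_le_eq mult_ac)
    qed
    finally show ?thesis .
  qed
  have "(B / \<alpha>)-lipschitz_on ?K ?f"
  proof (rule lipschitz_onI)
    fix C D assume C: "C \<in> ?K" and D: "D \<in> ?K"
    have iC: "integrable Q (log_ratio C)" and iD: "integrable Q (log_ratio D)"
      using C D log_ratio_integrable by auto
    have "\<bar>log_ratio C y - log_ratio D y\<bar> \<le> B / \<alpha> * norm (C - D)" for y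
      using one[OF C D, of y] one[OF D C, of y] by (simp add: log_ratio_def norm_minus_commute abs_le_iff)
    then have "norm (\<integral>y. log_ratio C y - log_ratio D y \<partial>Q) \<le> (\<integral>y. B / \<alpha> * norm (C - D) \<partial>Q)"
      using iC iD by (intro order_trans[OF integral_norm_bound] integral_mono) auto
    then show "dist (?f C) (?f D) \<le> B / \<alpha> * dist C D"
      using iC iD by (simp add: dist_norm prob_space[unfolded space_Q])
  qed (use B0 assms in simp)
  then show ?thesis by (rule lipschitz_on_continuous_on)
qed

text \<open>
  The objective is continuous in \<open>C = A\<^sup>-\<^sup>1\<close>, and by \<open>coercive\<close> only a compact set of \<open>C\<close> competes with the
  identity matrix.
\<close>

theorem minimizer_exists: "\<exists>A. posdef A \<and> (\<forall>B. posdef B \<longrightarrow> objective A \<le> objective B)"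
proof -
  have I: "posdef (mat 1 :: real^'n^'n)" by (auto simp: posdef_def transpose_mat)
  obtain \<alpha> \<beta> where \<alpha>: "0 < \<alpha>" and co: "\<And>A y. posdef A \<Longrightarrow> objective A \<le> objective (mat 1) \<Longrightarrow>
    \<alpha> * (norm y)\<^sup>2 \<le> quad (matrix_inv A) y \<and> quad (matrix_inv A) y \<le> \<beta> * (norm y)\<^sup>2"
    using coercive[of "objective (mat 1)"] by blast
  define K where "K = {C :: real^'n^'n. transpose C = C \<and> (\<forall>y. \<alpha> * (norm y)\<^sup>2 \<le> quad C y \<and> quad C y \<le> \<beta> * (norm y)\<^sup>2)}"
  have pK: "posdef C" if "C \<in> K" for C
    unfolding posdef_def
  proof (intro conjI allI impI)
    show "transpose C = C" using that by (simp add: K_def)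
    fix x :: "real^'n" assume "x \<noteq> 0"
    then have "0 < \<alpha> * (norm x)\<^sup>2" using \<alpha> by simp
    also have "\<dots> \<le> quad C x" using that by (simp add: K_def)
    finally show "0 < x \<bullet> (C *v x)" by (simp add: quad_def)
  qed
  have memK: "matrix_inv A \<in> K" if "posdef A" "objective A \<le> objective (mat 1)" for A
    using co[OF that] posdef_inverse[OF that(1)] by (simp add: K_def posdef_def)
  have compK: "compact K" unfolding K_def by (rule compact_quad_bounds)
  have neK: "K \<noteq> {}" using memK[OF I] by auto
  define f where "f C = dof * (\<integral>y. log_ratio C y \<partial>Q) - ln (det C)" for C
  have det_pos: "0 < det C" if "posdef C" for C :: "real^'n^'n"
    by (rule simultaneous_coordinates[OF that that])
  have obj: "2 * objective A = f (matrix_inv A)" if "posdef A" for A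
  proof -
    have "det A * det (matrix_inv A) = 1"
      using det_mul[of A "matrix_inv A"] matrix_inv_right_left[OF posdef_invertible[OF that]] by simp
    then have "det (matrix_inv A) = inverse (det A)" by (metis inverse_unique)
    then have "ln (det (matrix_inv A)) = - ln (det A)" by (simp add: ln_inverse)
    then show ?thesis by (simp add: objective_def f_def)
  qed
  have "continuous_on K f"
    unfolding f_def[abs_def]
  proof (intro continuous_intros continuous_on_det)
    show "continuous_on K (\<lambda>C. \<integral>y. log_ratio C y \<partial>Q)"
      by (rule continuous_on_subset[OF continuous_log_ratio_integral[OF \<alpha>]]) (use pK in \<open>auto simp: K_def\<close>)
    show "\<forall>C\<in>K. det C \<noteq> 0" using det_pos pK by (metis less_irrefl)
  qed
  then obtain C where C: "C \<in> K" "\<And>D. D \<in> K \<Longrightarrow> f C \<le> f D"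
    using continuous_attains_inf[OF compK neK] by blast
  define A where "A = matrix_inv C"
  have A: "posdef A" unfolding A_def by (rule posdef_inverse[OF pK[OF C(1)]])
  have iA: "matrix_inv A = C" unfolding A_def by (rule matrix_inv_inv[OF posdef_invertible[OF pK[OF C(1)]]])
  have low: "objective A \<le> objective B" if "posdef B" "objective B \<le> objective (mat 1)" for B
    using C(2)[OF memK[OF that]] obj[OF A] obj[OF that(1)] iA by simp
  have "objective A \<le> objective B" if "posdef B" for B
    using low[OF that] low[OF I] by linarith
  then show ?thesis using A by blast
qed

theorem critical_unique: "\<exists>!A. critical A"
proof -
  obtain A where "posdef A" "\<And>B. posdef B \<Longrightarrow> objective A \<le> objective B" using minimizer_exists by blast
  then have A: "critical A" by (rule minimal_critical)
  have "B = A" if "critical B" for B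
  proof -
    have pA: "posdef A" and pB: "posdef B" using A that by (auto simp: critical_def)
    have "objective B = objective A"
      using critical_minimal(1)[OF A pB] critical_minimal(1)[OF that pA] by linarith
    then show ?thesis by (rule critical_minimal(2)[OF A pB])
  qed
  with A show ?thesis by blast
qed

lemma critical_is_arg_min:
  assumes "critical A"
  shows "is_arg_min (scatter_objective \<nu> Q) (\<lambda>A. A \<in> pos_def) B \<longleftrightarrow> B = symmat_of A"
proof -
  have A: "posdef A" using assms by (simp add: critical_def)
  note sA = posdef_symmat[OF A]
  have min: "scatter_objective \<nu> Q (symmat_of A) \<le> scatter_objective \<nu> Q B" if "B \<in> pos_def" for B
    using critical_minimal(1)[OF assms] that sA by (simp add: scatter_objective_eq pos_def_iff)
  have uniq: "B = symmat_of A" if "B \<in> pos_def" "scatter_objective \<nu> Q B \<le> scatter_objective \<nu> Q (symmat_of A)" for B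
  proof -
    have "objective (mat_of B) = objective A"
      using min[OF that(1)] that sA by (simp add: scatter_objective_eq)
    then have "mat_of B = A" using critical_minimal(2)[OF assms, of "mat_of B"] that by (simp add: pos_def_iff)
    then show ?thesis by (metis mat_of_inverse)
  qed
  show ?thesis
    unfolding is_arg_min_def using min uniq sA(1) by (auto simp: not_less)
qed

theorem t_scatter_eq:
  assumes "critical A"
  shows "t_scatter \<nu> Q = symmat_of A"
  unfolding t_scatter_def by (rule the_equality) (simp_all only: critical_is_arg_min[OF assms])

theorem t_scatter_critical: "critical (mat_of (t_scatter \<nu> Q))"
proof -
  obtain A where "critical A" using critical_unique by blast
  then show ?thesis using t_scatter_eq posdef_symmat(2)[of A] by (simp add: critical_def)
qed

end

section \<open>Bounded bilinear maps\<close>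

lemma bounded_bilinear_add:
  assumes "bounded_bilinear f" "bounded_bilinear g"
  shows "bounded_bilinear (\<lambda>x y. f x y + g x y)"
proof -
  interpret f: bounded_bilinear f by fact
  interpret g: bounded_bilinear g by fact
  obtain F where F: "\<And>x y. norm (f x y) \<le> norm x * norm y * F" using f.bounded by blast
  obtain G where G: "\<And>x y. norm (g x y) \<le> norm x * norm y * G" using g.bounded by blast
  show ?thesis
  proof
    have "norm (f x y + g x y) \<le> norm x * norm y * (F + G)" for x y
      using norm_triangle_ineq[of "f x y" "g x y"] F[of x y] G[of x y] by (simp add: distrib_left)
    then show "\<exists>K. \<forall>x y. norm (f x y + g x y) \<le> norm x * norm y * K" by blast
  qed (simp_all add: f.add_left f.add_right g.add_left g.add_right f.scaleR_left f.scaleR_right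
      g.scaleR_left g.scaleR_right scaleR_add_right)
qed

lemma bounded_bilinear_post:
  assumes "bounded_linear L" "bounded_bilinear f"
  shows "bounded_bilinear (\<lambda>x y. L (f x y))"
proof -
  interpret L: bounded_linear L by fact
  interpret f: bounded_bilinear f by fact
  obtain K where K: "0 < K" "\<And>x. norm (L x) \<le> norm x * K" using L.pos_bounded by blast
  obtain F where F: "\<And>x y. norm (f x y) \<le> norm x * norm y * F" using f.bounded by blast
  show ?thesis
  proof
    have "norm (L (f x y)) \<le> norm x * norm y * (F * K)" for x y
    proof -
      have "norm (L (f x y)) \<le> norm (f x y) * K" by (rule K)
      also have "\<dots> \<le> norm x * norm y * F * K" using F K(1) by (intro mult_right_mono) auto
      finally show ?thesis by (simp add: mult.assoc)
    qed
    then show "\<exists>K. \<forall>x y. norm (L (f x y)) \<le> norm x * norm y * K" by blast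
  qed (simp_all add: f.add_left f.add_right f.scaleR_left f.scaleR_right L.add L.scaleR)
qed

lemma bounded_bilinear_minus:
  "bounded_bilinear f \<Longrightarrow> bounded_bilinear (\<lambda>x y. - f x y)"
  by (rule bounded_bilinear_post[OF bounded_linear_minus[OF bounded_linear_ident]])

lemma bounded_bilinear_diff:
  "bounded_bilinear f \<Longrightarrow> bounded_bilinear g \<Longrightarrow> bounded_bilinear (\<lambda>x y. f x y - g x y)"
  using bounded_bilinear_add[OF _ bounded_bilinear_minus, of f g] by simp

lemma bounded_bilinear_zero: "bounded_bilinear (\<lambda>x y. 0)"
  by standard (auto intro: exI[of _ 0])

lemma bounded_bilinear_Pair:
  assumes "bounded_bilinear f" "bounded_bilinear g"
  shows "bounded_bilinear (\<lambda>x y. (f x y, g x y))"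
proof -
  have 1: "bounded_linear (\<lambda>x. (x, 0))" and 2: "bounded_linear (\<lambda>x. (0, x))"
    by (intro bounded_linear_Pair bounded_linear_ident bounded_linear_zero)+
  have "bounded_bilinear (\<lambda>x y. (f x y, 0) + (0, g x y))"
    by (intro bounded_bilinear_add bounded_bilinear_post[OF 1 assms(1)] bounded_bilinear_post[OF 2 assms(2)])
  then show ?thesis by simp
qed

lemmas bounded_bilinear_comp = bounded_bilinear.comp

lemma bounded_bilinear_matrix_mult:
  "bounded_bilinear ((**) :: real^'n^'n \<Rightarrow> real^'n^'n \<Rightarrow> real^'n^'n)"
  unfolding bilinear_conv_bounded_bilinear[symmetric] bilinear_def
proof (intro conjI allI linearI)
  fix A B C :: "real^'n^'n" and r :: real
  show "A ** (B + C) = A ** B + A ** C" by (rule matrix_add_ldistrib)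
  show "(B + C) ** A = B ** A + C ** A"
    by (simp add: vec_eq_iff matrix_matrix_mult_def sum.distrib distrib_right)
  show "A ** (r *\<^sub>R B) = r *\<^sub>R (A ** B)"
    by (simp add: vec_eq_iff matrix_matrix_mult_def sum_distrib_left mult.left_commute)
  show "(r *\<^sub>R B) ** A = r *\<^sub>R (B ** A)"
    by (simp add: vec_eq_iff matrix_matrix_mult_def sum_distrib_left mult.assoc)
qed

lemma matrix_expansion: "(A :: real^'n^'m) = (\<Sum>i\<in>UNIV. \<Sum>j\<in>UNIV. (A $ i $ j) *\<^sub>R axis i (axis j 1))"
proof -
  have "(\<Sum>i\<in>UNIV. \<Sum>j\<in>UNIV. (A $ i $ j) *\<^sub>R axis i (axis j 1 :: real^'n)) $ k $ l = A $ k $ l" for k :: 'm and l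
  proof -
    have "(\<Sum>i\<in>UNIV. \<Sum>j\<in>UNIV. (A $ i $ j) *\<^sub>R axis i (axis j 1 :: real^'n)) $ k $ l =
        (\<Sum>i\<in>UNIV. \<Sum>j\<in>UNIV. if i = k \<and> j = l then A $ i $ j else 0)"
      by (simp add: axis_def sum_component) (intro sum.cong refl, auto)
    also have "\<dots> = A $ k $ l"
      by (subst sum_eq_single[of _ k]; simp add: sum_eq_single[of _ l])
    finally show ?thesis .
  qed
  then show ?thesis by (simp add: vec_eq_iff)
qed

lemma bounded_linear_matrixI:
  fixes f :: "'a::real_normed_vector \<Rightarrow> real^'n^'m"
  assumes "\<And>i j. bounded_linear (\<lambda>x. f x $ i $ j)"
  shows "bounded_linear f"
proof -
  have "bounded_linear (\<lambda>x. \<Sum>i\<in>UNIV. \<Sum>j\<in>UNIV. (f x $ i $ j) *\<^sub>R axis i (axis j (1::real)))"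
    by (intro bounded_linear_sum bounded_linear_scaleR_const assms)
  then show ?thesis unfolding matrix_expansion[symmetric] .
qed

section \<open>The algebra of bounded Lipschitz functions\<close>

lemma bl_functions_mult:
  assumes "f \<in> bl_functions" "g \<in> bl_functions"
  shows "(\<lambda>x. f x * g x) \<in> bl_functions"
    and "sup_abs (\<lambda>x. f x * g x) \<le> sup_abs f * sup_abs g"
    and "lip_const (\<lambda>x. f x * g x) \<le> sup_abs f * lip_const g + lip_const f * sup_abs g"
proof -
  note ub = sup_abs_upper[OF assms(1)] sup_abs_upper[OF assms(2)]
  have f0: "0 \<le> sup_abs f" using ub(1) abs_ge_zero order_trans by blast
  have g0: "0 \<le> sup_abs g" using ub(2) abs_ge_zero order_trans by blast
  have s: "\<bar>f x * g x\<bar> \<le> sup_abs f * sup_abs g" for x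
    unfolding abs_mult using ub f0 by (intro mult_mono) auto
  have l: "\<bar>f x * g x - f y * g y\<bar> \<le> (sup_abs f * lip_const g + lip_const f * sup_abs g) * norm (x - y)" for x y
  proof -
    have "f x * g x - f y * g y = f x * (g x - g y) + (f x - f y) * g y" by (simp add: algebra_simps)
    also have "\<bar>\<dots>\<bar> \<le> \<bar>f x\<bar> * \<bar>g x - g y\<bar> + \<bar>f x - f y\<bar> * \<bar>g y\<bar>"
      by (simp add: abs_mult[symmetric] abs_triangle_ineq)
    also have "\<dots> \<le> sup_abs f * (lip_const g * norm (x - y)) + (lip_const f * norm (x - y)) * sup_abs g"
      using ub lip_const_upper[OF assms(1), of x y] lip_const_upper[OF assms(2), of x y] f0
        lip_const_nonneg[OF assms(1)]
      by (intro add_mono mult_mono) auto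
    finally show ?thesis by (simp add: algebra_simps)
  qed
  show "(\<lambda>x. f x * g x) \<in> bl_functions" by (rule bl_functionsI[OF s l])
  show "sup_abs (\<lambda>x. f x * g x) \<le> sup_abs f * sup_abs g" by (rule sup_abs_least[OF s])
  show "lip_const (\<lambda>x. f x * g x) \<le> sup_abs f * lip_const g + lip_const f * sup_abs g"
    by (rule lip_const_least[OF l])
qed

lift_definition bl_mult :: "'a::euclidean_space bl \<Rightarrow> 'a bl \<Rightarrow> 'a bl" is "\<lambda>f g x. f x * g x"
  by (rule bl_functions_mult)

lemma norm_bl_mult: "norm (bl_mult f g) \<le> norm f * norm g"
proof transfer
  fix f g :: "'a \<Rightarrow> real" assume fg: "f \<in> bl_functions" "g \<in> bl_functions"
  have "0 \<le> lip_const f * lip_const g" using lip_const_nonneg fg by (intro mult_nonneg_nonneg)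
  then show "sup_abs (\<lambda>x. f x * g x) + lip_const (\<lambda>x. f x * g x) \<le> (sup_abs f + lip_const f) * (sup_abs g + lip_const g)"
    using bl_functions_mult(2,3)[OF fg] by (simp add: algebra_simps)
qed

lemma bl_eqI: "(\<And>x. bl_apply f x = bl_apply g x) \<Longrightarrow> f = g"
  by (metis bl_apply_inject ext)

lemma bounded_bilinear_bl_mult: "bounded_bilinear bl_mult"
proof
  show "\<exists>K. \<forall>f g :: 'a bl. norm (bl_mult f g) \<le> norm f * norm g * K"
    by (rule exI[of _ 1]) (simp add: norm_bl_mult)
qed (rule bl_eqI, simp add: bl_mult.rep_eq plus_bl.rep_eq scaleR_bl.rep_eq algebra_simps)+

text \<open>
  The dual is a module over the algebra of bounded Lipschitz functions: \<open>act \<psi> f\<close> has density \<open>f\<close> with respect to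
  \<open>\<psi>\<close>. This stands in for dividing a functional by a varying function, which would not be polynomial.
\<close>

definition act :: "'a::euclidean_space bl_dual \<Rightarrow> 'a bl \<Rightarrow> 'a bl_dual" where
  "act \<psi> f = Blinfun (\<lambda>g. blinfun_apply \<psi> (bl_mult f g))"

lemma act_apply [simp]: "blinfun_apply (act \<psi> f) g = blinfun_apply \<psi> (bl_mult f g)"
  unfolding act_def
  by (subst bounded_linear_Blinfun_apply)
    (rule bounded_linear_compose[OF blinfun.bounded_linear_right bounded_bilinear.bounded_linear_right[OF bounded_bilinear_bl_mult]], rule refl)

lemma bounded_bilinear_act: "bounded_bilinear act"
proof -
  interpret bl: bounded_bilinear "bl_mult :: 'a bl \<Rightarrow> 'a bl \<Rightarrow> 'a bl" by (rule bounded_bilinear_bl_mult)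
  show ?thesis
  proof
    have "norm (act \<psi> f) \<le> norm \<psi> * norm f * 1" for \<psi> :: "'a bl_dual" and f
    proof (rule norm_blinfun_bound)
      fix g
      have "norm (blinfun_apply \<psi> (bl_mult f g)) \<le> norm \<psi> * norm (bl_mult f g)" by (rule norm_blinfun)
      also have "\<dots> \<le> norm \<psi> * (norm f * norm g)" by (intro mult_left_mono norm_bl_mult) auto
      finally show "norm (blinfun_apply (act \<psi> f) g) \<le> norm \<psi> * norm f * 1 * norm g" by (simp add: mult.assoc)
    qed simp
    then show "\<exists>K. \<forall>(\<psi> :: 'a bl_dual) f. norm (act \<psi> f) \<le> norm \<psi> * norm f * K" by blast
  qed (rule blinfun_eqI, simp add: blinfun.add_left blinfun.add_right blinfun.scaleR_left blinfun.scaleR_right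
      bl.add_left bl.scaleR_left)+
qed

definition combination :: "('n::finite \<Rightarrow> 'n \<Rightarrow> 'a::euclidean_space bl) \<Rightarrow> real^'n^'n \<Rightarrow> 'a bl" where
  "combination h c = (\<Sum>i\<in>UNIV. \<Sum>j\<in>UNIV. (c $ i $ j) *\<^sub>R h i j)"

lemma bounded_linear_combination: "bounded_linear (combination h)"
  unfolding combination_def[abs_def]
  by (intro bounded_linear_sum bounded_linear_scaleR_const bounded_linear_compose[OF bounded_linear_vec_nth bounded_linear_vec_nth])

definition pairing :: "('n::finite \<Rightarrow> 'n \<Rightarrow> 'a::euclidean_space bl) \<Rightarrow> 'a bl_dual \<Rightarrow> real^'n^'n" where
  "pairing h \<psi> = (\<chi> i j. blinfun_apply \<psi> (h i j))"

lemma bounded_linear_pairing: "bounded_linear (pairing h)"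
  by (rule bounded_linear_matrixI) (simp add: pairing_def blinfun.bounded_linear_left)

section \<open>The quadratic systems for the scatter functional\<close>

context
  fixes h :: "'n::finite \<Rightarrow> 'n \<Rightarrow> 'a::euclidean_space bl" and \<phi>0 :: "'a bl_dual"
    and A0 C0 :: "real^'n^'n" and \<kappa> :: real
  assumes inv: "A0 ** C0 = mat 1"
begin

interpretation mm: bounded_bilinear "(**) :: real^'n^'n \<Rightarrow> real^'n^'n \<Rightarrow> real^'n^'n"
  by (rule bounded_bilinear_matrix_mult)
interpretation ac: bounded_bilinear "act :: 'a bl_dual \<Rightarrow> 'a bl \<Rightarrow> 'a bl_dual"
  by (rule bounded_bilinear_act)
interpretation u: bounded_linear "combination h" by (rule bounded_linear_combination)
interpretation H: bounded_linear "pairing h :: 'a bl_dual \<Rightarrow> real^'n^'n" by (rule bounded_linear_pairing)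

lemma inv': "C0 ** A0 = mat 1" using inv matrix_left_right_inverse by blast

text \<open>
  The matrices \<open>A0\<close>, \<open>C0\<close> and the functional \<open>\<phi>0\<close> are the base point, \<open>h\<close> the kernels for \<open>C0\<close>, and \<open>c\<close>
  stands for \<open>C - C0\<close>. To first order, \<open>A C = 1\<close> gives \<open>A - A0 = - A0 c A0\<close>, and \<open>\<psi> + u \<cdot> \<psi> = \<phi>\<close> gives
  \<open>\<psi> - \<phi>0 = - u \<cdot> \<phi>0\<close>. Inserting both into \<open>A = \<kappa> \<psi>(h)\<close> with \<open>\<phi> = \<phi>0\<close> shows that this map has to vanish.
\<close>

definition linearization :: "real^'n^'n \<Rightarrow> real^'n^'n" where
  "linearization c = A0 ** c ** A0 - \<kappa> *\<^sub>R pairing h (act \<phi>0 (combination h c))"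

lemma bounded_linear_linearization: "bounded_linear linearization"
proof -
  have 1: "bounded_linear (\<lambda>c. A0 ** c ** A0)"
    by (rule bounded_linear_compose[OF mm.bounded_linear_left mm.bounded_linear_right])
  have 2: "bounded_linear (\<lambda>c. \<kappa> *\<^sub>R pairing h (act \<phi>0 (combination h c)))"
    by (rule bounded_linear_const_scaleR, rule bounded_linear_compose[OF H.bounded_linear_axioms],
      rule bounded_linear_compose[OF ac.bounded_linear_right u.bounded_linear_axioms])
  show ?thesis unfolding linearization_def[abs_def] by (rule bounded_linear_sub[OF 1 2])
qed

text \<open>
  The unknowns are the increments \<open>(c, a, s)\<close> of \<open>(C, A, \<psi>)\<close> at \<open>(C0, A0, \<phi>0)\<close>, the parameter \<open>q\<close> is the
  increment of \<open>\<phi>\<close>. Eliminating \<open>a\<close> and \<open>s\<close> from the linear part of the third equation leaves the linearization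
  applied to \<open>c\<close>; multiplying by its inverse \<open>N\<close> brings the system into the form \<open>z = l q + b z z\<close>. As \<open>c\<close>
  is then itself given by linear and bilinear terms, it may be substituted in the two other equations.
\<close>

theorem scatter_system:
  fixes pr :: "real^'n^'n \<Rightarrow> 'v::banach"
  assumes base: "A0 = \<kappa> *\<^sub>R pairing h \<phi>0"
    and inj: "\<And>c. linearization c = 0 \<Longrightarrow> c = 0"
    and pr: "bounded_linear pr" and \<beta>: "bounded_bilinear \<beta>" and "0 < e"
  shows "\<exists>r>0. \<exists>g C \<psi>. frechet_analytic_on (ball \<phi>0 r) (\<lambda>\<phi>. pr (g \<phi>) + \<beta> (g \<phi>) (g \<phi>)) \<and>
    (\<forall>\<phi>\<in>ball \<phi>0 r. g \<phi> ** C \<phi> = mat 1 \<and> g \<phi> = \<kappa> *\<^sub>R pairing h (\<psi> \<phi>) \<and>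
      \<psi> \<phi> + act (\<psi> \<phi>) (combination h (C \<phi> - C0)) = \<phi> \<and> norm (C \<phi> - C0) < e)"
proof -
  interpret M: bounded_linear linearization by (rule bounded_linear_linearization)
  interpret pr: bounded_linear pr by fact
  interpret \<beta>: bounded_bilinear \<beta> by fact
  have "inj linearization"
    using inj by (simp add: linear_injective_0[OF M.linear_axioms])
  then obtain N where N: "linear N" "\<And>B. linearization (N B) = B"
    using linear_injective_isomorphism[OF M.linear_axioms] by blast
  have N': "bounded_linear N" using N(1) by (rule linear_linear[THEN iffD1, OF _] | simp add: linear_conv_bounded_linear)
  interpret N: bounded_linear N by (rule N')
  define lc where "lc p = N (- (\<kappa> *\<^sub>R pairing h p))" for p
  define l where "l p = (lc p, - (A0 ** lc p ** A0), p - act \<phi>0 (combination h (lc p)))" for p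
  define bc :: "(real^'n^'n) \<times> (real^'n^'n) \<times> 'a bl_dual \<Rightarrow> (real^'n^'n) \<times> (real^'n^'n) \<times> 'a bl_dual \<Rightarrow> real^'n^'n"
    where "bc z z' = N (\<kappa> *\<^sub>R pairing h (act (snd (snd z')) (combination h (fst z))) - A0 ** fst z ** fst (snd z'))" for z z'
  define b :: "(real^'n^'n) \<times> (real^'n^'n) \<times> 'a bl_dual \<Rightarrow> (real^'n^'n) \<times> (real^'n^'n) \<times> 'a bl_dual \<Rightarrow> (real^'n^'n) \<times> (real^'n^'n) \<times> 'a bl_dual"
    where "b z z' = (bc z z', - (A0 ** bc z z' ** A0) - A0 ** fst z ** fst (snd z'),
      - act \<phi>0 (combination h (bc z z')) - act (snd (snd z')) (combination h (fst z)))" for z z'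
  have A0cA0: "bounded_linear (\<lambda>c. A0 ** c ** A0)"
    by (rule bounded_linear_compose[OF mm.bounded_linear_left mm.bounded_linear_right])
  have au: "bounded_linear (\<lambda>c. act \<phi>0 (combination h c))"
    by (rule bounded_linear_compose[OF ac.bounded_linear_right u.bounded_linear_axioms])
  have lc: "bounded_linear lc"
    unfolding lc_def[abs_def]
    by (rule bounded_linear_compose[OF N'], rule bounded_linear_minus, rule bounded_linear_const_scaleR, rule H.bounded_linear_axioms)
  have l: "bounded_linear l"
    unfolding l_def[abs_def]
    by (intro bounded_linear_Pair lc bounded_linear_minus bounded_linear_compose[OF A0cA0 lc] bounded_linear_sub
      bounded_linear_ident bounded_linear_compose[OF au lc])
  have p1: "bounded_linear (\<lambda>z :: (real^'n^'n) \<times> (real^'n^'n) \<times> 'a bl_dual. fst z)"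
    and p2: "bounded_linear (\<lambda>z :: (real^'n^'n) \<times> (real^'n^'n) \<times> 'a bl_dual. fst (snd z))"
    and p3: "bounded_linear (\<lambda>z :: (real^'n^'n) \<times> (real^'n^'n) \<times> 'a bl_dual. snd (snd z))"
    by (intro bounded_linear_fst bounded_linear_compose[OF bounded_linear_fst bounded_linear_snd]
      bounded_linear_compose[OF bounded_linear_snd bounded_linear_snd])+
  note b1 = bounded_bilinear.flip[OF ac.comp[OF p3 bounded_linear_compose[OF u.bounded_linear_axioms p1]]]
  note b2 = mm.comp[OF bounded_linear_compose[OF mm.bounded_linear_right p1] p2, of A0]
  have bc: "bounded_bilinear bc"
    unfolding bc_def[abs_def]
    by (rule bounded_bilinear_post[OF N'], rule bounded_bilinear_diff, rule bounded_bilinear_post[OF bounded_linear_const_scaleR[OF H.bounded_linear_axioms]],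
      rule b1, rule b2)
  have b: "bounded_bilinear b"
    unfolding b_def[abs_def]
    by (intro bounded_bilinear_Pair bc bounded_bilinear_diff bounded_bilinear_minus bounded_bilinear_post[OF A0cA0 bc]
      bounded_bilinear_post[OF au bc] b1 b2)
  (* the linear part of \<open>pr + \<beta>\<close> in the increment of \<open>A\<close>, expanded at \<open>A0\<close> *)
  define pa where "pa z = pr (fst (snd z)) + \<beta> A0 (fst (snd z)) + \<beta> (fst (snd z)) A0"
    for z :: "(real^'n^'n) \<times> (real^'n^'n) \<times> 'a bl_dual"
  define \<beta>a where "\<beta>a z z' = \<beta> (fst (snd z)) (fst (snd z'))"
    for z z' :: "(real^'n^'n) \<times> (real^'n^'n) \<times> 'a bl_dual"
  have pa: "bounded_linear pa"
    unfolding pa_def[abs_def]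
    by (intro bounded_linear_add bounded_linear_compose[OF pr p2] bounded_linear_compose[OF \<beta>.bounded_linear_right p2]
      bounded_linear_compose[OF \<beta>.bounded_linear_left p2])
  have \<beta>a: "bounded_bilinear \<beta>a" unfolding \<beta>a_def[abs_def] by (rule \<beta>.comp[OF p2 p2])
  obtain r K z where r: "0 < r" and an: "frechet_analytic_on (ball 0 r) (\<lambda>q. pa (z q) + \<beta>a (z q) (z q))"
    and small: "\<And>q. norm q < r \<Longrightarrow> norm (z q) \<le> K * norm q"
    and eq: "\<And>q. norm q < r \<Longrightarrow> z q = l q + b (z q) (z q)"
    using quadratic_system[OF l b pa \<beta>a] by blast
  define r' where "r' = min r (e / (\<bar>K\<bar> + 1))"
  have r': "0 < r'" "r' \<le> r" using r \<open>0 < e\<close> by (simp_all add: r'_def add_nonneg_pos)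
  define g where "g \<phi> = A0 + fst (snd (z (\<phi> - \<phi>0)))" for \<phi>
  define C where "C \<phi> = C0 + fst (z (\<phi> - \<phi>0))" for \<phi>
  define \<psi> where "\<psi> \<phi> = \<phi>0 + snd (snd (z (\<phi> - \<phi>0)))" for \<phi>
  have out: "pr (g \<phi>) + \<beta> (g \<phi>) (g \<phi>) = (pr A0 + \<beta> A0 A0) + (pa (z (\<phi> - \<phi>0)) + \<beta>a (z (\<phi> - \<phi>0)) (z (\<phi> - \<phi>0)))" for \<phi>
    by (simp add: g_def pa_def \<beta>a_def pr.add \<beta>.add_left \<beta>.add_right)
  have "frechet_analytic_on {\<phi>. id \<phi> + (- \<phi>0) \<in> ball 0 r} (\<lambda>\<phi>. pa (z (id \<phi> + (- \<phi>0))) + \<beta>a (z (id \<phi> + (- \<phi>0))) (z (id \<phi> + (- \<phi>0))))"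
    by (rule frechet_analytic_on_precompose_affine[OF _ an]) (simp add: id_def bounded_linear_ident)
  then have "frechet_analytic_on (ball \<phi>0 r) (\<lambda>\<phi>. pa (z (\<phi> - \<phi>0)) + \<beta>a (z (\<phi> - \<phi>0)) (z (\<phi> - \<phi>0)))"
    by (simp add: ball_def dist_norm norm_minus_commute)
  then have "frechet_analytic_on (ball \<phi>0 r) (\<lambda>\<phi>. pr (g \<phi>) + \<beta> (g \<phi>) (g \<phi>))"
    unfolding out by (rule frechet_analytic_on_compose_linear[OF bounded_linear_ident])
  then have an': "frechet_analytic_on (ball \<phi>0 r') (\<lambda>\<phi>. pr (g \<phi>) + \<beta> (g \<phi>) (g \<phi>))"
    by (rule frechet_analytic_on_subset) (use r' in auto)
  have main: "g \<phi> ** C \<phi> = mat 1 \<and> g \<phi> = \<kappa> *\<^sub>R pairing h (\<psi> \<phi>) \<and>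
      \<psi> \<phi> + act (\<psi> \<phi>) (combination h (C \<phi> - C0)) = \<phi> \<and> norm (C \<phi> - C0) < e" if \<phi>: "\<phi> \<in> ball \<phi>0 r'" for \<phi>
  proof -
    define q where "q = \<phi> - \<phi>0"
    have q: "norm q < r'" using \<phi> by (simp add: q_def dist_norm norm_minus_commute)
    then have qr: "norm q < r" using r' by simp
    define c where "c = fst (z q)"
    define a where "a = fst (snd (z q))"
    define s where "s = snd (snd (z q))"
    have zq: "z q = (c, a, s)" by (simp add: c_def a_def s_def)
    have c: "c = lc q + bc (c, a, s) (c, a, s)"
      and a: "a = - (A0 ** lc q ** A0) + (- (A0 ** bc (c, a, s) (c, a, s) ** A0) - A0 ** c ** a)"
      and s: "s = q - act \<phi>0 (combination h (lc q)) + (- act \<phi>0 (combination h (bc (c, a, s) (c, a, s))) - act s (combination h c))"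
      using eq[OF qr] unfolding zq l_def b_def by simp_all
    have a': "a = - (A0 ** c ** A0) - A0 ** c ** a"
    proof -
      have "A0 ** c ** A0 = A0 ** lc q ** A0 + A0 ** bc (c, a, s) (c, a, s) ** A0"
        by (subst c) (simp only: mm.add_left mm.add_right)
      then have "- (A0 ** c ** A0) - A0 ** c ** a =
          - (A0 ** lc q ** A0) + (- (A0 ** bc (c, a, s) (c, a, s) ** A0) - A0 ** c ** a)" by simp
      then show ?thesis by (rule trans[OF a sym])
    qed
    have s': "s = q - act \<phi>0 (combination h c) - act s (combination h c)"
    proof -
      have "act \<phi>0 (combination h c) = act \<phi>0 (combination h (lc q)) + act \<phi>0 (combination h (bc (c, a, s) (c, a, s)))"
        by (subst c) (simp only: u.add ac.add_right)
      then have "q - act \<phi>0 (combination h c) - act s (combination h c) = q - act \<phi>0 (combination h (lc q)) +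
          (- act \<phi>0 (combination h (bc (c, a, s) (c, a, s))) - act s (combination h c))" by simp
      then show ?thesis by (rule trans[OF s sym])
    qed
    have "c = N (- (\<kappa> *\<^sub>R pairing h q) + (\<kappa> *\<^sub>R pairing h (act s (combination h c)) - A0 ** c ** a))"
      using c by (simp add: lc_def bc_def N.add[symmetric])
    then have "linearization c = - (\<kappa> *\<^sub>R pairing h q) + (\<kappa> *\<^sub>R pairing h (act s (combination h c)) - A0 ** c ** a)"
      using N(2) by metis
    then have "- (A0 ** c ** A0) - A0 ** c ** a =
        \<kappa> *\<^sub>R (pairing h q - pairing h (act \<phi>0 (combination h c)) - pairing h (act s (combination h c)))"
      by (simp add: linearization_def algebra_simps)
    also have "\<dots> = \<kappa> *\<^sub>R pairing h s"
    proof -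
      have "pairing h s = pairing h (q - act \<phi>0 (combination h c) - act s (combination h c))"
        by (rule arg_cong[OF s'])
      then show ?thesis by (simp only: H.diff)
    qed
    finally have as: "a = \<kappa> *\<^sub>R pairing h s" using a' by simp
    have ga: "g \<phi> = A0 + a" and Cc: "C \<phi> = C0 + c" and \<psi>s: "\<psi> \<phi> = \<phi>0 + s"
      by (simp_all add: g_def C_def \<psi>_def q_def[symmetric] zq)
    have 1: "g \<phi> = \<kappa> *\<^sub>R pairing h (\<psi> \<phi>)"
      unfolding ga \<psi>s as H.add scaleR_add_right base[symmetric] ..
    have 2: "\<psi> \<phi> + act (\<psi> \<phi>) (combination h (C \<phi> - C0)) = \<phi>"
    proof -
      have "C \<phi> - C0 = c" by (simp add: Cc)
      moreover have "s + act \<phi>0 (combination h c) + act s (combination h c) = q"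
        using s' by (metis (no_types, lifting) add.commute diff_add_cancel diff_diff_eq)
      ultimately show ?thesis by (simp add: \<psi>s ac.add_left q_def algebra_simps)
    qed
    have ag: "a = - (A0 ** c ** (A0 + a))" using a' by (simp add: matrix_add_ldistrib)
    have "C0 ** (A0 + a) = mat 1 - c ** (A0 + a)"
    proof -
      have "C0 ** a = - (C0 ** (A0 ** c ** (A0 + a)))" by (subst ag) (simp only: mm.minus_right)
      also have "C0 ** (A0 ** c ** (A0 + a)) = (C0 ** A0) ** c ** (A0 + a)" by (simp only: matrix_mul_assoc)
      finally show ?thesis by (simp add: matrix_add_ldistrib inv')
    qed
    then have "(C0 + c) ** (A0 + a) = mat 1" by (simp add: mm.add_left)
    then have 3: "g \<phi> ** C \<phi> = mat 1" unfolding ga Cc using matrix_left_right_inverse by blast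
    have "norm c \<le> norm (z q)" unfolding zq by (rule norm_fst_le)
    also have "\<dots> \<le> K * norm q" by (rule small[OF qr])
    also have "\<dots> \<le> \<bar>K\<bar> * norm q" by (intro mult_right_mono) auto
    also have "\<dots> \<le> (\<bar>K\<bar> + 1) * norm q" by (intro mult_right_mono) auto
    also have "\<dots> < e"
    proof -
      have "0 < \<bar>K\<bar> + 1" by linarith
      moreover have "norm q < e / (\<bar>K\<bar> + 1)" using q by (simp add: r'_def)
      ultimately show ?thesis by (simp add: pos_less_divide_eq mult.commute)
    qed
    finally have "norm (C \<phi> - C0) < e" by (simp add: Cc)
    with 1 2 3 show ?thesis by blast
  qed
  show ?thesis
    by (rule exI[of _ r'], rule conjI, rule r'(1), rule exI[of _ g], rule exI[of _ C], rule exI[of _ \<psi>],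
      rule conjI, rule an', rule ballI, erule main)
qed

text \<open>
  Now \<open>A = A0 + L B\<close> is prescribed, and only \<open>C\<close> and \<open>\<psi>\<close> have to be found. The parameters \<open>p\<close> and \<open>L B\<close> are
  carried along as components of the solution, because the products \<open>L B ** C\<close> and \<open>\<phi>(1) A\<close> must be bilinear in the
  unknowns. The linear map \<open>L\<close> is the inclusion of the symmetric matrices.
\<close>

theorem estimating_function_system:
  fixes e1 :: "'a bl" and L :: "'s::real_normed_vector \<Rightarrow> real^'n^'n"
  assumes L: "bounded_linear L"
  shows "\<exists>r>0. \<exists>F C \<psi>. frechet_analytic_on (ball 0 r) F \<and>
    (F has_derivative (\<lambda>(p, B). - (1/2) *\<^sub>R (blinfun_apply \<phi>0 e1 *\<^sub>R L B + blinfun_apply p e1 *\<^sub>R A0) +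
      (\<kappa> / 2) *\<^sub>R pairing h (p + act \<phi>0 (combination h (C0 ** L B ** C0))))) (at 0) \<and>
    (\<forall>p B. norm (p, B) < r \<longrightarrow> (A0 + L B) ** C (p, B) = mat 1 \<and>
      \<psi> (p, B) + act (\<psi> (p, B)) (combination h (C (p, B) - C0)) = \<phi>0 + p \<and>
      F (p, B) = - (1/2) *\<^sub>R (blinfun_apply (\<phi>0 + p) e1 *\<^sub>R (A0 + L B)) + (\<kappa> / 2) *\<^sub>R pairing h (\<psi> (p, B)))"
proof -
  interpret L: bounded_linear L by fact
  define l :: "'a bl_dual \<times> 's \<Rightarrow> 'a bl_dual \<times> (real^'n^'n) \<times> (real^'n^'n) \<times> 'a bl_dual"
    where "l q = (fst q, L (snd q), - (C0 ** L (snd q) ** C0), fst q + act \<phi>0 (combination h (C0 ** L (snd q) ** C0)))" for q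
  define b :: "'a bl_dual \<times> (real^'n^'n) \<times> (real^'n^'n) \<times> 'a bl_dual \<Rightarrow> 'a bl_dual \<times> (real^'n^'n) \<times> (real^'n^'n) \<times> 'a bl_dual \<Rightarrow> 'a bl_dual \<times> (real^'n^'n) \<times> (real^'n^'n) \<times> 'a bl_dual"
    where "b z z' = (0, 0, - (C0 ** fst (snd z) ** fst (snd (snd z'))),
      act \<phi>0 (combination h (C0 ** fst (snd z) ** fst (snd (snd z')))) - act (snd (snd (snd z'))) (combination h (fst (snd (snd z)))))" for z z'
  define pr where "pr z = - (1/2) *\<^sub>R (blinfun_apply \<phi>0 e1 *\<^sub>R fst (snd z) + blinfun_apply (fst z) e1 *\<^sub>R A0) +
      (\<kappa> / 2) *\<^sub>R pairing h (snd (snd (snd z)))" for z :: "'a bl_dual \<times> (real^'n^'n) \<times> (real^'n^'n) \<times> 'a bl_dual"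
  define \<beta> where "\<beta> z z' = - (1/2) *\<^sub>R (blinfun_apply (fst z) e1 *\<^sub>R fst (snd z'))"
    for z z' :: "'a bl_dual \<times> (real^'n^'n) \<times> (real^'n^'n) \<times> 'a bl_dual"
  have CcC: "bounded_linear (\<lambda>c. C0 ** c ** C0)"
    by (rule bounded_linear_compose[OF mm.bounded_linear_left mm.bounded_linear_right])
  have au: "bounded_linear (\<lambda>c. act \<phi>0 (combination h c))"
    by (rule bounded_linear_compose[OF ac.bounded_linear_right u.bounded_linear_axioms])
  have Ls: "bounded_linear (\<lambda>q :: 'a bl_dual \<times> 's. L (snd q))" by (rule bounded_linear_compose[OF L bounded_linear_snd])
  have CLC: "bounded_linear (\<lambda>q :: 'a bl_dual \<times> 's. C0 ** L (snd q) ** C0)" by (rule bounded_linear_compose[OF CcC Ls])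
  have l: "bounded_linear l"
    unfolding l_def[abs_def]
    by (intro bounded_linear_Pair bounded_linear_fst Ls bounded_linear_minus CLC bounded_linear_add
      bounded_linear_compose[OF au CLC])
  have p1: "bounded_linear (\<lambda>z :: 'a bl_dual \<times> (real^'n^'n) \<times> (real^'n^'n) \<times> 'a bl_dual. fst z)"
    and p2: "bounded_linear (\<lambda>z :: 'a bl_dual \<times> (real^'n^'n) \<times> (real^'n^'n) \<times> 'a bl_dual. fst (snd z))"
    and p3: "bounded_linear (\<lambda>z :: 'a bl_dual \<times> (real^'n^'n) \<times> (real^'n^'n) \<times> 'a bl_dual. fst (snd (snd z)))"
    and p4: "bounded_linear (\<lambda>z :: 'a bl_dual \<times> (real^'n^'n) \<times> (real^'n^'n) \<times> 'a bl_dual. snd (snd (snd z)))"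
    by (intro bounded_linear_fst bounded_linear_compose[OF bounded_linear_fst bounded_linear_snd]
      bounded_linear_compose[OF bounded_linear_fst bounded_linear_compose[OF bounded_linear_snd bounded_linear_snd]]
      bounded_linear_compose[OF bounded_linear_snd bounded_linear_compose[OF bounded_linear_snd bounded_linear_snd]])+
  note b1 = mm.comp[OF bounded_linear_compose[OF mm.bounded_linear_right p2] p3, of C0]
  note b2 = bounded_bilinear.flip[OF ac.comp[OF p4 bounded_linear_compose[OF u.bounded_linear_axioms p3]]]
  have b: "bounded_bilinear b"
    unfolding b_def[abs_def]
    by (intro bounded_bilinear_Pair bounded_bilinear_zero bounded_bilinear_minus b1 bounded_bilinear_diff
      bounded_bilinear_post[OF au b1] b2)
  have ev: "bounded_linear (\<lambda>z :: 'a bl_dual \<times> (real^'n^'n) \<times> (real^'n^'n) \<times> 'a bl_dual. blinfun_apply (fst z) e1)"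
    by (rule bounded_linear_compose[OF blinfun.bounded_linear_left p1])
  have pr: "bounded_linear pr"
    unfolding pr_def[abs_def]
    by (intro bounded_linear_add bounded_linear_const_scaleR bounded_linear_scaleR_const p2 ev
      bounded_linear_compose[OF H.bounded_linear_axioms p4])
  have \<beta>: "bounded_bilinear \<beta>"
    unfolding \<beta>_def[abs_def]
    by (rule bounded_bilinear_post[OF bounded_linear_const_scaleR[OF bounded_linear_ident]
      bounded_bilinear.comp[OF bounded_bilinear_scaleR ev p2]])
  obtain r K z where r: "0 < r" and an: "frechet_analytic_on (ball 0 r) (\<lambda>q. pr (z q) + \<beta> (z q) (z q))"
    and der: "((\<lambda>q. pr (z q) + \<beta> (z q) (z q)) has_derivative (\<lambda>q. pr (l q))) (at 0)"
    and eq: "\<And>q. norm q < r \<Longrightarrow> z q = l q + b (z q) (z q)"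
    using quadratic_system[OF l b pr \<beta>] by blast
  define F0 where "F0 = - (1/2) *\<^sub>R (blinfun_apply \<phi>0 e1 *\<^sub>R A0) + (\<kappa> / 2) *\<^sub>R pairing h \<phi>0"
  define F where "F q = F0 + (pr (z q) + \<beta> (z q) (z q))" for q
  define C where "C q = C0 + fst (snd (snd (z q)))" for q
  define \<psi> where "\<psi> q = \<phi>0 + snd (snd (snd (z q)))" for q
  have an': "frechet_analytic_on (ball 0 r) F"
    unfolding F_def[abs_def] by (rule frechet_analytic_on_compose_linear[OF bounded_linear_ident an])
  have "(F has_derivative (\<lambda>q. 0 + pr (l q))) (at 0)"
    unfolding F_def[abs_def] by (rule has_derivative_add[OF has_derivative_const der])
  then have der': "(F has_derivative (\<lambda>(p, B). - (1/2) *\<^sub>R (blinfun_apply \<phi>0 e1 *\<^sub>R L B + blinfun_apply p e1 *\<^sub>R A0) +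
      (\<kappa> / 2) *\<^sub>R pairing h (p + act \<phi>0 (combination h (C0 ** L B ** C0))))) (at 0)"
    by (simp add: pr_def l_def case_prod_unfold)
  have main: "(A0 + L B) ** C (p, B) = mat 1 \<and>
      \<psi> (p, B) + act (\<psi> (p, B)) (combination h (C (p, B) - C0)) = \<phi>0 + p \<and>
      F (p, B) = - (1/2) *\<^sub>R (blinfun_apply (\<phi>0 + p) e1 *\<^sub>R (A0 + L B)) + (\<kappa> / 2) *\<^sub>R pairing h (\<psi> (p, B))"
    if q: "norm (p, B) < r" for p B
  proof -
    define c where "c = fst (snd (snd (z (p, B))))"
    define s where "s = snd (snd (snd (z (p, B))))"
    have zq: "z (p, B) = (p, L B, c, s)"
    proof -
      have "fst (z (p, B)) = fst (l (p, B) + b (z (p, B)) (z (p, B)))"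
        by (rule arg_cong[OF eq[OF q]])
      also have "\<dots> = p" by (simp add: l_def b_def)
      finally have 1: "fst (z (p, B)) = p" .
      have "fst (snd (z (p, B))) = fst (snd (l (p, B) + b (z (p, B)) (z (p, B))))"
        by (rule arg_cong[OF eq[OF q]])
      also have "\<dots> = L B" by (simp add: l_def b_def)
      finally have 2: "fst (snd (z (p, B))) = L B" .
      note 1 2
      with 1 show ?thesis by (simp add: c_def s_def prod_eq_iff)
    qed
    let ?a = "L B"
    have c: "c = - (C0 ** ?a ** C0) - C0 ** ?a ** c"
      and s: "s = p + act \<phi>0 (combination h (C0 ** ?a ** C0)) + (act \<phi>0 (combination h (C0 ** ?a ** c)) - act s (combination h c))"
      using eq[OF q] unfolding zq l_def b_def by simp_all
    have s': "s + act s (combination h c) = p - act \<phi>0 (combination h c)"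
    proof -
      have "act \<phi>0 (combination h c) = - act \<phi>0 (combination h (C0 ** ?a ** C0)) - act \<phi>0 (combination h (C0 ** ?a ** c))"
        by (subst c) (simp only: u.diff linear_neg[OF u.linear_axioms] ac.diff_right ac.minus_right)
      moreover have "s + act s (combination h c) = p + act \<phi>0 (combination h (C0 ** ?a ** C0)) + act \<phi>0 (combination h (C0 ** ?a ** c))"
        by (subst (1) s) simp
      ultimately show ?thesis by simp
    qed
    have Cc: "C (p, B) = C0 + c" and \<psi>s: "\<psi> (p, B) = \<phi>0 + s" by (simp_all add: C_def \<psi>_def zq)
    have ca: "c = - (C0 ** ?a ** (C0 + c))" using c by (simp add: matrix_add_ldistrib)
    have "A0 ** (C0 + c) = mat 1 - ?a ** (C0 + c)"
    proof -
      have "A0 ** c = - (A0 ** (C0 ** ?a ** (C0 + c)))" by (subst ca) (simp only: mm.minus_right)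
      also have "A0 ** (C0 ** ?a ** (C0 + c)) = (A0 ** C0) ** ?a ** (C0 + c)" by (simp only: matrix_mul_assoc)
      finally show ?thesis by (simp add: matrix_add_ldistrib inv)
    qed
    then have 1: "(A0 + ?a) ** C (p, B) = mat 1" by (simp add: Cc mm.add_left)
    have 2: "\<psi> (p, B) + act (\<psi> (p, B)) (combination h (C (p, B) - C0)) = \<phi>0 + p"
      using s' by (simp add: Cc \<psi>s ac.add_left algebra_simps)
    have 3: "F (p, B) = - (1/2) *\<^sub>R (blinfun_apply (\<phi>0 + p) e1 *\<^sub>R (A0 + ?a)) + (\<kappa> / 2) *\<^sub>R pairing h (\<psi> (p, B))"
      unfolding F_def F0_def pr_def \<beta>_def zq \<psi>s H.add
      by (simp add: blinfun.add_left scaleR_add_left scaleR_add_right algebra_simps)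
    from 1 2 3 show ?thesis by blast
  qed
  show ?thesis
    by (rule exI[of _ r], rule conjI, rule r, rule exI[of _ F], rule exI[of _ C], rule exI[of _ \<psi>],
      intro conjI an' der' allI impI) (use main in blast)+
qed

end

section \<open>The kernels of the estimating function\<close>

lemma bl_apply_Bl: "f \<in> bl_functions \<Longrightarrow> bl_apply (Bl f) = f"
  by (rule Bl_inverse)

lemma bl_apply_sum: "finite I \<Longrightarrow> bl_apply (\<Sum>i\<in>I. f i) x = (\<Sum>i\<in>I. bl_apply (f i) x)"
  by (induction I rule: finite_induct) (simp_all add: zero_bl.rep_eq plus_bl.rep_eq)

lemma bl_apply_combination:
  "bl_apply (combination h c) x = (\<Sum>i\<in>UNIV. \<Sum>j\<in>UNIV. c $ i $ j * bl_apply (h i j) x)"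
  by (simp add: combination_def bl_apply_sum scaleR_bl.rep_eq)

definition bl_one :: "'a::euclidean_space bl" where
  "bl_one = Bl (\<lambda>x. 1)"

lemma bl_apply_one [simp]: "bl_apply bl_one x = 1"
proof -
  have "(\<lambda>x::'a. 1 :: real) \<in> bl_functions" by (rule bl_functionsI[of _ 1 0]) auto
  then show ?thesis by (simp add: bl_one_def bl_apply_Bl)
qed

text \<open>
  The constant \<open>\<epsilon>\<close> is \<open>\<nu>\<close> except for laws on the line, where a part of the constant is moved into the
  quadratic form.
\<close>

definition bl_kernel :: "real \<Rightarrow> real^'n^'n \<Rightarrow> 'n \<Rightarrow> 'n \<Rightarrow> (real^'n) bl" where
  "bl_kernel \<epsilon> D i j = Bl (\<lambda>y. (y $ i * y $ j) / (\<epsilon> + quad D y))"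

lemma t_G_nth:
  fixes A :: "'n::finite symmat"
  shows "mat_of (t_G \<nu> y A) $ i $ j = - (mat_of A $ i $ j) / 2 +
    (\<nu> + real CARD('n)) / 2 * ((y $ i * y $ j) / (\<nu> + quad (matrix_inv (mat_of A)) y))"
  by (simp add: t_G.rep_eq quad_def matrix_matrix_mult_def columnvector_def rowvector_def)

lemma const_bl: "(\<lambda>y :: 'a::euclidean_space. k) \<in> bl_functions"
  by (rule bl_functionsI[of _ "\<bar>k\<bar>" 0]) auto

text \<open>
  The kernel is an affine function of the entry of \<open>t_G\<close> for the matrix \<open>D\<^sup>-\<^sup>1\<close>, so it inherits being bounded
  Lipschitz.
\<close>

lemma bl_kernel_apply:
  fixes D :: "real^'n^'n"
  assumes "0 < \<epsilon>" "posdef D"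
  shows "bl_apply (bl_kernel \<epsilon> D i j) y = (y $ i * y $ j) / (\<epsilon> + quad D y)"
proof -
  define A where "A = symmat_of (matrix_inv D)"
  note A = posdef_symmat[OF posdef_inverse[OF assms(2)], folded A_def]
  have inv: "matrix_inv (mat_of A) = D"
    unfolding A(2) by (rule matrix_inv_inv[OF posdef_invertible[OF assms(2)]])
  define c where "c = 2 / (\<epsilon> + real CARD('n))"
  have pos: "0 < \<epsilon> + real CARD('n)" using assms(1) by (simp add: add_pos_nonneg)
  have "(\<lambda>y. c * (mat_of (t_G \<epsilon> y A) $ i $ j + mat_of A $ i $ j / 2)) \<in> bl_functions"
    by (intro bl_functions_scale bl_functions_add t_G_bl assms(1) A(1) const_bl)
  moreover have "c * (mat_of (t_G \<epsilon> y A) $ i $ j + mat_of A $ i $ j / 2) = (y $ i * y $ j) / (\<epsilon> + quad D y)" for y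
  proof -
    have "c * (- a / 2 + (\<epsilon> + real CARD('n)) / 2 * x + a / 2) = x" for a x
      using pos by (simp add: c_def)
    then show ?thesis unfolding t_G_nth inv .
  qed
  ultimately have "(\<lambda>y. (y $ i * y $ j) / (\<epsilon> + quad D y)) \<in> bl_functions" by simp
  then show ?thesis by (simp add: bl_kernel_def bl_apply_Bl)
qed

lemma bl_kernel_sym: "bl_kernel \<epsilon> D i j = bl_kernel \<epsilon> D j i"
  by (simp add: bl_kernel_def mult.commute)

lemma pairing_kernel_sym: "transpose (pairing (bl_kernel \<epsilon> D) \<psi>) = pairing (bl_kernel \<epsilon> D) \<psi>"
  by (simp add: vec_eq_iff transpose_def pairing_def bl_kernel_sym)

lemma combination_kernel_apply:
  assumes "0 < \<epsilon>" "posdef D"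
  shows "bl_apply (combination (bl_kernel \<epsilon> D) c) y = quad c y / (\<epsilon> + quad D y)"
  unfolding bl_apply_combination bl_kernel_apply[OF assms] quad_sum[of c]
  by (simp add: sum_divide_distrib)

text \<open>
  This is \<open>h D0 = (1 + u) h D\<close> for \<open>u = quad (D - D0) / (\<epsilon> + quad D0)\<close>.
\<close>

lemma kernel_perturbation:
  assumes "0 < \<epsilon>" "posdef D0" "posdef D"
  shows "bl_kernel \<epsilon> D0 i j = bl_kernel \<epsilon> D i j + bl_mult (combination (bl_kernel \<epsilon> D0) (D - D0)) (bl_kernel \<epsilon> D i j)"
proof (rule bl_eqI)
  fix y
  have p: "0 < \<epsilon> + quad D y" "0 < \<epsilon> + quad D0 y" using assms quad_nonneg by (auto intro: add_pos_nonneg)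
  have q: "quad (D - D0) y = quad D y - quad D0 y"
    by (simp add: quad_def matrix_vector_mult_diff_rdistrib inner_diff_right)
  have "a / s = a / t + (t - s) / s * (a / t)" if "0 < s" "0 < t" for a s t :: real
    using that by (simp add: field_simps)
  from this[OF p(2,1)]
  show "bl_apply (bl_kernel \<epsilon> D0 i j) y = bl_apply (bl_kernel \<epsilon> D i j + bl_mult (combination (bl_kernel \<epsilon> D0) (D - D0)) (bl_kernel \<epsilon> D i j)) y"
    by (simp add: plus_bl.rep_eq bl_mult.rep_eq combination_kernel_apply bl_kernel_apply assms q)
qed

lemma pairing_kernel_transfer:
  assumes "0 < \<epsilon>" "posdef D0" "posdef D"
    and \<psi>: "\<psi> + act \<psi> (combination (bl_kernel \<epsilon> D0) (D - D0)) = \<phi>"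
  shows "pairing (bl_kernel \<epsilon> D0) \<psi> = pairing (bl_kernel \<epsilon> D) \<phi>"
proof -
  have "blinfun_apply \<psi> (bl_kernel \<epsilon> D0 i j) = blinfun_apply \<phi> (bl_kernel \<epsilon> D i j)" for i j
    unfolding kernel_perturbation[OF assms(1-3), of i j] \<psi>[symmetric]
    by (simp add: blinfun.add_left blinfun.add_right)
  then show ?thesis by (simp add: pairing_def)
qed

lemma mat_of_t_F:
  fixes A :: "'n::finite symmat"
  assumes "0 < \<nu>" "A \<in> pos_def"
  shows "mat_of (t_F \<nu> \<phi> A) = - (1/2) *\<^sub>R (blinfun_apply \<phi> bl_one *\<^sub>R mat_of A) +
    ((\<nu> + real CARD('n)) / 2) *\<^sub>R pairing (bl_kernel \<nu> (matrix_inv (mat_of A))) \<phi>"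
proof -
  have C: "posdef (matrix_inv (mat_of A))" using assms(2) by (simp add: pos_def_iff posdef_inverse)
  have "Bl (\<lambda>y. mat_of (t_G \<nu> y A) $ i $ j) = (- (mat_of A $ i $ j) / 2) *\<^sub>R bl_one +
      ((\<nu> + real CARD('n)) / 2) *\<^sub>R bl_kernel \<nu> (matrix_inv (mat_of A)) i j" for i j
    by (rule bl_eqI) (subst bl_apply_Bl[OF t_G_bl[OF assms]], unfold t_G_nth plus_bl.rep_eq scaleR_bl.rep_eq
      bl_kernel_apply[OF assms(1) C] bl_apply_one, simp)
  then have "mat_of (t_F \<nu> \<phi> A) $ i $ j = (- (1/2) *\<^sub>R (blinfun_apply \<phi> bl_one *\<^sub>R mat_of A) +
    ((\<nu> + real CARD('n)) / 2) *\<^sub>R pairing (bl_kernel \<nu> (matrix_inv (mat_of A))) \<phi>) $ i $ j" for i j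
    by (simp add: t_F_entry blinfun.add_right blinfun.diff_right blinfun.scaleR_right pairing_def)
  then show ?thesis by (simp add: vec_eq_iff)
qed

section \<open>Symmetric matrices as a normed space\<close>

text \<open>
  A bounded linear left inverse of \<open>mat_of\<close>: results of computations with plain matrices are brought
  back to \<open>symmat\<close> by it.
\<close>

definition sym_part :: "real^'n::finite^'n \<Rightarrow> 'n symmat" where
  "sym_part X = symmat_of ((1/2) *\<^sub>R (X + transpose X))"

lemma mat_of_sym_part: "mat_of (sym_part X) = (1/2) *\<^sub>R (X + transpose X)"
  unfolding sym_part_def by (rule symmat_of_inverse) (simp add: transpose_def vec_eq_iff add.commute)

lemma symmat_eq_iff: "A = B \<longleftrightarrow> mat_of A = mat_of B"
  by (simp add: mat_of_inject)

lemma sym_part_symmetric: "transpose X = X \<Longrightarrow> mat_of (sym_part X) = X"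
  by (simp add: mat_of_sym_part scaleR_2[symmetric])

lemma sym_part_mat_of [simp]: "sym_part (mat_of A) = A"
  by (simp add: symmat_eq_iff sym_part_symmetric)

lemma bounded_linear_mat_of: "bounded_linear mat_of"
  by (rule bounded_linear_intro[where K = 1]) (simp_all add: plus_symmat.rep_eq scaleR_symmat.rep_eq norm_symmat.rep_eq)

lemma bounded_linear_transpose: "bounded_linear (transpose :: real^'n::finite^'n \<Rightarrow> real^'n^'n)"
  by (rule bounded_linear_matrixI) (simp add: transpose_def,
    rule bounded_linear_compose[OF bounded_linear_vec_nth bounded_linear_vec_nth])

lemma bounded_linear_sym_part: "bounded_linear sym_part"
proof -
  have "bounded_linear (\<lambda>X :: real^'a^'a. (1/2) *\<^sub>R (X + transpose X))"
    by (intro bounded_linear_const_scaleR bounded_linear_add bounded_linear_ident bounded_linear_transpose)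
  then interpret m: bounded_linear "\<lambda>X :: real^'a^'a. (1/2) *\<^sub>R (X + transpose X)" .
  obtain K where K: "\<And>X :: real^'a^'a. norm ((1/2) *\<^sub>R (X + transpose X)) \<le> norm X * K" using m.bounded by blast
  show ?thesis
  proof (rule bounded_linear_intro[where K = K])
    fix X Y :: "real^'a^'a" and r :: real
    show "sym_part (X + Y) = sym_part X + sym_part Y"
      using m.add[of X Y] by (simp add: symmat_eq_iff plus_symmat.rep_eq mat_of_sym_part)
    show "sym_part (r *\<^sub>R X) = r *\<^sub>R sym_part X"
      using m.scaleR[of r X] by (simp add: symmat_eq_iff scaleR_symmat.rep_eq mat_of_sym_part)
    show "norm (sym_part X) \<le> norm X * K" using K[of X] by (simp add: norm_symmat.rep_eq mat_of_sym_part)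
  qed
qed

lemma posdef_perturb:
  fixes D0 :: "real^'n^'n"
  assumes "posdef D0"
  obtains e where "0 < e" "\<And>D. transpose D = D \<Longrightarrow> norm (D - D0) < e \<Longrightarrow> posdef D"
proof -
  obtain c where c: "0 < c" "\<And>x. c * (norm x)\<^sup>2 \<le> quad D0 x"
    using posdef_coercive[OF assms] unfolding quad_def by blast
  let ?N = "real CARD('n) * real CARD('n)"
  have N: "0 < ?N" by simp
  have "posdef D" if "transpose D = D" "norm (D - D0) < c / ?N" for D
    unfolding posdef_def
  proof (intro conjI allI impI that)
    fix x :: "real^'n" assume "x \<noteq> 0"
    have "?N * norm (D - D0) < c" using that(2) N by (simp add: pos_less_divide_eq mult.commute)
    then have "?N * norm (D - D0) * (norm x)\<^sup>2 < c * (norm x)\<^sup>2" using \<open>x \<noteq> 0\<close> by (intro mult_strict_right_mono) auto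
    moreover have "- quad (D - D0) x \<le> ?N * norm (D - D0) * (norm x)\<^sup>2" using quad_norm_bound[of "D - D0" x] by linarith
    moreover have "quad D x = quad D0 x + quad (D - D0) x"
      by (simp add: quad_def matrix_vector_mult_diff_rdistrib inner_diff_right)
    ultimately have "0 < quad D x" using c(2)[of x] by linarith
    then show "0 < x \<bullet> (D *v x)" by (simp add: quad_def)
  qed
  then show ?thesis using that[of "c / ?N"] c(1) N by simp
qed

lemma open_pos_def: "open (pos_def :: 'n::finite symmat set)"
proof -
  have "\<exists>e>0. \<forall>B. dist B A < e \<longrightarrow> B \<in> pos_def" if "A \<in> pos_def" for A :: "'n symmat"
  proof -
    have "posdef (mat_of A)" using that by (simp add: pos_def_iff)
    then obtain e where "0 < e" "\<And>D. transpose D = D \<Longrightarrow> norm (D - mat_of A) < e \<Longrightarrow> posdef D"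
      using posdef_perturb by blast
    then show ?thesis
      by (intro exI[of _ e]) (auto simp: pos_def_iff dist_norm norm_symmat.rep_eq minus_symmat.rep_eq)
  qed
  then show ?thesis unfolding open_dist by blast
qed

section \<open>Analyticity of the estimating function\<close>

text \<open>
  The abstract system with the kernels of \<open>C0\<close>. Near the base point its component \<open>C\<close> is the inverse of a positive
  definite matrix, so that \<open>pairing_kernel_transfer\<close> identifies its output with \<open>t_F\<close>.
\<close>

lemma estimating_function_local:
  fixes \<phi>0 :: "(real^'n::finite) bl_dual" and A0 :: "'n symmat"
  assumes nu: "0 < \<nu>" and A0: "A0 \<in> pos_def"
  defines "C0 \<equiv> matrix_inv (mat_of A0)" and "\<kappa> \<equiv> \<nu> + real CARD('n)"
  shows "\<exists>r>0. \<exists>F. frechet_analytic_on (ball 0 r) F \<and>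
    (F has_derivative (\<lambda>(p, B). - (1/2) *\<^sub>R (blinfun_apply \<phi>0 bl_one *\<^sub>R mat_of B + blinfun_apply p bl_one *\<^sub>R mat_of A0) +
      (\<kappa> / 2) *\<^sub>R pairing (bl_kernel \<nu> C0) (p + act \<phi>0 (combination (bl_kernel \<nu> C0) (C0 ** mat_of B ** C0))))) (at 0) \<and>
    (\<forall>p B. norm (p, B) < r \<longrightarrow> A0 + B \<in> pos_def \<and> F (p, B) = mat_of (t_F \<nu> (\<phi>0 + p) (A0 + B)))"
proof -
  have pA0: "posdef (mat_of A0)" using A0 by (simp add: pos_def_iff)
  have C0: "posdef C0" unfolding C0_def by (rule posdef_inverse[OF pA0])
  have inv: "mat_of A0 ** C0 = mat 1" unfolding C0_def by (rule matrix_inv_right_left(1)[OF posdef_invertible[OF pA0]])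
  obtain r F C \<psi> where r: "0 < r" and an: "frechet_analytic_on (ball 0 r) F"
    and der: "(F has_derivative (\<lambda>(p, B). - (1/2) *\<^sub>R (blinfun_apply \<phi>0 bl_one *\<^sub>R mat_of B + blinfun_apply p bl_one *\<^sub>R mat_of A0) +
      (\<kappa> / 2) *\<^sub>R pairing (bl_kernel \<nu> C0) (p + act \<phi>0 (combination (bl_kernel \<nu> C0) (C0 ** mat_of B ** C0))))) (at 0)"
    and main: "\<And>p B. norm (p, B) < r \<Longrightarrow> (mat_of A0 + mat_of B) ** C (p, B) = mat 1 \<and>
      \<psi> (p, B) + act (\<psi> (p, B)) (combination (bl_kernel \<nu> C0) (C (p, B) - C0)) = \<phi>0 + p \<and>
      F (p, B) = - (1/2) *\<^sub>R (blinfun_apply (\<phi>0 + p) bl_one *\<^sub>R (mat_of A0 + mat_of B)) +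
        (\<kappa> / 2) *\<^sub>R pairing (bl_kernel \<nu> C0) (\<psi> (p, B))"
    using estimating_function_system[OF inv bounded_linear_mat_of, of \<phi>0 bl_one \<kappa> "bl_kernel \<nu> C0"] by blast
  obtain e where e: "0 < e" "\<And>B. dist B A0 < e \<Longrightarrow> B \<in> pos_def"
    using open_pos_def A0 unfolding open_dist by blast
  have "A0 + B \<in> pos_def \<and> F (p, B) = mat_of (t_F \<nu> (\<phi>0 + p) (A0 + B))" if q: "norm (p, B) < min r e" for p B
  proof -
    have "norm B < e" using norm_snd_le[of B p] q by simp
    then have pd: "A0 + B \<in> pos_def" by (intro e(2)) (simp add: dist_norm)
    have q': "norm (p, B) < r" using q by simp
    note m = main[OF q']
    have Ci: "C (p, B) = matrix_inv (mat_of (A0 + B))"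
      using m matrix_inv_eqI(1)[of "mat_of A0 + mat_of B" "C (p, B)"] by (simp add: plus_symmat.rep_eq)
    then have C: "posdef (C (p, B))" using pd by (simp add: pos_def_iff posdef_inverse)
    have "pairing (bl_kernel \<nu> C0) (\<psi> (p, B)) = pairing (bl_kernel \<nu> (C (p, B))) (\<phi>0 + p)"
      by (rule pairing_kernel_transfer[OF nu C0 C]) (use m in blast)
    then show ?thesis using m pd Ci by (simp add: mat_of_t_F[OF nu pd] plus_symmat.rep_eq \<kappa>_def)
  qed
  moreover have "frechet_analytic_on (ball 0 (min r e)) F"
    by (rule frechet_analytic_on_subset[OF an]) auto
  ultimately show ?thesis using r e(1) der by (intro exI[of _ "min r e"] conjI exI[of _ F]) auto
qed

theorem t_F_analytic:
  assumes nu: "0 < \<nu>"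
  shows "frechet_analytic_on (UNIV \<times> pos_def) (\<lambda>(\<phi> :: (real^'n::finite) bl_dual, A). t_F \<nu> \<phi> A)"
proof (rule frechet_analytic_on_local)
  show "open (UNIV \<times> (pos_def :: 'n symmat set))" by (intro open_Times open_UNIV open_pos_def)
  fix x :: "(real^'n) bl_dual \<times> 'n symmat" assume "x \<in> UNIV \<times> pos_def"
  then obtain \<phi>0 A0 where x: "x = (\<phi>0, A0)" and A0: "A0 \<in> pos_def" by auto
  obtain r F where r: "0 < r" and an: "frechet_analytic_on (ball 0 r) F"
    and F: "\<And>p B. norm (p, B) < r \<Longrightarrow> F (p, B) = mat_of (t_F \<nu> (\<phi>0 + p) (A0 + B))"
    using estimating_function_local[OF nu A0, of \<phi>0] by blast
  have "frechet_analytic_on (ball 0 r) (\<lambda>q. 0 + sym_part (F q))"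
    by (rule frechet_analytic_on_compose_linear[OF bounded_linear_sym_part an])
  then have "frechet_analytic_on {y. y + (- x) \<in> ball 0 r} (\<lambda>y. 0 + sym_part (F (y + (- x))))"
    by (rule frechet_analytic_on_precompose_affine[OF bounded_linear_ident])
  moreover have "{y. y + (- x) \<in> ball 0 r} = ball x r" by (auto simp: dist_norm norm_minus_commute)
  ultimately have "frechet_analytic_on (ball x r) (\<lambda>y. sym_part (F (y - x)))" by simp
  then have "frechet_analytic_on (ball x r) (\<lambda>(\<phi>, A). t_F \<nu> \<phi> A)"
  proof (rule frechet_analytic_on_cong)
    fix y assume y: "y \<in> ball x r"
    obtain \<phi> A where yy: "y = (\<phi>, A)" by force
    have "norm (y - x) < r" using y by (simp add: dist_norm norm_minus_commute)
    then have "norm (\<phi> - \<phi>0, A - A0) < r" by (simp add: x yy)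
    from F[OF this] show "sym_part (F (y - x)) = (case y of (\<phi>, A) \<Rightarrow> t_F \<nu> \<phi> A)" by (simp add: x yy)
  qed
  then show "\<exists>r>0. frechet_analytic_on (ball x r) (\<lambda>(\<phi>, A). t_F \<nu> \<phi> A)" using r by blast
qed

section \<open>Invertibility of the linearization\<close>

lemma posdef_cauchy_schwarz:
  fixes A :: "real^'n^'n"
  assumes A: "posdef A"
  shows "(u \<bullet> (A *v v))\<^sup>2 \<le> quad A u * quad A v"
proof (cases "v = 0")
  case True
  then show ?thesis by (simp add: quad_def)
next
  case False
  have q: "0 < quad A v" using A False by (simp add: posdef_def quad_def)
  define t where "t = (u \<bullet> (A *v v)) / quad A v"
  have sym: "v \<bullet> (A *v u) = u \<bullet> (A *v v)"
    using symmetric_inner[of A v u] A by (simp add: posdef_def inner_commute)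
  have "0 \<le> quad A (u - t *\<^sub>R v)" by (rule quad_nonneg[OF A])
  also have "\<dots> = quad A u - 2 * t * (u \<bullet> (A *v v)) + t\<^sup>2 * quad A v"
    using sym by (simp add: quad_def matrix_vector_mult_diff_distrib matrix_vector_mult_scaleR
      inner_diff_left inner_diff_right power2_eq_square algebra_simps)
  also have "\<dots> = quad A u - (u \<bullet> (A *v v))\<^sup>2 / quad A v"
    using q by (simp add: t_def power2_eq_square field_simps)
  finally show ?thesis using q by (simp add: pos_divide_le_eq)
qed

context law_scatter
begin

lemma pairing_kernel_law:
  assumes "posdef C"
  shows "dof *\<^sub>R pairing (bl_kernel \<nu> C) (law_phi Q) = weighted_cov C"
  by (simp add: vec_eq_iff pairing_def weighted_cov_def law_phi_apply[OF law] bl_kernel_apply[OF nu assms])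

lemma law_phi_one: "blinfun_apply (law_phi Q) bl_one = 1"
  by (simp add: law_phi_apply[OF law] prob_space[unfolded space_Q])

lemma critical_iff_pairing:
  assumes "posdef A"
  shows "critical A \<longleftrightarrow> dof *\<^sub>R pairing (bl_kernel \<nu> (matrix_inv A)) (law_phi Q) = A"
  using assms by (simp add: critical_def pairing_kernel_law posdef_inverse)

text \<open>
  Integrating a quadratic form against the weight is pairing it with the weighted covariance.
\<close>

lemma quad_weight_integrable:
  assumes "posdef C"
  shows "integrable Q (\<lambda>y. quad D y / (\<nu> + quad C y))"
    and "dof * (\<integral>y. quad D y / (\<nu> + quad C y) \<partial>Q) = (\<Sum>i\<in>UNIV. \<Sum>j\<in>UNIV. D $ i $ j * weighted_cov C $ i $ j)"
proof -
  have eq: "quad D y / (\<nu> + quad C y) = (\<Sum>i\<in>UNIV. 1 * (\<Sum>j\<in>UNIV. D $ i $ j * ((y $ i * y $ j) / (\<nu> + quad C y))))" for y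
    by (simp add: quad_sum[of D] sum_divide_distrib)
  note i1 = linear_combination_integral[OF weight_integrable[OF assms]]
  show "integrable Q (\<lambda>y. quad D y / (\<nu> + quad C y))"
    unfolding eq by (rule linear_combination_integral(1), rule i1(1))
  have "(\<integral>y. quad D y / (\<nu> + quad C y) \<partial>Q) =
      (\<Sum>i\<in>UNIV. 1 * (\<integral>y. (\<Sum>j\<in>UNIV. D $ i $ j * ((y $ i * y $ j) / (\<nu> + quad C y))) \<partial>Q))"
    unfolding eq by (rule linear_combination_integral(2), rule i1(1))
  also have "\<dots> = (\<Sum>i\<in>UNIV. \<Sum>j\<in>UNIV. D $ i $ j * (\<integral>y. (y $ i * y $ j) / (\<nu> + quad C y) \<partial>Q))"
    unfolding i1(2) by simp
  finally show "dof * (\<integral>y. quad D y / (\<nu> + quad C y) \<partial>Q) = (\<Sum>i\<in>UNIV. \<Sum>j\<in>UNIV. D $ i $ j * weighted_cov C $ i $ j)"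
    by (simp add: weighted_cov_def sum_distrib_left mult.left_commute)
qed

end

context spread_law_scatter
begin

text \<open>
  Put \<open>T = B' A B\<close>, so that \<open>y' T y\<close> is the \<open>A\<close>-norm of \<open>B y\<close>, and let \<open>d y = \<nu> + y' C y\<close>. Let \<open>E\<close> be the trace
  of \<open>T A\<close>. The fixed point equation for \<open>A\<close> gives \<open>E = dof * \<integral> (y' T y) / d\<close>, and the hypothesis paired with
  \<open>B\<close> gives \<open>E = dof * \<integral> (y' B y)\<^sup>2 / d\<^sup>2\<close>. But \<open>y' B y = (C y)' A (B y)\<close>, and the Cauchy-Schwarz inequality bounds
  its square by \<open>(y' C y) (y' T y) = (d - \<nu>) (y' T y)\<close>. Hence \<open>\<nu> * \<integral> (y' T y) / d\<^sup>2 \<le> 0\<close>, so \<open>B y = 0\<close> almost surely.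
\<close>

theorem linearization_injective:
  fixes B :: "real^'n^'n"
  assumes crit: "critical A"
    and eq: "A ** B ** A = (\<chi> i j. dof * (\<integral>y. quad B y / (\<nu> + quad (matrix_inv A) y) * ((y $ i * y $ j) / (\<nu> + quad (matrix_inv A) y)) \<partial>Q))"
  shows "B = 0"
proof -
  have A: "posdef A" and wA: "weighted_cov (matrix_inv A) = A" using crit by (auto simp: critical_def)
  define C where "C = matrix_inv A"
  have C: "posdef C" unfolding C_def by (rule posdef_inverse[OF A])
  have AC: "A ** C = mat 1" unfolding C_def by (rule matrix_inv_right_left(1)[OF posdef_invertible[OF A]])
  have At: "transpose A = A" using A by (simp add: posdef_def)
  define T where "T = transpose B ** A ** B"
  define E where "E = (\<Sum>i\<in>UNIV. \<Sum>j\<in>UNIV. T $ i $ j * A $ i $ j)"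
  have T: "quad T y = quad A (B *v y)" for y
  proof -
    have "quad T y = y \<bullet> (transpose B *v (A *v (B *v y)))"
      by (simp only: quad_def T_def matrix_vector_mul_assoc matrix_mul_assoc)
    then show ?thesis by (simp only: inner_transpose_mult quad_def)
  qed
  have T0: "0 \<le> quad T y" for y unfolding T by (rule quad_nonneg[OF A])
  let ?d = "\<lambda>y. \<nu> + quad C y"
  have d: "0 < ?d y" for y by (rule denominator_pos[OF C])
  have ET: "dof * (\<integral>y. quad T y / ?d y \<partial>Q) = E"
    using quad_weight_integrable(2)[OF C, of T] wA by (simp add: E_def C_def)
  note iT = quad_weight_integrable(1)[OF C, of T]
  have cs: "(quad B y)\<^sup>2 \<le> quad C y * quad T y" for y
  proof -
    have "quad B y = (A *v (C *v y)) \<bullet> (B *v y)" by (simp add: quad_def matrix_vector_mul_assoc AC)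
    also have "\<dots> = (C *v y) \<bullet> (A *v (B *v y))" by (rule symmetric_inner[OF At, symmetric])
    finally have "(quad B y)\<^sup>2 \<le> quad A (C *v y) * quad A (B *v y)" using posdef_cauchy_schwarz[OF A] by simp
    also have "quad A (C *v y) = quad C y"
      by (simp add: quad_def matrix_vector_mul_assoc AC inner_commute)
    finally show ?thesis by (simp add: T)
  qed
  have cont: "continuous_on UNIV (\<lambda>y. quad D y / ?d y)" for D
    by (intro continuous_intros) (metis d less_irrefl)
  have qb: "\<exists>K. \<forall>y. \<bar>quad D y / ?d y\<bar> \<le> K" for D
  proof -
    obtain c where c: "0 < c" "\<And>x. c * (norm x)\<^sup>2 \<le> quad C x"
      using posdef_coercive[OF C] unfolding quad_def by blast
    let ?N = "real CARD('n) * real CARD('n) * norm D"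
    have "\<bar>quad D y\<bar> \<le> ?N / c * ?d y" for y
    proof -
      have "(norm y)\<^sup>2 \<le> ?d y / c" using c nu by (simp add: pos_le_divide_eq mult.commute add_increasing)
      then have "?N * (norm y)\<^sup>2 \<le> ?N * (?d y / c)" by (intro mult_left_mono) auto
      then show ?thesis using quad_norm_bound[of D y] by simp
    qed
    then have "\<bar>quad D y / ?d y\<bar> \<le> ?N / c" for y
      using d[of y] by (simp add: pos_divide_le_eq)
    then show ?thesis by blast
  qed
  have prod_i: "integrable Q (\<lambda>y. f y * g y)" if fg: "continuous_on UNIV f" "continuous_on UNIV g"
      "\<exists>K. \<forall>y. \<bar>f y\<bar> \<le> K" "\<exists>K. \<forall>y. \<bar>g y\<bar> \<le> K" for f g :: "real^'n \<Rightarrow> real"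
  proof -
    obtain K L where KL: "\<And>y. \<bar>f y\<bar> \<le> K" "\<And>y. \<bar>g y\<bar> \<le> L" using fg by blast
    have K0: "0 \<le> K" using KL(1) abs_ge_zero order_trans by blast
    show ?thesis
      by (rule continuous_bounded_integrable[where B = "K * L"])
        (use fg KL K0 in \<open>auto simp: abs_mult intro!: mult_mono continuous_intros\<close>)
  qed
  have iBB: "integrable Q (\<lambda>y. quad B y / ?d y * (quad B y / ?d y))" by (intro prod_i cont qb)
  have inu: "continuous_on UNIV (\<lambda>y. 1 / ?d y)" "\<exists>K. \<forall>y. \<bar>1 / ?d y\<bar> \<le> K"
  proof -
    show "continuous_on UNIV (\<lambda>y. 1 / ?d y)" by (intro continuous_intros) (metis d less_irrefl)
    have "\<bar>1 / ?d y\<bar> \<le> 1 / \<nu>" for y using quad_nonneg[OF C, of y] nu by (simp add: frac_le)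
    then show "\<exists>K. \<forall>y. \<bar>1 / ?d y\<bar> \<le> K" by blast
  qed
  have iT2: "integrable Q (\<lambda>y. quad T y / ?d y * (1 / ?d y))" by (intro prod_i cont qb inu)
  have EB: "E = dof * (\<integral>y. quad B y / ?d y * (quad B y / ?d y) \<partial>Q)"
  proof -
    have iw: "integrable Q (\<lambda>y. quad B y / ?d y * ((y $ i * y $ j) / ?d y))" for i j
    proof -
      define S :: "real^'n^'n" where "S = (\<chi> k l. if k = i \<and> l = j then 1 else 0)"
      have "quad S y = y $ i * y $ j" for y
      proof -
        have "quad S y = (\<Sum>k\<in>UNIV. \<Sum>l\<in>UNIV. (if k = i \<and> l = j then y $ k * y $ l else 0))"
          unfolding quad_sum S_def by (intro sum.cong refl) auto
        also have "\<dots> = y $ i * y $ j"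
          by (subst sum_eq_single[of _ i]; simp add: sum_eq_single[of _ j])
        finally show ?thesis .
      qed
      then show ?thesis using prod_i[OF cont[of B] cont[of S] qb qb] by simp
    qed
    have "(\<Sum>i\<in>UNIV. \<Sum>j\<in>UNIV. B $ i $ j * (A ** B ** A) $ i $ j) = E"
    proof -
      have "(\<Sum>i\<in>UNIV. \<Sum>j\<in>UNIV. B $ i $ j * (A ** B ** A) $ i $ j) =
          (\<Sum>i\<in>UNIV. \<Sum>j\<in>UNIV. B $ i $ j * (A ** (B ** A)) $ i $ j)" by (simp only: matrix_mul_assoc)
      also have "\<dots> = trace (transpose B ** (A ** (B ** A)))"
        by (subst sum.swap) (simp add: trace_def matrix_matrix_mult_def transpose_def)
      also have "transpose B ** (A ** (B ** A)) = T ** A" by (simp only: T_def matrix_mul_assoc)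
      also have "trace (T ** A) = E"
        using At by (simp add: trace_def matrix_matrix_mult_def E_def transpose_def vec_eq_iff)
      finally show ?thesis .
    qed
    moreover have "(\<Sum>i\<in>UNIV. \<Sum>j\<in>UNIV. B $ i $ j * (A ** B ** A) $ i $ j) =
        dof * (\<integral>y. quad B y / ?d y * (quad B y / ?d y) \<partial>Q)"
    proof -
      have q: "quad B y / ?d y * (quad B y / ?d y) =
          (\<Sum>i\<in>UNIV. 1 * (\<Sum>j\<in>UNIV. B $ i $ j * (quad B y / ?d y * ((y $ i * y $ j) / ?d y))))" for y
        by (subst (3) quad_sum) (simp add: sum_divide_distrib sum_distrib_left mult_ac)
      have "(\<integral>y. quad B y / ?d y * (quad B y / ?d y) \<partial>Q) =
          (\<Sum>i\<in>UNIV. 1 * (\<integral>y. (\<Sum>j\<in>UNIV. B $ i $ j * (quad B y / ?d y * ((y $ i * y $ j) / ?d y))) \<partial>Q))"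
        unfolding q by (rule linear_combination_integral(2), rule linear_combination_integral(1)[OF iw])
      also have "\<dots> = (\<Sum>i\<in>UNIV. \<Sum>j\<in>UNIV. B $ i $ j * (\<integral>y. quad B y / ?d y * ((y $ i * y $ j) / ?d y) \<partial>Q))"
        unfolding linear_combination_integral(2)[OF iw] by simp
      finally show ?thesis unfolding eq C_def[symmetric]
        by (simp add: sum_distrib_left mult.left_commute)
    qed
    ultimately show ?thesis by simp
  qed
  have le: "quad B y / ?d y * (quad B y / ?d y) \<le> quad T y / ?d y - \<nu> * (quad T y / ?d y * (1 / ?d y))" for y
  proof -
    have "quad B y / ?d y * (quad B y / ?d y) = (quad B y)\<^sup>2 / (?d y)\<^sup>2" by (simp add: power2_eq_square)
    also have "\<dots> \<le> (quad C y * quad T y) / (?d y)\<^sup>2" by (intro divide_right_mono cs) auto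
    also have "\<dots> = quad T y / ?d y - \<nu> * (quad T y / ?d y * (1 / ?d y))"
    proof -
      have "((e - n) * t) / e\<^sup>2 = t / e - n * (t / e * (1 / e))" if "0 < e" for e n t :: real
        using that by (simp add: power2_eq_square field_simps)
      from this[OF d[of y], of \<nu> "quad T y"] show ?thesis by simp
    qed
    finally show ?thesis .
  qed
  have "E \<le> dof * ((\<integral>y. quad T y / ?d y \<partial>Q) - \<nu> * (\<integral>y. quad T y / ?d y * (1 / ?d y) \<partial>Q))"
  proof -
    have "(\<integral>y. quad B y / ?d y * (quad B y / ?d y) \<partial>Q) \<le> (\<integral>y. quad T y / ?d y - \<nu> * (quad T y / ?d y * (1 / ?d y)) \<partial>Q)"
      by (intro integral_mono iBB Bochner_Integration.integrable_diff iT integrable_mult_right iT2 le)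
    also have "\<dots> = (\<integral>y. quad T y / ?d y \<partial>Q) - \<nu> * (\<integral>y. quad T y / ?d y * (1 / ?d y) \<partial>Q)"
      unfolding Bochner_Integration.integral_diff[OF iT integrable_mult_right[OF iT2]] by (simp only: integral_mult_right_zero)
    finally show ?thesis unfolding EB using dof_pos by (intro mult_left_mono) auto
  qed
  then have "E \<le> E - dof * \<nu> * (\<integral>y. quad T y / ?d y * (1 / ?d y) \<partial>Q)"
    unfolding right_diff_distrib ET by (simp only: mult.assoc)
  then have "dof * \<nu> * (\<integral>y. quad T y / ?d y * (1 / ?d y) \<partial>Q) \<le> 0" by linarith
  moreover have "x \<le> 0" if "k * x \<le> 0" "0 < k" for k x :: real
    using that mult_pos_pos[of k x] by linarith
  ultimately have "(\<integral>y. quad T y / ?d y * (1 / ?d y) \<partial>Q) \<le> 0"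
    using mult_pos_pos[OF dof_pos nu] by blast
  moreover have t0: "0 \<le> quad T y / ?d y * (1 / ?d y)" for y using T0 d[of y] by simp
  moreover have "0 \<le> (\<integral>y. quad T y / ?d y * (1 / ?d y) \<partial>Q)" using t0 by (intro integral_nonneg_AE) auto
  ultimately have "(\<integral>y. quad T y / ?d y * (1 / ?d y) \<partial>Q) = 0" by linarith
  then have "AE y in Q. quad T y / ?d y * (1 / ?d y) = 0"
    using integral_nonneg_eq_0_iff_AE[OF iT2] t0 by simp
  then have ae: "AE y in Q. y \<in> {y. B *v y = 0}"
  proof eventually_elim
    case (elim y)
    then have "quad A (B *v y) = 0" using d[of y] by (simp add: T)
    then have "B *v y = 0" using A unfolding posdef_def quad_def by force
    then show ?case by simp
  qed
  have "closed {y. B *v y = 0}" by (intro closed_Collect_eq continuous_intros)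
  then have "{y. B *v y = 0} \<in> sets Q" by simp
  then have one: "measure Q {y. B *v y = 0} = 1" using ae prob_eq_1 by simp
  have sub: "subspace {y. B *v y = 0}"
    by (auto simp: subspace_def matrix_vector_right_distrib matrix_vector_mult_scaleR)
  have "\<not> dim {y. B *v y = 0} < CARD('n)" using subspace_measure(2)[OF sub] one by auto
  then have "dim {y. B *v y = 0} = DIM(real^'n)"
    using dim_subset_UNIV[of "{y. B *v y = 0}"] by simp
  then have "{y. B *v y = 0} = UNIV" using sub by (metis dim_eq_full span_eq_iff)
  then show "B = 0" by (auto simp: matrix_eq)
qed

lemma linearization_law:
  assumes "posdef C"
  shows "dof *\<^sub>R pairing (bl_kernel \<nu> C) (act (law_phi Q) (combination (bl_kernel \<nu> C) B)) =
    (\<chi> i j. dof * (\<integral>y. quad B y / (\<nu> + quad C y) * ((y $ i * y $ j) / (\<nu> + quad C y)) \<partial>Q))"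
  by (simp add: vec_eq_iff pairing_def law_phi_apply[OF law] bl_mult.rep_eq
      combination_kernel_apply[OF nu assms] bl_kernel_apply[OF nu assms])

end

section \<open>The derivative of the estimating function in the inverse matrix\<close>

text \<open>
  The inverse \<open>A0 + x\<close> of \<open>C0 + c\<close> satisfies \<open>x = - A0 c A0 - A0 c x\<close>, again a quadratic equation.
\<close>

lemma symmat_inv_has_derivative:
  fixes A0 :: "'n::finite symmat"
  assumes "A0 \<in> pos_def"
  shows "((\<lambda>c. symmat_inv (symmat_inv A0 + c) - A0) has_derivative
    (\<lambda>c. sym_part (- (mat_of A0 ** mat_of c ** mat_of A0)))) (at 0)"
proof -
  interpret mm: bounded_bilinear "(**) :: real^'n^'n \<Rightarrow> real^'n^'n \<Rightarrow> real^'n^'n"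
    by (rule bounded_bilinear_matrix_mult)
  define A where "A = mat_of A0"
  define C where "C = matrix_inv A"
  have pA: "posdef A" using assms by (simp add: A_def pos_def_iff)
  have AC: "A ** C = mat 1" "C ** A = mat 1"
    unfolding C_def by (rule matrix_inv_right_left[OF posdef_invertible[OF pA]])+
  have C: "mat_of (symmat_inv A0) = C" using symmat_inv_pos_def(1)[OF assms] by (simp add: C_def A_def)
  define l where "l c = (mat_of c, - (A ** mat_of c ** A))" for c :: "'n symmat"
  define b :: "(real^'n^'n) \<times> (real^'n^'n) \<Rightarrow> (real^'n^'n) \<times> (real^'n^'n) \<Rightarrow> (real^'n^'n) \<times> (real^'n^'n)"
    where "b z z' = (0, - (A ** fst z ** snd z'))" for z z'
  have AcA: "bounded_linear (\<lambda>c. A ** mat_of c ** A)"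
    by (rule bounded_linear_compose[OF mm.bounded_linear_left bounded_linear_compose[OF mm.bounded_linear_right bounded_linear_mat_of]])
  have l: "bounded_linear l"
    unfolding l_def[abs_def] by (intro bounded_linear_Pair bounded_linear_mat_of bounded_linear_minus AcA)
  have b: "bounded_bilinear b"
    unfolding b_def[abs_def]
    by (intro bounded_bilinear_Pair bounded_bilinear_zero bounded_bilinear_minus
      mm.comp[OF bounded_linear_compose[OF mm.bounded_linear_right bounded_linear_fst] bounded_linear_snd])
  obtain r z where r: "0 < r" and der: "((\<lambda>q. snd (z q) + 0) has_derivative (\<lambda>q. snd (l q))) (at 0)"
    and eq: "\<And>q. norm q < r \<Longrightarrow> z q = l q + b (z q) (z q)"
    using quadratic_system[OF l b bounded_linear_snd bounded_bilinear_zero] by blast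
  have inv: "mat_of (symmat_inv (symmat_inv A0 + c)) = A + snd (z c)" if c: "norm c < r" for c
  proof -
    define a where "a = snd (z c)"
    have "fst (z c) = fst (l c + b (z c) (z c))" by (rule arg_cong[OF eq[OF c]])
    then have f: "fst (z c) = mat_of c" by (simp add: l_def b_def)
    have "snd (z c) = snd (l c + b (z c) (z c))" by (rule arg_cong[OF eq[OF c]])
    then have "a = - (A ** mat_of c ** A) - A ** mat_of c ** a" by (simp add: a_def l_def b_def f)
    then have ag: "a = - (A ** mat_of c ** (A + a))" by (simp add: matrix_add_ldistrib)
    have "C ** (A + a) = mat 1 - mat_of c ** (A + a)"
    proof -
      have "C ** a = - (C ** (A ** mat_of c ** (A + a)))" by (subst ag) (simp only: mm.minus_right)
      also have "C ** (A ** mat_of c ** (A + a)) = (C ** A) ** mat_of c ** (A + a)" by (simp only: matrix_mul_assoc)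
      finally show ?thesis by (simp add: matrix_add_ldistrib AC)
    qed
    then have "(C + mat_of c) ** (A + a) = mat 1" by (simp add: mm.add_left)
    note i = matrix_inv_eqI[OF this]
    show ?thesis using i by (simp add: symmat_inv.rep_eq[of "symmat_inv A0 + c"] plus_symmat.rep_eq C a_def)
  qed
  have "((\<lambda>q. sym_part (snd (z q) + 0)) has_derivative (\<lambda>q. sym_part (snd (l q)))) (at 0)"
    by (rule bounded_linear.has_derivative[OF bounded_linear_sym_part der])
  then have "((\<lambda>q. sym_part (snd (z q))) has_derivative (\<lambda>c. sym_part (- (mat_of A0 ** mat_of c ** mat_of A0)))) (at 0)"
    by (simp add: l_def A_def)
  then show ?thesis
  proof (rule has_derivative_transform_within_open[where s = "ball 0 r"])
    fix c :: "'n symmat" assume "c \<in> ball 0 r"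
    then have "mat_of (symmat_inv (symmat_inv A0 + c) - A0) = snd (z c)"
      using inv[of c] by (simp add: minus_symmat.rep_eq A_def)
    then show "sym_part (snd (z c)) = symmat_inv (symmat_inv A0 + c) - A0" by (metis sym_part_mat_of)
  qed (use r in auto)
qed

context spread_law_scatter
begin

text \<open>
  In terms of \<open>C\<close>, the derivative of \<open>F\<close> is half of the linearization, restricted to symmetric matrices. Injectivity
  on all matrices gives surjectivity on all matrices; preimages of symmetric matrices are symmetric
  since the linearization commutes with transposition.
\<close>

theorem derivative_invertible:
  fixes A0 :: "'n symmat"
  assumes crit: "critical (mat_of A0)"
  shows "\<exists>L. ((\<lambda>C. t_F \<nu> (law_phi Q) (symmat_inv C)) has_derivative L) (at (symmat_inv A0)) \<and> bij L"
proof -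
  define A where "A = mat_of A0"
  have pA: "posdef A" using crit by (simp add: A_def critical_def)
  have A0: "A0 \<in> pos_def" using pA by (simp add: A_def pos_def_iff)
  define C where "C = matrix_inv A"
  have pC: "posdef C" unfolding C_def by (rule posdef_inverse[OF pA])
  have AC: "A ** C = mat 1" "C ** A = mat 1"
    unfolding C_def by (rule matrix_inv_right_left[OF posdef_invertible[OF pA]])+
  have At: "transpose A = A" using pA by (simp add: posdef_def)
  let ?h = "bl_kernel \<nu> C"
  define M where "M B = A ** B ** A - dof *\<^sub>R pairing ?h (act (law_phi Q) (combination ?h B))" for B
  have M_lin: "M = linearization ?h (law_phi Q) A dof"
    by (simp add: fun_eq_iff M_def linearization_def[OF AC(1)])
  have M: "bounded_linear M" unfolding M_lin by (rule bounded_linear_linearization[OF AC(1)])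
  interpret M: bounded_linear M by (rule M)
  have M0: "B = 0" if "M B = 0" for B
  proof (rule linearization_injective[OF crit[folded A_def]])
    show "A ** B ** A = (\<chi> i j. dof * (\<integral>y. quad B y / (\<nu> + quad (matrix_inv A) y) * ((y $ i * y $ j) / (\<nu> + quad (matrix_inv A) y)) \<partial>Q))"
      using that linearization_law[OF pC, of B] by (simp add: M_def C_def)
  qed
  have quadT: "combination ?h (transpose B) = combination ?h B" for B
    unfolding combination_def by (subst sum.swap) (simp add: transpose_def bl_kernel_sym)
  have Mt: "M (transpose B) = transpose (M B)" for B
  proof -
    have "transpose (A ** B ** A) = A ** transpose B ** A"
      by (simp add: matrix_transpose_mul At matrix_mul_assoc)
    moreover have "transpose (dof *\<^sub>R pairing ?h \<psi>) = dof *\<^sub>R pairing ?h \<psi>" for \<psi>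
      using pairing_kernel_sym[of \<nu> C \<psi>] by (simp add: vec_eq_iff transpose_def)
    moreover have "transpose (X - Y) = transpose X - transpose Y" for X Y :: "real^'n^'n"
      by (simp add: vec_eq_iff transpose_def)
    ultimately show ?thesis by (simp add: M_def quadT)
  qed
  define L where "L c = sym_part ((1/2) *\<^sub>R M (mat_of c))" for c
  have mL: "mat_of (L c) = (1/2) *\<^sub>R M (mat_of c)" for c
    unfolding L_def
  proof (rule sym_part_symmetric)
    have "transpose (M (mat_of c)) = M (mat_of c)" using Mt[of "mat_of c"] by simp
    then show "transpose ((1/2) *\<^sub>R M (mat_of c)) = (1/2) *\<^sub>R M (mat_of c)"
      by (simp add: vec_eq_iff transpose_def)
  qed
  have inj: "inj M" using M0 by (simp add: linear_injective_0[OF M.linear_axioms])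
  then have surj: "surj M" using linear_injective_imp_surjective[OF M.linear_axioms] by simp
  have "bij L"
    unfolding bij_def
  proof
    show "inj L"
    proof (rule injI)
      fix c d assume "L c = L d"
      then have "(1/2) *\<^sub>R M (mat_of c) = (1/2) *\<^sub>R M (mat_of d)" using mL by metis
      then have "M (mat_of c) = M (mat_of d)" by simp
      then show "c = d" using inj by (simp add: inj_eq symmat_eq_iff)
    qed
    have "\<exists>c. B = L c" for B
    proof -
      obtain X where X: "2 *\<^sub>R mat_of B = M X" using surj by blast
      have "transpose (2 *\<^sub>R mat_of B) = 2 *\<^sub>R transpose (mat_of B)" by (simp add: vec_eq_iff transpose_def)
      then have "M (transpose X) = M X" unfolding Mt X[symmetric] by simp
      then have "transpose X = X" using inj by (simp add: inj_eq)
      then have "mat_of (L (sym_part X)) = mat_of B" by (simp add: mL sym_part_symmetric X[symmetric])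
      then show ?thesis by (metis mat_of_inject)
    qed
    then show "surj L" unfolding surj_def by blast
  qed
  define DF :: "(real^'n) bl_dual \<times> 'n symmat \<Rightarrow> real^'n^'n" where "DF = (\<lambda>(p, B). - (1/2) *\<^sub>R (blinfun_apply (law_phi Q) bl_one *\<^sub>R mat_of B + blinfun_apply p bl_one *\<^sub>R mat_of A0) +
      ((\<nu> + real CARD('n)) / 2) *\<^sub>R pairing (bl_kernel \<nu> (matrix_inv (mat_of A0))) (p + act (law_phi Q) (combination (bl_kernel \<nu> (matrix_inv (mat_of A0))) (matrix_inv (mat_of A0) ** mat_of B ** matrix_inv (mat_of A0)))))"
  obtain r F where r: "0 < r" and der: "(F has_derivative DF) (at 0)"
    and F: "\<And>p B. norm (p, B) < r \<Longrightarrow> F (p, B) = mat_of (t_F \<nu> (law_phi Q + p) (A0 + B))"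
    using estimating_function_local[OF nu A0, of "law_phi Q"] unfolding DF_def by blast
  define G where "G c = symmat_inv (symmat_inv A0 + c) - A0" for c
  have dG: "(G has_derivative (\<lambda>c. sym_part (- (A ** mat_of c ** A)))) (at 0)"
    unfolding G_def[abs_def] A_def by (rule symmat_inv_has_derivative[OF A0])
  have G0: "G 0 = 0"
    using symmat_inv_pos_def[OF A0] matrix_inv_inv[OF posdef_invertible[OF pA]]
    by (simp add: G_def symmat_eq_iff symmat_inv.rep_eq zero_symmat.rep_eq minus_symmat.rep_eq A_def
      pos_def_invertible posdef_invertible posdef_inverse[OF pA[unfolded A_def]])
  have "((\<lambda>c. (0 :: (real^'n) bl_dual, G c)) has_derivative (\<lambda>c. (0, sym_part (- (A ** mat_of c ** A))))) (at 0)"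
    by (intro has_derivative_Pair has_derivative_const dG)
  then have "((\<lambda>c. F (0, G c)) has_derivative (\<lambda>c. DF (0, sym_part (- (A ** mat_of c ** A))))) (at 0)"
    by (rule has_derivative_compose) (simp add: G0 zero_prod_def[symmetric] der)
  moreover have "DF (0, sym_part (- (A ** mat_of c ** A))) =
      (1/2) *\<^sub>R M (mat_of c)" for c
  proof -
    interpret cb: bounded_linear "combination ?h" by (rule bounded_linear_combination)
    interpret ac: bounded_bilinear "act :: (real^'n) bl_dual \<Rightarrow> (real^'n) bl \<Rightarrow> (real^'n) bl_dual" by (rule bounded_bilinear_act)
    interpret H: bounded_linear "pairing ?h :: (real^'n) bl_dual \<Rightarrow> real^'n^'n" by (rule bounded_linear_pairing)
    interpret mm: bounded_bilinear "(**) :: real^'n^'n \<Rightarrow> real^'n^'n \<Rightarrow> real^'n^'n"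
      by (rule bounded_bilinear_matrix_mult)
    have "transpose (A ** mat_of c ** A) = A ** mat_of c ** A"
      by (simp add: matrix_transpose_mul At matrix_mul_assoc)
    then have sp: "mat_of (sym_part (- (A ** mat_of c ** A))) = - (A ** mat_of c ** A)"
      by (intro sym_part_symmetric) (simp add: vec_eq_iff transpose_def)
    have "C ** (A ** mat_of c ** A) ** C = (C ** A) ** mat_of c ** (A ** C)" by (simp only: matrix_mul_assoc)
    then have CAC: "C ** (- (A ** mat_of c ** A)) ** C = - mat_of c" by (simp add: AC mm.minus_left mm.minus_right)
    show ?thesis
      unfolding DF_def prod.case A_def[symmetric] C_def[symmetric] sp CAC
      by (simp add: law_phi_one M_def dof_def[symmetric] linear_neg[OF cb.linear_axioms] ac.minus_right
        linear_neg[OF H.linear_axioms] blinfun.zero_left scaleR_diff_right)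
  qed
  ultimately have "((\<lambda>c. F (0, G c)) has_derivative (\<lambda>c. (1/2) *\<^sub>R M (mat_of c))) (at 0)" by simp
  then have "((\<lambda>c. sym_part (F (0, G c))) has_derivative L) (at 0)"
    unfolding L_def[abs_def] by (rule bounded_linear.has_derivative[OF bounded_linear_sym_part])
  moreover have "((\<lambda>C. C - symmat_inv A0) has_derivative (\<lambda>c. c)) (at (symmat_inv A0))"
    by (intro derivative_eq_intros) auto
  ultimately have "((\<lambda>C. sym_part (F (0, G (C - symmat_inv A0)))) has_derivative L) (at (symmat_inv A0))"
    using has_derivative_compose[of "\<lambda>C. C - symmat_inv A0" "\<lambda>c. c" "symmat_inv A0" UNIV "\<lambda>c. sym_part (F (0, G c))" L] by simp
  moreover obtain \<delta> where \<delta>: "0 < \<delta>" "\<And>c. dist c 0 < \<delta> \<Longrightarrow> dist (G c) (G 0) < r"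
    using has_derivative_continuous[OF dG] r unfolding continuous_at_eps_delta by blast
  ultimately have "((\<lambda>C. t_F \<nu> (law_phi Q) (symmat_inv C)) has_derivative L) (at (symmat_inv A0))"
  proof (elim has_derivative_transform_within_open[where s = "ball (symmat_inv A0) \<delta>"])
    fix C assume "C \<in> ball (symmat_inv A0) \<delta>"
    then have "norm (G (C - symmat_inv A0)) < r"
      using \<delta>(2)[of "C - symmat_inv A0"] G0 by (simp add: dist_norm norm_minus_commute)
    then have "norm (0 :: (real^'n) bl_dual, G (C - symmat_inv A0)) < r" by (simp add: norm_Pair)
    from F[OF this] show "sym_part (F (0, G (C - symmat_inv A0))) = t_F \<nu> (law_phi Q) (symmat_inv C)"
      by (simp add: G_def)
  qed (use \<delta> in auto)
  with \<open>bij L\<close> show ?thesis by blast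
qed

end

section \<open>Local analytic solutions of the estimating equation\<close>

text \<open>
  The shift \<open>E\<close> of the quadratic form is zero except for laws on the line. The output is a linear plus a quadratic function of
  the solution, as location and scatter are of this form.
\<close>

theorem scatter_local_solution:
  fixes A0 C0 E :: "real^'n::finite^'n" and pr :: "real^'n^'n \<Rightarrow> 'v::banach"
  assumes eps: "0 < \<epsilon>" and A0: "posdef A0" and C0: "C0 = matrix_inv A0"
    and E: "posdef (C0 + E)"
    and base: "A0 = \<kappa> *\<^sub>R pairing (bl_kernel \<epsilon> (C0 + E)) \<phi>0"
    and inj: "\<And>c. A0 ** c ** A0 = \<kappa> *\<^sub>R pairing (bl_kernel \<epsilon> (C0 + E)) (act \<phi>0 (combination (bl_kernel \<epsilon> (C0 + E)) c)) \<Longrightarrow> c = 0"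
    and pr: "bounded_linear pr" and \<beta>: "bounded_bilinear \<beta>"
  shows "\<exists>r>0. \<exists>g. frechet_analytic_on (ball \<phi>0 r) (\<lambda>\<phi>. pr (g \<phi>) + \<beta> (g \<phi>) (g \<phi>)) \<and>
    (\<forall>\<phi>\<in>ball \<phi>0 r. posdef (g \<phi>) \<and> posdef (matrix_inv (g \<phi>) + E) \<and>
      g \<phi> = \<kappa> *\<^sub>R pairing (bl_kernel \<epsilon> (matrix_inv (g \<phi>) + E)) \<phi>)"
proof -
  have pC0: "posdef C0" unfolding C0 by (rule posdef_inverse[OF A0])
  have Et: "transpose E = E"
  proof -
    have "transpose (C0 + E) - transpose C0 = (C0 + E) - C0" using E pC0 by (simp add: posdef_def)
    then show ?thesis by (simp add: vec_eq_iff transpose_def)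
  qed
  have inv: "A0 ** C0 = mat 1" unfolding C0 by (rule matrix_inv_right_left(1)[OF posdef_invertible[OF A0]])
  obtain e1 where e1: "0 < e1" "\<And>D. transpose D = D \<Longrightarrow> norm (D - C0) < e1 \<Longrightarrow> posdef D"
    using posdef_perturb[OF pC0] by blast
  obtain e2 where e2: "0 < e2" "\<And>D. transpose D = D \<Longrightarrow> norm (D - (C0 + E)) < e2 \<Longrightarrow> posdef D"
    using posdef_perturb[OF E] by blast
  let ?h = "bl_kernel \<epsilon> (C0 + E)"
  have inj': "c = 0" if "linearization ?h \<phi>0 A0 \<kappa> c = 0" for c
    using that inj by (simp add: linearization_def[OF inv])
  have e: "0 < min e1 e2" using e1(1) e2(1) by simp
  obtain r g C \<psi> where r: "0 < r" and an: "frechet_analytic_on (ball \<phi>0 r) (\<lambda>\<phi>. pr (g \<phi>) + \<beta> (g \<phi>) (g \<phi>))"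
    and main: "\<And>\<phi>. \<phi> \<in> ball \<phi>0 r \<Longrightarrow> g \<phi> ** C \<phi> = mat 1 \<and> g \<phi> = \<kappa> *\<^sub>R pairing ?h (\<psi> \<phi>) \<and>
      \<psi> \<phi> + act (\<psi> \<phi>) (combination ?h (C \<phi> - C0)) = \<phi> \<and> norm (C \<phi> - C0) < min e1 e2"
    using scatter_system[OF inv base inj' pr \<beta> e] by blast
  have "posdef (g \<phi>) \<and> posdef (matrix_inv (g \<phi>) + E) \<and>
      g \<phi> = \<kappa> *\<^sub>R pairing (bl_kernel \<epsilon> (matrix_inv (g \<phi>) + E)) \<phi>" if "\<phi> \<in> ball \<phi>0 r" for \<phi>
  proof -
    note m = main[OF that]
    have gC: "g \<phi> ** C \<phi> = mat 1" using m by blast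
    have Cg: "C \<phi> = matrix_inv (g \<phi>)" using matrix_inv_eqI(1)[OF gC] by simp
    have gt: "transpose (g \<phi>) = g \<phi>"
      using m pairing_kernel_sym[of \<epsilon> "C0 + E" "\<psi> \<phi>"] by (simp add: vec_eq_iff transpose_def)
    have Ct: "transpose (C \<phi>) = C \<phi>"
      unfolding Cg by (rule matrix_inv_symmetric[OF gt matrix_inv_eqI(2)[OF gC]])
    have pC: "posdef (C \<phi>)" using Ct m by (intro e1(2)) auto
    have gC': "g \<phi> = matrix_inv (C \<phi>)"
      unfolding Cg by (rule matrix_inv_inv[OF matrix_inv_eqI(2)[OF gC], symmetric])
    have pg: "posdef (g \<phi>)" unfolding gC' by (rule posdef_inverse[OF pC])
    have "transpose (C \<phi> + E) = C \<phi> + E" using Ct Et by (simp add: vec_eq_iff transpose_def)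
    then have pCE: "posdef (C \<phi> + E)" using m by (intro e2(2)) auto
    have "pairing ?h (\<psi> \<phi>) = pairing (bl_kernel \<epsilon> (C \<phi> + E)) \<phi>"
      by (rule pairing_kernel_transfer[OF eps E pCE]) (use m in simp)
    then show ?thesis using pg pCE m by (simp add: Cg)
  qed
  then show ?thesis using r an by blast
qed

theorem t_scatter_analytic:
  assumes nu: "0 < \<nu>"
  shows "analytic_functional law_phi (law_U (\<nu> + real CARD('n)) :: (real^'n::finite) measure set) (t_scatter \<nu>)"
  unfolding analytic_functional_def
proof
  fix Q0 :: "(real^'n) measure" assume Q0: "Q0 \<in> law_U (\<nu> + real CARD('n))"
  note loc = spread_law_scatterI[OF nu]
  interpret Q0: spread_law_scatter Q0 \<nu> by (rule loc[OF Q0])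
  define A0 where "A0 = mat_of (t_scatter \<nu> Q0)"
  have crit: "Q0.critical A0" unfolding A0_def by (rule Q0.t_scatter_critical)
  have A0: "posdef A0" using crit by (simp add: Q0.critical_def)
  define C0 where "C0 = matrix_inv A0"
  have pC0: "posdef C0" unfolding C0_def by (rule posdef_inverse[OF A0])
  let ?\<kappa> = "\<nu> + real CARD('n)"
  have base: "A0 = ?\<kappa> *\<^sub>R pairing (bl_kernel \<nu> (C0 + 0)) (law_phi Q0)"
    using crit by (simp add: Q0.critical_iff_pairing[OF A0] C0_def Q0.dof_def)
  have inj: "c = 0" if "A0 ** c ** A0 = ?\<kappa> *\<^sub>R pairing (bl_kernel \<nu> (C0 + 0)) (act (law_phi Q0) (combination (bl_kernel \<nu> (C0 + 0)) c))" for c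
    using that Q0.linearization_law[OF pC0, of c] by (intro Q0.linearization_injective[OF crit]) (simp add: C0_def Q0.dof_def)
  obtain r g where r: "0 < r" and an: "frechet_analytic_on (ball (law_phi Q0) r) (\<lambda>\<phi>. id (g \<phi>) + 0)"
    and g: "\<And>\<phi>. \<phi> \<in> ball (law_phi Q0) r \<Longrightarrow> posdef (g \<phi>) \<and> posdef (matrix_inv (g \<phi>) + 0) \<and>
      g \<phi> = ?\<kappa> *\<^sub>R pairing (bl_kernel \<nu> (matrix_inv (g \<phi>) + 0)) \<phi>"
    using scatter_local_solution[OF nu A0 C0_def _ base inj, of id "\<lambda>x y. 0"] pC0
    by (auto simp: id_def bounded_linear_ident bounded_bilinear_zero)
  show "\<exists>U ga. law_phi Q0 \<in> U \<and> frechet_analytic_on U ga \<and>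
      (\<forall>Q\<in>law_U (\<nu> + real CARD('n)). law_phi Q \<in> U \<longrightarrow> ga (law_phi Q) = t_scatter \<nu> Q)"
  proof (intro exI[of _ "ball (law_phi Q0) r"] exI[of _ "\<lambda>\<phi>. 0 + sym_part (id (g \<phi>) + 0)"] conjI ballI impI)
    show "law_phi Q0 \<in> ball (law_phi Q0) r" using r by simp
    show "frechet_analytic_on (ball (law_phi Q0) r) (\<lambda>\<phi>. 0 + sym_part (id (g \<phi>) + 0))"
      by (rule frechet_analytic_on_compose_linear[OF bounded_linear_sym_part an])
    fix Q :: "(real^'n) measure" assume Q: "Q \<in> law_U (\<nu> + real CARD('n))" and m: "law_phi Q \<in> ball (law_phi Q0) r"
    interpret Q: spread_law_scatter Q \<nu> by (rule loc[OF Q])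
    have pd: "posdef (g (law_phi Q))" using g[OF m] by blast
    have "Q.critical (g (law_phi Q))"
      using g[OF m] by (simp add: Q.critical_iff_pairing[OF pd] Q.dof_def)
    from Q.t_scatter_eq[OF this] show "0 + sym_part (id (g (law_phi Q)) + 0) = t_scatter \<nu> Q"
      using posdef_symmat(2)[OF pd] by (metis add.left_neutral add.right_neutral id_apply sym_part_mat_of)
  qed
qed

section \<open>Location and scatter as scatter in one more dimension\<close>

lemma sum_option: "(\<Sum>k\<in>(UNIV :: 'n::finite option set). f k) = f None + (\<Sum>i\<in>UNIV. f (Some i))"
proof -
  have "(\<Sum>k\<in>(UNIV :: 'n option set). f k) = f None + sum f (range Some)"
    unfolding UNIV_option_conv by (subst sum.insert) auto
  also have "sum f (range Some) = (\<Sum>i\<in>UNIV. f (Some i))"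
    by (subst sum.reindex) (auto simp: o_def)
  finally show ?thesis .
qed

lemma prod_option: "(\<Prod>k\<in>(UNIV :: 'n::finite option set). f k) = f None * (\<Prod>i\<in>UNIV. f (Some i))"
proof -
  have "(\<Prod>k\<in>(UNIV :: 'n option set). f k) = f None * prod f (range Some)"
    unfolding UNIV_option_conv by (subst prod.insert) auto
  also have "prod f (range Some) = (\<Prod>i\<in>UNIV. f (Some i))"
    by (subst prod.reindex) (auto simp: o_def)
  finally show ?thesis .
qed

lemma all_option: "(\<forall>k :: 'n option. P k) \<longleftrightarrow> P None \<and> (\<forall>i. P (Some i))"
  by (metis option.exhaust)

text \<open>
  The additional coordinate \<open>None\<close> is constantly one.
\<close>

definition append_one :: "real^'n::finite \<Rightarrow> real^('n option)" where
  "append_one y = (\<chi> k. case k of None \<Rightarrow> 1 | Some i \<Rightarrow> y $ i)"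

definition block :: "real^'n::finite^'n \<Rightarrow> real^('n option)^('n option)" where
  "block X = (\<chi> k l. case k of None \<Rightarrow> (case l of None \<Rightarrow> 1 | Some j \<Rightarrow> 0)
     | Some i \<Rightarrow> (case l of None \<Rightarrow> 0 | Some j \<Rightarrow> X $ i $ j))"

definition shear :: "real^'n::finite \<Rightarrow> real^('n option)^('n option)" where
  "shear \<mu> = (\<chi> k l. case k of None \<Rightarrow> (case l of None \<Rightarrow> 1 | Some j \<Rightarrow> 0)
     | Some i \<Rightarrow> (case l of None \<Rightarrow> \<mu> $ i | Some j \<Rightarrow> if i = j then 1 else 0))"

text \<open>
  The matrix \<open>[\<Sigma> + \<mu> \<mu>', \<mu>; \<mu>', 1]\<close>. Its factorization by a shear that moves the mean to the origin
  gives determinant and inverse.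
\<close>

definition extended_scatter :: "real^'n::finite \<Rightarrow> real^'n^'n \<Rightarrow> real^('n option)^('n option)" where
  "extended_scatter \<mu> X = shear \<mu> ** block X ** transpose (shear \<mu>)"

definition location_part :: "real^('n::finite option)^('n option) \<Rightarrow> real^'n" where
  "location_part A = (\<chi> i. A $ Some i $ None)"

text \<open>
  The inverse of \<open>extended_scatter\<close> on symmetric matrices whose last diagonal entry is one.
\<close>

definition scatter_part :: "real^('n::finite option)^('n option) \<Rightarrow> real^'n^'n" where
  "scatter_part A = (\<chi> i j. A $ Some i $ Some j - A $ Some i $ None * A $ Some j $ None)"

lemma append_one_nth [simp]: "append_one y $ None = 1" "append_one y $ Some i = y $ i"
  by (simp_all add: append_one_def)

lemma block_nth [simp]: "block X $ None $ None = 1" "block X $ None $ Some j = 0"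
    "block X $ Some i $ None = 0" "block X $ Some i $ Some j = X $ i $ j"
  by (simp_all add: block_def)

lemma shear_nth [simp]: "shear \<mu> $ None $ None = 1" "shear \<mu> $ None $ Some j = 0"
    "shear \<mu> $ Some i $ None = \<mu> $ i" "shear \<mu> $ Some i $ Some j = (if i = j then 1 else 0)"
  by (simp_all add: shear_def)

lemma mat_option_nth [simp]: "(mat 1 :: real^('n::finite option)^('n option)) $ None $ None = 1"
    "(mat 1 :: real^('n option)^('n option)) $ None $ Some j = 0"
    "(mat 1 :: real^('n option)^('n option)) $ Some i $ None = 0"
    "(mat 1 :: real^('n option)^('n option)) $ Some i $ Some j = (if i = j then 1 else 0)"
  by (simp_all add: mat_def)

lemma matrix_option_eqI:
  fixes A B :: "real^('n::finite option)^('n option)"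
  assumes "A $ None $ None = B $ None $ None" "\<And>j. A $ None $ Some j = B $ None $ Some j"
    "\<And>i. A $ Some i $ None = B $ Some i $ None" "\<And>i j. A $ Some i $ Some j = B $ Some i $ Some j"
  shows "A = B"
  using assms by (simp add: vec_eq_iff all_option)

lemma matrix_mult_nth: "(A ** B) $ i $ j = (\<Sum>k\<in>UNIV. A $ i $ k * B $ k $ j)"
  by (simp add: matrix_matrix_mult_def)

lemma sum_if_eq [simp]: "(\<Sum>k\<in>UNIV. (if i = k then 1 else 0) * f k) = (f i :: real)" for i :: "'n::finite"
  by (subst sum_eq_single[of _ i]) auto

lemma sum_if_eq' [simp]: "(\<Sum>k\<in>UNIV. f k * (if k = j then 1 else 0)) = (f j :: real)" for j :: "'n::finite"
  by (subst sum_eq_single[of _ j]) auto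

lemma sum_if_eq'' [simp]: "(\<Sum>k\<in>UNIV. f k * (if j = k then 1 else 0)) = (f j :: real)" for j :: "'n::finite"
  by (subst sum_eq_single[of _ j]) auto

lemma shear_inverse: "shear \<mu> ** shear (- \<mu>) = mat 1"
proof (rule matrix_option_eqI)
  fix i :: 'a
  have "(\<Sum>k\<in>UNIV. (if i = k then 1 else 0) * - \<mu> $ k) = - \<mu> $ i" by (rule sum_if_eq)
  then show "(shear \<mu> ** shear (- \<mu>)) $ Some i $ None = mat 1 $ Some i $ None"
    by (simp add: matrix_mult_nth sum_option del: mult_minus_right)
qed (simp_all add: matrix_mult_nth sum_option)

lemma shear_inverse': "shear (- \<mu>) ** shear \<mu> = mat 1"
  using shear_inverse[of "- \<mu>"] by simp

lemma invertible_shear: "invertible (shear \<mu>)"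
  using shear_inverse shear_inverse' by (auto simp: invertible_def)

lemma block_mult: "block X ** block Y = block (X ** Y)"
  by (rule matrix_option_eqI) (simp_all add: matrix_mult_nth sum_option)

lemma block_one: "block (mat 1) = mat 1"
  by (rule matrix_option_eqI) (simp_all add: mat_def)

lemma transpose_block: "transpose (block X) = block (transpose X)"
  by (rule matrix_option_eqI) (simp_all add: transpose_def)

lemma quad_block: "quad (block X) z = (z $ None)\<^sup>2 + quad X (\<chi> i. z $ Some i)"
  by (simp add: quad_sum sum_option power2_eq_square)

lemma posdef_block:
  assumes "posdef X"
  shows "posdef (block X)"
  unfolding posdef_def
proof (intro conjI allI impI)
  show "transpose (block X) = block X" using assms by (simp add: transpose_block posdef_def)
  fix z :: "real^('a option)" assume z: "z \<noteq> 0"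
  let ?x = "\<chi> i. z $ Some i"
  have "0 < (z $ None)\<^sup>2 + quad X ?x"
  proof (cases "?x = 0")
    case True
    then have "z $ None \<noteq> 0" using z by (auto simp: vec_eq_iff all_option)
    then show ?thesis using True by (simp add: quad_def)
  next
    case False
    then have "0 < quad X ?x" using assms by (simp add: posdef_def quad_def)
    then show ?thesis by (simp add: add_nonneg_pos)
  qed
  then show "0 < z \<bullet> (block X *v z)" using quad_block[of X z] by (simp add: quad_def)
qed

text \<open>
  Diagonalizing \<open>X\<close> avoids expanding the determinant: the block matrix is diagonalized by the block of the
  same orthogonal matrix.
\<close>

lemma det_block:
  fixes X :: "real^'n::finite^'n"
  assumes "transpose X = X"
  shows "det (block X) = det X"
proof -
  obtain idx :: "'n \<Rightarrow> nat" where idx: "bij_betw idx UNIV {..<CARD('n)}" by (rule finite_index)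
  obtain U :: "real^'n^'n" and m where U: "orthogonal_matrix U" and X: "X = transpose U ** diagonal m ** U"
    using spectral_decomposition[OF assms idx] by blast
  have UU: "transpose U ** U = mat 1" using U by (simp add: orthogonal_matrix_def)
  have d1: "det U * det U = 1" using det_mul[of "transpose U" U] UU by (simp add: det_transpose)
  have "transpose (block U) ** block U = mat 1" by (simp add: transpose_block block_mult UU block_one)
  then have d2: "det (block U) * det (block U) = 1"
    using det_mul[of "transpose (block U)" "block U"] by (simp add: det_transpose)
  have "block (diagonal m) = diagonal (\<lambda>k. case k of None \<Rightarrow> 1 | Some i \<Rightarrow> m i)"
    by (rule matrix_option_eqI) simp_all
  then have d3: "det (block (diagonal m)) = prod m UNIV" by (simp add: det_diagonal_prod prod_option)
  have "block X = transpose (block U) ** block (diagonal m) ** block U"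
    by (simp add: X transpose_block block_mult)
  then have "det (block X) = (det (block U) * det (block U)) * prod m UNIV"
    by (simp add: det_mul det_transpose d3)
  moreover have "det X = (det U * det U) * prod m UNIV"
    by (simp add: X det_mul det_transpose det_diagonal_prod)
  ultimately show ?thesis by (simp add: d1 d2)
qed

lemma diagonal_mult_nth: "(diagonal d ** X) $ i $ j = d i * X $ i $ j" "(X ** diagonal d) $ i $ j = X $ i $ j * d j"
  unfolding matrix_mult_nth
  by (subst sum_eq_single[of _ i], auto simp: diagonal_def) (subst sum_eq_single[of _ j], auto)

text \<open>
  Only the square of the determinant matters. Reversing the sign of all coordinates but the last conjugates the shear into its
  inverse, so both have the same determinant.
\<close>

lemma det_shear: "det (shear \<mu>) * det (shear \<mu>) = 1"
proof -
  define D :: "real^('a option)^('a option)" where "D = diagonal (\<lambda>k. case k of None \<Rightarrow> 1 | Some i \<Rightarrow> - 1)"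
  have "D ** D = mat 1"
    unfolding D_def diagonal_mult by (rule matrix_option_eqI) (simp_all add: diagonal_def)
  then have D: "det D * det D = 1" using det_mul[of D D] by simp
  have "D ** shear \<mu> ** D = shear (- \<mu>)"
    unfolding D_def by (rule matrix_option_eqI) (simp_all only: diagonal_mult_nth, simp_all)
  then have "det (shear (- \<mu>)) = det D * det (shear \<mu>) * det D" using det_mul[of "D ** shear \<mu>" D] det_mul[of D "shear \<mu>"] by simp
  also have "\<dots> = (det D * det D) * det (shear \<mu>)" by simp
  finally have "det (shear (- \<mu>)) = det (shear \<mu>)" using D by simp
  moreover have "det (shear \<mu>) * det (shear (- \<mu>)) = 1" by (simp add: det_mul[symmetric] shear_inverse)
  ultimately show ?thesis by simp
qed

lemma posdef_extended_scatter: "posdef X \<Longrightarrow> posdef (extended_scatter \<mu> X)"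
  unfolding extended_scatter_def by (intro posdef_congruence posdef_block invertible_shear)

lemma det_extended_scatter:
  assumes "transpose X = X"
  shows "det (extended_scatter \<mu> X) = det X"
proof -
  have "det (extended_scatter \<mu> X) = (det (shear \<mu>) * det (shear \<mu>)) * det X"
    by (simp add: extended_scatter_def det_mul det_transpose det_block[OF assms])
  then show ?thesis by (simp add: det_shear)
qed

lemma extended_scatter_nth:
  "extended_scatter \<mu> X $ None $ None = 1" "extended_scatter \<mu> X $ Some i $ None = \<mu> $ i"
  "extended_scatter \<mu> X $ None $ Some i = \<mu> $ i" "extended_scatter \<mu> X $ Some i $ Some j = X $ i $ j + \<mu> $ i * \<mu> $ j"
  by (simp_all add: extended_scatter_def matrix_mult_nth sum_option transpose_def)

lemma parts_extended_scatter [simp]: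
  "location_part (extended_scatter \<mu> X) = \<mu>" "scatter_part (extended_scatter \<mu> X) = X"
  by (simp_all add: location_part_def scatter_part_def extended_scatter_nth vec_eq_iff)

lemma extended_scatter_parts:
  assumes "transpose A = A" "A $ None $ None = 1"
  shows "extended_scatter (location_part A) (scatter_part A) = A"
proof (rule matrix_option_eqI)
  have sym: "A $ k $ l = A $ l $ k" for k l using assms(1) by (simp add: vec_eq_iff transpose_def)
  show "extended_scatter (location_part A) (scatter_part A) $ None $ Some j = A $ None $ Some j" for j
    using sym[of None "Some j"] by (simp add: extended_scatter_nth location_part_def)
qed (simp_all add: extended_scatter_nth location_part_def scatter_part_def assms(2))

lemma posdef_scatter_part:
  assumes A: "posdef A" and "A $ None $ None = 1"
  shows "posdef (scatter_part A)"
proof -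
  define \<mu> where "\<mu> = location_part A"
  define X where "X = scatter_part A"
  have At: "transpose A = A" using A by (simp add: posdef_def)
  have eq: "A = shear \<mu> ** block X ** transpose (shear \<mu>)"
    using extended_scatter_parts[OF At assms(2)] by (simp add: extended_scatter_def \<mu>_def X_def)
  have "shear (- \<mu>) ** A ** transpose (shear (- \<mu>)) =
      (shear (- \<mu>) ** shear \<mu>) ** block X ** transpose (shear (- \<mu>) ** shear \<mu>)"
    unfolding eq by (simp only: matrix_transpose_mul matrix_mul_assoc)
  then have "shear (- \<mu>) ** A ** transpose (shear (- \<mu>)) = block X"
    by (simp add: shear_inverse' transpose_mat)
  then have pb: "posdef (block X)" using posdef_congruence[OF A invertible_shear[of "- \<mu>"]] by simp
  show ?thesis
    unfolding posdef_def X_def[symmetric]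
  proof (intro conjI allI impI)
    have "block X $ Some i $ Some j = block X $ Some j $ Some i" for i j
      using pb by (simp add: posdef_def transpose_def vec_eq_iff del: block_nth)
    then show "transpose X = X" by (simp add: transpose_def vec_eq_iff)
    fix x :: "real^'a" assume "x \<noteq> 0"
    define z :: "real^('a option)" where "z = (\<chi> k. case k of None \<Rightarrow> 0 | Some i \<Rightarrow> x $ i)"
    have z: "z $ None = 0" "(\<chi> i. z $ Some i) = x" by (simp_all add: z_def vec_eq_iff)
    have "z \<noteq> 0" using \<open>x \<noteq> 0\<close> by (auto simp: z_def vec_eq_iff all_option)
    then have "0 < quad (block X) z" using pb by (simp add: posdef_def quad_def)
    also have "quad (block X) z = quad X x" by (simp add: quad_block z)
    finally show "0 < x \<bullet> (X *v x)" by (simp add: quad_def)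
  qed
qed

lemma shear_append_one: "shear (- \<mu>) *v append_one y = append_one (y - \<mu>)"
  by (simp add: vec_eq_iff all_option matrix_vector_mult_def sum_option)

text \<open>
  The one on the right turns the constant \<open>\<nu> - 1\<close> of the extended problem into the constant \<open>\<nu>\<close>.
\<close>

lemma quad_inv_extended_scatter:
  assumes X: "posdef X"
  shows "quad (matrix_inv (extended_scatter \<mu> X)) (append_one y) = 1 + quad (matrix_inv X) (y - \<mu>)"
proof -
  have XX: "X ** matrix_inv X = mat 1" by (rule matrix_inv_right_left(1)[OF posdef_invertible[OF X]])
  let ?S = "shear \<mu>" and ?T = "shear (- \<mu>)"
  have "extended_scatter \<mu> X ** (transpose ?T ** block (matrix_inv X) ** ?T) =
      ?S ** (block X ** (transpose (?T ** ?S) ** block (matrix_inv X))) ** ?T"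
    by (simp only: extended_scatter_def matrix_transpose_mul matrix_mul_assoc)
  also have "\<dots> = mat 1" by (simp add: shear_inverse shear_inverse' transpose_mat block_mult XX block_one)
  finally have "matrix_inv (extended_scatter \<mu> X) = transpose ?T ** block (matrix_inv X) ** ?T"
    by (rule matrix_inv_eqI)
  then have "quad (matrix_inv (extended_scatter \<mu> X)) (append_one y) = quad (block (matrix_inv X)) (?T *v append_one y)"
    using inner_transpose_mult[of "append_one y" ?T "block (matrix_inv X) *v (?T *v append_one y)"]
    by (simp only: quad_def matrix_vector_mul_assoc matrix_mul_assoc)
  also have "(\<chi> i. append_one (y - \<mu>) $ Some i) = y - \<mu>" by (simp add: vec_eq_iff)
  then have "quad (block (matrix_inv X)) (?T *v append_one y) = 1 + quad (matrix_inv X) (y - \<mu>)"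
    unfolding shear_append_one by (simp add: quad_block)
  finally show ?thesis .
qed

lemma append_one_inner: "append_one y \<bullet> append_one y = 1 + y \<bullet> y"
  by (simp add: inner_vec_def sum_option)

lemma norm_append_one_diff: "norm (append_one x - append_one y) = norm (x - y)"
  by (simp add: norm_eq inner_vec_def sum_option)

lemma continuous_append_one: "continuous_on S append_one"
proof (rule lipschitz_on_continuous_on)
  show "1-lipschitz_on S append_one"
    by (rule lipschitz_onI) (simp_all add: dist_norm norm_append_one_diff)
qed

lemma append_one_measurable: "append_one \<in> borel_measurable borel"
  by (rule borel_measurable_continuous_onI) (rule continuous_append_one)

lemma law_measurable: "law P \<Longrightarrow> f \<in> borel_measurable borel \<Longrightarrow> f \<in> measurable P borel"
  unfolding law_def using measurable_cong_sets[OF _ refl] by blast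

lemma law_distr:
  assumes "law P" "f \<in> borel_measurable borel"
  shows "law (distr P borel f)"
proof -
  interpret prob_space P using assms by (simp add: law_def)
  show ?thesis using law_measurable[OF assms] by (simp add: law_def prob_space_distr)
qed

lemma affine_append_one_vimage: "subspace H \<Longrightarrow> affine (append_one -` H)"
  unfolding affine_alt
proof (intro ballI allI)
  fix x y and u :: real assume H: "subspace H" and "x \<in> append_one -` H" "y \<in> append_one -` H"
  then have "(1 - u) *\<^sub>R append_one x + u *\<^sub>R append_one y \<in> H" by (intro subspace_add subspace_scale) auto
  also have "(1 - u) *\<^sub>R append_one x + u *\<^sub>R append_one y = append_one ((1 - u) *\<^sub>R x + u *\<^sub>R y)"
    by (simp add: vec_eq_iff all_option)
  finally show "(1 - u) *\<^sub>R x + u *\<^sub>R y \<in> append_one -` H" by simp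
qed

text \<open>
  A subspace that meets the affine hyperplane \<open>z $ None = 1\<close> contains zero in addition to this intersection, which costs one
  dimension. This is why affine subspaces appear in the condition on the law.
\<close>

lemma aff_dim_append_one_vimage:
  fixes H :: "(real^('n::finite option)) set"
  assumes H: "subspace H" and ne: "append_one -` H \<noteq> {}"
  shows "aff_dim (append_one -` H) + 1 \<le> int (dim H)"
proof -
  let ?J = "append_one -` H"
  define f where "f y = append_one y - append_one 0" for y :: "real^'n"
  have "linear f"
    by (rule linearI) (simp_all add: f_def vec_eq_iff all_option)
  moreover have "inj f"
  proof (rule injI)
    fix x y assume "f x = f y"
    then have "norm (append_one x - append_one y) = 0" by (simp add: f_def)
    then show "x = y" by (simp add: norm_append_one_diff)
  qed
  ultimately have d: "aff_dim (f ` ?J) = aff_dim ?J" by (rule aff_dim_injective_linear_image)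
  have "append_one ` ?J = (\<lambda>x. append_one 0 + x) ` f ` ?J" by (auto simp: f_def image_image)
  then have d2: "aff_dim (append_one ` ?J) = aff_dim ?J" using aff_dim_translation_eq[of "append_one 0" "f ` ?J"] d by simp
  have "affine {z :: real^('n option). z $ None = 1}"
    by (auto simp: affine_alt algebra_simps)
  then have "affine hull (append_one ` ?J) \<subseteq> {z. z $ None = 1}" by (intro hull_minimal) auto
  then have "0 \<notin> affine hull (append_one ` ?J)" by auto
  then have "aff_dim (insert 0 (append_one ` ?J)) = aff_dim ?J + 1"
    unfolding aff_dim_insert d2 by (simp del: image_vimage_eq)
  moreover have "aff_dim (insert 0 (append_one ` ?J)) \<le> aff_dim H"
    using H by (intro aff_dim_subset) (auto simp: subspace_0)
  moreover have "aff_dim H = int (dim H)" by (rule aff_dim_subspace[OF H])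
  ultimately show ?thesis by simp
qed

text \<open>
  The numbers of degrees of freedom agree: \<open>(\<nu> - 1) + (d + 1) = \<nu> + d\<close>. A subspace that misses the hyperplane has mass zero, which is
  allowed because \<open>\<nu> > 1\<close>.
\<close>

lemma spread_append_one:
  fixes P :: "(real^'n::finite) measure"
  assumes nu: "1 < \<nu>" and P: "P \<in> law_V (\<nu> + real CARD('n))"
  shows "spread_law_scatter (distr P borel append_one) (\<nu> - 1)"
proof -
  have law: "law P" using P by (simp add: law_V_def)
  have lawQ: "law (distr P borel append_one)" by (rule law_distr[OF law append_one_measurable])
  interpret Q: law_scatter "distr P borel append_one" "\<nu> - 1" using lawQ nu by unfold_locales auto
  have dof: "Q.dof = \<nu> + real CARD('n)" by (simp add: Q.dof_def)
  let ?a = "\<nu> + real CARD('n)"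
  have a: "0 < ?a" using nu by (simp add: add_pos_nonneg)
  have "measure (distr P borel append_one) H < 1 - (real (CARD('n) + 1) - real (dim H)) / ?a"
    if H: "subspace H" "dim H < CARD('n) + 1" for H :: "(real^('n option)) set"
  proof -
    let ?J = "append_one -` H"
    have "closed H" using H(1) by (rule closed_subspace)
    then have m: "measure (distr P borel append_one) H = measure P ?J"
      using law_measurable[OF law append_one_measurable] law_space[OF law] by (subst measure_distr) auto
    show ?thesis
    proof (cases "?J = {}")
      case True
      have "(real (CARD('n) + 1) - real (dim H)) / ?a < 1"
        using nu a by (simp add: pos_divide_less_eq)
      then show ?thesis unfolding m True by simp
    next
      case False
      have ad: "aff_dim ?J + 1 \<le> int (dim H)" by (rule aff_dim_append_one_vimage[OF H(1) False])
      have "0 \<le> aff_dim ?J" using False aff_dim_geq[of ?J] aff_dim_empty[of ?J] by linarith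
      moreover have "aff_dim ?J < int DIM(real^'n)" using ad H(2) by simp
      ultimately have "measure P ?J < 1 - (real DIM(real^'n) - real_of_int (aff_dim ?J)) / ?a"
        using P affine_append_one_vimage[OF H(1)] unfolding law_V_def by blast
      also have "\<dots> \<le> 1 - (real (CARD('n) + 1) - real (dim H)) / ?a"
      proof -
        have "real_of_int (aff_dim ?J) + 1 \<le> real (dim H)" using ad by linarith
        then show ?thesis using a by (simp add: divide_right_mono)
      qed
      finally show ?thesis unfolding m .
    qed
  qed
  then have "distr P borel append_one \<in> law_U Q.dof"
    using lawQ unfolding dof law_U_def by simp
  then show ?thesis by unfold_locales
qed

lemma location_scatter_objective_eq:
  fixes P :: "(real^'n::finite) measure"
  assumes nu: "1 < \<nu>" and law: "law P" and S: "S \<in> pos_def"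
  shows "location_scatter_objective \<nu> P (\<mu>, S) =
    law_scatter.objective (distr P borel append_one) (\<nu> - 1) (extended_scatter \<mu> (mat_of S))"
proof -
  have lawQ: "law (distr P borel append_one)" by (rule law_distr[OF law append_one_measurable])
  interpret Q: law_scatter "distr P borel append_one" "\<nu> - 1" using lawQ nu by unfold_locales auto
  interpret P: law_scatter P \<nu> using law nu by unfold_locales auto
  have pS: "posdef (mat_of S)" using S by (simp add: pos_def_iff)
  let ?A = "extended_scatter \<mu> (mat_of S)"
  have pA: "posdef ?A" by (rule posdef_extended_scatter[OF pS])
  have dof: "Q.dof = \<nu> + real CARD('n)" by (simp add: Q.dof_def)
  have q0: "0 \<le> (y - \<mu>) \<bullet> (matrix_inv (mat_of S) *v (y - \<mu>))" for y
    using quad_nonneg[OF posdef_inverse[OF pS], of "y - \<mu>"] by (simp add: quad_def)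
  have lr: "Q.log_ratio (matrix_inv ?A) (append_one y) =
      ln (\<nu> + (y - \<mu>) \<bullet> (matrix_inv (mat_of S) *v (y - \<mu>))) - ln (\<nu> + y \<bullet> y)" for y
    by (simp add: Q.log_ratio_def quad_inv_extended_scatter[OF pS] append_one_inner) (simp add: quad_def)
  have "(\<integral>z. Q.log_ratio (matrix_inv ?A) z \<partial>distr P borel append_one) = (\<integral>y. Q.log_ratio (matrix_inv ?A) (append_one y) \<partial>P)"
  proof (rule integral_distr[OF law_measurable[OF law append_one_measurable]])
    show "Q.log_ratio (matrix_inv ?A) \<in> borel_measurable borel"
      using borel_measurable_integrable[OF Q.log_ratio_integrable[OF posdef_inverse[OF pA]]] by simp
  qed
  then show ?thesis
    unfolding Q.objective_def det_extended_scatter[OF transpose_mat_of] dof location_scatter_objective_def prod.case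
    by (simp add: lr P.t_rho_diff[OF q0 inner_ge_zero])
qed

text \<open>
  All extended scatter matrices have last diagonal entry one, so minimizing over \<open>(\<mu>, \<Sigma>)\<close> restricts the scatter
  problem of the extended law. The restriction does not matter because the unrestricted minimum has this form: its
  last entry is one by \<open>norm1\<close> below.
\<close>

theorem t_location_scatter_eq:
  fixes P :: "(real^'n::finite) measure"
  assumes nu: "1 < \<nu>" and P: "P \<in> law_V (\<nu> + real CARD('n))"
    and crit: "law_scatter.critical (distr P borel append_one) (\<nu> - 1) A"
  shows "t_location_scatter \<nu> P = (location_part A, sym_part (scatter_part A))"
proof -
  have law: "law P" using P by (simp add: law_V_def)
  interpret Q: spread_law_scatter "distr P borel append_one" "\<nu> - 1" by (rule spread_append_one[OF nu P])
  let ?Q = "distr P borel append_one"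
  have dof: "Q.dof = \<nu> + real CARD('n)" by (simp add: Q.dof_def)
  have A: "posdef A" and wA: "Q.weighted_cov (matrix_inv A) = A" using crit by (auto simp: Q.critical_def)
  define C where "C = matrix_inv A"
  have C: "posdef C" unfolding C_def by (rule posdef_inverse[OF A])
  have AC: "A ** C = mat 1" unfolding C_def by (rule matrix_inv_right_left(1)[OF posdef_invertible[OF A]])
  have At: "transpose A = A" using A by (simp add: posdef_def)
  (* The trace of \<open>A C = 1\<close> fixes the mean of \<open>quad C z / (\<nu> - 1 + quad C z)\<close>. As the last coordinate of \<open>z\<close> is one,
     the last entry of the estimating equation is the mean of the complement of this ratio, up to the factor \<open>\<nu> - 1\<close>. *)
  have norm1: "A $ None $ None = 1"
  proof -
    let ?d = "\<lambda>z. \<nu> - 1 + quad C z"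
    have d: "0 < ?d z" for z by (rule Q.denominator_pos[OF C])
    have iq: "integrable ?Q (\<lambda>z. quad C z / ?d z)" by (rule Q.quad_weight_integrable(1)[OF C])
    have tr: "Q.dof * (\<integral>z. quad C z / ?d z \<partial>?Q) = real CARD('n) + 1"
    proof -
      have "Q.dof * (\<integral>z. quad C z / ?d z \<partial>?Q) = (\<Sum>i\<in>UNIV. \<Sum>j\<in>UNIV. C $ i $ j * A $ i $ j)"
        using Q.quad_weight_integrable(2)[OF C, of C] wA by (simp add: C_def)
      also have "\<dots> = (\<Sum>i\<in>UNIV. \<Sum>j\<in>UNIV. A $ i $ j * C $ j $ i)"
        using C by (simp add: posdef_def transpose_def vec_eq_iff mult.commute)
      also have "\<dots> = (\<Sum>i\<in>UNIV. (A ** C) $ i $ i)" by (simp add: matrix_mult_nth)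
      also have "\<dots> = real CARD('n) + 1" by (simp add: AC mat_def)
      finally show ?thesis .
    qed
    have ae: "AE z in ?Q. z $ None = 1"
    proof -
      have "{z :: real^('n option). z $ None = 1} \<in> sets borel"
        by (intro borel_closed closed_Collect_eq continuous_intros)
      then show ?thesis using law_measurable[OF law append_one_measurable] by (subst AE_distr_iff) auto
    qed
    have e1: "Q.dof * (\<integral>z. (z $ None * z $ None) / ?d z \<partial>?Q) = A $ None $ None"
      using arg_cong[OF wA, of "\<lambda>X. X $ None $ None"] by (simp add: Q.weighted_cov_def C_def)
    have e2: "(\<integral>z. (z $ None * z $ None) / ?d z \<partial>?Q) = (\<integral>z. (1 - quad C z / ?d z) / (\<nu> - 1) \<partial>?Q)"
    proof (rule integral_cong_AE)
      show "(\<lambda>z. (z $ None * z $ None) / ?d z) \<in> borel_measurable ?Q"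
        using Q.weight_integrable[OF C] by (rule borel_measurable_integrable)
      show "(\<lambda>z. (1 - quad C z / ?d z) / (\<nu> - 1)) \<in> borel_measurable ?Q"
        using iq by (intro borel_measurable_divide borel_measurable_diff borel_measurable_integrable[OF iq]) auto
      show "AE z in ?Q. (z $ None * z $ None) / ?d z = (1 - quad C z / ?d z) / (\<nu> - 1)"
        using ae
      proof eventually_elim
        case (elim z)
        have "1 / (n + q) = (1 - q / (n + q)) / n" if "0 < n" "0 < n + q" for n q :: real
          using that by (simp add: divide_simps mult.commute)
        from this[of "\<nu> - 1" "quad C z"] show ?case using d[of z] nu elim by simp
      qed
    qed
    have e3: "(\<integral>z. (1 - quad C z / ?d z) / (\<nu> - 1) \<partial>?Q) = (1 - (\<integral>z. quad C z / ?d z \<partial>?Q)) / (\<nu> - 1)"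
      using Bochner_Integration.integral_diff[OF Q.integrable_const iq, of 1]
      by (simp add: Q.prob_space[unfolded Q.space_Q])
    have "A $ None $ None = Q.dof * ((1 - (\<integral>z. quad C z / ?d z \<partial>?Q)) / (\<nu> - 1))"
      unfolding e1[symmetric] e2 e3 ..
    moreover have "a * n = d - d * x" if "a = d * ((1 - x) / n)" "n \<noteq> 0" for a d x n :: real
      using that by (simp add: right_diff_distrib)
    ultimately have "A $ None $ None * (\<nu> - 1) = Q.dof - Q.dof * (\<integral>z. quad C z / ?d z \<partial>?Q)"
using nu by simp
    also have "\<dots> = \<nu> - 1" unfolding tr by (simp add: dof)
    finally show ?thesis using nu by simp
  qed
  define \<mu> where "\<mu> = location_part A"
  define X where "X = scatter_part A"
  have X: "posdef X" unfolding X_def by (rule posdef_scatter_part[OF A norm1])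
  have AX: "extended_scatter \<mu> X = A" unfolding \<mu>_def X_def by (rule extended_scatter_parts[OF At norm1])
  note sX = posdef_symmat[OF X]
  have spX: "sym_part X = symmat_of X" using sX(2) by (metis sym_part_mat_of)
  have obj: "location_scatter_objective \<nu> P (m, S) = Q.objective (extended_scatter m (mat_of S))" if "S \<in> pos_def" for m S
    by (rule location_scatter_objective_eq[OF nu law that])
  have objA: "location_scatter_objective \<nu> P (\<mu>, symmat_of X) = Q.objective A"
    using obj[OF sX(1), of \<mu>] by (simp add: sX(2) AX)
  have pE: "posdef (extended_scatter m (mat_of S))" if "S \<in> pos_def" for m S
    using that by (intro posdef_extended_scatter) (simp add: pos_def_iff)
  have min: "location_scatter_objective \<nu> P (\<mu>, symmat_of X) \<le> location_scatter_objective \<nu> P (m, S)" if "S \<in> pos_def" for m S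
    unfolding objA obj[OF that] by (rule Q.critical_minimal(1)[OF crit pE[OF that]])
  have uniq: "(m, S) = (\<mu>, symmat_of X)"
    if S: "S \<in> pos_def" and le: "location_scatter_objective \<nu> P (m, S) \<le> location_scatter_objective \<nu> P (\<mu>, symmat_of X)" for m S
  proof -
    have "Q.objective (extended_scatter m (mat_of S)) = Q.objective A"
      using min[OF S, of m] le unfolding objA obj[OF S] by simp
    then have eq: "extended_scatter m (mat_of S) = A" by (rule Q.critical_minimal(2)[OF crit pE[OF S]])
    have "m = \<mu>" "mat_of S = X" unfolding \<mu>_def X_def eq[symmetric] by simp_all
    then show ?thesis by (metis mat_of_inverse)
  qed
  have "is_arg_min (location_scatter_objective \<nu> P) (\<lambda>p. p \<in> UNIV \<times> pos_def) (\<mu>, symmat_of X)"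
    unfolding is_arg_min_def using min sX(1) by (auto simp: not_less)
  moreover have "p = (\<mu>, symmat_of X)"
    if "is_arg_min (location_scatter_objective \<nu> P) (\<lambda>p. p \<in> UNIV \<times> pos_def) p" for p
  proof (cases p)
    case (Pair m S)
    then have "S \<in> pos_def" "\<not> location_scatter_objective \<nu> P (\<mu>, symmat_of X) < location_scatter_objective \<nu> P (m, S)"
      using that sX(1) unfolding is_arg_min_def by auto
    then show ?thesis unfolding Pair by (intro uniq) auto
  qed
  ultimately have "t_location_scatter \<nu> P = (\<mu>, symmat_of X)"
    unfolding t_location_scatter_def by (rule the_equality)
  then show ?thesis by (simp add: \<mu>_def[symmetric] X_def[symmetric] spX)
qed

section \<open>Analyticity of the location-scatter functional\<close>

definition location_scatter_linear :: "real^('n::finite option)^('n option) \<Rightarrow> (real^'n) \<times> (real^'n^'n)" where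
  "location_scatter_linear A = (location_part A, \<chi> i j. A $ Some i $ Some j)"

definition location_scatter_bilinear :: "real^('n::finite option)^('n option) \<Rightarrow> real^('n option)^('n option) \<Rightarrow> (real^'n) \<times> (real^'n^'n)" where
  "location_scatter_bilinear A B = (0, \<chi> i j. - (A $ Some i $ None * B $ Some j $ None))"

lemma location_scatter_split:
  "location_scatter_linear A + location_scatter_bilinear A A = (location_part A, scatter_part A)"
  by (simp add: location_scatter_linear_def location_scatter_bilinear_def scatter_part_def vec_eq_iff)

lemma bounded_linear_location_scatter_linear: "bounded_linear location_scatter_linear"
  unfolding linear_conv_bounded_linear[symmetric]
  by (rule linearI) (simp_all add: location_scatter_linear_def location_part_def vec_eq_iff)

lemma bounded_bilinear_location_scatter_bilinear: "bounded_bilinear location_scatter_bilinear"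
  unfolding bilinear_conv_bounded_bilinear[symmetric] bilinear_def
  by (auto intro!: linearI simp: location_scatter_bilinear_def vec_eq_iff algebra_simps)

lemma bounded_linear_sym_pair: "bounded_linear (\<lambda>p. (fst p, sym_part (snd p)))"
  by (intro bounded_linear_Pair bounded_linear_fst bounded_linear_compose[OF bounded_linear_sym_part bounded_linear_snd])

lemma bl_functions_append_one:
  fixes f :: "real^('n::finite option) \<Rightarrow> real"
  assumes "f \<in> bl_functions"
  shows "(\<lambda>y. f (append_one y)) \<in> bl_functions"
proof -
  obtain B L where BL: "\<And>x. \<bar>f x\<bar> \<le> B" "\<And>x y. \<bar>f x - f y\<bar> \<le> L * norm (x - y)"
    using assms by (elim bl_functionsE) blast
  show ?thesis
    by (rule bl_functionsI[of _ B L]) (use BL(1) BL(2)[of "append_one _" "append_one _"] in \<open>auto simp: norm_append_one_diff\<close>)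
qed

definition bl_pull :: "(real^('n::finite option)) bl \<Rightarrow> (real^'n) bl" where
  "bl_pull f = Bl (\<lambda>y. bl_apply f (append_one y))"

lemma bl_pull_apply: "bl_apply (bl_pull f) y = bl_apply f (append_one y)"
  unfolding bl_pull_def by (subst bl_apply_Bl[OF bl_functions_append_one[OF bl_apply]]) simp

lemma norm_bl_pull: "norm (bl_pull f) \<le> norm f"
proof -
  have "sup_abs (bl_apply (bl_pull f)) \<le> sup_abs (bl_apply f)"
    by (rule sup_abs_least) (simp add: bl_pull_apply sup_abs_upper[OF bl_apply])
  moreover have "lip_const (bl_apply (bl_pull f)) \<le> lip_const (bl_apply f)"
    by (rule lip_const_least)
      (use lip_const_upper[OF bl_apply, of f "append_one _" "append_one _"] in \<open>simp add: bl_pull_apply norm_append_one_diff\<close>)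
  ultimately show ?thesis by (simp add: norm_bl.rep_eq)
qed

lemma bounded_linear_bl_pull: "bounded_linear bl_pull"
  by (rule bounded_linear_intro[where K = 1])
    (auto intro!: bl_eqI simp: bl_pull_apply plus_bl.rep_eq scaleR_bl.rep_eq norm_bl_pull)

definition push :: "(real^'n::finite) bl_dual \<Rightarrow> (real^('n option)) bl_dual" where
  "push \<phi> = \<phi> o\<^sub>L Blinfun bl_pull"

lemma bounded_linear_push: "bounded_linear push"
  unfolding push_def[abs_def] by (rule bounded_bilinear.bounded_linear_left[OF bounded_bilinear_blinfun_compose])

lemma bl_apply_measurable: "bl_apply f \<in> borel_measurable borel"
proof -
  obtain L where "L-lipschitz_on UNIV (bl_apply f)" using bl_apply[of f] by (auto simp: bl_functions_def)
  then show ?thesis by (intro borel_measurable_continuous_onI lipschitz_on_continuous_on)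
qed

lemma push_law_phi:
  assumes "law P"
  shows "push (law_phi P) = law_phi (distr P borel append_one)"
proof (rule blinfun_eqI)
  fix f
  have "blinfun_apply (push (law_phi P)) f = (\<integral>y. bl_apply f (append_one y) \<partial>P)"
    by (simp add: push_def bounded_linear_Blinfun_apply[OF bounded_linear_bl_pull] law_phi_apply[OF assms] bl_pull_apply)
  also have "\<dots> = (\<integral>z. bl_apply f z \<partial>distr P borel append_one)"
    by (rule integral_distr[OF law_measurable[OF assms append_one_measurable] bl_apply_measurable, symmetric])
  also have "\<dots> = blinfun_apply (law_phi (distr P borel append_one)) f"
    by (rule law_phi_apply[OF law_distr[OF assms append_one_measurable], symmetric])
  finally show "blinfun_apply (push (law_phi P)) f = blinfun_apply (law_phi (distr P borel append_one)) f" .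
qed

theorem t_location_scatter_analytic:
  assumes nu: "1 < \<nu>"
  shows "analytic_functional law_phi (law_V (\<nu> + real CARD('n)) :: (real^'n::finite) measure set) (t_location_scatter \<nu>)"
  unfolding analytic_functional_def
proof
  fix P0 :: "(real^'n) measure" assume P0: "P0 \<in> law_V (\<nu> + real CARD('n))"
  have law: "law P" if "P \<in> law_V (\<nu> + real CARD('n))" for P :: "(real^'n) measure"
    using that by (simp add: law_V_def)
  let ?start = "distr P0 borel append_one"
  interpret Q0: spread_law_scatter ?start "\<nu> - 1" by (rule spread_append_one[OF nu P0])
  have nu': "0 < \<nu> - 1" using nu by simp
  obtain A0 where crit: "Q0.critical A0" using Q0.critical_unique by blast
  have A0: "posdef A0" using crit by (simp add: Q0.critical_def)
  define C0 where "C0 = matrix_inv A0"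
  have pC0: "posdef C0" unfolding C0_def by (rule posdef_inverse[OF A0])
  define \<kappa> where "\<kappa> = Q0.dof"
  have \<kappa>: "\<kappa> = \<nu> + real CARD('n)" by (simp add: \<kappa>_def Q0.dof_def)
  have base: "A0 = \<kappa> *\<^sub>R pairing (bl_kernel (\<nu> - 1) (C0 + 0)) (law_phi ?start)"
    using crit by (simp add: Q0.critical_iff_pairing[OF A0] C0_def \<kappa>_def)
  have inj: "c = 0" if "A0 ** c ** A0 = \<kappa> *\<^sub>R pairing (bl_kernel (\<nu> - 1) (C0 + 0)) (act (law_phi ?start) (combination (bl_kernel (\<nu> - 1) (C0 + 0)) c))" for c
    using that Q0.linearization_law[OF pC0, of c] by (intro Q0.linearization_injective[OF crit]) (simp add: C0_def \<kappa>_def)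
  have E: "posdef (C0 + 0)" using pC0 by simp
  obtain r g where r: "0 < r"
    and an: "frechet_analytic_on (ball (law_phi ?start) r) (\<lambda>\<phi>. location_scatter_linear (g \<phi>) + location_scatter_bilinear (g \<phi>) (g \<phi>))"
    and g: "\<And>\<phi>. \<phi> \<in> ball (law_phi ?start) r \<Longrightarrow> posdef (g \<phi>) \<and> posdef (matrix_inv (g \<phi>) + 0) \<and>
      g \<phi> = \<kappa> *\<^sub>R pairing (bl_kernel (\<nu> - 1) (matrix_inv (g \<phi>) + 0)) \<phi>"
    using scatter_local_solution[OF nu' A0 C0_def E base inj bounded_linear_location_scatter_linear bounded_bilinear_location_scatter_bilinear]
    by blast
  define G where "G \<phi> = 0 + (\<lambda>p. (fst p, sym_part (snd p))) (location_scatter_linear (g \<phi>) + location_scatter_bilinear (g \<phi>) (g \<phi>))" for \<phi>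
  have "frechet_analytic_on (ball (law_phi ?start) r) G"
    unfolding G_def[abs_def] by (rule frechet_analytic_on_compose_linear[OF bounded_linear_sym_pair an])
  then have an': "frechet_analytic_on {\<phi>. push \<phi> + 0 \<in> ball (law_phi ?start) r} (\<lambda>\<phi>. G (push \<phi> + 0))"
    by (rule frechet_analytic_on_precompose_affine[OF bounded_linear_push])
  show "\<exists>U ga. law_phi P0 \<in> U \<and> frechet_analytic_on U ga \<and>
      (\<forall>P\<in>law_V (\<nu> + real CARD('n)). law_phi P \<in> U \<longrightarrow> ga (law_phi P) = t_location_scatter \<nu> P)"
  proof (intro exI[of _ "{\<phi>. push \<phi> + 0 \<in> ball (law_phi ?start) r}"] exI[of _ "\<lambda>\<phi>. G (push \<phi> + 0)"] conjI ballI impI an')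
    show "law_phi P0 \<in> {\<phi>. push \<phi> + 0 \<in> ball (law_phi ?start) r}"
      using r by (simp add: push_law_phi[OF law[OF P0]])
    fix P :: "(real^'n) measure" assume P: "P \<in> law_V (\<nu> + real CARD('n))"
      and m': "law_phi P \<in> {\<phi>. push \<phi> + 0 \<in> ball (law_phi ?start) r}"
    let ?Q = "distr P borel append_one"
    have pu: "push (law_phi P) = law_phi ?Q" by (rule push_law_phi[OF law[OF P]])
    have m: "law_phi ?Q \<in> ball (law_phi ?start) r" using m' unfolding mem_Collect_eq pu add_0_right .
    interpret Q: spread_law_scatter ?Q "\<nu> - 1" by (rule spread_append_one[OF nu P])
    have pd: "posdef (g (law_phi ?Q))" using g[OF m] by blast
    have "Q.critical (g (law_phi ?Q))"
      using g[OF m] by (simp add: Q.critical_iff_pairing[OF pd] \<kappa> Q.dof_def)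
    from t_location_scatter_eq[OF nu P this] show "G (push (law_phi P) + 0) = t_location_scatter \<nu> P"
      by (simp add: G_def pu location_scatter_split)
  qed
qed

section \<open>Finite signed measures on the line have bounded variation\<close>

lemma signed_measure_diff:
  assumes "A \<in> sets borel" "B \<in> sets borel" "A \<subseteq> B"
  shows "sm_apply \<tau> (B - A) = sm_apply \<tau> B - sm_apply \<tau> A"
proof -
  have "A \<union> (B - A) = B" using assms(3) by auto
  then show ?thesis using signed_measures_Un[OF sm_apply, of A "B - A" \<tau>] assms by simp
qed

lemma signed_measure_decseq_convergent:
  assumes "range A \<subseteq> sets borel" "decseq A"
  shows "convergent (\<lambda>n. sm_apply \<tau> (A n))"
proof -
  have A: "A n \<in> sets borel" for n using assms(1) by auto
  have "convergent (\<lambda>n. sm_apply \<tau> (UNIV - A n))"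
    using assms by (intro signed_measures_incseq[OF sm_apply]) (auto simp: decseq_def incseq_def)
  then have "convergent (\<lambda>n. sm_apply \<tau> UNIV - sm_apply \<tau> (UNIV - A n))"
    by (intro convergent_diff convergent_const)
  moreover have "sm_apply \<tau> UNIV - sm_apply \<tau> (UNIV - A n) = sm_apply \<tau> (A n)" for n
    using signed_measure_diff[of "A n" UNIV \<tau>] A by simp
  ultimately show ?thesis by simp
qed

text \<open>
  If \<open>\<tau>\<close> were unbounded, one could choose decreasing sets on each of which it is unbounded, and whose measures tend
  to infinity in absolute value: of a set \<open>A\<close> of large measure in \<open>E\<close> and its complement in \<open>E\<close>, which then has large measure
  too, at least one again contains sets of arbitrarily large measure. But the measures of decreasing sets converge.
\<close>

lemma signed_measure_bounded:
  obtains B where "\<And>A. \<bar>sm_apply \<tau> A\<bar> \<le> B"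
proof -
  define unbdd where "unbdd E \<longleftrightarrow> (\<forall>M. \<exists>A\<in>sets borel. A \<subseteq> E \<and> M < \<bar>sm_apply \<tau> A\<bar>)" for E
  have step: "\<exists>A. A \<in> sets borel \<and> A \<subseteq> E \<and> M < \<bar>sm_apply \<tau> A\<bar> \<and> unbdd A"
    if E: "E \<in> sets borel" and u: "unbdd E" for E and M :: real
  proof -
    obtain A where A: "A \<in> sets borel" "A \<subseteq> E" "\<bar>M\<bar> + \<bar>sm_apply \<tau> E\<bar> < \<bar>sm_apply \<tau> A\<bar>"
      using u unfolding unbdd_def by blast
    have d: "sm_apply \<tau> (E - A) = sm_apply \<tau> E - sm_apply \<tau> A" by (rule signed_measure_diff[OF A(1) E A(2)])
    have "unbdd A \<or> unbdd (E - A)"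
    proof (rule ccontr)
      assume "\<not> (unbdd A \<or> unbdd (E - A))"
      then obtain M1 M2 where M: "\<And>B. B \<in> sets borel \<Longrightarrow> B \<subseteq> A \<Longrightarrow> \<bar>sm_apply \<tau> B\<bar> \<le> M1"
          "\<And>B. B \<in> sets borel \<Longrightarrow> B \<subseteq> E - A \<Longrightarrow> \<bar>sm_apply \<tau> B\<bar> \<le> M2"
        unfolding unbdd_def by (meson not_le)
      obtain B where B: "B \<in> sets borel" "B \<subseteq> E" "M1 + M2 < \<bar>sm_apply \<tau> B\<bar>"
        using u unfolding unbdd_def by blast
      have "sm_apply \<tau> (B - B \<inter> A) = sm_apply \<tau> B - sm_apply \<tau> (B \<inter> A)"
        using A(1) B(1) by (intro signed_measure_diff) auto
      moreover have "\<bar>sm_apply \<tau> (B \<inter> A)\<bar> \<le> M1" using A(1) B(1) by (intro M(1)) auto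
      moreover have "\<bar>sm_apply \<tau> (B - B \<inter> A)\<bar> \<le> M2" using A(1) B(1,2) by (intro M(2)) auto
      ultimately show False using B(3) by linarith
    qed
    then show ?thesis
    proof
      assume "unbdd A"
      then show ?thesis using A by (intro exI[of _ A]) auto
    next
      assume "unbdd (E - A)"
      then show ?thesis using A d E by (intro exI[of _ "E - A"]) auto
    qed
  qed
  have "\<not> unbdd UNIV"
  proof
    assume u: "unbdd UNIV"
    have "\<exists>E. \<forall>n. (E n \<in> sets borel \<and> unbdd (E n)) \<and> (E (Suc n) \<subseteq> E n \<and> real n < \<bar>sm_apply \<tau> (E (Suc n))\<bar>)"
    proof (rule dependent_nat_choice)
      show "\<exists>E. E \<in> sets borel \<and> unbdd E" using u by (intro exI[of _ UNIV]) simp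
      fix E n assume "E \<in> sets borel \<and> unbdd E"
      then obtain A where "A \<in> sets borel" "A \<subseteq> E" "real n < \<bar>sm_apply \<tau> A\<bar>" "unbdd A" using step[of E "real n"] by blast
      then show "\<exists>A. (A \<in> sets borel \<and> unbdd A) \<and> A \<subseteq> E \<and> real n < \<bar>sm_apply \<tau> A\<bar>" by blast
    qed
    then obtain E where E: "\<And>n. E n \<in> sets borel" "\<And>n. E (Suc n) \<subseteq> E n" "\<And>n. real n < \<bar>sm_apply \<tau> (E (Suc n))\<bar>"
      by auto
    have "convergent (\<lambda>n. sm_apply \<tau> (E n))"
      using E(1,2) by (intro signed_measure_decseq_convergent decseq_SucI) auto
    then have "Bseq (\<lambda>n. sm_apply \<tau> (E n))" by (rule convergent_imp_Bseq)
    then obtain K where K: "\<And>n. \<bar>sm_apply \<tau> (E n)\<bar> \<le> K" by (auto simp: Bseq_def)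
    obtain n where "K < real n" using reals_Archimedean2 by blast
    then show False using K[of "Suc n"] E(3)[of n] by linarith
  qed
  then obtain M where M: "\<And>A. A \<in> sets borel \<Longrightarrow> \<bar>sm_apply \<tau> A\<bar> \<le> M" unfolding unbdd_def by (meson not_le subset_UNIV)
  have "\<bar>sm_apply \<tau> A\<bar> \<le> \<bar>M\<bar>" for A
    using M[of A] sm_apply[of \<tau>] by (cases "A \<in> sets borel") (auto simp: signed_measures_def)
  then show ?thesis by (rule that)
qed

lemma signed_measure_finite_UN:
  assumes "finite I" "\<And>i. i \<in> I \<Longrightarrow> A i \<in> sets borel" "disjoint_family_on A I"
  shows "sm_apply \<tau> (\<Union>i\<in>I. A i) = (\<Sum>i\<in>I. sm_apply \<tau> (A i))"
  using assms
proof (induction I rule: finite_induct)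
  case empty
  then show ?case by (simp add: signed_measures_empty[OF sm_apply])
next
  case (insert i I)
  have "A i \<inter> (\<Union>i\<in>I. A i) = {}" using insert.prems(2) insert.hyps(2) by (auto simp: disjoint_family_on_def)
  then have "sm_apply \<tau> (A i \<union> (\<Union>i\<in>I. A i)) = sm_apply \<tau> (A i) + sm_apply \<tau> (\<Union>i\<in>I. A i)"
    using insert.prems(1) insert.hyps(1) by (intro signed_measures_Un[OF sm_apply] sets.finite_UN) auto
  moreover have "disjoint_family_on A I" using insert.prems(2) by (auto simp: disjoint_family_on_def)
  ultimately show ?case using insert by simp
qed

text \<open>
  Separate the sets of nonnegative and of negative measure.
\<close>

lemma signed_measure_variation:
  assumes B: "\<And>A. \<bar>sm_apply \<tau> A\<bar> \<le> B" and I: "finite I" "\<And>i. i \<in> I \<Longrightarrow> A i \<in> sets borel" "disjoint_family_on A I"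
  shows "(\<Sum>i\<in>I. \<bar>sm_apply \<tau> (A i)\<bar>) \<le> 2 * B"
proof -
  let ?P = "{i\<in>I. 0 \<le> sm_apply \<tau> (A i)}" and ?N = "{i\<in>I. \<not> 0 \<le> sm_apply \<tau> (A i)}"
  have sub: "sm_apply \<tau> (\<Union>i\<in>J. A i) = (\<Sum>i\<in>J. sm_apply \<tau> (A i))" if "J \<subseteq> I" for J
    using that I by (intro signed_measure_finite_UN) (auto intro: finite_subset disjoint_family_on_mono)
  have "(\<Sum>i\<in>I. \<bar>sm_apply \<tau> (A i)\<bar>) = (\<Sum>i\<in>?P. \<bar>sm_apply \<tau> (A i)\<bar>) + (\<Sum>i\<in>?N. \<bar>sm_apply \<tau> (A i)\<bar>)"
    using I(1) by (subst sum.union_disjoint[symmetric]) (auto intro!: sum.cong)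
  also have "(\<Sum>i\<in>?P. \<bar>sm_apply \<tau> (A i)\<bar>) = sm_apply \<tau> (\<Union>i\<in>?P. A i)" by (subst sub) auto
  also have "(\<Sum>i\<in>?N. \<bar>sm_apply \<tau> (A i)\<bar>) = - sm_apply \<tau> (\<Union>i\<in>?N. A i)"
    by (subst sub) (auto simp: sum_negf[symmetric] intro!: sum.cong)
  finally show ?thesis using B[of "\<Union>i\<in>?P. A i"] B[of "\<Union>i\<in>?N. A i"] by linarith
qed

lemma signed_measure_UNIV_le: "\<bar>sm_apply \<tau> UNIV\<bar> \<le> norm \<tau>"
proof -
  let ?A = "\<lambda>n. if n = 0 then {..0} else {real n - 1<..real n}"
  have dis: "disjoint_family ?A"
    unfolding disjoint_family_on_def
  proof (intro ballI impI)
    fix m n :: nat assume "m \<noteq> n"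
    then have "real m + 1 \<le> real n \<or> real n + 1 \<le> real m"
      by (metis Suc_leI linorder_neqE_nat of_nat_Suc of_nat_le_iff add.commute)
    then show "?A m \<inter> ?A n = {}" by auto
  qed
  have un: "(\<Union>n<Suc m. ?A n) = {..real m}" for m
  proof (induction m)
    case (Suc m)
    then show ?case by (auto simp: lessThan_Suc[of "Suc m"])
  qed auto
  have "(\<Union>n. ?A n) = (\<Union>m. \<Union>n<Suc m. ?A n)" by blast
  also have "\<dots> = (\<Union>m. {..real m})" by (simp only: un)
  also have "\<dots> = UNIV" using real_arch_simple by auto
  finally have "(\<lambda>n. sm_apply \<tau> (?A n)) sums sm_apply \<tau> UNIV"
    using signed_measures_sums[OF sm_apply[of \<tau>] _ dis] by (simp only:) (simp add: image_subset_iff)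
  then have "(\<lambda>m. \<Sum>n<Suc m. sm_apply \<tau> (?A n)) \<longlonglongrightarrow> sm_apply \<tau> UNIV"
    unfolding sums_def by (rule LIMSEQ_Suc)
  moreover have "(\<Sum>n<Suc m. sm_apply \<tau> (?A n)) = sm_apply \<tau> {..real m}" for m
    unfolding un[symmetric] using dis
    by (intro signed_measure_finite_UN[symmetric]) (auto intro: disjoint_family_on_mono)
  ultimately have "(\<lambda>m. sm_apply \<tau> {..real m}) \<longlonglongrightarrow> sm_apply \<tau> UNIV" by (simp only:)
  then have "(\<lambda>m. \<bar>sm_apply \<tau> {..real m}\<bar>) \<longlonglongrightarrow> \<bar>sm_apply \<tau> UNIV\<bar>" by (rule tendsto_rabs)
  then show ?thesis by (rule LIMSEQ_le_const2) (auto intro: norm_signed_measure_upper)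
qed

section \<open>Stieltjes integrals over the compactified line\<close>

text \<open>
  A half-line, described by the angle \<open>\<theta>\<close> with \<open>x = tan \<theta>\<close>; at and beyond the ends of the
  open interval from \<open>- pi / 2\<close> to \<open>pi / 2\<close> it is empty or the whole line.
\<close>

definition angle_set :: "real \<Rightarrow> real set" where
  "angle_set \<theta> = {x. arctan x \<le> \<theta>}"

lemma angle_set_cases: "angle_set \<theta> = {} \<or> angle_set \<theta> = UNIV \<or> (\<exists>x. angle_set \<theta> = {..x})"
proof -
  consider "\<theta> \<le> - (pi/2)" | "pi/2 \<le> \<theta>" | "- (pi/2) < \<theta>" "\<theta> < pi/2" by linarith
  then show ?thesis
  proof cases
    case 1
    have "\<not> arctan x \<le> \<theta>" for x using arctan_lbound[of x] 1 by linarith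
    then show ?thesis by (auto simp: angle_set_def)
  next
    case 2
    have "arctan x \<le> \<theta>" for x using arctan_ubound[of x] 2 by linarith
    then show ?thesis by (auto simp: angle_set_def)
  next
    case 3
    have "arctan x \<le> \<theta> \<longleftrightarrow> x \<le> tan \<theta>" for x using arctan_le_iff[of x "tan \<theta>"] arctan_tan[of \<theta>] 3 by simp
    then have "angle_set \<theta> = {..tan \<theta>}" by (auto simp: angle_set_def)
    then show ?thesis by blast
  qed
qed

lemma angle_set_borel: "angle_set \<theta> \<in> sets borel"
  using angle_set_cases[of \<theta>] by auto

lemma angle_set_le: "\<bar>sm_apply \<tau> (angle_set \<theta>)\<bar> \<le> norm \<tau>"
  using angle_set_cases[of \<theta>] signed_measure_UNIV_le[of \<tau>] norm_signed_measure_upper[of \<tau>]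
  by (auto simp: signed_measures_empty[OF sm_apply])

definition node :: "nat \<Rightarrow> nat \<Rightarrow> real" where
  "node n k = - (pi/2) + real k * (pi / 2 ^ n)"

lemma angle_set_node: "angle_set (node n 0) = {}" "angle_set (node n (2 ^ n)) = UNIV"
  using arctan_lbound less_imp_le[OF arctan_ubound] by (auto simp: angle_set_def node_def not_le)

lemma node_Suc: "node n (Suc k) - node n k = pi / 2 ^ n"
  by (simp add: node_def algebra_simps add_divide_distrib)

lemma node_refine: "node (Suc n) (2 * k) = node n k"
  by (simp add: node_def)

lemma node_mono: "k \<le> l \<Longrightarrow> node n k \<le> node n l"
  by (simp add: node_def divide_right_mono mult_right_mono)

definition cell :: "nat \<Rightarrow> nat \<Rightarrow> real set" where
  "cell n k = angle_set (node n (Suc k)) - angle_set (node n k)"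

lemma cell_borel: "cell n k \<in> sets borel"
  unfolding cell_def by (intro sets.Diff angle_set_borel)

lemma angle_set_mono: "\<theta> \<le> \<eta> \<Longrightarrow> angle_set \<theta> \<subseteq> angle_set \<eta>"
  by (auto simp: angle_set_def)

lemma sm_cell: "sm_apply \<tau> (cell n k) = sm_apply \<tau> (angle_set (node n (Suc k))) - sm_apply \<tau> (angle_set (node n k))"
  unfolding cell_def by (intro signed_measure_diff angle_set_borel angle_set_mono node_mono) simp

lemma disjoint_cells: "disjoint_family_on (cell n) I"
  unfolding disjoint_family_on_def
proof (intro ballI impI)
  fix k l :: nat assume "k \<noteq> l"
  then have "node n (Suc k) \<le> node n l \<or> node n (Suc l) \<le> node n k"
    using node_mono[of "Suc k" l n] node_mono[of "Suc l" k n] by linarith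
  then show "cell n k \<inter> cell n l = {}" by (auto simp: cell_def angle_set_def)
qed

lemma cell_refine: "sm_apply \<tau> (cell n k) = sm_apply \<tau> (cell (Suc n) (2 * k)) + sm_apply \<tau> (cell (Suc n) (Suc (2 * k)))"
  using node_refine[of n k] node_refine[of n "Suc k"] by (simp add: sm_cell)

definition circle_point :: "real \<Rightarrow> real^(1 option)" where
  "circle_point \<theta> = (\<chi> k. case k of None \<Rightarrow> cos \<theta> | Some i \<Rightarrow> sin \<theta>)"

lemma circle_point_nth [simp]: "circle_point \<theta> $ None = cos \<theta>" "circle_point \<theta> $ Some i = sin \<theta>"
  by (simp_all add: circle_point_def)

lemma circle_point_diff: "norm (circle_point \<theta> - circle_point \<eta>) \<le> 2 * \<bar>\<theta> - \<eta>\<bar>"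
proof -
  have s: "\<bar>sin x\<bar> \<le> \<bar>x\<bar>" for x :: real by (rule abs_sin_x_le_abs_x)
  have "\<bar>sin \<theta> - sin \<eta>\<bar> \<le> \<bar>\<theta> - \<eta>\<bar>"
  proof -
    have "\<bar>sin \<theta> - sin \<eta>\<bar> = 2 * \<bar>sin ((\<theta> - \<eta>) / 2)\<bar> * \<bar>cos ((\<theta> + \<eta>) / 2)\<bar>"
      by (simp add: sin_diff_sin abs_mult)
    also have "\<dots> \<le> 2 * \<bar>(\<theta> - \<eta>) / 2\<bar> * 1" using s[of "(\<theta> - \<eta>) / 2"] by (intro mult_mono) auto
    finally show ?thesis by simp
  qed
  moreover have "\<bar>cos \<theta> - cos \<eta>\<bar> \<le> \<bar>\<theta> - \<eta>\<bar>"
  proof -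
    have "\<bar>cos \<theta> - cos \<eta>\<bar> = 2 * \<bar>sin ((\<eta> - \<theta>) / 2)\<bar> * \<bar>sin ((\<theta> + \<eta>) / 2)\<bar>"
      by (simp add: cos_diff_cos abs_mult mult.commute mult.left_commute)
    also have "\<dots> \<le> 2 * \<bar>(\<eta> - \<theta>) / 2\<bar> * 1" using s[of "(\<eta> - \<theta>) / 2"] by (intro mult_mono) auto
    finally show ?thesis by simp
  qed
  moreover have "norm (circle_point \<theta> - circle_point \<eta>) \<le> (\<Sum>k\<in>UNIV. \<bar>(circle_point \<theta> - circle_point \<eta>) $ k\<bar>)"
    by (rule norm_le_l1_cart)
  ultimately show ?thesis by (simp add: sum_option)
qed

abbreviation circle_fun :: "(real^(1 option)) bl \<Rightarrow> real \<Rightarrow> real" where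
  "circle_fun f \<theta> \<equiv> bl_apply f (circle_point \<theta>)"

lemma circle_fun_le: "\<bar>circle_fun f \<theta>\<bar> \<le> norm f"
  using sup_abs_upper[OF bl_apply, of f "circle_point \<theta>"] lip_const_nonneg[OF bl_apply, of f] by (simp add: norm_bl.rep_eq)

lemma circle_fun_diff: "\<bar>circle_fun f \<theta> - circle_fun f \<eta>\<bar> \<le> 2 * norm f * \<bar>\<theta> - \<eta>\<bar>"
proof -
  have "\<bar>circle_fun f \<theta> - circle_fun f \<eta>\<bar> \<le> lip_const (bl_apply f) * norm (circle_point \<theta> - circle_point \<eta>)"
    by (rule lip_const_upper[OF bl_apply])
  also have "\<dots> \<le> norm f * (2 * \<bar>\<theta> - \<eta>\<bar>)"
    using sup_abs_upper[OF bl_apply, of f 0] lip_const_nonneg[OF bl_apply, of f] by (intro mult_mono circle_point_diff) (auto simp: norm_bl.rep_eq)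
  finally show ?thesis by simp
qed

text \<open>
  The sum for the dyadic partition of the half-circle into \<open>2 ^ n\<close> arcs, evaluated at right endpoints.
\<close>

definition stieltjes_sum :: "nat \<Rightarrow> signed_measure \<Rightarrow> (real^(1 option)) bl \<Rightarrow> real" where
  "stieltjes_sum n \<tau> f = (\<Sum>k<2 ^ n. circle_fun f (node n (Suc k)) * sm_apply \<tau> (cell n k))"

lemma summation_by_parts:
  fixes a b :: "nat \<Rightarrow> real"
  shows "(\<Sum>k<N. b (Suc k) * (a (Suc k) - a k)) = b N * a N - b 0 * a 0 - (\<Sum>k<N. a k * (b (Suc k) - b k))"
  by (induction N) (simp_all add: algebra_simps)

text \<open>
  Summation by parts moves the differences from the distribution function, which is bounded by the Kolmogorov norm, to the
  function on the half-circle, whose variation is at most its Lipschitz constant times the length. There is no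
  contribution of the left end because the distribution function vanishes there.
\<close>

lemma stieltjes_sum_le: "\<bar>stieltjes_sum n \<tau> f\<bar> \<le> (1 + 2 * pi) * norm \<tau> * norm f"
proof -
  let ?b = "\<lambda>k. circle_fun f (node n k)" and ?a = "\<lambda>k. sm_apply \<tau> (angle_set (node n k))"
  have "stieltjes_sum n \<tau> f = ?b (2 ^ n) * ?a (2 ^ n) - (\<Sum>k<2 ^ n. ?a k * (?b (Suc k) - ?b k))"
    unfolding stieltjes_sum_def sm_cell summation_by_parts[of ?b ?a]
    by (simp add: angle_set_node signed_measures_empty[OF sm_apply])
  then have "\<bar>stieltjes_sum n \<tau> f\<bar> \<le> \<bar>?b (2 ^ n) * ?a (2 ^ n)\<bar> + (\<Sum>k<2 ^ n. \<bar>?a k * (?b (Suc k) - ?b k)\<bar>)"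
    using sum_abs[of "\<lambda>k. ?a k * (?b (Suc k) - ?b k)" "{..<2 ^ n}"] by linarith
  also have "\<dots> \<le> norm f * norm \<tau> + (\<Sum>k<(2::nat) ^ n. norm \<tau> * (2 * norm f * (pi / 2 ^ n)))"
  proof (intro add_mono sum_mono)
    show "\<bar>?b (2 ^ n) * ?a (2 ^ n)\<bar> \<le> norm f * norm \<tau>"
      unfolding abs_mult by (intro mult_mono circle_fun_le angle_set_le) auto
    fix k
    have "\<bar>?b (Suc k) - ?b k\<bar> \<le> 2 * norm f * (pi / 2 ^ n)"
      using circle_fun_diff[of f "node n (Suc k)" "node n k"] unfolding node_Suc by simp
    then show "\<bar>?a k * (?b (Suc k) - ?b k)\<bar> \<le> norm \<tau> * (2 * norm f * (pi / 2 ^ n))"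
      unfolding abs_mult by (intro mult_mono angle_set_le) auto
  qed
  also have "\<dots> = (1 + 2 * pi) * norm \<tau> * norm f" by (simp add: algebra_simps)
  finally show ?thesis .
qed

text \<open>
  Refining the partition changes the value only on the left half of each arc, by at most the oscillation there. Summed against
  the total variation of \<open>\<tau>\<close>, these changes form a geometric series. The variation is finite but not controlled by the
  Kolmogorov norm; it enters only the convergence, not the bound.
\<close>

lemma stieltjes_sum_convergent: "convergent (\<lambda>n. stieltjes_sum n \<tau> f)"
proof -
  obtain B where B: "\<And>A. \<bar>sm_apply \<tau> A\<bar> \<le> B" using signed_measure_bounded by blast
  have b: "norm (stieltjes_sum (Suc n) \<tau> f - stieltjes_sum n \<tau> f) \<le> (2 * norm f * pi * (2 * B)) * (1/2) ^ Suc n" for n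
  proof -
    let ?m = "\<lambda>k. sm_apply \<tau> (cell (Suc n) k)" and ?b = "\<lambda>k. circle_fun f (node (Suc n) k)"
    have "stieltjes_sum (Suc n) \<tau> f = (\<Sum>k<2 ^ n. ?b (Suc (2 * k)) * ?m (2 * k) + ?b (Suc (Suc (2 * k))) * ?m (Suc (2 * k)))"
      using sum.nat_group[of "\<lambda>k. ?b (Suc k) * ?m k" 2 "2 ^ n", symmetric]
      by (simp add: stieltjes_sum_def mult.commute numeral_2_eq_2)
    moreover have "stieltjes_sum n \<tau> f = (\<Sum>k<2 ^ n. ?b (Suc (Suc (2 * k))) * ?m (2 * k) + ?b (Suc (Suc (2 * k))) * ?m (Suc (2 * k)))"
    proof -
      have "node n (Suc k) = node (Suc n) (Suc (Suc (2 * k)))" for k using node_refine[of n "Suc k"] by simp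
      then show ?thesis unfolding stieltjes_sum_def cell_refine[of \<tau> n] by (simp only: distrib_left)
    qed
    ultimately have eq: "stieltjes_sum (Suc n) \<tau> f - stieltjes_sum n \<tau> f = (\<Sum>k<2 ^ n. (?b (Suc (2 * k)) - ?b (Suc (Suc (2 * k)))) * ?m (2 * k))"
      by (simp only: sum_subtractf[symmetric]) (rule sum.cong, simp_all add: left_diff_distrib)
    have "\<bar>stieltjes_sum (Suc n) \<tau> f - stieltjes_sum n \<tau> f\<bar> \<le> (\<Sum>k<2 ^ n. \<bar>(?b (Suc (2 * k)) - ?b (Suc (Suc (2 * k)))) * ?m (2 * k)\<bar>)"
      unfolding eq by (rule sum_abs)
    also have "\<dots> \<le> (\<Sum>k<2 ^ n. (2 * norm f * (pi / 2 ^ Suc n)) * \<bar>?m (2 * k)\<bar>)"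
    proof (rule sum_mono)
      fix k
      have "\<bar>?b (Suc (2 * k)) - ?b (Suc (Suc (2 * k)))\<bar> \<le> 2 * norm f * (pi / 2 ^ Suc n)"
        using circle_fun_diff[of f "node (Suc n) (Suc (Suc (2 * k)))" "node (Suc n) (Suc (2 * k))"]
        unfolding node_Suc by (simp add: abs_minus_commute)
      then show "\<bar>(?b (Suc (2 * k)) - ?b (Suc (Suc (2 * k)))) * ?m (2 * k)\<bar> \<le> (2 * norm f * (pi / 2 ^ Suc n)) * \<bar>?m (2 * k)\<bar>"
        unfolding abs_mult by (rule mult_right_mono) simp
    qed
    also have "\<dots> = (2 * norm f * (pi / 2 ^ Suc n)) * (\<Sum>k<2 ^ n. \<bar>sm_apply \<tau> (cell (Suc n) (2 * k))\<bar>)"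
      by (simp add: sum_distrib_left)
    also have "\<dots> \<le> (2 * norm f * (pi / 2 ^ Suc n)) * (2 * B)"
    proof (intro mult_left_mono signed_measure_variation[OF B] cell_borel)
      show "disjoint_family_on (\<lambda>k. cell (Suc n) (2 * k)) {..<2 ^ n}"
        using disjoint_cells[of "Suc n" UNIV] by (simp add: disjoint_family_on_def)
    qed auto
    also have "\<dots> = (2 * norm f * pi * (2 * B)) * (1/2) ^ Suc n" by (simp add: power_divide)
    finally show ?thesis by simp
  qed
  have s: "summable (\<lambda>n. (2 * norm f * pi * (2 * B)) * (1/2 :: real) ^ Suc n)"
    using summable_mult[OF summable_ignore_initial_segment[OF summable_geometric[of "1/2 :: real"], of 1]] by simp
  have "summable (\<lambda>n. stieltjes_sum (Suc n) \<tau> f - stieltjes_sum n \<tau> f)"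
    by (rule summable_comparison_test'[OF s b])
  then have "convergent (\<lambda>n. (\<Sum>k<n. stieltjes_sum (Suc k) \<tau> f - stieltjes_sum k \<tau> f) + stieltjes_sum 0 \<tau> f)"
    by (intro convergent_add convergent_const) (simp add: summable_iff_convergent)
  moreover have "(\<Sum>k<n. stieltjes_sum (Suc k) \<tau> f - stieltjes_sum k \<tau> f) + stieltjes_sum 0 \<tau> f = stieltjes_sum n \<tau> f" for n
    using sum_lessThan_telescope[of "\<lambda>k. stieltjes_sum k \<tau> f" n] by linarith
  ultimately show ?thesis by (simp only:)
qed

definition stieltjes_integral :: "signed_measure \<Rightarrow> (real^(1 option)) bl \<Rightarrow> real" where
  "stieltjes_integral \<tau> f = lim (\<lambda>n. stieltjes_sum n \<tau> f)"

lemma stieltjes_integral_LIMSEQ: "(\<lambda>n. stieltjes_sum n \<tau> f) \<longlonglongrightarrow> stieltjes_integral \<tau> f"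
  unfolding stieltjes_integral_def using stieltjes_sum_convergent by (simp add: convergent_LIMSEQ_iff)

lemma bounded_bilinear_stieltjes_integral: "bounded_bilinear stieltjes_integral"
proof
  note L = stieltjes_integral_LIMSEQ
  fix \<tau> \<sigma> f g and r :: real
  have "stieltjes_sum n (\<tau> + \<sigma>) f = stieltjes_sum n \<tau> f + stieltjes_sum n \<sigma> f" for n
    by (simp add: stieltjes_sum_def plus_signed_measure.rep_eq distrib_left sum.distrib)
  then have "(\<lambda>n. stieltjes_sum n (\<tau> + \<sigma>) f) \<longlonglongrightarrow> stieltjes_integral \<tau> f + stieltjes_integral \<sigma> f"
    using tendsto_add[OF L L] by simp
  then show "stieltjes_integral (\<tau> + \<sigma>) f = stieltjes_integral \<tau> f + stieltjes_integral \<sigma> f"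
    by (rule LIMSEQ_unique[OF L])
  have "stieltjes_sum n \<tau> (f + g) = stieltjes_sum n \<tau> f + stieltjes_sum n \<tau> g" for n
    by (simp add: stieltjes_sum_def plus_bl.rep_eq distrib_right sum.distrib)
  then have "(\<lambda>n. stieltjes_sum n \<tau> (f + g)) \<longlonglongrightarrow> stieltjes_integral \<tau> f + stieltjes_integral \<tau> g"
    using tendsto_add[OF L L] by simp
  then show "stieltjes_integral \<tau> (f + g) = stieltjes_integral \<tau> f + stieltjes_integral \<tau> g"
    by (rule LIMSEQ_unique[OF L])
  have "stieltjes_sum n (r *\<^sub>R \<tau>) f = r *\<^sub>R stieltjes_sum n \<tau> f" for n
    by (simp add: stieltjes_sum_def scaleR_signed_measure.rep_eq sum_distrib_left mult.left_commute)
  then have "(\<lambda>n. stieltjes_sum n (r *\<^sub>R \<tau>) f) \<longlonglongrightarrow> r *\<^sub>R stieltjes_integral \<tau> f"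
    using tendsto_scaleR[OF tendsto_const L] by simp
  then show "stieltjes_integral (r *\<^sub>R \<tau>) f = r *\<^sub>R stieltjes_integral \<tau> f"
    by (rule LIMSEQ_unique[OF L])
  have "stieltjes_sum n \<tau> (r *\<^sub>R f) = r *\<^sub>R stieltjes_sum n \<tau> f" for n
    by (simp add: stieltjes_sum_def scaleR_bl.rep_eq sum_distrib_left mult.assoc)
  then have "(\<lambda>n. stieltjes_sum n \<tau> (r *\<^sub>R f)) \<longlonglongrightarrow> r *\<^sub>R stieltjes_integral \<tau> f"
    using tendsto_scaleR[OF tendsto_const L] by simp
  then show "stieltjes_integral \<tau> (r *\<^sub>R f) = r *\<^sub>R stieltjes_integral \<tau> f"
    by (rule LIMSEQ_unique[OF L])
next
  have "norm (stieltjes_integral \<tau> f) \<le> norm \<tau> * norm f * (1 + 2 * pi)" for \<tau> f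
  proof (rule LIMSEQ_le_const2[OF tendsto_norm[OF stieltjes_integral_LIMSEQ]], intro exI allI impI)
    fix n show "norm (stieltjes_sum n \<tau> f) \<le> norm \<tau> * norm f * (1 + 2 * pi)"
      using stieltjes_sum_le[of n \<tau> f] by (simp add: ac_simps)
  qed
  then show "\<exists>K. \<forall>\<tau> f. norm (stieltjes_integral \<tau> f) \<le> norm \<tau> * norm f * K" by blast
qed

definition circle_functional :: "signed_measure \<Rightarrow> (real^(1 option)) bl_dual" where
  "circle_functional \<tau> = Blinfun (stieltjes_integral \<tau>)"

lemma circle_functional_apply: "blinfun_apply (circle_functional \<tau>) f = stieltjes_integral \<tau> f"
  unfolding circle_functional_def
  by (simp add: bounded_linear_Blinfun_apply bounded_bilinear.bounded_linear_right[OF bounded_bilinear_stieltjes_integral])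

lemma bounded_linear_circle_functional: "bounded_linear circle_functional"
proof -
  interpret S: bounded_bilinear stieltjes_integral by (rule bounded_bilinear_stieltjes_integral)
  obtain K where K: "0 \<le> K" "\<And>\<tau> f. norm (stieltjes_integral \<tau> f) \<le> norm \<tau> * norm f * K" using S.nonneg_bounded by blast
  show ?thesis
  proof (rule bounded_linear_intro[where K = K])
    fix \<tau> \<sigma> and r :: real
    show "circle_functional (\<tau> + \<sigma>) = circle_functional \<tau> + circle_functional \<sigma>"
      by (rule blinfun_eqI) (simp add: circle_functional_apply S.add_left blinfun.add_left)
    show "circle_functional (r *\<^sub>R \<tau>) = r *\<^sub>R circle_functional \<tau>"
      by (rule blinfun_eqI) (simp add: circle_functional_apply S.scaleR_left[simplified] blinfun.scaleR_left)
    show "norm (circle_functional \<tau>) \<le> norm \<tau> * K"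
      using K by (intro norm_blinfun_bound) (auto simp: circle_functional_apply ac_simps)
  qed
qed

text \<open>
  For a law, the sum is the integral of a step function that differs from the integrand by at most the oscillation on one
  arc.
\<close>

lemma stieltjes_integral_law:
  assumes law: "law P"
  shows "stieltjes_integral (law_signed P) f = (\<integral>x. circle_fun f (arctan x) \<partial>P)"
proof -
  interpret prob_space P using law by (simp add: law_def)
  have sP: "sets P = sets borel" using law by (simp add: law_def)
  have cont: "continuous_on UNIV (circle_fun f)"
    by (rule lipschitz_on_continuous_on[of "2 * norm f"], rule lipschitz_onI) (auto simp: dist_real_def circle_fun_diff)
  have m: "(\<lambda>x. circle_fun f (arctan x)) \<in> borel_measurable P"
    by (intro law_measurable[OF law] borel_measurable_continuous_onI continuous_on_compose2[OF cont] continuous_intros) auto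
  have i: "integrable P (\<lambda>x. circle_fun f (arctan x))"
    by (rule integrable_const_bound[of _ "norm f"]) (auto simp: circle_fun_le m)
  have b: "norm (stieltjes_sum n (law_signed P) f - (\<integral>x. circle_fun f (arctan x) \<partial>P)) \<le> 2 * norm f * pi * (1/2) ^ n" for n
  proof -
    let ?h = "\<lambda>x. \<Sum>k<2 ^ n. circle_fun f (node n (Suc k)) * indicator (cell n k) x"
    have ic: "integrable P (\<lambda>x. circle_fun f (node n (Suc k)) * indicator (cell n k) x)" for k
      using cell_borel[of n k] sP by (intro integrable_mult_right integrable_real_indicator) (auto simp: emeasure_eq_measure)
    have ih: "integrable P ?h" by (intro Bochner_Integration.integrable_sum ic)
    have "stieltjes_sum n (law_signed P) f = (\<integral>x. ?h x \<partial>P)"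
    proof -
      have "(\<integral>x. ?h x \<partial>P) = (\<Sum>k<2 ^ n. (\<integral>x. circle_fun f (node n (Suc k)) * indicator (cell n k) x \<partial>P))"
        by (rule Bochner_Integration.integral_sum) (rule ic)
      also have "\<dots> = (\<Sum>k<2 ^ n. circle_fun f (node n (Suc k)) * measure P (cell n k))"
        using cell_borel sP law_space[OF law] by (intro sum.cong refl) simp
      finally show ?thesis by (simp add: stieltjes_sum_def law_signed_apply[OF law])
    qed
    then have 1: "stieltjes_sum n (law_signed P) f - (\<integral>x. circle_fun f (arctan x) \<partial>P) = (\<integral>x. ?h x - circle_fun f (arctan x) \<partial>P)"
      using ih i by simp
    have "norm (?h x - circle_fun f (arctan x)) \<le> 2 * norm f * (pi / 2 ^ n)" for x
    proof -
      have "indicator (cell n k) x = (indicator (angle_set (node n (Suc k))) x - indicator (angle_set (node n k)) x :: real)" for k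
        using angle_set_mono[OF node_mono[of k "Suc k" n]] by (auto simp: cell_def indicator_def)
      then have one: "(\<Sum>k<2 ^ n. indicator (cell n k) x) = (1 :: real)"
        by (simp add: sum_lessThan_telescope[where f = "\<lambda>k. indicator (angle_set (node n k)) x"] angle_set_node)
      have "?h x - circle_fun f (arctan x) = ?h x - circle_fun f (arctan x) * (\<Sum>k<2 ^ n. indicator (cell n k) x)" by (simp add: one)
      also have "\<dots> = (\<Sum>k<2 ^ n. (circle_fun f (node n (Suc k)) - circle_fun f (arctan x)) * indicator (cell n k) x)"
        by (simp add: sum_distrib_left sum_subtractf left_diff_distrib)
      also have "norm \<dots> \<le> (\<Sum>k<2 ^ n. 2 * norm f * (pi / 2 ^ n) * indicator (cell n k) x)"
      proof (rule sum_norm_le)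
        fix k
        show "norm ((circle_fun f (node n (Suc k)) - circle_fun f (arctan x)) * indicator (cell n k) x) \<le> 2 * norm f * (pi / 2 ^ n) * indicator (cell n k) x"
        proof (cases "x \<in> cell n k")
          case True
          then have "\<bar>node n (Suc k) - arctan x\<bar> \<le> pi / 2 ^ n"
            using node_Suc[of n k] by (auto simp: cell_def angle_set_def)
          then have "2 * norm f * \<bar>node n (Suc k) - arctan x\<bar> \<le> 2 * norm f * (pi / 2 ^ n)" by (intro mult_left_mono) auto
          then show ?thesis using True circle_fun_diff[of f "node n (Suc k)" "arctan x"] by simp
        qed simp
      qed
      also have "\<dots> = 2 * norm f * (pi / 2 ^ n)" by (simp only: sum_distrib_left[symmetric] one mult_1_right)
      finally show ?thesis .
    qed
    then have 2: "(\<integral>x. norm (?h x - circle_fun f (arctan x)) \<partial>P) \<le> (\<integral>x. 2 * norm f * (pi / 2 ^ n) \<partial>P)"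
      using ih i by (intro integral_mono) auto
    have b: "norm (stieltjes_sum n (law_signed P) f - (\<integral>x. circle_fun f (arctan x) \<partial>P)) \<le> (\<integral>x. norm (?h x - circle_fun f (arctan x)) \<partial>P)"
      unfolding 1 by (rule integral_norm_bound)
    also note 2
    also have "(\<integral>x. 2 * norm f * (pi / 2 ^ n) \<partial>P) = 2 * norm f * pi * (1/2) ^ n"
      by (simp add: prob_space power_divide)
    finally show ?thesis .
  qed
  have lim: "(\<lambda>n. 2 * norm f * pi * (1/2) ^ n) \<longlonglongrightarrow> 0"
    using tendsto_mult_right_zero[OF LIMSEQ_power_zero[of "1/2 :: real"], of "2 * norm f * pi"] by simp
  have "(\<lambda>n. stieltjes_sum n (law_signed P) f - (\<integral>x. circle_fun f (arctan x) \<partial>P)) \<longlonglongrightarrow> 0"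
    by (rule Lim_null_comparison[OF always_eventually lim]) (use b in blast)
  then have "(\<lambda>n. stieltjes_sum n (law_signed P) f) \<longlonglongrightarrow> (\<integral>x. circle_fun f (arctan x) \<partial>P)"
    by (simp add: LIM_zero_iff)
  then show ?thesis by (rule LIMSEQ_unique[OF stieltjes_integral_LIMSEQ])
qed

section \<open>The location and scatter functionals on the line\<close>

text \<open>
  The composite of the identification of numbers with vectors of one component and of the extension by the
  coordinate one.
\<close>

definition lift_line :: "real \<Rightarrow> real^(1 option)" where
  "lift_line x = append_one (vec x)"

lemma lift_line_nth [simp]: "lift_line x $ None = 1" "lift_line x $ Some i = x"
  by (simp_all add: lift_line_def)

lemma circle_point_arctan: "circle_point (arctan x) = (1 / sqrt (1 + x\<^sup>2)) *\<^sub>R lift_line x"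
  by (simp add: vec_eq_iff all_option cos_arctan sin_arctan)

lemma vec_measurable: "(vec :: real \<Rightarrow> real^1) \<in> borel_measurable borel"
  by (intro borel_measurable_continuous_onI linear_continuous_on linear_conv_bounded_linear[THEN iffD1] linear_vec)

lemma lift_line_measurable: "lift_line \<in> borel_measurable borel"
  unfolding lift_line_def[abs_def] by (rule measurable_compose[OF vec_measurable append_one_measurable])

lemma distr_lift_line:
  assumes "law P"
  shows "distr (distr P borel (vec :: real \<Rightarrow> real^1)) borel append_one = distr P borel lift_line"
  using distr_distr[OF append_one_measurable law_measurable[OF assms vec_measurable]]
  by (simp add: lift_line_def[abs_def] comp_def)

lemma law_V_vec:
  assumes "P \<in> law_V (\<nu> + 1)"
  shows "distr P borel (vec :: real \<Rightarrow> real^1) \<in> law_V (\<nu> + real CARD(1))"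
proof -
  have law: "law P" using assms by (simp add: law_V_def)
  have "measure (distr P borel vec) J < 1 - (real DIM(real^1) - real_of_int (aff_dim J)) / (\<nu> + real CARD(1))"
    if J: "affine J" "0 \<le> aff_dim J" "aff_dim J < int DIM(real^1)" for J :: "(real^1) set"
  proof -
    let ?I = "(vec :: real \<Rightarrow> real^1) -` J"
    have inj: "inj (vec :: real \<Rightarrow> real^1)" by (auto simp: inj_def vec_eq_iff)
    have "x = vec (x $ 1)" for x :: "real^1" by (simp add: vec_eq_iff)
    then have "surj (vec :: real \<Rightarrow> real^1)" by (rule surjI[OF sym])
    then have "vec ` ?I = J" by (rule surj_image_vimage_eq)
    then have ad: "aff_dim ?I = aff_dim J"
      using aff_dim_injective_linear_image[OF linear_vec inj, of ?I] by simp
    have "affine ?I"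
      unfolding affine_alt
    proof (intro ballI allI)
      fix x y u assume "x \<in> ?I" "y \<in> ?I"
      then have "(1 - u) *\<^sub>R vec x + u *\<^sub>R vec y \<in> J" using J(1) by (simp add: affine_alt)
      also have "(1 - u) *\<^sub>R vec x + u *\<^sub>R vec y = (vec ((1 - u) *\<^sub>R x + u *\<^sub>R y) :: real^1)" by (simp add: vec_eq_iff)
      finally show "(1 - u) *\<^sub>R x + u *\<^sub>R y \<in> ?I" by simp
    qed
    then have "affine ?I \<and> 0 \<le> aff_dim ?I \<and> aff_dim ?I < int DIM(real)" using J ad by simp
    then have "measure P ?I < 1 - (real DIM(real) - real_of_int (aff_dim ?I)) / (\<nu> + 1)"
      using assms unfolding law_V_def by blast
    moreover have "closed J" using J(1) by (rule affine_closed)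
    then have "measure (distr P borel vec) J = measure P ?I"
      using law_measurable[OF law vec_measurable] law_space[OF law] by (subst measure_distr) auto
    ultimately show ?thesis by (simp add: ad)
  qed
  then show ?thesis using law_distr[OF law vec_measurable] unfolding law_V_def by blast
qed

lemma spread_lift_line:
  assumes "1 < \<nu>" "P \<in> law_V (\<nu> + 1)"
  shows "spread_law_scatter (distr P borel lift_line) (\<nu> - 1)"
  using spread_append_one[OF assms(1) law_V_vec[OF assms(2)]] assms(2) distr_lift_line[of P] by (simp add: law_V_def)

text \<open>
  On unit vectors, \<open>\<nu> * (z $ None)\<^sup>2 + quad C z = \<epsilon> + quad (C + circle_shift \<nu> \<epsilon>) z\<close>, because \<open>\<epsilon>\<close> may be written as
  \<open>\<epsilon> * (z \<bullet> z)\<close>. The left side is homogeneous of degree two and equals \<open>\<nu> + quad C z\<close> at \<open>z = (x, 1)\<close>. The right side is a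
  denominator of the kind that \<open>bl_kernel\<close> admits, with positive constant \<open>\<epsilon>\<close>.
\<close>

definition circle_shift :: "real \<Rightarrow> real \<Rightarrow> real^(1 option)^(1 option)" where
  "circle_shift \<nu> \<epsilon> = (\<chi> i j. (if i = None \<and> j = None then \<nu> else 0) - (if i = j then \<epsilon> else 0))"

lemma quad_circle_shift: "quad (circle_shift \<nu> \<epsilon>) z = \<nu> * (z $ None)\<^sup>2 - \<epsilon> * (z \<bullet> z)"
  by (simp add: quad_sum circle_shift_def sum_option inner_vec_def UNIV_1 power2_eq_square algebra_simps)

lemma quad_add: "quad (A + B) z = quad A z + quad B z"
  by (simp add: quad_def matrix_vector_mult_add_rdistrib inner_add_right)

lemma quad_scaleR: "quad A (s *\<^sub>R z) = s\<^sup>2 * quad A z"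
  by (simp add: quad_def matrix_vector_mult_scaleR power2_eq_square)

text \<open>
  Numerator and denominator are homogeneous of degree two, and \<open>circle_point (arctan x)\<close> is a positive multiple of
  \<open>lift_line x\<close>.
\<close>

lemma circle_kernel:
  fixes B C :: "real^(1 option)^(1 option)" and \<nu> \<epsilon> :: real
  assumes "posdef C" "0 < \<nu>"
  defines "D \<equiv> C + circle_shift \<nu> \<epsilon>"
  shows "(circle_point (arctan x) $ i * circle_point (arctan x) $ j) / (\<epsilon> + quad D (circle_point (arctan x))) =
      (lift_line x $ i * lift_line x $ j) / (\<nu> + quad C (lift_line x))"
    and "quad B (circle_point (arctan x)) / (\<epsilon> + quad D (circle_point (arctan x))) =
      quad B (lift_line x) / (\<nu> + quad C (lift_line x))"
proof -
  define s where "s = 1 / sqrt (1 + x\<^sup>2)"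
  have p: "0 < 1 + x\<^sup>2" by (simp add: add_pos_nonneg)
  have s2: "s\<^sup>2 * (1 + x\<^sup>2) = 1" "s \<noteq> 0" using p by (auto simp: s_def power_divide)
  have w: "circle_point (arctan x) = s *\<^sub>R lift_line x" by (simp add: s_def circle_point_arctan)
  have "lift_line x \<bullet> lift_line x = 1 + x\<^sup>2" by (simp add: inner_vec_def sum_option power2_eq_square)
  then have "quad (circle_shift \<nu> \<epsilon>) (lift_line x) = \<nu> - \<epsilon> * (1 + x\<^sup>2)" by (simp add: quad_circle_shift)
  then have "\<epsilon> + quad D (s *\<^sub>R lift_line x) = \<epsilon> + s\<^sup>2 * (quad C (lift_line x) + \<nu>) - \<epsilon> * (s\<^sup>2 * (1 + x\<^sup>2))"
    by (simp only: D_def quad_scaleR quad_add) (simp add: algebra_simps)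
  then have den: "\<epsilon> + quad D (s *\<^sub>R lift_line x) = s\<^sup>2 * (\<nu> + quad C (lift_line x))"
    by (simp add: s2 add.commute)
  show "(circle_point (arctan x) $ i * circle_point (arctan x) $ j) / (\<epsilon> + quad D (circle_point (arctan x))) =
      (lift_line x $ i * lift_line x $ j) / (\<nu> + quad C (lift_line x))"
    unfolding w den using s2(2) by (simp add: power2_eq_square)
  show "quad B (circle_point (arctan x)) / (\<epsilon> + quad D (circle_point (arctan x))) =
      quad B (lift_line x) / (\<nu> + quad C (lift_line x))"
    unfolding w den unfolding quad_scaleR using s2(2) by simp
qed

lemma circle_functional_kernel:
  fixes B C :: "real^(1 option)^(1 option)" and \<nu> \<epsilon> :: real
  assumes law: "law P" and nu: "0 < \<nu>" and eps: "0 < \<epsilon>" and C: "posdef C" and D: "posdef (C + circle_shift \<nu> \<epsilon>)"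
  defines "h \<equiv> bl_kernel \<epsilon> (C + circle_shift \<nu> \<epsilon>)" and "Q \<equiv> distr P borel lift_line"
  shows "pairing h (circle_functional (law_signed P)) = (\<chi> i j. \<integral>z. (z $ i * z $ j) / (\<nu> + quad C z) \<partial>Q)"
    and "pairing h (act (circle_functional (law_signed P)) (combination h B)) =
      (\<chi> i j. \<integral>z. quad B z / (\<nu> + quad C z) * ((z $ i * z $ j) / (\<nu> + quad C z)) \<partial>Q)"
proof -
  have ne: "\<nu> + quad C z \<noteq> 0" for z using quad_nonneg[OF C, of z] nu by linarith
  have m1: "(\<lambda>z. (z $ i * z $ j) / (\<nu> + quad C z)) \<in> borel_measurable borel" for i j
    using ne by (intro borel_measurable_continuous_onI continuous_intros) auto
  have m2: "(\<lambda>z. quad B z / (\<nu> + quad C z)) \<in> borel_measurable borel"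
    using ne by (intro borel_measurable_continuous_onI continuous_intros) auto
  note d = integral_distr[OF law_measurable[OF law lift_line_measurable]]
  show "pairing h (circle_functional (law_signed P)) = (\<chi> i j. \<integral>z. (z $ i * z $ j) / (\<nu> + quad C z) \<partial>Q)"
    unfolding Q_def d[OF m1]
    by (simp add: pairing_def circle_functional_apply stieltjes_integral_law[OF law] h_def
      bl_kernel_apply[OF eps D] circle_kernel(1)[OF C nu])
  show "pairing h (act (circle_functional (law_signed P)) (combination h B)) =
      (\<chi> i j. \<integral>z. quad B z / (\<nu> + quad C z) * ((z $ i * z $ j) / (\<nu> + quad C z)) \<partial>Q)"
    unfolding Q_def d[OF borel_measurable_times[OF m2 m1]]
    by (simp only: pairing_def act_apply circle_functional_apply stieltjes_integral_law[OF law] h_def bl_mult.rep_eq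
      bl_kernel_apply[OF eps D] combination_kernel_apply[OF eps D] circle_kernel[OF C nu])
qed

definition line_scatter :: "real \<Rightarrow> real measure \<Rightarrow> real^(1 option)^(1 option)" where
  "line_scatter \<nu> P = (THE A. law_scatter.critical (distr P borel lift_line) (\<nu> - 1) A)"

lemma t_real_eq_line_scatter:
  assumes nu: "1 < \<nu>" and P: "P \<in> law_V (\<nu> + 1)"
  defines "A \<equiv> line_scatter \<nu> P"
  shows "t_location_real \<nu> P = A $ Some 1 $ None"
    and "t_scatter_real \<nu> P = A $ Some 1 $ Some 1 - A $ Some 1 $ None * A $ Some 1 $ None"
proof -
  have law: "law P" using P by (simp add: law_V_def)
  interpret Q: spread_law_scatter "distr P borel lift_line" "\<nu> - 1" by (rule spread_lift_line[OF nu P])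
  have crit: "Q.critical A" unfolding A_def line_scatter_def by (rule theI'[OF Q.critical_unique])
  have "t_location_scatter \<nu> (distr P borel (vec :: real \<Rightarrow> real^1)) = (location_part A, sym_part (scatter_part A))"
    by (rule t_location_scatter_eq[OF nu law_V_vec[OF P]]) (simp only: distr_lift_line[OF law] crit)
  then show "t_location_real \<nu> P = A $ Some 1 $ None"
    "t_scatter_real \<nu> P = A $ Some 1 $ Some 1 - A $ Some 1 $ None * A $ Some 1 $ None"
    by (simp_all add: t_location_real_def t_scatter_real_def location_part_def scatter_part_def mat_of_sym_part transpose_def)
qed

text \<open>
  The functional \<open>circle_functional (law_signed P)\<close> satisfies the estimating equation with shift \<open>circle_shift (\<nu> - 1) \<epsilon>\<close>
  exactly if the law of \<open>(x, 1)\<close> satisfies the ordinary one. So the local solution on the dual space, composed with the bounded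
  linear map \<open>circle_functional\<close>, extends the scatter matrix to an open set of signed measures.
\<close>

theorem line_scatter_analytic:
  fixes pr :: "real^(1 option)^(1 option) \<Rightarrow> real"
  assumes nu: "1 < \<nu>" and pr: "bounded_linear pr" and \<beta>: "bounded_bilinear \<beta>"
  shows "analytic_functional law_signed (law_V (\<nu> + 1))
    (\<lambda>P. pr (line_scatter \<nu> P) + \<beta> (line_scatter \<nu> P) (line_scatter \<nu> P))"
  unfolding analytic_functional_def
proof
  fix P0 :: "real measure" assume P0: "P0 \<in> law_V (\<nu> + 1)"
  have law: "law P" if "P \<in> law_V (\<nu> + 1)" for P :: "real measure"
    using that by (simp add: law_V_def)
  interpret Q0: spread_law_scatter "distr P0 borel lift_line" "\<nu> - 1" by (rule spread_lift_line[OF nu P0])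
  have nu': "0 < \<nu> - 1" using nu by simp
  obtain A0 where crit: "Q0.critical A0" using Q0.critical_unique by blast
  have A0: "posdef A0" and wA0: "Q0.weighted_cov (matrix_inv A0) = A0" using crit by (auto simp: Q0.critical_def)
  define C0 where "C0 = matrix_inv A0"
  have pC0: "posdef C0" unfolding C0_def by (rule posdef_inverse[OF A0])
  define \<kappa> where "\<kappa> = \<nu> + 1"
  have \<kappa>: "Q0.dof = \<kappa>" by (simp add: \<kappa>_def Q0.dof_def)
  obtain c where c: "0 < c" "\<And>x. c * (norm x)\<^sup>2 \<le> quad C0 x"
    using posdef_coercive[OF pC0] unfolding quad_def by blast
  (* small enough for the shifted form to remain positive definite *)
  define \<epsilon> where "\<epsilon> = c / 2"
  have eps: "0 < \<epsilon>" "\<epsilon> < c" using c(1) by (auto simp: \<epsilon>_def)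
  define E where "E = circle_shift (\<nu> - 1) \<epsilon>"
  have E: "posdef (C0 + E)"
    unfolding posdef_def
  proof (intro conjI allI impI)
    have "E $ i $ j = E $ j $ i" for i j by (auto simp: E_def circle_shift_def)
    then show "transpose (C0 + E) = C0 + E" using pC0 by (simp add: posdef_def transpose_def vec_eq_iff)
    fix z :: "real^(1 option)" assume "z \<noteq> 0"
    then have "0 < (c - \<epsilon>) * (norm z)\<^sup>2" using eps by simp
    also have "\<dots> \<le> quad (C0 + E) z"
      using c(2)[of z] mult_nonneg_nonneg[OF less_imp_le[OF nu'] zero_le_power2[of "z $ None"]]
      by (simp add: quad_add E_def quad_circle_shift power2_norm_eq_inner left_diff_distrib)
    finally show "0 < z \<bullet> ((C0 + E) *v z)" by (simp add: quad_def)
  qed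
  let ?h = "bl_kernel \<epsilon> (C0 + E)" and ?\<phi> = "circle_functional (law_signed P0)"
  note kern = circle_functional_kernel[OF law[OF P0] nu' eps(1) pC0 E[unfolded E_def], folded E_def]
  have base: "A0 = \<kappa> *\<^sub>R pairing ?h ?\<phi>"
    using wA0 unfolding kern(1) by (simp add: Q0.weighted_cov_def \<kappa> C0_def vec_eq_iff)
  have inj: "B = 0" if "A0 ** B ** A0 = \<kappa> *\<^sub>R pairing ?h (act ?\<phi> (combination ?h B))" for B
    using that unfolding kern(2)
    by (intro Q0.linearization_injective[OF crit]) (simp add: C0_def \<kappa> vec_eq_iff)
  obtain r g where r: "0 < r"
    and an: "frechet_analytic_on (ball ?\<phi> r) (\<lambda>\<phi>. pr (g \<phi>) + \<beta> (g \<phi>) (g \<phi>))"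
    and g: "\<And>\<phi>. \<phi> \<in> ball ?\<phi> r \<Longrightarrow> posdef (g \<phi>) \<and> posdef (matrix_inv (g \<phi>) + E) \<and>
      g \<phi> = \<kappa> *\<^sub>R pairing (bl_kernel \<epsilon> (matrix_inv (g \<phi>) + E)) \<phi>"
    using scatter_local_solution[OF eps(1) A0 C0_def E base inj pr \<beta>] by blast
  let ?U = "{\<tau>. circle_functional \<tau> + 0 \<in> ball ?\<phi> r}"
  let ?G = "\<lambda>\<tau>. pr (g (circle_functional \<tau> + 0)) + \<beta> (g (circle_functional \<tau> + 0)) (g (circle_functional \<tau> + 0))"
  have an': "frechet_analytic_on ?U ?G"
    by (rule frechet_analytic_on_precompose_affine[OF bounded_linear_circle_functional an])
  show "\<exists>U ga. law_signed P0 \<in> U \<and> frechet_analytic_on U ga \<and>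
      (\<forall>P\<in>law_V (\<nu> + 1). law_signed P \<in> U \<longrightarrow>
        ga (law_signed P) = pr (line_scatter \<nu> P) + \<beta> (line_scatter \<nu> P) (line_scatter \<nu> P))"
  proof (intro exI[of _ ?U] exI[of _ ?G] conjI ballI impI an')
    show "law_signed P0 \<in> ?U" using r by simp
    fix P :: "real measure" assume P: "P \<in> law_V (\<nu> + 1)" and m': "law_signed P \<in> ?U"
    then have m: "circle_functional (law_signed P) \<in> ball ?\<phi> r" by simp
    define A where "A = g (circle_functional (law_signed P))"
    have A: "posdef A" "posdef (matrix_inv A + E)"
      and eq: "A = \<kappa> *\<^sub>R pairing (bl_kernel \<epsilon> (matrix_inv A + E)) (circle_functional (law_signed P))"
      using g[OF m] unfolding A_def by blast+
    interpret Q: spread_law_scatter "distr P borel lift_line" "\<nu> - 1" by (rule spread_lift_line[OF nu P])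
    have "Q.weighted_cov (matrix_inv A) = A"
      by (subst (2) eq, subst circle_functional_kernel(1)[OF law[OF P] nu' eps(1) posdef_inverse[OF A(1)] A(2)[unfolded E_def], folded E_def])
        (simp add: Q.weighted_cov_def Q.dof_def \<kappa>_def vec_eq_iff)
    then have "Q.critical A" using A(1) by (simp add: Q.critical_def)
    then have "line_scatter \<nu> P = A"
      unfolding line_scatter_def using Q.critical_unique by (metis the1_equality)
    then show "?G (law_signed P) = pr (line_scatter \<nu> P) + \<beta> (line_scatter \<nu> P) (line_scatter \<nu> P)"
      by (simp add: A_def)
  qed
qed

lemma analytic_functional_cong:
  assumes "\<And>Q. Q \<in> D \<Longrightarrow> S Q = T Q" "analytic_functional emb D T"
  shows "analytic_functional emb D S"
  using assms unfolding analytic_functional_def by (metis (no_types, lifting))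

theorem t_location_real_analytic:
  assumes "1 < \<nu>"
  shows "analytic_functional law_signed (law_V (\<nu> + 1)) (t_location_real \<nu>)"
proof (rule analytic_functional_cong)
  have l: "bounded_linear (\<lambda>A :: real^(1 option)^(1 option). A $ Some 1 $ None)"
    by (rule bounded_linear_compose[OF bounded_linear_vec_nth[of None] bounded_linear_vec_nth[of "Some 1"]])
  from line_scatter_analytic[OF assms l bounded_bilinear_zero]
  show "analytic_functional law_signed (law_V (\<nu> + 1)) (\<lambda>P. line_scatter \<nu> P $ Some 1 $ None + 0)" .
qed (simp add: t_real_eq_line_scatter[OF assms])

theorem t_scatter_real_analytic:
  assumes "1 < \<nu>"
  shows "analytic_functional law_signed (law_V (\<nu> + 1)) (t_scatter_real \<nu>)"
proof (rule analytic_functional_cong)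
  have l: "bounded_linear (\<lambda>A :: real^(1 option)^(1 option). A $ Some 1 $ k)" for k
    by (rule bounded_linear_compose[OF bounded_linear_vec_nth[of k] bounded_linear_vec_nth[of "Some 1"]])
  have "bounded_bilinear (\<lambda>(A :: real^(1 option)^(1 option)) (B :: real^(1 option)^(1 option)). - (A $ Some 1 $ None * B $ Some 1 $ None))"
    by (rule bounded_bilinear_minus[OF bounded_bilinear.comp[OF bounded_bilinear_mult l[of None] l[of None]]])
  from line_scatter_analytic[OF assms l this, of "Some 1"]
  show "analytic_functional law_signed (law_V (\<nu> + 1))
    (\<lambda>P. line_scatter \<nu> P $ Some 1 $ Some 1 + - (line_scatter \<nu> P $ Some 1 $ None * line_scatter \<nu> P $ Some 1 $ None))" .
qed (simp add: t_real_eq_line_scatter[OF assms])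

theorem theorem9:
  fixes \<nu> :: real
  shows
    "(\<nu> > 0 \<longrightarrow>
        frechet_analytic_on (UNIV \<times> pos_def)
          (\<lambda>(\<phi> :: (real^'d::finite) bl_dual, A). t_F \<nu> \<phi> A) \<and>
        (\<forall>Q \<in> (law_U (\<nu> + real CARD('d)) :: (real^'d) measure set).
           \<exists>L. ((\<lambda>C. t_F \<nu> (law_phi Q) (symmat_inv C)) has_derivative L)
                 (at (symmat_inv (t_scatter \<nu> Q))) \<and> bij L) \<and>
        analytic_functional law_phi (law_U (\<nu> + real CARD('d)) :: (real^'d) measure set)
          (t_scatter \<nu>)) \<and>
     (\<nu> > 1 \<longrightarrow>
        analytic_functional law_phi (law_V (\<nu> + real CARD('d)) :: (real^'d) measure set)
          (t_location_scatter \<nu>) \<and>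
        analytic_functional law_signed (law_V (\<nu> + 1)) (t_location_real \<nu>) \<and>
        analytic_functional law_signed (law_V (\<nu> + 1)) (t_scatter_real \<nu>))"
proof (intro conjI impI ballI)
  assume nu: "0 < \<nu>"
  show "frechet_analytic_on (UNIV \<times> pos_def) (\<lambda>(\<phi> :: (real^'d::finite) bl_dual, A). t_F \<nu> \<phi> A)"
    by (rule t_F_analytic[OF nu])
  show "analytic_functional law_phi (law_U (\<nu> + real CARD('d)) :: (real^'d) measure set) (t_scatter \<nu>)"
    by (rule t_scatter_analytic[OF nu])
  fix Q :: "(real^'d) measure" assume Q: "Q \<in> law_U (\<nu> + real CARD('d))"
  interpret spread_law_scatter Q \<nu> by (rule spread_law_scatterI[OF nu Q])
  show "\<exists>L. ((\<lambda>C. t_F \<nu> (law_phi Q) (symmat_inv C)) has_derivative L) (at (symmat_inv (t_scatter \<nu> Q))) \<and> bij L"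
    by (rule derivative_invertible[OF t_scatter_critical])
next
  assume nu: "1 < \<nu>"
  show "analytic_functional law_phi (law_V (\<nu> + real CARD('d)) :: (real^'d) measure set) (t_location_scatter \<nu>)"
    by (rule t_location_scatter_analytic[OF nu])
  show "analytic_functional law_signed (law_V (\<nu> + 1)) (t_location_real \<nu>)"
    by (rule t_location_real_analytic[OF nu])
  show "analytic_functional law_signed (law_V (\<nu> + 1)) (t_scatter_real \<nu>)"
    by (rule t_scatter_real_analytic[OF nu])
qed

end
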